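(* Let $k\ge 1$ and $1\le r\le k$ be fixed integers. Assume that $\{\lg n-\lg\lg n\}\to\gamma\in[0,1]$ as $n\to\infty$ (along a sequence of positive integers $n$). Let $\mathcal X_n^r$ be the number of $r$-records in the complete binary tree of size $n$. Then $$\frac{\lg(n)^{\frac rk+1}}{C_2(r)\,n}\,\mathcal X_n^r-\mu_{r,n}\ \xrightarrow{d}\ 1-C_3(r)\,W_{r,k,\gamma},$$ where $$\mu_{r,n}=\frac kr\lg(n)+\sum_{i=1}^kC_1(r,i)\lg(n)^{1-\frac ik}+\lg(\lg(n)),$$ and $W_{r,k,\gamma}$ has an infinitely divisible distribution with characteristic function $$\mathbb E\left[\exp(\mathrm i tW_{r,k,\gamma})\right]=\exp\left(\mathrm i f_{r,k,\gamma}t+\int_0^\infty\left(e^{\mathrm i tx}-1-\mathrm i tx\,\mathbf 1[x<1]\right)\mathrm d\nu_{r,k,\gamma}(x)\right),$$ where the Lévy measure $\nu_{r,k,\gamma}$ has support on $(0,\infty)$ with density $$\frac{\mathrm d\nu_{r,k,\gamma}}{\mathrm dx}=\frac{\Gamma(\frac rk)^2}{x^2}\sum_{s\ge1}4^{\theta(x)-s}\exp\left(Q^{-1}\left(\tfrac rk,2^{\theta(x)-s}\right)\right)Q^{-1}\left(\tfrac rk,2^{\theta(x)-s}\right)^{1-\frac rk},\qquad \theta(x)=\left\{\gamma+\lg\left(x/\Gamma(\tfrac rk)\right)\right\}.$$ The constants $C_1,C_2,C_3$ and $f_{r,k,\gamma}$ are the explicit ones given in the context.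
   Context: Notation: $\lg=\log_2$; $\{x\}=x-\lfloor x\rfloor$; $\Gamma(a,x)=\int_x^\infty e^{-t}t^{a-1}\,dt$; $Q(a,x)=\Gamma(a,x)/\Gamma(a)$; $Q^{-1}(a,\cdot):(0,1]\to[0,\infty)$ is the inverse of $x\mapsto Q(a,x)$; $\xrightarrow{d}$ is convergence in distribution. Complete binary tree $T_n^{\mathrm{bin}}$ of size $n$: the rooted binary tree with $n$ nodes in which every level is full except possibly the last, whose nodes occupy the leftmost positions. $r$-records: let $(E_{j,v})_{j\ge1,\,v\in T_n^{\mathrm{bin}}}$ be i.i.d. exponential random variables with mean $1$ and $T_{r,v}=\sum_{j=1}^rE_{j,v}$. For $1\le r\le k$, node $v$ is an $r$-record if $T_{r,v}<\min_{u\prec v}T_{k,u}$, where $u\prec v$ means that $u$ is a (strict) ancestor of $v$ (the root is always an $r$-record). $\mathcal X_n^r$ is the number of nodes $v$ that are $r$-records. Constants (depending on the fixed $k$): for $1\le j\le k$ and $jk+j\le b\le jk+k$, $C_6(j,b)$ is the coefficient of $m^jx^b$ in the expansion in powers of $x$ (with coefficients polynomial in $m$) of $\frac{e^{-x}}{2Q(k,x)-1}\left(e^{x^k/k!}Q(k,x)\right)^m$. Then $$C_7(r,i)=\frac{(-1)^ik(k!)^{i/k}\Gamma(\frac{i+r}k)}{r\,i!\,\Gamma(\frac rk)},\quad C_8(r,j,b)=\frac{k(k!)^{b/k}C_6(j,b)\Gamma(\frac{b+r}k)}{r\,\Gamma(\frac rk)},\quad C_1(r,i)=C_7(r,i)+\sum_{j=1}^iC_8(r,j,jk+i),$$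 $$C_2(r)=\frac{(k!)^{r/k}\,\Gamma(\frac rk)}{k^2\,\Gamma(r)},\qquad C_3(r)=\frac1{\Gamma(1+\frac rk)}.$$ With $\theta_0=\{\gamma-\lg\Gamma(\frac rk)\}$ and $q_t=Q^{-1}(\frac rk,2^{\theta_0-t})$, $$f_{r,k,\gamma}=\sum_{t=1}^\infty e^{-q_t}q_t^{r/k}-\sum_{t=1}^\infty2^{\theta_0-t}\Gamma(\tfrac rk)q_t+\Gamma(1+\tfrac rk)\left(2^{\theta_0}-\theta_0-\lg\Gamma(\tfrac rk)-1\right).$$
   Formalization: The constant C_2(r) is taken to be r times the printed formula, i.e. r(k!)^{r/k}Γ(r/k)/(k^2Γ(r)); the printed value is right only for r=1 and makes the claim false for r≥2 (e.g. k=r=2 must agree with k=r=1). *)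

theory Defs
  imports "HOL-Probability.Probability" "HOL-Computational_Algebra.Polynomial"
begin

section \<open>The incomplete Gamma function\<close>

definition upper_Gamma :: "real \<Rightarrow> real \<Rightarrow> real" where
  "upper_Gamma a x = (LINT t:{x..}|lborel. exp (- t) * t powr (a - 1))"

definition Gamma_Q :: "real \<Rightarrow> real \<Rightarrow> real" where
  "Gamma_Q a x = upper_Gamma a x / Gamma a"

text \<open>For \<open>a > 0\<close>, \<open>Gamma_Q a\<close> is a decreasing bijection from \<open>[0, \<infinity>)\<close> onto \<open>(0, 1]\<close>;
  only arguments \<open>y\<close> in \<open>(0, 1]\<close> are meaningful below.\<close>

definition Gamma_Q_inv :: "real \<Rightarrow> real \<Rightarrow> real" where
  "Gamma_Q_inv a y = the_inv_into {0..} (Gamma_Q a) y"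


section \<open>Records in complete binary trees\<close>

text \<open>The nodes of the infinite binary tree are numbered \<open>1, 2, 3, \<dots>\<close> level by level and from
  left to right, so that \<open>v\<close> has the children \<open>2 * v\<close> and \<open>2 * v + 1\<close>. The complete binary tree of
  size \<open>n\<close> consists of the nodes \<open>1, \<dots>, n\<close>: level \<open>d\<close> is \<open>{2 ^ d..<2 ^ (d + 1)}\<close>, hence every level
  is full except possibly the last one, which is filled from the left.\<close>

definition bin_tree :: "nat \<Rightarrow> nat set" where
  "bin_tree n = {1..n}"

definition parent_child :: "(nat \<times> nat) set" where
  "parent_child = {(u, v). 1 \<le> u \<and> (v = 2 * u \<or> v = 2 * u + 1)}"

definition ancestor :: "nat \<Rightarrow> nat \<Rightarrow> bool" where
  "ancestor u v \<longleftrightarrow> (u, v) \<in> parent_child\<^sup>+"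

definition iid_exponential :: "'a measure \<Rightarrow> nat \<Rightarrow> (nat \<Rightarrow> nat \<Rightarrow> 'a \<Rightarrow> real) \<Rightarrow> bool" where
  "iid_exponential M n E \<longleftrightarrow>
     prob_space M \<and>
     prob_space.indep_vars M (\<lambda>_. borel) (\<lambda>(j, v). E j v) ({1..} \<times> bin_tree n) \<and>
     (\<forall>j\<ge>1. \<forall>v\<in>bin_tree n. distributed M lborel (E j v) (exponential_density 1))"

definition alarm :: "(nat \<Rightarrow> nat \<Rightarrow> 'a \<Rightarrow> real) \<Rightarrow> nat \<Rightarrow> nat \<Rightarrow> 'a \<Rightarrow> real" where
  "alarm E r v \<omega> = (\<Sum>j=1..r. E j v \<omega>)"

text \<open>Being smaller than a finite minimum is being smaller than every term; the minimum over the
  empty set of ancestors of the root is \<open>\<infinity>\<close>, so that the root is always a record.\<close>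

definition is_record ::
    "(nat \<Rightarrow> nat \<Rightarrow> 'a \<Rightarrow> real) \<Rightarrow> nat \<Rightarrow> nat \<Rightarrow> nat \<Rightarrow> 'a \<Rightarrow> bool" where
  "is_record E k r v \<omega> \<longleftrightarrow> (\<forall>u. ancestor u v \<longrightarrow> alarm E r v \<omega> < alarm E k u \<omega>)"

definition num_records ::
    "(nat \<Rightarrow> nat \<Rightarrow> 'a \<Rightarrow> real) \<Rightarrow> nat \<Rightarrow> nat \<Rightarrow> nat \<Rightarrow> 'a \<Rightarrow> nat" where
  "num_records E k r n \<omega> = card {v \<in> bin_tree n. is_record E k r v \<omega>}"


section \<open>Constants\<close>

text \<open>The unique sequence of polynomials \<open>p 0, p 1, \<dots>\<close> in \<open>m\<close> such that
  \<open>e\<^sup>-\<^sup>x / (2 Q(k,x) - 1) \<cdot> (e^(x^k/k!) Q(k,x))^m\<close> equals the sum of \<open>p b (m) x^b\<close> over \<open>b\<close>, for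
  all small \<open>x\<close>. The expansion is taken to the right of \<open>0\<close>, as \<open>powr\<close> in \<open>upper_Gamma\<close> does not
  extend analytically to negative arguments.\<close>

definition expansion_coeffs :: "nat \<Rightarrow> nat \<Rightarrow> real poly" where
  "expansion_coeffs k = (THE p. \<forall>m::nat. \<forall>\<^sub>F x in at_right 0.
     (\<lambda>b. poly (p b) (real m) * x ^ b) sums
       (exp (- x) / (2 * Gamma_Q (real k) x - 1) *
         (exp (x ^ k / fact k) * Gamma_Q (real k) x) ^ m))"

definition C6 :: "nat \<Rightarrow> nat \<Rightarrow> nat \<Rightarrow> real" where
  "C6 k j b = coeff (expansion_coeffs k b) j"

definition C7 :: "nat \<Rightarrow> nat \<Rightarrow> nat \<Rightarrow> real" where
  "C7 k r i = (- 1) ^ i * real k * fact k powr (real i / real k) * Gamma (real (i + r) / real k)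
     / (real r * fact i * Gamma (real r / real k))"

definition C8 :: "nat \<Rightarrow> nat \<Rightarrow> nat \<Rightarrow> nat \<Rightarrow> real" where
  "C8 k r j b = real k * fact k powr (real b / real k) * C6 k j b * Gamma (real (b + r) / real k)
     / (real r * Gamma (real r / real k))"

definition C1 :: "nat \<Rightarrow> nat \<Rightarrow> nat \<Rightarrow> real" where
  "C1 k r i = C7 k r i + (\<Sum>j=1..i. C8 k r j (j * k + i))"

text \<open>A node with \<open>d\<close> ancestors is an \<open>r\<close>-record with probability asymptotic to
  \<open>K d^(-r/k)\<close>, where \<open>K = (k!)^(r/k) \<Gamma>(r/k) / (k \<Gamma>(r))\<close>. The leading term \<open>k/r \<cdot> lg n\<close> of the
  centering therefore forces the normalising constant to be \<open>C2 = r/k \<cdot> K\<close>. The formula without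
  the leading factor \<open>r\<close>, as it is found in the source, is correct only for \<open>r = 1\<close>: for \<open>r = k\<close>
  the records are those of i.i.d. continuous variables attached to the nodes, whatever \<open>k\<close> is, so
  that \<open>C2\<close> has to be \<open>1\<close> for every \<open>k = r\<close>.\<close>

definition C2 :: "nat \<Rightarrow> nat \<Rightarrow> real" where
  "C2 k r = real r *
     (fact k powr (real r / real k) * Gamma (real r / real k) / (real k ^ 2 * Gamma (real r)))"

lemma C2_diagonal: "k \<ge> 1 \<Longrightarrow> C2 k k = 1"
proof -
  assume k: "k \<ge> 1"
  then obtain l where l: "k = Suc l"
    by (cases k) auto
  have "Gamma (real k) = fact l"
    using Gamma_fact[of l, where 'a = real] by (simp add: l add.commute)
  then show ?thesis
    by (simp add: C2_def l power2_eq_square del: of_nat_Suc)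
qed

definition C3 :: "nat \<Rightarrow> nat \<Rightarrow> real" where
  "C3 k r = 1 / Gamma (1 + real r / real k)"

definition centering :: "nat \<Rightarrow> nat \<Rightarrow> nat \<Rightarrow> real" where
  "centering k r n = real k / real r * log 2 (real n)
     + (\<Sum>i=1..k. C1 k r i * log 2 (real n) powr (1 - real i / real k))
     + log 2 (log 2 (real n))"


section \<open>The limit law\<close>

definition theta0 :: "nat \<Rightarrow> nat \<Rightarrow> real \<Rightarrow> real" where
  "theta0 k r \<gamma> = frac (\<gamma> - log 2 (Gamma (real r / real k)))"

definition qt :: "nat \<Rightarrow> nat \<Rightarrow> real \<Rightarrow> nat \<Rightarrow> real" where
  "qt k r \<gamma> t = Gamma_Q_inv (real r / real k) (2 powr (theta0 k r \<gamma> - real t))"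

text \<open>The sums over \<open>t \<ge> 1\<close> and \<open>s \<ge> 1\<close> are written with \<open>Suc t\<close> and \<open>Suc s\<close>.\<close>

definition drift :: "nat \<Rightarrow> nat \<Rightarrow> real \<Rightarrow> real" where
  "drift k r \<gamma> =
     (\<Sum>t. exp (- qt k r \<gamma> (Suc t)) * qt k r \<gamma> (Suc t) powr (real r / real k))
     - (\<Sum>t. 2 powr (theta0 k r \<gamma> - real (Suc t)) * Gamma (real r / real k) * qt k r \<gamma> (Suc t))
     + Gamma (1 + real r / real k) *
         (2 powr theta0 k r \<gamma> - theta0 k r \<gamma> - log 2 (Gamma (real r / real k)) - 1)"

definition theta :: "nat \<Rightarrow> nat \<Rightarrow> real \<Rightarrow> real \<Rightarrow> real" where
  "theta k r \<gamma> x = frac (\<gamma> + log 2 (x / Gamma (real r / real k)))"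

definition nu_density :: "nat \<Rightarrow> nat \<Rightarrow> real \<Rightarrow> real \<Rightarrow> real" where
  "nu_density k r \<gamma> x = Gamma (real r / real k) ^ 2 / x ^ 2 *
     (\<Sum>s. let q = Gamma_Q_inv (real r / real k) (2 powr (theta k r \<gamma> x - real (Suc s)))
           in 4 powr (theta k r \<gamma> x - real (Suc s)) * exp q * q powr (1 - real r / real k))"

definition nu :: "nat \<Rightarrow> nat \<Rightarrow> real \<Rightarrow> real measure" where
  "nu k r \<gamma> = density lborel (\<lambda>x. ennreal (indicator {0<..} x * nu_density k r \<gamma> x))"

definition levy_measure :: "real measure \<Rightarrow> bool" where
  "levy_measure \<nu> \<longleftrightarrow> sets \<nu> = sets borel \<and> emeasure \<nu> {0} = 0 \<and>
     (\<integral>\<^sup>+x. ennreal (min 1 (x ^ 2)) \<partial>\<nu>) < \<infinity>"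

text \<open>A law is infinitely divisible if, for every \<open>n \<ge> 1\<close>, it is the law of a sum of \<open>n\<close> i.i.d.
  real random variables.\<close>

definition infinitely_divisible :: "real measure \<Rightarrow> bool" where
  "infinitely_divisible W \<longleftrightarrow> (\<forall>n::nat. n \<ge> 1 \<longrightarrow> (\<exists>V. real_distribution V \<and>
     distr (\<Pi>\<^sub>M i\<in>{..<n}. V) borel (\<lambda>x. \<Sum>i<n. x i) = W))"

end

theory Submission
  imports Defs "HOL-Complex_Analysis.Complex_Analysis" "HOL-Real_Asymp.Real_Asymp"
begin

text \<open>Write l = lg n and a = r/k. Given that its own r-th alarm rings at x, a node of depth d
  is an r-record with probability Q(k,x)^d, so its record probability is \<open>psi k r d\<close>,
  of order d^(-a). Records are dependent because an unusually early alarm at a node with a large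
  subtree suppresses records in that whole subtree; the limit law is made of these losses.

  Linearisation. Let J be of order l^5 and condition on the alarms of the nodes 1..J. The record
  indicators minus their conditional probabilities are orthogonal unless two nodes share a node of
  their paths beyond J (\<open>orthogonal\<close>), which happens for at most 4n^2/(J+1) pairs
  (\<open>card_conflicts\<close>). Hence the sum of these differences is O(n/sqrt J) in L1
  (\<open>record_sum_variance\<close>), negligible against n/l^(a+1). Alarms of top nodes are rarely
  early enough to matter, so the product of survival indicators in the conditional probability may
  be replaced by its linear part (\<open>Y_linearization\<close>). Up to a small L1 error the number
  of records is therefore a deterministic sum of \<open>psi\<close> over depths, minus the sum over
  u <= J of the subtree size of u times the centred loss \<open>L m (T u)\<close> with m = floor l
  (\<open>num_records_approx\<close>). The last sum has independent terms.

  Poisson limit. In the coordinate z = m T^k/k! an alarm has intensity about dz/m, and the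
  normalised loss tends to \<Gamma>(a,z) (\<open>gL_limit\<close>). About n/2^h nodes have a subtree
  with h levels, and all but at most one of these subtrees have 2^h - 1 nodes. Write n = l 2^(g+H)
  with integer H and put h = H - j: the class j has about m w_j nodes with jumps \<Gamma>(a,z)/w_j,
  where w_j tends to 2^(\<gamma>+j). So the Levy measure of the limit is the sum over all integers j
  of w_j times the image of Lebesgue measure under z -> \<Gamma>(a,z)/w_j. A change of variables
  identifies it with \<open>nu\<close> (\<open>nu_density_slices\<close>,
  \<open>nu_integral_slices\<close>). On the side of characteristic functions, the convergence is
  \<open>array_limit\<close>, dominated convergence over j, together with
  \<open>poissonization\<close>.

  Centering. The array compensates entire classes j >= 0, whereas the Levy-Khinchine exponent
  compensates the jumps below 1; the difference is evaluated in \<open>drift_identity\<close> and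
  produces f. Laplace's method gives an expansion of \<open>psi\<close> in powers of d^(-1/k) whose
  coefficients are the C1 (\<open>psi_expansion\<close>), hence the mean equals
  \<open>centering\<close> plus \<open>mean_height\<close> up to o(1)
  (\<open>mean_record_sum\<close>). The total mean of the jumps contains \<open>mean_height\<close>
  as well, because subtree sizes and depths have the same sum up to n
  (\<open>shallow_subtrees\<close>), and the two contributions cancel (\<open>shift_limit\<close>).

  Existence. For c >= 0, exp of c times the limit exponent is a limit of compound Poisson
  characteristic functions and continuous at 0, hence a characteristic function
  (\<open>is_char_limit\<close>, \<open>limit_law_is_char\<close>). The case c = 1 gives W, the
  cases c = 1/n its convolution roots, and Levy's continuity theorem gives the convergence in
  law.\<close>

abbreviation pos_integrable :: "(real => 'b::{banach, second_countable_topology}) => bool" where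
 "pos_integrable \<equiv> set_integrable lborel {0<..}"

abbreviation pos_integral :: "(real => 'b::{banach, second_countable_topology}) => 'b" (binder "PINT " 10) where
 "pos_integral \<equiv> set_lebesgue_integral lborel {0<..}"

notation LIMSEQ ("((_)/ ----> (_))" [60, 60] 60)
notation tendsto (infixr "--->" 55)

lemmas bochner_add = Bochner_Integration.integrable_add
lemmas bochner_diff = Bochner_Integration.integrable_diff
lemmas bochner_integral_add = Bochner_Integration.integral_add
lemmas bochner_integral_cong = Bochner_Integration.integral_cong
lemmas bochner_integral_diff = Bochner_Integration.integral_diff
lemmas bochner_integral_mult_right_zero = Bochner_Integration.integral_mult_right_zero
lemmas bochner_integral_scaleR_right = Bochner_Integration.integral_scaleR_right
lemmas bochner_integral_sum = Bochner_Integration.integral_sum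
lemmas bochner_sum = Bochner_Integration.integrable_sum

section \<open>Characteristic functions: closure properties, the continuity theorem, infinite
  divisibility\<close>

definition is_char :: "(real => complex) => bool" where
 "is_char \<phi> \<longleftrightarrow> (\<exists>V. real_distribution V & char V = \<phi>)"

lemma is_charE:
 assumes "is_char \<phi>" obtains V where "real_distribution V" "char V = \<phi>"
 using assms unfolding is_char_def by blast

lemma is_char_norm_le: "is_char \<phi> ==> norm (\<phi> t) <= 1"
 by (auto simp: is_char_def real_distribution.cmod_char_le_1)

lemma is_char_measurable: "is_char \<phi> ==> \<phi> \<in> borel_measurable borel"
 by (auto simp: is_char_def real_distribution.char_measurable)

lemma is_char_distr:
 assumes "prob_space M" "X \<in> borel_measurable M"
 shows "is_char (char (distr M borel X))"
proof -
 interpret prob_space M by fact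
 have "real_distribution (distr M borel X)"
  by (rule real_distribution_distr) fact
 thus ?thesis unfolding is_char_def by blast
qed

lemma is_char_iexp: "is_char (%t. iexp (t*b))"
proof -
 interpret prob_space "return borel b" by (rule prob_space_return) simp
 have "real_distribution (return borel b)" by standard simp
 moreover have "char (return borel b) = (%t. iexp (t*b))"
  by (rule ext) (simp add: char_def integral_return)
 ultimately show ?thesis unfolding is_char_def by blast
qed

lemma is_char_mult:
 assumes "is_char \<phi>" "is_char \<psi>"
 shows "is_char (%t. \<phi> t*\<psi> t)"
proof -
 obtain U V where U: "real_distribution U" "char U = \<phi>" and V: "real_distribution V" "char V = \<psi>"
  using assms by (auto elim!: is_charE)
 interpret U: real_distribution U by fact
 interpret V: real_distribution V by fact
 interpret UV: pair_prob_space U V ..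
 let ?X = "%x::real \<times> real. fst x + snd x"
 have "char (distr (U \<Otimes>\<^sub>M V) borel ?X) t = \<phi> t*\<psi> t" for t
 proof -
  have "char (distr (U \<Otimes>\<^sub>M V) borel ?X) t = (CLINT x|U \<Otimes>\<^sub>M V. iexp (t*?X x))"
   by (simp add: char_def integral_distr)
  also have "... = (CLINT x|U. CLINT y|V. iexp (t*?X (x, y)))"
   by (rule UV.integral_fst'[symmetric], rule UV.integrable_const_bound[of _ 1]) auto
  also have "... = (CLINT x|U. CLINT y|V. iexp (t*x)*iexp (t*y))"
   by (simp add: exp_add[symmetric] algebra_simps)
  also have "... = \<phi> t*\<psi> t"
   using U(2) V(2) by (auto simp: char_def fun_eq_iff)
  finally show ?thesis .
 qed
 moreover have "is_char (char (distr (U \<Otimes>\<^sub>M V) borel ?X))"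
  by (intro is_char_distr UV.prob_space_axioms) auto
 ultimately show ?thesis by presburger
qed

lemma is_char_prod:
 assumes "!!i. i \<in> I ==> is_char (\<phi> i)"
 shows "is_char (%t. \<Prod>i\<in>I. \<phi> i t)"
 using assms
proof (induction I rule: infinite_finite_induct)
 case (insert x F)
 thus ?case using is_char_mult by auto
qed (use is_char_iexp[of 0] in auto)

text \<open>This belongs to a variable with characteristic function \<open>\<phi>\<close> that is
  switched off, that is set to 0, with probability \<open>1 - p\<close>. Products of such mixtures
  approximate compound Poisson laws in \<open>is_char_exp\<close>.\<close>

lemma is_char_mix:
 assumes "is_char \<phi>" and p: "0 <= p" "p <= 1"
 shows "is_char (%t. 1 + of_real p*(\<phi> t - 1))"
proof -
 obtain V where V: "real_distribution V" "char V = \<phi>"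
  using assms by (auto elim!: is_charE)
 interpret V: real_distribution V by fact
 let ?B = "measure_pmf (bernoulli_pmf p)"
 interpret UV: pair_prob_space ?B V ..
 let ?X = "%x::bool \<times> real. if fst x then snd x else 0"
 have [measurable]: "?X \<in> borel_measurable (?B \<Otimes>\<^sub>M V)" by measurable
 have "char (distr (?B \<Otimes>\<^sub>M V) borel ?X) t = 1 + of_real p*(\<phi> t - 1)" for t
 proof -
  have "char (distr (?B \<Otimes>\<^sub>M V) borel ?X) t = (CLINT x|?B \<Otimes>\<^sub>M V. iexp (t*?X x))"
   by (simp add: char_def integral_distr)
  also have "... = (CLINT x|?B. CLINT y|V. iexp (t*?X (x, y)))"
   by (rule UV.integral_fst'[symmetric], rule UV.integrable_const_bound[of _ 1]) auto
  also have "... = (\<Sum>b\<in>UNIV. pmf (bernoulli_pmf p) b *\<^sub>R (CLINT y|V. iexp (t*?X (b, y))))"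
   by (rule integral_measure_pmf) auto
  also have "... = of_real p*\<phi> t + (1 - of_real p)"
   using V p V.prob_space
   by (auto simp: UNIV_bool char_def fun_eq_iff scaleR_conv_of_real V.space_eq_univ)
  finally show ?thesis by (simp add: algebra_simps)
 qed
 moreover have "is_char (char (distr (?B \<Otimes>\<^sub>M V) borel ?X))"
  by (intro is_char_distr UV.prob_space_axioms) auto
 ultimately show ?thesis by presburger
qed

text \<open>Fubini and the self-duality of the Gaussian: averaging a characteristic function over a
  Gaussian gives a Gaussian average of the law itself, from which tails can be read off.\<close>

lemma gaussian_smoothing:
 assumes "real_distribution V"
 shows "(CLINT t|std_normal_distribution. char V (\<sigma>*t)) = of_real (LINT x|V. exp (- ((\<sigma>*x)\<^sup>2/2)))"
proof -
 interpret V: real_distribution V by fact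
 interpret N: real_distribution std_normal_distribution by (rule real_dist_normal_dist)
 interpret UV: pair_prob_space std_normal_distribution V ..
 have "(CLINT t|std_normal_distribution. char V (\<sigma>*t))
   = (CLINT t|std_normal_distribution. CLINT x|V. iexp (\<sigma>*t*x))"
  by (simp add: char_def)
 also have "... = (CLINT x|V. CLINT t|std_normal_distribution. iexp (\<sigma>*t*x))"
  by (rule UV.Fubini_integral[symmetric], rule UV.integrable_const_bound[of _ 1])
    (auto simp: case_prod_beta')
 also have "... = (CLINT x|V. char std_normal_distribution (\<sigma>*x))"
  by (simp add: char_def mult.commute mult.left_commute)
 also have "... = (CLINT x|V. of_real (exp (- ((\<sigma>*x)\<^sup>2/2))))"
  by (simp add: char_std_normal_distribution exp_of_real[symmetric])
 finally show ?thesis by simp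
qed

text \<open>Markov's inequality: outside the window \<open>\<bar>\<sigma>*x\<bar> >= 1\<close>,
  where \<open>1 - exp (- 1/2) >= 1/3\<close>, which explains the factor 3.\<close>

lemma gaussian_smoothing_tail:
 assumes "real_distribution V" "\<sigma> > 0"
 shows "measure V {- (1/\<sigma>)<..1/\<sigma>} >= 1 - 3*(1 - (LINT x|V. exp (- ((\<sigma>*x)\<^sup>2/2))))"
proof -
 interpret V: real_distribution V by fact
 have int1: "integrable V (%x. exp (- ((\<sigma>*x)\<^sup>2/2)))"
  by (rule V.integrable_const_bound[of _ 1]) auto
 have pw: "indicator (- {- (1/\<sigma>)<..1/\<sigma>}) x <= 3*(1 - exp (- ((\<sigma>*x)\<^sup>2/2)))" for x :: real
 proof (cases "x \<in> - {- (1/\<sigma>)<..1/\<sigma>}")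
  case True
  hence "\<bar>\<sigma>*x\<bar> >= 1" using \<open>\<sigma> > 0\<close> by (auto simp: abs_mult field_simps abs_if)
  hence "(\<sigma>*x)\<^sup>2 >= 1" by (metis abs_le_square_iff abs_one power_one)
  hence "exp (- ((\<sigma>*x)\<^sup>2/2)) <= exp (-1/2)" by simp
  also have "exp (-1/2 :: real) <= 2/3"
   using exp_ge_add_one_self[of "1/2::real"] by (simp add: exp_minus field_simps)
  finally show ?thesis using True by simp
 qed simp
 have "measure V (- {- (1/\<sigma>)<..1/\<sigma>}) = (LINT x|V. indicator (- {- (1/\<sigma>)<..1/\<sigma>}) x)" by simp
 also have "... <= (LINT x|V. 3*(1 - exp (- ((\<sigma>*x)\<^sup>2/2))))"
  using pw by (intro integral_mono) (auto intro!: int1 simp: integrable_indicator_iff V.emeasure_eq_measure)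
 also have "... = 3*(1 - (LINT x|V. exp (- ((\<sigma>*x)\<^sup>2/2))))"
  using int1 V.prob_space by (simp add: V.space_eq_univ)
 finally show ?thesis
  using V.prob_compl[of "{- (1/\<sigma>)<..1/\<sigma>}"] by (simp add: Compl_eq_Diff_UNIV V.space_eq_univ)
qed

text \<open>Covering all larger windows allows one common window to be chosen later for finitely
  many laws.\<close>

lemma real_distribution_tight:
 assumes "real_distribution V" "\<epsilon> > 0"
 shows "\<exists>c>0. \<forall>c'\<ge>c. measure V {-c'<..c'} > 1 - \<epsilon>"
proof -
 interpret V: real_distribution V by fact
 let ?A = "%j::nat. {- real j<..real j}"
 have "(%j. measure V (?A j)) ----> measure V (\<Union>j. ?A j)"
  by (rule V.finite_Lim_measure_incseq) (auto simp: incseq_def)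
 moreover have "(\<Union>j. ?A j) = UNIV"
 proof (intro equalityI subsetI UnI1)
  fix x :: real
  obtain j :: nat where "\<bar>x\<bar> < real j" using reals_Archimedean2 by blast
  thus "x \<in> (\<Union>j. ?A j)" by (auto intro!: exI[of _ j])
 qed auto
 ultimately have "(%j. measure V (?A j)) ----> 1"
  using V.prob_space by (simp add: V.space_eq_univ)
 hence "\<forall>\<^sub>F j in sequentially. measure V (?A j) > 1 - \<epsilon>"
  using \<open>\<epsilon> > 0\<close> by (intro order_tendstoD) auto
 then obtain j0 where j0: "!!j. j >= j0 ==> measure V (?A j) > 1 - \<epsilon>"
  by (auto simp: eventually_sequentially)
 show ?thesis
 proof (intro exI[of _ "real (Suc j0)"] conjI allI impI)
  fix c' assume "real (Suc j0) <= c'"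
  hence "measure V (?A j0) <= measure V {-c'<..c'}"
   by (intro V.finite_measure_mono) auto
  thus "measure V {-c'<..c'} > 1 - \<epsilon>" using j0[of j0] by simp
 qed simp
qed

text \<open>Levy's continuity theorem in the form that creates the limit law. Continuity at 0 makes
  Gaussian averages of \<open>\<psi>\<close> close to 1 at small scales; the same then holds for
  \<open>\<phi> n\<close> with large \<open>n\<close>, so the laws are tight. Any weak subsequential
  limit has characteristic function \<open>\<psi>\<close>.\<close>

theorem is_char_limit:
 assumes ch: "!!n. is_char (\<phi> n)"
  and lim: "!!t. (%n. \<phi> n t) ----> \<psi> t"
  and cont: "isCont \<psi> 0"
 shows "is_char \<psi>"
proof -
 from ch have "\<forall>n. \<exists>V. real_distribution V & char V = \<phi> n" by (simp add: is_char_def)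
 then obtain V where V: "!!n. real_distribution (V n)" and charV: "!!n. char (V n) = \<phi> n"
  by metis
 interpret V: real_distribution "V n" for n by (rule V)
 interpret N: real_distribution std_normal_distribution by (rule real_dist_normal_dist)
 have [measurable]: "\<phi> n \<in> borel_measurable borel" for n using is_char_measurable[OF ch] .
 have [measurable]: "\<psi> \<in> borel_measurable borel"
  by (rule borel_measurable_LIMSEQ_metric[of \<phi>]) (use lim in auto)
 have norm_psi: "norm (\<psi> t) <= 1" for t
  by (rule Lim_bounded[OF tendsto_norm[OF lim], of 0]) (use is_char_norm_le[OF ch] in auto)
 have psi0: "\<psi> 0 = 1"
 proof -
  have "\<phi> n 0 = 1" for n using V.char_zero[of n] charV[of n] by simp
  thus ?thesis using LIMSEQ_unique[OF lim[of 0]] by simp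
 qed
 have lim1: "(%n. CLINT t|std_normal_distribution. \<phi> n (\<sigma>*t)) ----> (CLINT t|std_normal_distribution. \<psi> (\<sigma>*t))" for \<sigma>
  by (rule integral_dominated_convergence[where w="%_. 1"])
    (use lim is_char_norm_le[OF ch] in auto)
 have lim2: "(%j. CLINT t|std_normal_distribution. \<psi> (inverse (real (Suc j))*t)) ----> (CLINT t|std_normal_distribution. 1)"
 proof (rule integral_dominated_convergence[where w="%_. 1"])
  have "(%j. \<psi> (inverse (real (Suc j))*t)) ----> 1" for t
  proof -
   have "(%j. inverse (real (Suc j))*t) ----> 0*t"
    by (intro tendsto_mult LIMSEQ_inverse_real_of_nat) auto
   thus ?thesis using isCont_tendsto_compose[OF cont] psi0 by simp
  qed
  thus "AE t in std_normal_distribution. (%j. \<psi> (inverse (real (Suc j))*t)) ----> 1" by simp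
 qed (use norm_psi in auto)
 have "tight V"
  unfolding tight_def
 proof (intro conjI allI impI V)
  fix \<epsilon> :: real assume \<epsilon>: "\<epsilon> > 0"
  have "(CLINT t|std_normal_distribution. (1::complex)) = 1"
   using N.prob_space by simp
  hence "\<forall>\<^sub>F j in sequentially. dist (CLINT t|std_normal_distribution. \<psi> (inverse (real (Suc j))*t)) 1 < \<epsilon>/6"
   using tendstoD[OF lim2, of "\<epsilon>/6"] \<epsilon> by simp
  then obtain j where "dist (CLINT t|std_normal_distribution. \<psi> (inverse (real (Suc j))*t)) 1 < \<epsilon>/6"
   by (auto simp: eventually_sequentially)
  moreover define \<sigma> where "\<sigma> = inverse (real (Suc j))"
  ultimately have j: "dist (CLINT t|std_normal_distribution. \<psi> (\<sigma>*t)) 1 < \<epsilon>/6" and \<sigma>: "\<sigma> > 0"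
   by simp_all
  have "\<forall>\<^sub>F n in sequentially. dist (CLINT t|std_normal_distribution. \<phi> n (\<sigma>*t)) (CLINT t|std_normal_distribution. \<psi> (\<sigma>*t)) < \<epsilon>/6"
   using tendstoD[OF lim1, of "\<epsilon>/6"] \<epsilon> by simp
  then obtain n0 where n0: "!!n. n >= n0 ==> dist (CLINT t|std_normal_distribution. \<phi> n (\<sigma>*t)) (CLINT t|std_normal_distribution. \<psi> (\<sigma>*t)) < \<epsilon>/6"
   by (auto simp: eventually_sequentially)
  \<comment> \<open>Two errors of \<open>\<epsilon>/6\<close> stay below
    \<open>\<epsilon>/3\<close>, and the factor 3 of \<open>gaussian_smoothing_tail\<close> turns
    this into the required mass \<open>1 - \<epsilon>\<close>.\<close>
  have tail: "\<bar>x - 1\<bar> < \<epsilon>/3 ==> 1 - 3*(1 - x) <= m ==> 1 - \<epsilon> < m" for x m :: real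
   unfolding abs_less_iff by (simp add: field_simps)
  have tri: "dist x y < \<epsilon>/6 ==> dist y z < \<epsilon>/6 ==> dist x z < \<epsilon>/3" for x y z :: complex
   using dist_triangle[of x z y] \<epsilon> by linarith
  have large: "measure (V n) {-(1/\<sigma>)<..1/\<sigma>} > 1 - \<epsilon>" if "n >= n0" for n
  proof -
   have "dist (CLINT t|std_normal_distribution. \<phi> n (\<sigma>*t)) 1 < \<epsilon>/3"
    by (rule tri[OF n0[OF that] j])
   hence "cmod (of_real (LINT x|V n. exp (- ((\<sigma>*x)\<^sup>2/2))) - 1) < \<epsilon>/3"
    using gaussian_smoothing[OF V[of n], of \<sigma>] charV by (simp add: dist_norm)
   hence "\<bar>(LINT x|V n. exp (- ((\<sigma>*x)\<^sup>2/2))) - 1\<bar> < \<epsilon>/3"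
    by (metis norm_of_real of_real_1 of_real_diff real_norm_def)
   thus ?thesis by (rule tail[OF _ gaussian_smoothing_tail[OF V[of n] \<sigma>]])
  qed
  have "\<forall>n. \<exists>c>0. \<forall>c'\<ge>c. measure (V n) {-c'<..c'} > 1 - \<epsilon>"
   using real_distribution_tight[OF V \<epsilon>] by blast
  then obtain c where c: "!!n. c n > 0" "!!n c'. c' >= c n ==> measure (V n) {-c'<..c'} > 1 - \<epsilon>"
   by metis
  \<comment> \<open>The laws before \<open>n0\<close> are not controlled by the limit; being
    finitely many, they are absorbed by a maximum.\<close>
  define b where "b = Max (insert (1/\<sigma>) (c ` {..<n0}))"
  have b1: "1/\<sigma> <= b" and b2: "!!n. n < n0 ==> c n <= b" unfolding b_def by auto
  show "\<exists>a b. a < b & (\<forall>n. measure (V n) {a<..b} > 1 - \<epsilon>)"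
  proof (intro exI conjI allI)
   show "- b < b" using b1 \<sigma> by (smt (verit) divide_pos_pos)
   fix n show "measure (V n) {-b<..b} > 1 - \<epsilon>"
   proof (cases "n < n0")
    case False
    have "measure (V n) {-(1/\<sigma>)<..1/\<sigma>} <= measure (V n) {-b<..b}"
     using b1 by (intro V.finite_measure_mono) auto
    thus ?thesis using large[of n] False by simp
   qed (use c b2 in auto)
  qed
 qed
 from tight_imp_convergent_subsubsequence[OF this strict_mono_id]
 obtain s W where s: "strict_mono (s :: nat => nat)" and W: "real_distribution W"
  and wc: "weak_conv_m (V \<circ> id \<circ> s) W" by blast
 have "char W = \<psi>"
 proof
  fix t
  have "(%n. char ((V \<circ> id \<circ> s) n) t) ----> char W t"
   by (rule levy_continuity1[OF _ W wc]) (use V in auto)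
  hence "(%n. \<phi> (s n) t) ----> char W t" by (simp add: charV)
  moreover have "(%n. \<phi> (s n) t) ----> \<psi> t"
   using LIMSEQ_subseq_LIMSEQ[OF lim s] by (simp add: comp_def)
  ultimately show "char W t = \<psi> t" by (rule LIMSEQ_unique)
 qed
 thus ?thesis using W unfolding is_char_def by blast
qed

lemma norm_exp_minus_linear:
 fixes z :: complex
 shows "norm (exp z - 1 - z) <= exp (norm z)*(norm z)\<^sup>2"
 using Taylor_exp_field[of z 1] by (simp add: power2_eq_square diff_diff_eq)

text \<open>The compound Poisson law with intensity \<open>c\<close>, as the limit of the
  \<open>n\<close>-fold products of \<open>1 + c/n * (\<phi> - 1)\<close>, each of which is a
  mixture in the sense of \<open>is_char_mix\<close>.\<close>

lemma is_char_exp: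
 assumes "is_char \<phi>" and c: "0 <= c"
 shows "is_char (%t. exp (of_real c*(\<phi> t - 1)))"
proof (rule is_char_limit)
 obtain V where V: "real_distribution V" "char V = \<phi>"
  using assms by (auto elim!: is_charE)
 interpret V: real_distribution V by fact
 show "isCont (%t. exp (of_real c*(\<phi> t - 1))) 0"
  using V.isCont_char[of 0] V(2) by (auto intro!: continuous_intros)
 \<comment> \<open>The minimum keeps \<open>p n\<close> a probability for the finitely many
   \<open>n\<close> with \<open>Suc n < c\<close>.\<close>
 define p where "p n = min 1 (c/real (Suc n))" for n
 have p: "0 <= p n" "p n <= 1" for n using c by (auto simp: p_def)
 show "is_char (%t. \<Prod>i<Suc n. 1 + of_real (p n)*(\<phi> t - 1))" for n
  by (intro is_char_prod is_char_mix p assms)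
 fix t
 let ?z = "\<phi> t - 1"
 have zz: "norm ?z <= 2"
  using norm_triangle_ineq4[of "\<phi> t" 1] is_char_norm_le[OF assms(1), of t] by simp
 have rez: "Re ?z <= 0"
  using complex_Re_le_cmod[of "\<phi> t"] is_char_norm_le[OF assms(1), of t] by simp
 have bound: "norm ((\<Prod>i<Suc n. 1 + of_real (p n)*?z) - exp (of_real c*?z)) <= 4*exp 2*c^2/real (Suc n)"
  if n: "real (Suc n) >= c" for n
 proof -
  have "c/real (Suc n) <= 1" using n by (simp add: divide_le_eq)
  hence pn: "p n = c/real (Suc n)" by (simp add: p_def)
  have "c = real (Suc n)*p n" by (simp add: pn del: of_nat_Suc)
  hence "of_real c*?z = of_nat (Suc n)*(of_real (p n)*?z)"
   by (simp only: of_real_mult of_real_of_nat_eq mult.assoc)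
  hence "exp (of_real c*?z) = (\<Prod>i<Suc n. exp (of_real (p n)*?z))"
   by (simp only: exp_of_nat_mult prod_constant card_lessThan)
  hence "norm ((\<Prod>i<Suc n. 1 + of_real (p n)*?z) - exp (of_real c*?z))
    <= (\<Sum>i<Suc n. norm (1 + of_real (p n)*?z - exp (of_real (p n)*?z)))"
  proof (simp only:, intro norm_prod_diff)
   show "norm (exp (of_real (p n)*?z)) <= 1" using rez p[of n] by (simp add: norm_exp_eq_Re mult_nonneg_nonpos)
   have "is_char (%t. 1 + of_real (p n)*(\<phi> t - 1))" by (intro is_char_mix p assms)
   from is_char_norm_le[OF this] show "norm (1 + of_real (p n)*?z) <= 1" .
  qed
  also have "... <= (\<Sum>i<Suc n. exp 2*(2*p n)\<^sup>2)"
  proof (intro sum_mono)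
   let ?w = "of_real (p n)*?z"
   have "norm ?w = p n*norm ?z" using p[of n] by (simp add: norm_mult)
   moreover have "p n*norm ?z <= p n*2" using p[of n] zz by (intro mult_left_mono) auto
   ultimately have w: "norm ?w <= 2*p n" "norm ?w <= 2" using p[of n] by linarith+
   have "norm (1 + ?w - exp ?w) = norm (exp ?w - 1 - ?w)"
    by (metis diff_diff_eq norm_minus_commute)
   also have "... <= exp (norm ?w)*(norm ?w)\<^sup>2" by (rule norm_exp_minus_linear)
   also have "... <= exp 2*(2*p n)\<^sup>2"
    using w by (intro mult_mono power_mono) auto
   finally show "norm (1 + ?w - exp ?w) <= exp 2*(2*p n)\<^sup>2" .
  qed
  also have "... = 4*exp 2*c^2/real (Suc n)"
   by (simp add: pn power2_eq_square field_simps del: of_nat_Suc)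
  finally show ?thesis .
 qed
 have "(%n. (\<Prod>i<Suc n. 1 + of_real (p n)*?z) - exp (of_real c*?z)) ----> 0"
 proof (rule Lim_null_comparison)
  show "\<forall>\<^sub>F n in sequentially. norm ((\<Prod>i<Suc n. 1 + of_real (p n)*?z) - exp (of_real c*?z)) <= 4*exp 2*c^2/real (Suc n)"
  proof -
   obtain n0 :: nat where "c < real n0" using reals_Archimedean2 by blast
   hence "real (Suc n) >= c" if "n >= n0" for n using that by simp
   thus ?thesis using bound by (intro eventually_sequentiallyI[of n0]) blast
  qed
  show "(%n. 4*exp 2*c^2/real (Suc n)) ----> 0" by real_asymp
 qed
 thus "(%n. \<Prod>i<Suc n. 1 + of_real (p n)*?z) ----> exp (of_real c*?z)"
  by (rule LIM_zero_cancel)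
qed

text \<open>Coordinates of a product measure are independent, so the sum has characteristic function
  \<open>\<phi>^n\<close>; Levy uniqueness turns the equality of characteristic functions into
  equality of laws.\<close>

lemma infinitely_divisibleI:
 assumes W: "real_distribution W"
  and root: "!!n. n >= 1 ==> \<exists>\<phi>. is_char \<phi> & (\<forall>t. \<phi> t^n = char W t)"
 shows "infinitely_divisible W"
 unfolding infinitely_divisible_def
proof (intro allI impI)
 fix n :: nat assume "n >= 1"
 from root[OF this] obtain \<phi> where \<phi>: "is_char \<phi>" "!!t. \<phi> t^n = char W t" by blast
 then obtain V where V: "real_distribution V" "char V = \<phi>" by (auto elim: is_charE)
 interpret V: real_distribution V by fact
 interpret P: product_prob_space "%_::nat. V" "{..<n}" ..
 let ?P = "\<Pi>\<^sub>M i\<in>{..<n}. V"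
 have mea: "(%x. x i) \<in> borel_measurable ?P" if "i < n" for i
 proof -
  have "(%x. x i) \<in> measurable ?P V" using that by (intro measurable_component_singleton) auto
  thus ?thesis by (simp add: measurable_def)
 qed
 have dc: "distr ?P borel (%x. x i) = V" if "i < n" for i
 proof -
  have "distr ?P borel (%x. x i) = distr ?P V (%x. x i)"
   by (rule distr_cong) auto
  also have "... = V" using that by (intro P.PiM_component) auto
  finally show ?thesis .
 qed
 have "P.indep_vars (%_. V) (%i x. x i) {..<n}"
 proof (cases "n = 0")
  case False
  have *: "distr ?P ?P (%x. \<lambda>i\<in>{..<n}. x i) = ?P"
   by (rule trans[OF distr_cong distr_id2]) (auto simp: space_PiM PiE_def restrict_extensional extensional_restrict)
  have **: "Pi\<^sub>M {..<n} (%i. distr ?P V (%x. x i)) = ?P"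
   by (intro PiM_cong refl P.PiM_component) auto
  have "{..<n} ~= {}" using False by auto
  thus ?thesis
   by (subst P.indep_vars_iff_distr_eq_PiM') (simp_all only: * **, auto)
 qed (use \<open>n >= 1\<close> in auto)
 hence "P.indep_vars (%_. borel) (%i x. x i) {..<n}"
  by (rule P.indep_vars_compose2) auto
 hence "char (distr ?P borel (%x. \<Sum>i<n. x i)) t = (\<Prod>i<n. char (distr ?P borel (%x. x i)) t)" for t
  by (rule P.char_distr_sum)
 also have "(\<Prod>i<n. char (distr ?P borel (%x. x i)) t) = char W t" for t
  using dc V \<phi> by simp
 finally have "char (distr ?P borel (%x. \<Sum>i<n. x i)) = char W" by blast
 moreover have "real_distribution (distr ?P borel (%x. \<Sum>i<n. x i))"
  by (rule P.real_distribution_distr) (use mea in \<open>auto intro!: borel_measurable_sum\<close>)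
 ultimately have "distr ?P borel (%x. \<Sum>i<n. x i) = W"
  using W Levy_uniqueness by blast
 thus "\<exists>V. real_distribution V & distr (Pi\<^sub>M {..<n} (%i. V)) borel (%x. \<Sum>i<n. x i) = W"
  using V by blast
qed

section \<open>Change of variables\<close>

lemma set_integrable_lebesgue_iff:
 fixes f :: "real => 'a::euclidean_space"
 assumes "set_borel_measurable borel S f"
 shows "set_integrable lebesgue S f \<longleftrightarrow> set_integrable lborel S f"
 using assms unfolding set_integrable_def set_borel_measurable_def
 by (intro integrable_completion) simp

text \<open>Transfer of the change of variables for the completed Lebesgue measure to Borel
  functions. The equation also holds without integrability: both integrals then have the default
  value 0.\<close>

lemma change_of_variables_lborel:
 fixes g g' :: "real => real" and f :: "real => 'a::euclidean_space"
 assumes S: "S \<in> sets borel" and gS: "g ` S \<in> sets borel"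
  and g: "!!x. x \<in> S ==> (g has_real_derivative g' x) (at x)" "inj_on g S"
  and f: "set_borel_measurable borel (g ` S) f"
  and fg: "set_borel_measurable borel S (%x. \<bar>g' x\<bar> *\<^sub>R f (g x))"
 shows "set_integrable lborel S (%x. \<bar>g' x\<bar> *\<^sub>R f (g x)) \<longleftrightarrow> set_integrable lborel (g ` S) f" (is "?A \<longleftrightarrow> ?B")
  and "(LINT x:S|lborel. \<bar>g' x\<bar> *\<^sub>R f (g x)) = (LINT y:g ` S|lborel. f y)"
proof -
 have S': "S \<in> sets lebesgue" using S by simp
 have d: "(g has_real_derivative g' x) (at x within S)" if "x \<in> S" for x
  using g(1)[OF that] by (rule has_field_derivative_at_within)
 note * = has_absolute_integral_change_of_variables_real[OF S' d g(2), where f=f]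
 have iff: "set_integrable lebesgue S (%x. \<bar>g' x\<bar> *\<^sub>R f (g x)) \<longleftrightarrow> set_integrable lebesgue (g ` S) f"
  using * by blast
 thus iff': "?A \<longleftrightarrow> ?B"
  using set_integrable_lebesgue_iff[OF f] set_integrable_lebesgue_iff[OF fg] by simp
 show "(LINT x:S|lborel. \<bar>g' x\<bar> *\<^sub>R f (g x)) = (LINT y:g ` S|lborel. f y)"
 proof (cases "?A")
  case True
  hence B: "?B" using iff' by simp
  have "set_integrable lebesgue S (%x. \<bar>g' x\<bar> *\<^sub>R f (g x))"
   using True set_integrable_lebesgue_iff[OF fg] by simp
  hence "integral S (%x. \<bar>g' x\<bar> *\<^sub>R f (g x)) = integral (g ` S) f"
   using * by blast
  thus ?thesis
   using set_borel_integral_eq_integral(2)[OF True] set_borel_integral_eq_integral(2)[OF B] by simp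
 next
  case False
  thus ?thesis using iff'
   by (simp add: set_lebesgue_integral_def set_integrable_def not_integrable_integral_eq)
 qed
qed

lemma integral_dominated_convergence_at_top':
 fixes s :: "real => 'a => real" and f w :: "'a => real"
 assumes "f \<in> borel_measurable M" "!!t. s t \<in> borel_measurable M" "integrable M w"
  and "!!x. ((%t. s t x) ---> f x) at_top"
  and "!!t x. t >= 1 ==> norm (s t x) <= w x"
 shows "((%t. integral\<^sup>L M (s t)) ---> integral\<^sup>L M f) at_top"
 by (rule integral_dominated_convergence_at_top[OF assms(1-3)])
   (use assms(4,5) in \<open>auto intro!: eventually_at_top_linorderI[of 1]\<close>)

section \<open>The incomplete Gamma function\<close>

text \<open>The constant continuation to negative arguments is continuous, hence Borel measurable on
  the whole line.\<close>

definition uG :: "real => real => real" where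
 "uG a z = upper_Gamma a (max 0 z)"

lemma Gamma_integrand:
 fixes a :: real
 assumes a: "0 < a"
 shows "set_integrable lborel {0..} (%t. exp (- t)*t powr (a - 1))"
  and "upper_Gamma a 0 = Gamma a"
proof -
 let ?f = "%t::real. indicator {0..} t*t powr (a - 1)/exp t"
 have "has_bochner_integral lborel ?f (Gamma a)"
 proof (rule has_bochner_integral_nn_integral)
  show "(\<integral>\<^sup>+ t. ennreal (?f t) \<partial>lborel) = ennreal (Gamma a)"
   using Gamma_conv_nn_integral_real[OF a] by simp
 qed (use a in \<open>auto simp: Gamma_real_pos less_imp_le indicator_def\<close>)
 moreover have "?f = (%t. indicator {0..} t *\<^sub>R (exp (- t)*t powr (a - 1)))"
  by (auto simp: exp_minus field_simps)
 ultimately have *: "has_bochner_integral lborel (%t. indicator {0..} t *\<^sub>R (exp (- t)*t powr (a - 1))) (Gamma a)"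
  by simp
 show "set_integrable lborel {0..} (%t. exp (- t)*t powr (a - 1))"
  using * by (auto simp: set_integrable_def has_bochner_integral_iff)
 show "upper_Gamma a 0 = Gamma a"
  using * by (auto simp: upper_Gamma_def set_lebesgue_integral_def has_bochner_integral_iff)
qed

context
 fixes a :: real
 assumes a: "0 < a"
begin

lemma Gamma_integrand_sub:
 assumes "A \<in> sets borel" "A \<subseteq> {0..}"
 shows "set_integrable lborel A (%t. exp (- t)*t powr (a - 1))"
 by (rule set_integrable_subset[OF Gamma_integrand(1)[OF a]]) (use assms in auto)

lemma upper_Gamma_split:
 assumes "0 <= x" "x <= y"
 shows "upper_Gamma a x = (LINT t:{x..<y}|lborel. exp (- t)*t powr (a - 1)) + upper_Gamma a y"
proof -
 have "{x..} = {x..<y} \<union> {y..}" using assms by auto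
 thus ?thesis unfolding upper_Gamma_def
  using assms by (simp, subst set_integral_Un) (auto intro!: Gamma_integrand_sub)
qed

lemma upper_Gamma_nonneg: "upper_Gamma a x >= 0"
 unfolding upper_Gamma_def set_lebesgue_integral_def by (intro integral_nonneg_AE AE_I2) auto

lemma upper_Gamma_has_deriv:
 assumes "0 < x"
 shows "(upper_Gamma a has_real_derivative - (exp (- x)*x powr (a - 1))) (at x)"
proof -
 let ?f = "%t::real. exp (- t)*t powr (a - 1)"
 define c where "c = x/2"
 have c: "0 < c" "c < x" using assms by (auto simp: c_def)
 have cont: "continuous_on {c..x+1} ?f" using c by (auto intro!: continuous_intros)
 have "((%y. integral {c..y} ?f) has_real_derivative ?f x) (at x within {c..x+1})"
  by (rule integral_has_real_derivative[OF cont]) (use c in auto)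
 hence 1: "((%y. integral {c..y} ?f) has_real_derivative ?f x) (at x)"
  using c by (subst (asm) at_within_Icc_at) auto
 have "((%y. upper_Gamma a c - integral {c..y} ?f) has_real_derivative - ?f x) (at x)"
  using DERIV_diff[OF DERIV_const 1, of "upper_Gamma a c"] by simp
 moreover have "\<forall>\<^sub>F y in nhds x. upper_Gamma a c - integral {c..y} ?f = upper_Gamma a y"
 proof -
  have "upper_Gamma a c - integral {c..y} ?f = upper_Gamma a y" if "y > c" for y
  proof -
   have "(LINT t:{c..<y}|lborel. ?f t) = (LINT t:{c..y}|lborel. ?f t)"
    unfolding set_lebesgue_integral_def
    by (rule integral_cong_AE) (auto intro!: AE_I[where N="{y}"] simp: indicator_def split: if_splits)
   also have "... = integral {c..y} ?f"
    by (rule set_borel_integral_eq_integral(2)) (use c in \<open>auto intro!: Gamma_integrand_sub\<close>)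
   finally show ?thesis using upper_Gamma_split[of c y] that c by simp
  qed
  thus ?thesis
   using eventually_nhds_in_open[of "{c<..}" x] c by (auto elim: eventually_mono)
 qed
 ultimately show ?thesis
  by (rule DERIV_cong_ev[THEN iffD1, OF refl _ refl, rotated])
qed

lemma upper_Gamma_continuous_on: "continuous_on {0..} (upper_Gamma a)"
proof (clarsimp simp: continuous_on_eq_continuous_within)
 fix x :: real assume x: "0 <= x"
 show "continuous (at x within {0..}) (upper_Gamma a)"
 proof (cases "x = 0")
  case False
  hence "isCont (upper_Gamma a) x" using upper_Gamma_has_deriv[of x] x DERIV_isCont by auto
  thus ?thesis by (rule continuous_at_imp_continuous_at_within)
 next
  case True
  \<comment> \<open>At 0 the integrand may be singular (\<open>a < 1\<close>), so one-sided
    continuity comes from dominated convergence with the full Gamma integrand as majorant.\<close>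
  let ?f = "%t::real. exp (- t)*t powr (a - 1)"
  have "((%y. LINT t|lborel. indicator {y..} t *\<^sub>R ?f t) ---> (LINT t|lborel. indicator {0..} t *\<^sub>R ?f t)) (at_right 0)"
  proof (rule tendsto_at_right_sequentially[of 0 1], simp, rule integral_dominated_convergence[where w="%t. indicator {0..} t *\<^sub>R ?f t"])
   fix X :: "nat => real" assume X: "!!n. 0 < X n" "X ----> 0"
   show "integrable lborel (%t. indicator {0..} t *\<^sub>R ?f t)"
    using Gamma_integrand(1)[OF a] by (simp add: set_integrable_def)
   show "AE x in lborel. norm (indicator {X i..} x *\<^sub>R ?f x) <= indicator {0..} x *\<^sub>R ?f x" for i
    using X(1)[of i] by (auto simp: indicator_def)
   have "((%y. indicator {y..} t *\<^sub>R ?f t) ---> indicator {0..} t *\<^sub>R ?f t) (at_right 0)" for t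
   proof (cases "t > 0")
    case True
    have "\<forall>\<^sub>F y in at_right 0. indicator {y..} t *\<^sub>R ?f t = indicator {0..} t *\<^sub>R ?f t"
     by (rule eventually_at_rightI[of 0 t]) (use True in \<open>auto simp: indicator_def\<close>)
    thus ?thesis by (simp add: tendsto_eventually)
   next
    case False
    have "\<forall>\<^sub>F y in at_right 0. indicator {y..} t *\<^sub>R ?f t = indicator {0..} t *\<^sub>R ?f t"
     by (rule eventually_at_rightI[of 0 1]) (use False in \<open>auto simp: indicator_def\<close>)
    thus ?thesis by (simp add: tendsto_eventually)
   qed
   moreover have "filterlim X (at_right 0) sequentially"
    using X by (auto simp: filterlim_at less_imp_neq[symmetric] intro!: always_eventually)
   ultimately show "AE x in lborel. ((%i. indicator {X i..} x *\<^sub>R ?f x) ----> indicator {0..} x *\<^sub>R ?f x)"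
    using filterlim_compose by (intro AE_I2) blast
  qed auto
  hence "(upper_Gamma a ---> upper_Gamma a 0) (at_right 0)"
   by (simp add: upper_Gamma_def[abs_def] set_lebesgue_integral_def)
  thus ?thesis using True
   by (simp add: continuous_within at_within_Ici_at_right)
 qed
qed

lemma upper_Gamma_less:
 assumes "0 <= x" "x < y"
 shows "upper_Gamma a y < upper_Gamma a x"
proof (rule DERIV_neg_imp_decreasing_open[OF assms(2)])
 fix z assume "x < z" "z < y"
 thus "\<exists>d. (upper_Gamma a has_real_derivative d) (at z) & d < 0"
  using upper_Gamma_has_deriv[of z] assms by (intro exI conjI) auto
qed (use assms in \<open>auto intro: continuous_on_subset[OF upper_Gamma_continuous_on]\<close>)

lemma upper_Gamma_le:
 assumes "0 <= x" "x <= y"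
 shows "upper_Gamma a y <= upper_Gamma a x"
 using upper_Gamma_less[of x y] assms by (cases "x = y") auto

lemma upper_Gamma_pos: "0 <= x ==> 0 < upper_Gamma a x"
 using upper_Gamma_less[of x "x + 1"] upper_Gamma_nonneg[of "x+1"] by simp

lemma upper_Gamma_less_Gamma: "0 < x ==> upper_Gamma a x < Gamma a"
 using upper_Gamma_less[of 0 x] Gamma_integrand(2)[OF a] by simp

lemma upper_Gamma_le_Gamma: "0 <= x ==> upper_Gamma a x <= Gamma a"
 using upper_Gamma_le[of 0 x] Gamma_integrand(2)[OF a] by simp

lemma inj_on_upper_Gamma: "inj_on (upper_Gamma a) {0..}"
 by (rule inj_onI) (metis atLeast_iff less_irrefl linorder_neqE_linordered_idom upper_Gamma_less)

lemma upper_Gamma_at_top: "(upper_Gamma a ---> 0) at_top"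
proof -
 let ?f = "%t::real. exp (- t)*t powr (a - 1)"
 have "((%y. LINT t|lborel. indicator {y..} t *\<^sub>R ?f t) ---> integral\<^sup>L lborel (%t::real. 0)) at_top"
 proof (rule integral_dominated_convergence_at_top'[where w="%t. indicator {0..} t *\<^sub>R ?f t"])
  show "integrable lborel (%t. indicator {0..} t *\<^sub>R ?f t)"
   using Gamma_integrand(1)[OF a] by (simp add: set_integrable_def)
  show "norm (indicator {i..} x *\<^sub>R ?f x) <= indicator {0..} x *\<^sub>R ?f x" if "i >= 1" for i x
   using that by (auto simp: indicator_def)
  show "((%y. indicator {y..} t *\<^sub>R ?f t) ---> 0) at_top" for t
  proof (rule tendsto_eventually)
   show "\<forall>\<^sub>F y in at_top. indicator {y..} t *\<^sub>R ?f t = 0"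
    by (rule eventually_at_top_linorderI[of "t + 1"]) (auto simp: indicator_def)
  qed
 qed auto
 thus ?thesis
  by (simp add: upper_Gamma_def[abs_def] set_lebesgue_integral_def)
qed

lemma uG_eq: "0 <= z ==> uG a z = upper_Gamma a z" by (simp add: uG_def)

lemma uG_pos: "0 < uG a z" by (simp add: uG_def upper_Gamma_pos)

lemma uG_measurable [measurable]: "uG a \<in> borel_measurable borel"
proof -
 have "continuous_on UNIV (uG a)" unfolding uG_def
  by (rule continuous_on_compose2[OF upper_Gamma_continuous_on]) (auto intro!: continuous_intros)
 thus ?thesis by (rule borel_measurable_continuous_onI)
qed

lemma upper_Gamma_surj:
 assumes "0 < w" "w < Gamma a"
 obtains q where "0 < q" "upper_Gamma a q = w"
proof -
 have "\<forall>\<^sub>F x in at_top. upper_Gamma a x < w" using order_tendstoD(2)[OF upper_Gamma_at_top assms(1)] .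
 then obtain b where b: "!!x. x >= b ==> upper_Gamma a x < w" by (auto simp: eventually_at_top_linorder)
 define B where "B = max b 1"
 have B0: "0 <= B" by (simp add: B_def)
 have "upper_Gamma a B <= w" "w <= upper_Gamma a 0" using b[of B] assms Gamma_integrand(2)[OF a] by (auto simp: B_def)
 then obtain q where "0 <= q" "q <= B" "upper_Gamma a q = w"
  using IVT2'[of "upper_Gamma a" B w 0] continuous_on_subset[OF upper_Gamma_continuous_on, of "{0..B}"] B0
  by auto
 moreover have "q ~= 0" using calculation assms Gamma_integrand(2)[OF a] by auto
 ultimately show thesis using that[of q] by simp
qed

lemma upper_Gamma_image: "upper_Gamma a ` {0<..} = {0<..<Gamma a}"
 using upper_Gamma_surj by (fastforce simp: upper_Gamma_pos upper_Gamma_less_Gamma less_imp_le)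

lemma Gamma_pos: "Gamma a > 0" using a by (rule Gamma_real_pos)

lemma Gamma_Q_inv_eq:
 assumes "0 <= q"
 shows "Gamma_Q_inv a (upper_Gamma a q/Gamma a) = q"
proof -
 have "inj_on (Gamma_Q a) {0..}"
  using inj_on_upper_Gamma Gamma_pos by (auto simp: Gamma_Q_def inj_on_def)
 thus ?thesis
  unfolding Gamma_Q_inv_def using the_inv_into_f_f[of "Gamma_Q a" "{0..}" q] assms
  by (simp add: Gamma_Q_def)
qed

lemma Gamma_Q_inv_spec:
 assumes "0 < y" "y < 1"
 shows "0 < Gamma_Q_inv a y" "upper_Gamma a (Gamma_Q_inv a y) = y*Gamma a"
proof -
 have "0 < y*Gamma a" "y*Gamma a < Gamma a" using assms Gamma_pos by auto
 from upper_Gamma_surj[OF this] obtain q where q: "0 < q" "upper_Gamma a q = y*Gamma a" .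
 have "Gamma_Q_inv a y = q" using Gamma_Q_inv_eq[of q] q Gamma_pos by simp
 thus "0 < Gamma_Q_inv a y" "upper_Gamma a (Gamma_Q_inv a y) = y*Gamma a" using q by auto
qed

text \<open>A monotone function is Borel; the indicator confines the inverse to arguments where it
  is a genuine inverse.\<close>

lemma Gamma_Q_inv_measurable: "(%y. indicator {0<..<1} y*Gamma_Q_inv a y) \<in> borel_measurable borel"
proof -
 have "antimono_on {0<..<1} (Gamma_Q_inv a)"
 proof (rule monotone_onI, rule ccontr)
  fix x y :: real assume xy: "x \<in> {0<..<1}" "y \<in> {0<..<1}" "x <= y" "~ Gamma_Q_inv a y <= Gamma_Q_inv a x"
  hence "upper_Gamma a (Gamma_Q_inv a y) < upper_Gamma a (Gamma_Q_inv a x)"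
   using Gamma_Q_inv_spec by (intro upper_Gamma_less) (auto simp: less_imp_le)
  hence "y*Gamma a < x*Gamma a" using xy Gamma_Q_inv_spec by simp
  thus False using xy Gamma_pos by simp
 qed
 hence "mono_on {0<..<1} (%x. - Gamma_Q_inv a x)"
  by (auto simp: monotone_on_def)
 hence "(%x. - Gamma_Q_inv a x) \<in> borel_measurable (restrict_space borel {0<..<1})"
  by (rule borel_measurable_mono_on_fnc)
 hence "(%x. - (- Gamma_Q_inv a x)) \<in> borel_measurable (restrict_space borel {0<..<1})"
  by (rule borel_measurable_uminus)
 thus ?thesis
  by (subst (asm) borel_measurable_restrict_space_iff) (auto simp: mult.commute)
qed

text \<open>The antiderivative is \<open>P z = z * \<Gamma>(a,z) - \<Gamma>(a+1,z)\<close>, written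
  out with the recurrence for \<open>\<Gamma>(a+1,z)\<close>; it vanishes at infinity. These
  integrals produce the series in the drift.\<close>

lemma upper_Gamma_integral:
 assumes "0 <= q"
 shows "set_integrable lborel {q<..} (uG a)"
  "(LINT z:{q<..}|lborel. uG a z) = a*upper_Gamma a q + q powr a*exp (- q) - q*upper_Gamma a q"
proof -
 define P where "P z = z*upper_Gamma a z - a*upper_Gamma a z - z powr a*exp (- z)" for z
 \<comment> \<open>On \<open>t >= y\<close> the factor \<open>y\<close> is at most \<open>t\<close>,
   so the integrand of \<open>Gamma (a + 1)\<close> dominates.\<close>
 have zG: "((%z. z*upper_Gamma a z) ---> 0) at_top"
 proof -
  have "((%y. LINT t|lborel. indicator {y..} t *\<^sub>R (y*(exp (- t)*t powr (a - 1)))) ---> integral\<^sup>L lborel (%t::real. 0)) at_top"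
  proof (rule integral_dominated_convergence_at_top'[where w="%t. indicator {0..} t *\<^sub>R (exp (- t)*t powr ((a + 1) - 1))"])
   show "integrable lborel (%t. indicator {0..} t *\<^sub>R (exp (- t)*t powr ((a + 1) - 1)))"
    using Gamma_integrand(1)[of "a + 1"] a by (simp add: set_integrable_def)
   fix i x :: real
   {
    assume i: "1 <= i"
    show "norm (indicator {i..} x *\<^sub>R (i*(exp (- x)*x powr (a - 1)))) <= indicator {0..} x *\<^sub>R (exp (- x)*x powr ((a + 1) - 1))"
    proof (cases "x >= i")
     case True
     hence "i*x powr (a - 1) <= x*x powr (a - 1)" by (intro mult_right_mono) auto
     also have "... = x powr a" using True i by (simp add: powr_mult_base)
     finally have "exp (- x)*(i*x powr (a - 1)) <= exp (- x)*x powr a" by (rule mult_left_mono) simp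
     thus ?thesis using True i by (simp add: abs_mult mult_ac)
    qed (use i in \<open>auto simp: indicator_def\<close>)
   }
   show "((%y. indicator {y..} t *\<^sub>R (y*(exp (- t)*t powr (a - 1)))) ---> 0) at_top" for t
   proof (rule tendsto_eventually)
    show "\<forall>\<^sub>F y in at_top. indicator {y..} t *\<^sub>R (y*(exp (- t)*t powr (a - 1))) = 0"
     by (rule eventually_at_top_linorderI[of "t + 1"]) (auto simp: indicator_def)
   qed
  qed auto
  moreover have "(LINT t|lborel. indicator {y..} t *\<^sub>R (y*(exp (- t)*t powr (a - 1)))) = y*upper_Gamma a y" for y
  proof -
   have "(LINT t|lborel. indicator {y..} t *\<^sub>R (y*(exp (- t)*t powr (a - 1)))) = (LINT t|lborel. y*(indicator {y..} t *\<^sub>R (exp (- t)*t powr (a - 1))))"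
    by (intro bochner_integral_cong) auto
   also have "... = y*upper_Gamma a y"
    by (simp only: upper_Gamma_def set_lebesgue_integral_def integral_mult_right_zero)
   finally show ?thesis .
  qed
  ultimately show ?thesis by simp
 qed
 have pe: "((%z. z powr a*exp (- z)) ---> 0) at_top" using a by real_asymp
 have Pinf: "(P ---> 0) at_top"
  unfolding P_def using tendsto_diff[OF tendsto_diff[OF zG tendsto_mult_left[OF upper_Gamma_at_top, of a]] pe] by simp
 have contG: "(upper_Gamma a ---> upper_Gamma a q) (at_right q)"
  using upper_Gamma_continuous_on assms unfolding continuous_on_def
  by (auto intro: tendsto_within_subset[of _ _ _ "{0..}" "{q<..}"])
 have Pq: "(P ---> P q) (at_right q)"
 proof -
  have "((%z. z powr a) ---> q powr a) (at_right q)"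
  proof (cases "q = 0")
   case True
   thus ?thesis using a by (simp, real_asymp)
  next
   case False
   thus ?thesis using assms by (intro tendsto_intros) auto
  qed
  moreover have "((%z. exp (- z)) ---> exp (- q)) (at_right q)" by (intro tendsto_intros)
  ultimately show ?thesis unfolding P_def
   by (intro tendsto_diff tendsto_mult tendsto_const contG tendsto_ident_at)
 qed
 have der: "(P has_real_derivative uG a x) (at x)" if "x > q" for x
 proof -
  have x: "x > 0" using that assms by simp
  have "x powr a = x*x powr (a - 1)" using x by (simp add: powr_mult_base)
  thus ?thesis unfolding P_def uG_eq[OF less_imp_le[OF x]] using x
   by (auto intro!: derivative_eq_intros upper_Gamma_has_deriv simp: field_simps)
 qed
 have cu: "isCont (uG a) x" if "x > q" for x
 proof -
  have "continuous_on UNIV (uG a)" unfolding uG_def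
   by (rule continuous_on_compose2[OF upper_Gamma_continuous_on]) (auto intro!: continuous_intros)
  thus ?thesis by (simp add: continuous_on_eq_continuous_at)
 qed
 note FTC = interval_integral_FTC_nonneg[of "ereal q" \<infinity> P "uG a" "P q" 0]
 have "set_integrable lborel (einterval (ereal q) \<infinity>) (uG a)"
  by (rule FTC(1)) (use der cu Pq Pinf uG_pos in \<open>auto simp: ereal_tendsto_simps less_imp_le\<close>)
 thus "set_integrable lborel {q<..} (uG a)" by simp
 have "(LBINT x=ereal q..\<infinity>. uG a x) = 0 - P q"
  by (rule FTC(2)) (use der cu Pq Pinf uG_pos in \<open>auto simp: ereal_tendsto_simps less_imp_le\<close>)
 thus "(LINT z:{q<..}|lborel. uG a z) = a*upper_Gamma a q + q powr a*exp (- q) - q*upper_Gamma a q"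
  by (simp add: interval_integral_to_infinity_eq P_def)
qed

lemma uG_integrable: "pos_integrable (uG a)"
 using upper_Gamma_integral(1)[of 0] by simp

lemma uG_integral: "(PINT z. uG a z) = Gamma (1 + a)"
 proof -
 have "a \<notin> \<int>\<^sub>\<le>\<^sub>0" using a nonpos_Ints_nonpos[of a] by auto
 hence "Gamma (a + 1) = a*Gamma a" by (rule Gamma_plus1)
 thus ?thesis using upper_Gamma_integral(2)[of 0] Gamma_integrand(2)[OF a] a
  by (simp add: add.commute)
qed

end

text \<open>For \<open>a <= 1\<close> the power in the integrand is decreasing and can be replaced
  by its value at the left endpoint.\<close>

lemma upper_Gamma_le_exp:
 assumes a: "0 < a" "a <= 1" and q: "0 < q"
 shows "upper_Gamma a q <= q powr (a - 1)*exp (- q)"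
proof -
 have "upper_Gamma a q <= (LINT t:{q..}|lborel. exp (- t)*q powr (a - 1))"
  unfolding upper_Gamma_def
 proof (rule set_integral_mono)
  show "set_integrable lborel {q..} (%t. exp (- t)*t powr (a - 1))"
   using a q by (intro Gamma_integrand_sub) auto
  show "set_integrable lborel {q..} (%t. exp (- t)*q powr (a - 1))"
  proof (intro set_integrable_mult_left impI)
   have "set_integrable lborel {q..} (%t. exp (- t)*t powr (1 - 1))"
    using q by (intro Gamma_integrand_sub) auto
   also have "?this \<longleftrightarrow> set_integrable lborel {q..} (%t::real. exp (- t))"
    by (rule set_integrable_cong) (use q in auto)
   finally show "set_integrable lborel {q..} (%t::real. exp (- t))" .
  qed
 qed (use a q in \<open>auto intro!: mult_left_mono powr_mono2'\<close>)
 also have "(LINT t:{q..}|lborel. exp (- t)*q powr (a - 1)) = q powr (a - 1)*upper_Gamma 1 q"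
  using q unfolding upper_Gamma_def set_lebesgue_integral_def
  by (subst bochner_integral_mult_right_zero[symmetric])
    (intro bochner_integral_cong, auto simp: indicator_def)
 \<comment> \<open>The difference of both sides is constant in \<open>q\<close> and tends to
   0.\<close>
 also have "upper_Gamma 1 q = exp (- q)"
 proof -
  have l1: "((%z. upper_Gamma 1 z - exp (- z)) ---> 0 - 0) at_top"
   by (intro tendsto_diff upper_Gamma_at_top) (simp, real_asymp)
  have "upper_Gamma 1 z - exp (- z) = upper_Gamma 1 q - exp (- q)" if "z >= q" for z
  proof (cases "z = q")
   case False
   hence "q < z" using that by simp
   hence "(%z. upper_Gamma 1 z - exp (- z)) z = (%z. upper_Gamma 1 z - exp (- z)) q"
   proof (rule DERIV_isconst_end)
    show "continuous_on {q..z} (%z. upper_Gamma 1 z - exp (- z))"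
     using q by (intro continuous_intros continuous_on_subset[OF upper_Gamma_continuous_on]) auto
    show "!!x. q < x ==> x < z ==> ((%z. upper_Gamma 1 z - exp (- z)) has_real_derivative 0) (at x)"
     using q by (auto intro!: derivative_eq_intros upper_Gamma_has_deriv)
   qed
   thus ?thesis by simp
  qed simp
  hence "\<forall>\<^sub>F z in at_top. upper_Gamma 1 z - exp (- z) = upper_Gamma 1 q - exp (- q)"
   by (intro eventually_at_top_linorderI[of q])
  hence l2: "((%z. upper_Gamma 1 z - exp (- z)) ---> upper_Gamma 1 q - exp (- q)) at_top"
   by (rule tendsto_eventually)
  have "upper_Gamma 1 q - exp (- q) = 0 - 0"
   by (rule tendsto_unique[OF trivial_limit_at_top_linorder l2 l1])
  thus ?thesis by simp
 qed
 finally show ?thesis .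
qed

section \<open>Sums over the integers\<close>

text \<open>Sums over all integers are integrals against counting measure, which makes Fubini and
  dominated convergence available. If the terms vanish from \<open>c\<close> on, enumerating
  downwards from \<open>c - 1\<close> gives an ordinary series.\<close>

lemma count_space_int_below:
 fixes f :: "int => 'b::{banach, second_countable_topology}"
 assumes "!!j. j >= c ==> f j = 0"
 shows "integrable (count_space UNIV) f \<longleftrightarrow> summable (%s::nat. norm (f (c - 1 - int s)))"
  and "summable (%s::nat. norm (f (c - 1 - int s))) ==>
   integral\<^sup>L (count_space UNIV) f = (\<Sum>s. f (c - 1 - int s))"
proof -
 have bij: "bij_betw (%s::nat. c - 1 - int s) UNIV {..<c}"
  by (rule bij_betwI[where g="%j. nat (c - 1 - j)"]) auto
 have ind: "(%j. indicator {..<c} j *\<^sub>R f j) = f"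
  using assms by (auto simp: indicator_def not_less)
 have 1: "integrable (count_space {..<c}) f \<longleftrightarrow> integrable (count_space UNIV) f"
  using integrable_restrict_space[of "{..<c}" "count_space UNIV" f]
  by (simp add: restrict_count_space ind)
 have 2: "integral\<^sup>L (count_space {..<c}) f = integral\<^sup>L (count_space UNIV) f"
  using integral_restrict_space[of "{..<c}" "count_space UNIV" f]
  by (simp add: restrict_count_space ind)
 show iff: "integrable (count_space UNIV) f \<longleftrightarrow> summable (%s::nat. norm (f (c - 1 - int s)))"
  using 1 integrable_bij_count_space[OF bij, of f] by (simp add: integrable_count_space_nat_iff)
 show "integral\<^sup>L (count_space UNIV) f = (\<Sum>s. f (c - 1 - int s))"
  if "summable (%s::nat. norm (f (c - 1 - int s)))"
  using 2 integral_bij_count_space[OF bij, of f] that integral_count_space_nat[of "%s::nat. f (c - 1 - int s)"]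
  by (simp add: integrable_count_space_nat_iff)
qed

lemma integrable_count_space_geometric_int:
 fixes \<rho> :: real
 assumes "0 <= \<rho>" "\<rho> < 1"
 shows "integrable (count_space (UNIV :: int set)) (%j. \<rho>^nat \<bar>j\<bar>)"
proof -
 let ?f = "%j::int. if j < 0 then \<rho>^nat \<bar>j\<bar> else 0"
 let ?g = "%j::int. if j < 1 then \<rho>^nat \<bar>j\<bar> else 0"
 have n1': "nat (int s + 1) = Suc s" for s by auto
 have "summable (%s. \<rho>^Suc s)" using assms by (intro summable_ignore_initial_segment[where k=1, simplified] summable_geometric) auto
 hence 1: "integrable (count_space UNIV) ?f"
  using assms by (subst count_space_int_below(1)[of 0]) (auto simp: n1')
 have "summable (%s. \<rho>^s)" using assms by (intro summable_geometric) auto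
 hence "integrable (count_space UNIV) ?g"
  using assms by (subst count_space_int_below(1)[of 1]) (auto simp: nat_int)
 moreover have "bij_betw (uminus :: int => int) UNIV UNIV"
  by (rule bij_betwI[where g=uminus]) auto
 ultimately have 2: "integrable (count_space UNIV) (%j. ?g (- j))"
  using integrable_bij_count_space[of uminus UNIV UNIV ?g] by simp
 have "(%j. ?f j + ?g (- j)) = (%j. \<rho>^nat \<bar>j\<bar>)"
  by (auto simp: fun_eq_iff)
 thus ?thesis using bochner_add[OF 1 2] by simp
qed

text \<open>Moving the jump of a unit step from 0 to \<open>-c\<close> adds \<open>c\<close> to the
  sum, for either sign of \<open>c\<close>. This is how the integer part of
  \<open>\<gamma> - lg \<Gamma>(a)\<close> enters the drift.\<close>

lemma integral_count_space_step:
 fixes c :: int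
 defines "f \<equiv> %j::int. (if - c <= j then 1 else 0) - (if 0 <= j then 1 else 0) :: real"
 shows "integrable (count_space UNIV) f" "integral\<^sup>L (count_space UNIV) f = of_int c"
proof -
 define A where "A = {- c..<0}"
 define B where "B = {0..<- c}"
 have f: "f = (%j. indicator A j - indicator B j)"
  by (auto simp: f_def A_def B_def indicator_def fun_eq_iff)
 have i: "integrable (count_space UNIV) (indicator S :: int => real)" if "finite S" for S
  using that by (simp add: integrable_indicator_iff emeasure_count_space ennreal_of_nat_eq_real_of_nat)
 have v: "integral\<^sup>L (count_space UNIV) (indicator S :: int => real) = real (card S)" if "finite S" for S
  using that by (simp add: measure_count_space)
 have fin: "finite A" "finite B" by (auto simp: A_def B_def)
 show "integrable (count_space UNIV) f"
  unfolding f by (intro bochner_diff i fin)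
 have "integral\<^sup>L (count_space UNIV) f = real (card A) - real (card B)"
  unfolding f by (subst bochner_integral_diff) (auto intro: i fin simp: v fin)
 also have "... = of_int c" by (auto simp: A_def B_def)
 finally show "integral\<^sup>L (count_space UNIV) f = of_int c" .
qed

section \<open>The L\'evy measure\<close>

text \<open>Density of \<open>w\<close> times the image of Lebesgue measure on the positive
  half-line under \<open>z -> \<Gamma>(a,z)/w\<close>, obtained from
  \<open>dz/dx = w * exp z * z powr (1 - a)\<close>. The Levy measure is the sum of these slices
  over \<open>w = wscale \<gamma> j\<close>.\<close>

definition nu_slice :: "real => real => real => real" where
 "nu_slice a w x = indicator {0<..<Gamma a/w} x *
   (w\<^sup>2*exp (Gamma_Q_inv a (x*w/Gamma a))*Gamma_Q_inv a (x*w/Gamma a) powr (1 - a))"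

lemma nu_slice_nonneg: "nu_slice a w x >= 0"
 by (simp add: nu_slice_def)

lemma nu_slice_measurable [measurable]:
 assumes "0 < a" "0 < w"
 shows "nu_slice a w \<in> borel_measurable borel"
proof -
 note [measurable] = Gamma_Q_inv_measurable[OF assms(1)]
 have G: "Gamma a > 0" using assms by (intro Gamma_pos)
 let ?h = "%y. indicator {0<..<1} y*Gamma_Q_inv a y"
 have "?h \<circ> (%x. x*w/Gamma a) \<in> borel_measurable borel" by measurable
 hence [measurable]: "(%x. ?h (x*w/Gamma a)) \<in> borel_measurable borel" by (simp add: comp_def)
 have "nu_slice a w = (%x. indicator {0<..<Gamma a/w} x *
   (w\<^sup>2*exp (?h (x*w/Gamma a))*?h (x*w/Gamma a) powr (1 - a)))"
  using G assms by (auto simp: nu_slice_def fun_eq_iff indicator_def field_simps)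
 thus ?thesis by simp
qed

text \<open>With \<open>\<Gamma>(a,q) = x*w\<close>, the bound \<open>upper_Gamma_le_exp\<close>
  says \<open>exp q * q powr (1 - a) <= 1/(x*w)\<close>.\<close>

lemma nu_slice_le:
 assumes a: "0 < a" "a <= 1" and w: "0 < w" and x: "0 < x"
 shows "nu_slice a w x <= w/x"
proof (cases "x < Gamma a/w")
 case True
 have G: "Gamma a > 0" using a by (intro Gamma_pos)
 define q where "q = Gamma_Q_inv a (x*w/Gamma a)"
 have y: "0 < x*w/Gamma a" "x*w/Gamma a < 1" using True x w G by (auto simp: field_simps)
 have q: "0 < q" "upper_Gamma a q = x*w"
  using Gamma_Q_inv_spec[OF a(1) y] G by (auto simp: q_def)
 have "x*w <= q powr (a - 1)*exp (- q)" using upper_Gamma_le_exp[OF a q(1)] q by simp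
 hence "(x*w)*(exp q*q powr (1 - a)) <= (q powr (a - 1)*exp (- q))*(exp q*q powr (1 - a))"
  by (intro mult_right_mono) auto
 also have "... = (q powr (a - 1)*q powr (1 - a))*(exp (- q)*exp q)" by (simp only: mult_ac)
 also have "... = 1" using q by (simp add: powr_add[symmetric] exp_add[symmetric])
 finally have "w*((x*w)*(exp q*q powr (1 - a))) <= w*1" using w by (intro mult_left_mono) auto
 hence "x*(w\<^sup>2*exp q*q powr (1 - a)) <= w" by (simp add: power2_eq_square mult_ac)
 hence "w\<^sup>2*exp q*q powr (1 - a) <= w/x" using x by (simp add: field_simps)
 thus ?thesis using True x by (simp add: nu_slice_def q_def[symmetric])
qed (use w x in \<open>simp add: nu_slice_def\<close>)

text \<open>Substitution \<open>x = \<Gamma>(a,z)/w\<close>: the Jacobian cancels everything in the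
  slice except one factor \<open>w\<close>.\<close>

lemma nu_slice_integral:
 fixes f :: "real => 'b::euclidean_space"
 assumes a: "0 < a" and w: "0 < w" and f [measurable]: "f \<in> borel_measurable borel"
 shows "pos_integrable (%x. nu_slice a w x *\<^sub>R f x) \<longleftrightarrow> pos_integrable (%z. f (uG a z/w))"
  and "(PINT x. nu_slice a w x *\<^sub>R f x) = w *\<^sub>R (PINT z. f (uG a z/w))"
proof -
 note [measurable] = nu_slice_measurable[OF a w] uG_measurable[OF a]
 have G: "Gamma a > 0" using a by (rule Gamma_pos)
 define g where "g z = upper_Gamma a z/w" for z
 define g' where "g' z = - (exp (- z)*z powr (a - 1))/w" for z
 let ?F = "%x. nu_slice a w x *\<^sub>R f x"
 have img: "g ` {0<..} = {0<..<Gamma a/w}"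
 proof -
  have "g ` {0<..} = (%x. x/w) ` (upper_Gamma a ` {0<..})" by (simp add: g_def[abs_def] image_image)
  also have "... = (%x. x/w) ` {0<..<Gamma a}" using upper_Gamma_image[OF a] by simp
  also have "... = {0<..<Gamma a/w}"
  proof (intro equalityI subsetI)
   fix x assume "x \<in> {0<..<Gamma a/w}"
   thus "x \<in> (%x. x/w) ` {0<..<Gamma a}" using w
    by (intro image_eqI[of _ _ "x*w"]) (auto simp: field_simps)
  qed (use w in \<open>auto simp: field_simps\<close>)
  finally show ?thesis .
 qed
 have pt: "\<bar>g' z\<bar> *\<^sub>R ?F (g z) = w *\<^sub>R f (uG a z/w)" if "z > 0" for z
 proof -
  have "Gamma_Q_inv a (g z*w/Gamma a) = z"
   using Gamma_Q_inv_eq[OF a, of z] that w by (simp add: g_def)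
  moreover have "g z \<in> {0<..<Gamma a/w}" using that img by blast
  ultimately have "nu_slice a w (g z) = w\<^sup>2*exp z*z powr (1 - a)" by (simp add: nu_slice_def)
  hence "\<bar>g' z\<bar>*nu_slice a w (g z) = w*((exp (- z)*exp z)*(z powr (a - 1)*z powr (1 - a)))"
   using w by (simp add: g'_def abs_mult power2_eq_square mult_ac)
  also have "... = w" using that by (simp add: exp_add[symmetric] powr_add[symmetric])
  finally show ?thesis using that by (simp add: g_def uG_eq[OF a])
 qed
 have der: "(g has_real_derivative g' z) (at z)" if "z \<in> {0<..}" for z
  using that w unfolding g_def g'_def
  by (auto intro!: derivative_eq_intros upper_Gamma_has_deriv a simp: field_simps)
 have inj: "inj_on g {0<..}"
  using inj_on_upper_Gamma[OF a] w by (auto simp: g_def inj_on_def)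
 have m1: "set_borel_measurable borel (g ` {0<..}) ?F"
  unfolding img set_borel_measurable_def by measurable
 have "(%x. indicator {0<..} x *\<^sub>R (\<bar>g' x\<bar> *\<^sub>R ?F (g x))) = (%x. indicator {0<..} x *\<^sub>R (w *\<^sub>R f (uG a x/w)))"
  using pt by (auto simp: indicator_def fun_eq_iff)
 hence m2: "set_borel_measurable borel {0<..} (%x. \<bar>g' x\<bar> *\<^sub>R ?F (g x))"
  unfolding set_borel_measurable_def by simp
 note cv = change_of_variables_lborel[OF _ _ der inj m1 m2, unfolded img, simplified]
 have e1: "set_integrable lborel {0<..<Gamma a/w} ?F \<longleftrightarrow> pos_integrable ?F"
  unfolding set_integrable_def
  by (rule arg_cong[of _ _ "integrable lborel"]) (use G w in \<open>auto simp: nu_slice_def fun_eq_iff indicator_def\<close>)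
 have e2: "(LINT x:{0<..<Gamma a/w}|lborel. ?F x) = (PINT x. ?F x)"
  unfolding set_lebesgue_integral_def
  by (rule arg_cong[of _ _ "integral\<^sup>L lborel"]) (use G w in \<open>auto simp: nu_slice_def fun_eq_iff indicator_def\<close>)
 have e3: "pos_integrable (%x. \<bar>g' x\<bar> *\<^sub>R ?F (g x)) \<longleftrightarrow> pos_integrable (%z. w *\<^sub>R f (uG a z/w))"
  by (rule set_integrable_cong) (use pt in auto)
 have e4: "(PINT x. \<bar>g' x\<bar> *\<^sub>R ?F (g x)) = (PINT z. w *\<^sub>R f (uG a z/w))"
  by (rule set_lebesgue_integral_cong) (use pt in auto)
 have e5: "pos_integrable (%z. w *\<^sub>R f (uG a z/w)) \<longleftrightarrow> pos_integrable (%z. f (uG a z/w))"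
 proof
  assume "pos_integrable (%z. w *\<^sub>R f (uG a z/w))"
  hence "pos_integrable (%z. inverse w *\<^sub>R (w *\<^sub>R f (uG a z/w)))"
   by (rule set_integrable_scaleR_right)
  thus "pos_integrable (%z. f (uG a z/w))" using w by simp
 qed (intro set_integrable_scaleR_right)
 have e6: "(PINT z. w *\<^sub>R f (uG a z/w)) = w *\<^sub>R (PINT z. f (uG a z/w))"
  by (rule set_integral_scaleR_right)
 show "pos_integrable ?F \<longleftrightarrow> pos_integrable (%z. f (uG a z/w))"
  using cv(1) e1 e3 e5 by simp
 show "(PINT x. ?F x) = w *\<^sub>R (PINT z. f (uG a z/w))"
  using cv(2) e2 e4 e6 by simp
qed

text \<open>This number plays a double role: in the limit it is the number of nodes of class
  \<open>j\<close> divided by \<open>m\<close>, and also the reciprocal of their jump scale.\<close>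

definition wscale :: "real => int => real" where
 "wscale \<gamma> j = 2 powr (\<gamma> + real_of_int j)"

lemma wscale_pos [simp]: "0 < wscale \<gamma> j" by (simp add: wscale_def)

lemma sums_half_Suc: "(%s. 2 powr (\<theta> - real (Suc s))) sums (2 powr \<theta>)"
proof -
 have "(%s. 2 powr \<theta>*(1/2)^Suc s) sums (2 powr \<theta>*1)"
  by (intro sums_mult power_half_series)
 moreover have "2 powr \<theta>*(1/2)^Suc s = 2 powr (\<theta> - real (Suc s))" for s
  by (simp add: powr_diff powr_realpow[symmetric] power_one_over field_simps del: of_nat_Suc power_Suc)
 ultimately show ?thesis by simp
qed

context
 fixes k r :: nat and \<gamma> a :: real
 defines "a \<equiv> real r/real k"
 assumes k: "1 <= k" and r: "1 <= r" "r <= k"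
begin

lemma a01: "0 < a" "a <= 1" using k r by (auto simp: a_def)

lemma Ga: "Gamma a > 0" by (rule Gamma_pos[OF a01(1)])

text \<open>At a fixed \<open>x\<close> only the slices with
  \<open>wscale \<gamma> j < \<Gamma>(a)/x\<close> are nonzero. Listing them downwards from the
  largest such \<open>j\<close> leaves the fractional part \<open>theta\<close> and gives the series
  of \<open>nu_density\<close>; \<open>nu_slice_le\<close> makes it geometric, whence the order
  \<open>1/x^2\<close>.\<close>

lemma nu_density_slices:
 assumes x: "0 < x"
 shows "integrable (count_space UNIV) (%j. nu_slice a (wscale \<gamma> j) x)" (is ?A)
  and "(LINT j|count_space UNIV. nu_slice a (wscale \<gamma> j) x) = nu_density k r \<gamma> x" (is ?B)
  and "nu_density k r \<gamma> x <= 2*Gamma a/x\<^sup>2" (is ?C)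
  and "0 <= nu_density k r \<gamma> x" (is ?D)
proof -
 note G = Ga
 \<comment> \<open>Integer part of the number whose fractional part is \<open>theta\<close>: the
   slices with \<open>j >= - e\<close> vanish at \<open>x\<close>.\<close>
 define e where "e = \<lfloor>\<gamma> + log 2 (x/Gamma a)\<rfloor>"
 define \<theta> where "\<theta> = theta k r \<gamma> x"
 have \<theta>: "\<theta> = \<gamma> + log 2 (x/Gamma a) - e" "0 <= \<theta>" "\<theta> < 1"
  by (auto simp: \<theta>_def theta_def frac_def e_def a_def[symmetric]) linarith+
 have sc: "wscale \<gamma> j = Gamma a/x*2 powr (\<theta> + (e + j))" for j
 proof -
  have "2 powr (\<theta> + (e + j)) = 2 powr (\<gamma> + j)*2 powr (log 2 (x/Gamma a))"
   by (simp add: \<theta>(1) powr_add[symmetric] algebra_simps)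
  also have "2 powr (log 2 (x/Gamma a)) = x/Gamma a" using x G by (intro powr_log_cancel) auto
  finally show ?thesis using x G by (simp add: wscale_def)
 qed
 let ?f = "%j. nu_slice a (wscale \<gamma> j) x"
 have zero: "?f j = 0" if "j >= - e" for j
 proof -
  have "2 powr (\<theta> + (e + j)) >= 1" using that \<theta> by (intro ge_one_powr_ge_zero) auto
  hence "wscale \<gamma> j >= Gamma a/x*1" unfolding sc using G x by (intro mult_left_mono) auto
  hence "~ x < Gamma a/wscale \<gamma> j" using x by (simp add: field_simps)
  thus ?thesis by (simp add: nu_slice_def)
 qed
 define t where "t s = 2 powr (\<theta> - real (Suc s))" for s
 have fs: "?f (- e - 1 - int s) = Gamma a^2/x^2*(let q = Gamma_Q_inv a (t s)
      in 4 powr (\<theta> - real (Suc s))*exp q*q powr (1 - a))" for s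
 proof -
  have s1: "wscale \<gamma> (- e - 1 - int s) = Gamma a/x*t s" by (simp add: sc t_def algebra_simps)
  have "x*wscale \<gamma> (- e - 1 - int s)/Gamma a = t s" using s1 x G by simp
  moreover have "t s < 1"
  proof -
   have "t s < 2 powr 0" unfolding t_def using \<theta> by (intro powr_less_mono) auto
   thus ?thesis by simp
  qed
  hence "x < Gamma a/wscale \<gamma> (- e - 1 - int s)"
   using s1 x G by (simp add: field_simps)
  moreover have "(t s)\<^sup>2 = 4 powr (\<theta> - real (Suc s))"
  proof -
   have "(t s)\<^sup>2 = (2*2) powr (\<theta> - real (Suc s))"
    unfolding t_def by (subst powr_mult) (auto simp: power2_eq_square)
   thus ?thesis by simp
  qed
  hence "(wscale \<gamma> (- e - 1 - int s))\<^sup>2 = Gamma a^2/x^2*4 powr (\<theta> - real (Suc s))"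
   by (simp add: s1 power_mult_distrib power_divide)
  ultimately show ?thesis using x by (simp add: nu_slice_def Let_def)
 qed
 have le: "?f (- e - 1 - int s) <= Gamma a/x\<^sup>2*t s" for s
 proof -
  have "?f (- e - 1 - int s) <= wscale \<gamma> (- e - 1 - int s)/x"
   by (rule nu_slice_le[OF a01 wscale_pos x])
  also have "... = Gamma a/x\<^sup>2*t s"
   by (simp add: sc t_def algebra_simps power2_eq_square)
  finally show ?thesis .
 qed
 have st: "(%s. Gamma a/x\<^sup>2*t s) sums (Gamma a/x\<^sup>2*2 powr \<theta>)"
  unfolding t_def by (intro sums_mult sums_half_Suc)
 have sm: "summable (%s. norm (?f (- e - 1 - int s)))"
  using le nu_slice_nonneg by (intro summable_comparison_test'[OF sums_summable[OF st], of 0]) auto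
 have sm': "summable (%s. ?f (- e - 1 - int s))"
  using summable_norm_cancel[OF sm] .
 show ?A using sm count_space_int_below(1)[of "-e" ?f] zero by simp
 have "(LINT j|count_space UNIV. ?f j) = (\<Sum>s. ?f (- e - 1 - int s))"
  using sm count_space_int_below(2)[of "-e" ?f] zero by simp
 also have dens: "... = nu_density k r \<gamma> x"
 proof -
  let ?u = "%s. let q = Gamma_Q_inv a (t s) in 4 powr (\<theta> - real (Suc s))*exp q*q powr (1 - a)"
  have "summable (%s. Gamma a^2/x^2*?u s)" using sm' by (simp only: fs)
  hence "summable ?u" using G x by (subst (asm) summable_cmult_iff) auto
  hence "(\<Sum>s. Gamma a^2/x^2*?u s) = Gamma a^2/x^2 * suminf ?u"
   by (rule suminf_mult)
  hence "(\<Sum>s. ?f (- e - 1 - int s)) = Gamma a^2/x^2 * suminf ?u" by (simp only: fs)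
  also have "... = nu_density k r \<gamma> x"
   unfolding nu_density_def \<theta>_def t_def a_def ..
  finally show ?thesis .
 qed
 finally show ?B .
 have "nu_density k r \<gamma> x <= Gamma a/x\<^sup>2*2 powr \<theta>"
  unfolding dens[symmetric] using suminf_le[OF le sm' sums_summable[OF st]] sums_unique[OF st] by simp
 also have "... <= Gamma a/x\<^sup>2*2 powr 1"
  using G \<theta> by (intro mult_left_mono powr_mono) auto
 finally show ?C by (simp add: mult.commute)
 show ?D unfolding dens[symmetric] by (intro suminf_nonneg sm' nu_slice_nonneg)
qed

lemma nu_density_measurable: "nu_density k r \<gamma> \<in> borel_measurable borel"
proof -
 note [measurable] = Gamma_Q_inv_measurable[OF a01(1)]
 let ?h = "%y. indicator {0<..<1} y*Gamma_Q_inv a y"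
 have [measurable]: "theta k r \<gamma> \<in> borel_measurable borel"
  unfolding theta_def frac_def by measurable
 have "?h \<circ> (%x. 2 powr (theta k r \<gamma> x - real (Suc s))) \<in> borel_measurable borel" for s
  by measurable
 moreover have "?h \<circ> (%x. 2 powr (theta k r \<gamma> x - real (Suc s))) = (%x. Gamma_Q_inv a (2 powr (theta k r \<gamma> x - real (Suc s))))" for s
 proof
  fix x
  have "theta k r \<gamma> x < 1" unfolding theta_def by (rule frac_lt_1)
  hence "2 powr (theta k r \<gamma> x - real (Suc s)) < 2 powr 0" by (intro powr_less_mono) auto
  thus "(?h \<circ> (%x. 2 powr (theta k r \<gamma> x - real (Suc s)))) x = Gamma_Q_inv a (2 powr (theta k r \<gamma> x - real (Suc s)))"
   by simp
 qed
 ultimately have [measurable]: "(%x. Gamma_Q_inv a (2 powr (theta k r \<gamma> x - real (Suc s)))) \<in> borel_measurable borel" for s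
  by metis
 show ?thesis
  unfolding nu_density_def Let_def a_def[symmetric] by measurable
qed

lemma integrable_min_inverse_square: "pos_integrable (%x::real. min 1 (x\<^sup>2)/x\<^sup>2)"
proof (rule set_integrable_bound)
 have "interval_lebesgue_integrable lborel 0 \<infinity> (%x::real. 1/(1 + x\<^sup>2))"
  by (rule integrable_I0i_1_div_plus_square)
 hence "pos_integrable (%x::real. 1/(1 + x\<^sup>2))"
  by (simp add: interval_lebesgue_integrable_def zero_ereal_def)
 thus "pos_integrable (%x::real. 2*(1/(1 + x\<^sup>2)))"
  by (rule set_integrable_mult_right)
 show "AE x::real in lborel. x \<in> {0<..} --> norm (min 1 (x\<^sup>2)/x\<^sup>2) <= norm (2*(1/(1 + x\<^sup>2)))"
 proof (intro AE_I2 impI)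
  fix x :: real assume "x \<in> {0<..}"
  hence p: "0 < x\<^sup>2" "0 < 1 + x\<^sup>2" by (auto intro: add_pos_pos)
  have "y*y <= y \<or> 1 <= y" if "0 < y" for y :: real using that by (cases "y <= 1") (auto simp: mult_left_le)
  from this[OF p(1)] have "min 1 (x\<^sup>2)*(1 + x\<^sup>2) <= 2*x\<^sup>2"
   by (auto simp: min_def distrib_left)
  thus "norm (min 1 (x\<^sup>2)/x\<^sup>2) <= norm (2*(1/(1 + x\<^sup>2)))"
   using p by (simp add: divide_simps)
 qed
qed (auto simp: set_borel_measurable_def)

text \<open>Since the density is \<open>O(1/x^2)\<close>, a majorant \<open>C * min 1 (x^2)\<close>
  settles integrability both near 0 and at infinity.\<close>

lemma nu_integrable:
 fixes f :: "real => 'b::euclidean_space"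
 assumes [measurable]: "f \<in> borel_measurable borel" and f: "!!x. x > 0 ==> norm (f x) <= C*min 1 (x\<^sup>2)"
 shows "integrable (nu k r \<gamma>) f"
  and "pos_integrable (%x. nu_density k r \<gamma> x *\<^sub>R f x)"
  and "(LINT x|nu k r \<gamma>. f x) = (PINT x. nu_density k r \<gamma> x *\<^sub>R f x)"
proof -
 note [measurable] = nu_density_measurable
 show si: "pos_integrable (%x. nu_density k r \<gamma> x *\<^sub>R f x)"
 proof (rule set_integrable_bound)
  show "pos_integrable (%x::real. 2*Gamma a*C*(min 1 (x\<^sup>2)/x\<^sup>2))"
   by (rule set_integrable_mult_right) (use integrable_min_inverse_square in auto)
  show "AE x in lborel. x \<in> {0<..} --> norm (nu_density k r \<gamma> x *\<^sub>R f x) <= norm (2*Gamma a*C*(min 1 (x\<^sup>2)/x\<^sup>2))"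
  proof (intro AE_I2 impI)
   fix x :: real assume "x \<in> {0<..}"
   hence x: "0 < x" by simp
   have "norm (nu_density k r \<gamma> x *\<^sub>R f x) = nu_density k r \<gamma> x*norm (f x)"
    using nu_density_slices(4)[OF x] by simp
   also have "... <= (2*Gamma a/x\<^sup>2)*(C*min 1 (x\<^sup>2))"
    using nu_density_slices(3,4)[OF x] f[OF x] Ga by (intro mult_mono) auto
   also have "... = 2*Gamma a*C*(min 1 (x\<^sup>2)/x\<^sup>2)" by simp
   also have "... <= norm (2*Gamma a*C*(min 1 (x\<^sup>2)/x\<^sup>2))" by (simp only: real_norm_def abs_ge_self)
   finally show "norm (nu_density k r \<gamma> x *\<^sub>R f x) <= norm (2*Gamma a*C*(min 1 (x\<^sup>2)/x\<^sup>2))" .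
  qed
 qed (auto simp: set_borel_measurable_def)
 have nn: "AE x in lborel. 0 <= indicator {0<..} x*nu_density k r \<gamma> x"
  using nu_density_slices(4) by (auto simp: indicator_def)
 show "integrable (nu k r \<gamma>) f"
  unfolding nu_def using si nn
  by (subst integrable_density) (auto simp: set_integrable_def)
 show "(LINT x|nu k r \<gamma>. f x) = (PINT x. nu_density k r \<gamma> x *\<^sub>R f x)"
  unfolding nu_def set_lebesgue_integral_def using nn
  by (subst integral_density) auto
qed

lemma nu_levy_measure: "levy_measure (nu k r \<gamma>)"
 unfolding levy_measure_def
proof (intro conjI)
 note [measurable] = nu_density_measurable
 show "sets (nu k r \<gamma>) = sets borel" by (simp add: nu_def)
 show "emeasure (nu k r \<gamma>) {0} = 0"
 proof -
  have "emeasure (nu k r \<gamma>) {0} = (\<integral>\<^sup>+x. ennreal (indicator {0<..} x*nu_density k r \<gamma> x)*indicator {0} x \<partial>lborel)"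
   unfolding nu_def by (subst emeasure_density) auto
  also have "... = (\<integral>\<^sup>+x. 0 \<partial>(lborel :: real measure))"
   by (intro nn_integral_cong) (auto simp: indicator_def)
  finally show ?thesis by simp
 qed
 have "integrable (nu k r \<gamma>) (%x. min 1 (x\<^sup>2))"
  by (rule nu_integrable(1)[where C=1]) auto
 hence "(\<integral>\<^sup>+x. ennreal (norm (min 1 (x\<^sup>2))) \<partial>nu k r \<gamma>) < \<infinity>"
  by (simp add: integrable_iff_bounded)
 thus "(\<integral>\<^sup>+x. ennreal (min 1 (x^2)) \<partial>nu k r \<gamma>) < \<infinity>" by simp
qed

text \<open>Fubini between Lebesgue and counting measure, followed by the substitution in every
  slice. The right-hand sums over classes are the form in which limits of the array arise.\<close>

lemma nu_integral_slices:
 fixes f :: "real => 'b::euclidean_space"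
 assumes f [measurable]: "f \<in> borel_measurable borel" and fb: "!!x. x > 0 ==> norm (f x) <= C*min 1 (x\<^sup>2)"
 shows "pos_integrable (%z. f (uG a z/wscale \<gamma> j))"
  and "integrable (count_space UNIV) (%j. wscale \<gamma> j *\<^sub>R (PINT z. f (uG a z/wscale \<gamma> j)))"
  and "(LINT j|count_space UNIV. wscale \<gamma> j *\<^sub>R (PINT z. f (uG a z/wscale \<gamma> j))) = (LINT x|nu k r \<gamma>. f x)"
proof -
 interpret S: sigma_finite_measure "count_space (UNIV :: int set)"
  by (rule sigma_finite_measure_count_space_countable) auto
 interpret P: pair_sigma_finite lborel "count_space (UNIV :: int set)" ..
 let ?F = "%x j. indicator {0<..} x *\<^sub>R (nu_slice a (wscale \<gamma> j) x *\<^sub>R f x)"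
 have [measurable]: "nu_slice a (wscale \<gamma> j) \<in> borel_measurable borel" for j
  using nu_slice_measurable[OF a01(1) wscale_pos] .
 have "(%p. ?F (snd p) (fst p)) \<in> borel_measurable (count_space (UNIV :: int set) \<Otimes>\<^sub>M lborel)"
  by (rule measurable_pair_measure_countable1) auto
 hence "(%p. ?F (snd p) (fst p)) \<circ> (%(x, y). (y, x)) \<in> borel_measurable (lborel \<Otimes>\<^sub>M count_space (UNIV :: int set))"
  by (intro measurable_comp[OF measurable_pair_swap'])
 hence mea: "(%p. ?F (fst p) (snd p)) \<in> borel_measurable (lborel \<Otimes>\<^sub>M count_space (UNIV :: int set))"
  by (simp add: comp_def case_prod_beta')
 have nj: "(%j. norm (?F x j)) = (%j. (indicator {0<..} x*norm (f x))*nu_slice a (wscale \<gamma> j) x)" for x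
  using nu_slice_nonneg by (auto simp: fun_eq_iff abs_mult)
 have ij: "integrable (count_space UNIV) (%j. ?F x j)" for x
 proof (cases "x > 0")
  case True
  have "integrable (count_space UNIV) (%j. nu_slice a (wscale \<gamma> j) x *\<^sub>R (indicator {0<..} x *\<^sub>R f x))"
   using nu_density_slices(1)[OF True] by (intro integrable_scaleR_left) auto
  thus ?thesis by (simp add: mult.commute)
 qed simp
 have vj: "(LINT j|count_space UNIV. ?F x j) = indicator {0<..} x *\<^sub>R (nu_density k r \<gamma> x *\<^sub>R f x)" for x
 proof (cases "x > 0")
  case True
  have "(LINT j|count_space UNIV. nu_slice a (wscale \<gamma> j) x *\<^sub>R f x) = nu_density k r \<gamma> x *\<^sub>R f x"
   using nu_density_slices(1,2)[OF True] by (subst integral_scaleR_left) auto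
  thus ?thesis using True by simp
 qed simp
 have vnj: "(LINT j|count_space UNIV. norm (?F x j)) = norm (indicator {0<..} x *\<^sub>R (nu_density k r \<gamma> x *\<^sub>R f x))" for x
 proof (cases "x > 0")
  case True
  thus ?thesis unfolding nj using nu_density_slices(2,4)[OF True] by simp
 qed simp
 have int: "integrable (lborel \<Otimes>\<^sub>M count_space UNIV) (%p. ?F (fst p) (snd p))"
 proof (rule P.Fubini_integrable[OF mea])
  show "integrable lborel (%x. LINT j|count_space UNIV. norm (?F (fst (x, j)) (snd (x, j))))"
   using nu_integrable(2)[OF f fb] unfolding fst_conv snd_conv vnj set_integrable_def
   by (rule integrable_norm)
  show "AE x in lborel. integrable (count_space UNIV) (%j. ?F (fst (x, j)) (snd (x, j)))"
   using ij by simp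
 qed
 hence int': "integrable (lborel \<Otimes>\<^sub>M count_space UNIV) (%(x, j). ?F x j)"
  by (simp add: case_prod_beta')
 have "AE j in count_space UNIV. integrable lborel (%x. ?F x j)"
  by (rule P.AE_integrable_snd[OF int'])
 hence sl: "pos_integrable (%x. nu_slice a (wscale \<gamma> j) x *\<^sub>R f x)" for j
  by (simp add: AE_count_space set_integrable_def)
 show "pos_integrable (%z. f (uG a z/wscale \<gamma> j))"
  using sl nu_slice_integral(1)[OF a01(1) wscale_pos f] by blast
 have sv: "(LINT x|lborel. ?F x j) = wscale \<gamma> j *\<^sub>R (PINT z. f (uG a z/wscale \<gamma> j))" for j
  using nu_slice_integral(2)[OF a01(1) wscale_pos f] by (simp add: set_lebesgue_integral_def)
 show "integrable (count_space UNIV) (%j. wscale \<gamma> j *\<^sub>R (PINT z. f (uG a z/wscale \<gamma> j)))"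
  using P.integrable_snd[OF int'] unfolding sv .
 have "(LINT j|count_space UNIV. LINT x|lborel. ?F x j) = (LINT x|lborel. LINT j|count_space UNIV. ?F x j)"
  by (rule P.Fubini_integral[OF int'])
 thus "(LINT j|count_space UNIV. wscale \<gamma> j *\<^sub>R (PINT z. f (uG a z/wscale \<gamma> j))) = (LINT x|nu k r \<gamma>. f x)"
  using nu_integrable(3)[OF f fb] unfolding sv vj set_lebesgue_integral_def by simp
qed

end

section \<open>The drift\<close>

text \<open>First moment of the slice \<open>w\<close> restricted to jumps below 1: a jump
  \<open>\<Gamma>(a,z)/w\<close> is below 1 iff \<open>uG a z < w\<close>, and the weight
  \<open>w\<close> cancels the scale \<open>1/w\<close>.\<close>

definition truncated_mean :: "real => real => real" where
 "truncated_mean a w = (PINT z. (if uG a z < w then uG a z else 0))"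

lemma truncated_mean_integrable:
 assumes "0 < a"
 shows "pos_integrable (%z. if uG a z < w then uG a z else 0)"
proof (rule set_integrable_bound[OF uG_integrable[OF assms]])
 note [measurable] = uG_measurable[OF assms]
 show "set_borel_measurable lborel {0<..} (%z. if uG a z < w then uG a z else 0)"
  unfolding set_borel_measurable_def by measurable
qed (auto simp: uG_pos[OF assms, THEN less_imp_le])

lemma truncated_mean_large:
 assumes a: "0 < a" and w: "Gamma a <= w"
 shows "truncated_mean a w = Gamma (1 + a)"
proof -
 have "uG a z < w" if "0 < z" for z
  using upper_Gamma_less_Gamma[OF a that] w uG_eq[OF a, of z] that by simp
 hence "truncated_mean a w = (PINT z. uG a z)"
  unfolding truncated_mean_def by (intro set_lebesgue_integral_cong) auto
 thus ?thesis using uG_integral[OF a] by simp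
qed

lemma truncated_mean_small:
 assumes a: "0 < a" and q: "0 < q"
 defines "w \<equiv> upper_Gamma a q"
 shows "truncated_mean a w = a*w + q powr a*exp (- q) - q*w"
proof -
 have "uG a z < w \<longleftrightarrow> q < z" if "0 < z" for z
  using upper_Gamma_less[OF a, of z q] upper_Gamma_less[OF a, of q z] that q uG_eq[OF a, of z]
  by (cases z q rule: linorder_cases) (auto simp: w_def)
 hence "truncated_mean a w = (LINT z:{q<..}|lborel. uG a z)"
  unfolding truncated_mean_def set_lebesgue_integral_def
  using q by (intro bochner_integral_cong refl) (auto simp: indicator_def)
 thus ?thesis using upper_Gamma_integral(2)[OF a, of q] q by (simp add: w_def)
qed

text \<open>Keeping only the unit interval from \<open>q\<close> to \<open>q + 1\<close> bounds the
  incomplete Gamma function from below. It makes the first series of the drift summable.\<close>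

lemma upper_Gamma_ge_exp:
 assumes a: "0 < a" "a <= 1" and q: "0 < q"
 shows "exp (- q)*q powr a <= exp 1*(q + 1)*upper_Gamma a q"
proof -
 have "exp (- (q + 1))*(q + 1) powr (a - 1) = (LINT t:{q..q+1}|lborel. exp (- (q + 1))*(q + 1) powr (a - 1))"
  by (simp add: set_lebesgue_integral_def)
 also have "... <= (LINT t:{q..q+1}|lborel. exp (- t)*t powr (a - 1))"
 proof (rule set_integral_mono)
  show "set_integrable lborel {q..q+1} (%t. exp (- (q + 1))*(q + 1) powr (a - 1))"
   by (simp add: set_integrable_def)
  show "set_integrable lborel {q..q+1} (%t. exp (- t)*t powr (a - 1))"
   using a q by (intro Gamma_integrand_sub) auto
 qed (use a q in \<open>auto intro!: mult_mono powr_mono2'\<close>)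
 also have "... <= upper_Gamma a q"
  unfolding upper_Gamma_def set_lebesgue_integral_def
 proof (rule integral_mono)
  show "integrable lborel (%t. indicator {q..q+1} t *\<^sub>R (exp (- t)*t powr (a - 1)))"
   "integrable lborel (%t. indicator {q..} t *\<^sub>R (exp (- t)*t powr (a - 1)))"
   using Gamma_integrand_sub[OF a(1), of "{q..q+1}"] Gamma_integrand_sub[OF a(1), of "{q..}"] q
   by (auto simp: set_integrable_def)
 qed (auto simp: indicator_def)
 finally have 1: "exp (- (q + 1))*(q + 1) powr (a - 1) <= upper_Gamma a q" .
 have "exp (- q)*q powr a <= exp (- q)*(q + 1) powr a"
  using a q by (intro mult_left_mono powr_mono2) auto
 also have "... = exp 1*(q + 1)*(exp (- (q + 1))*(q + 1) powr (a - 1))"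
 proof -
  have e1: "(q + 1) powr a = (q + 1)*(q + 1) powr (a - 1)" using q by (simp add: powr_mult_base)
  have e2: "exp (- q) = exp 1*exp (- (q + 1))" by (simp add: exp_add[symmetric])
  show ?thesis by (simp only: e1 e2 mult_ac)
 qed
 also have "... <= exp 1*(q + 1)*upper_Gamma a q"
  using 1 q by (intro mult_left_mono) auto
 finally show ?thesis .
qed

lemma summable_linear_half: "summable (%s. (A + B*real s)*2 powr (\<theta> - real (Suc s)))"
proof (rule summable_comparison_test_ev)
 have e: "2 powr (\<theta> - real (Suc s)) = 2 powr \<theta>/2*(1/2)^s" for s
  by (simp add: powr_diff powr_add powr_realpow power_one_over)
 have "\<forall>\<^sub>F s in sequentially. (1 + real s)*(1/2)^s <= (3/4)^s"
  by real_asymp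
 thus "\<forall>\<^sub>F s in sequentially. norm ((A + B*real s)*2 powr (\<theta> - real (Suc s))) <= ((\<bar>A\<bar> + \<bar>B\<bar>)*(2 powr \<theta>/2))*(3/4)^s"
 proof eventually_elim
  case (elim s)
  have "\<bar>A + B*real s\<bar> <= \<bar>A\<bar> + \<bar>B\<bar>*real s" using abs_triangle_ineq[of A "B*real s"] by (simp add: abs_mult)
  also have "... <= (\<bar>A\<bar> + \<bar>B\<bar>)*(1 + real s)" by (simp add: algebra_simps)
  finally have "\<bar>A + B*real s\<bar>*(2 powr \<theta>/2*(1/2)^s) <= (\<bar>A\<bar> + \<bar>B\<bar>)*(1 + real s)*(2 powr \<theta>/2*(1/2)^s)"
   by (intro mult_right_mono) auto
  also have "... = ((\<bar>A\<bar> + \<bar>B\<bar>)*(2 powr \<theta>/2))*((1 + real s)*(1/2)^s)" by (simp only: mult_ac)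
  also have "... <= ((\<bar>A\<bar> + \<bar>B\<bar>)*(2 powr \<theta>/2))*(3/4)^s" using elim by (intro mult_left_mono) auto
  finally show ?case by (simp only: e norm_mult real_norm_def abs_mult) (simp add: abs_mult)
 qed
qed (intro summable_mult summable_geometric, simp)

context
 fixes k r :: nat and \<gamma> a :: real
 defines "a \<equiv> real r/real k"
 assumes k: "1 <= k" and r: "1 <= r" "r <= k"
begin

text \<open>Exchange rate between two ways of compensating: jumps below 1, or all jumps of the
  classes \<open>j >= 0\<close>. Classes with \<open>wscale \<gamma> j >= \<Gamma>(a)\<close> have
  all jumps below 1, with total mean \<open>\<Gamma>(1+a)\<close>; the remaining ones, listed
  downwards, give by \<open>truncated_mean_small\<close> the two series in
  \<open>drift\<close>.\<close>

lemma drift_identity: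
 defines "F \<equiv> %j::int. truncated_mean a (wscale \<gamma> j) - (if 0 <= j then Gamma (1 + a) else 0)"
 shows "integrable (count_space UNIV) F"
  and "integral\<^sup>L (count_space UNIV) F = drift k r \<gamma> + Gamma (1 + a)*(\<gamma> + 1)"
proof -
 have a: "0 < a" "a <= 1" using k r by (auto simp: a_def)
 have G: "Gamma a > 0" by (rule Gamma_pos[OF a(1)])
 have aG: "a*Gamma a = Gamma (1 + a)"
 proof -
  have "a \<notin> \<int>\<^sub>\<le>\<^sub>0" using a nonpos_Ints_nonpos[of a] by auto
  thus ?thesis using Gamma_plus1[of a] by (simp add: add.commute)
 qed
 \<comment> \<open>Its negative is the first class all of whose jumps lie below 1; the remaining
   fractional part is \<open>theta0\<close>.\<close>
 define c where "c = \<lfloor>\<gamma> - log 2 (Gamma a)\<rfloor>"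
 define \<theta> where "\<theta> = theta0 k r \<gamma>"
 have \<theta>: "\<theta> = \<gamma> - log 2 (Gamma a) - c" "0 <= \<theta>" "\<theta> < 1"
  by (auto simp: \<theta>_def theta0_def frac_def c_def a_def[symmetric]) linarith+
 have sc: "wscale \<gamma> j = Gamma a*2 powr (\<theta> + (c + j))" for j
 proof -
  have "2 powr \<gamma> = 2 powr (log 2 (Gamma a))*2 powr (\<theta> + c)" by (simp add: \<theta>(1) powr_add[symmetric])
  also have "2 powr (log 2 (Gamma a)) = Gamma a" using G by (intro powr_log_cancel) auto
  finally show ?thesis by (simp add: wscale_def powr_add mult_ac)
 qed
 define q where "q s = qt k r \<gamma> (Suc s)" for s
 define t where "t s = 2 powr (\<theta> - real (Suc s))" for s
 have t1: "0 < t s" "t s < 1" for s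
 proof -
  have "t s < 2 powr 0" unfolding t_def using \<theta> by (intro powr_less_mono) auto
  thus "t s < 1" by simp
 qed (simp add: t_def)
 have q: "0 < q s" "upper_Gamma a (q s) = t s*Gamma a" for s
  using Gamma_Q_inv_spec[OF a(1) t1, of s] unfolding q_def qt_def a_def[symmetric] \<theta>_def[symmetric] t_def[symmetric] by auto
 \<comment> \<open>The same summand with the cut at \<open>- c\<close>, where it vanishes from the
   cut on; the shift of the cut to 0 is \<open>integral_count_space_step\<close>.\<close>
 define F1 where "F1 j = truncated_mean a (wscale \<gamma> j) - (if - c <= j then Gamma (1 + a) else 0)" for j
 have zero: "F1 j = 0" if "- c <= j" for j
 proof -
  have "2 powr (\<theta> + (c + j)) >= 1" using that \<theta> by (intro ge_one_powr_ge_zero) auto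
  hence "wscale \<gamma> j >= Gamma a*1" unfolding sc using G by (intro mult_left_mono) auto
  thus ?thesis using truncated_mean_large[OF a(1)] that by (simp add: F1_def)
 qed
 have ws: "wscale \<gamma> (- c - 1 - int s) = upper_Gamma a (q s)" for s
  by (simp add: sc q t_def algebra_simps)
 have F1s: "F1 (- c - 1 - int s) = a*Gamma a*t s + exp (- q s)*q s powr a - t s*Gamma a*q s" for s
 proof -
  have "F1 (- c - 1 - int s) = truncated_mean a (upper_Gamma a (q s))" by (simp add: F1_def ws)
  also have "... = a*upper_Gamma a (q s) + q s powr a*exp (- q s) - q s*upper_Gamma a (q s)"
   by (rule truncated_mean_small[OF a(1) q(1)])
  finally show ?thesis by (simp add: q mult_ac)
 qed
 \<comment> \<open>For \<open>q s > 1\<close> one has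
   \<open>\<Gamma>(a, q s) <= exp (- q s)\<close>, while \<open>t s\<close> decays like
   \<open>2^(-s)\<close>; hence \<open>q s\<close> grows at most linearly.\<close>
 have qb: "q s <= 1 + \<bar>ln (Gamma a)\<bar> + 2 + real s" for s
 proof (cases "q s <= 1")
  case False
  have "t s*Gamma a <= q s powr (a - 1)*exp (- q s)" using upper_Gamma_le_exp[OF a q(1)] q by simp
  also have "q s powr (a - 1) <= 1"
   using powr_mono[of "a - 1" 0 "q s"] False a by simp
  finally have "t s*Gamma a <= exp (- q s)" by (simp add: mult_right_le_one_le)
  hence "ln (t s*Gamma a) <= ln (exp (- q s))" using t1[of s] G by (subst ln_le_cancel_iff) auto
  hence "ln (t s*Gamma a) <= - q s" by simp
  hence "q s <= - ln (t s) - ln (Gamma a)" using t1[of s] G by (simp add: ln_mult)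
  also have "- ln (t s) = (real (Suc s) - \<theta>)*ln 2" by (simp add: t_def ln_powr algebra_simps)
  also have "... <= real (Suc s)*1" using \<theta> ln2_le_25_over_36 by (intro mult_mono) auto
  finally show ?thesis by simp
 qed auto
 let ?A = "3 + \<bar>ln (Gamma a)\<bar>"
 have sumt: "t sums (2 powr \<theta>)" unfolding t_def by (rule sums_half_Suc)
 have sum2: "summable (%s. t s*Gamma a*q s)"
 proof (rule summable_comparison_test')
  show "summable (%s. Gamma a*((?A + 1*real s)*t s))"
   unfolding t_def by (intro summable_mult summable_linear_half)
  show "norm (t s*Gamma a*q s) <= Gamma a*((?A + 1*real s)*t s)" for s
  proof -
   have "norm (t s*Gamma a*q s) = Gamma a*(q s*t s)" using t1[of s] G q(1)[of s] by (simp add: abs_mult mult_ac)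
   also have "... <= Gamma a*((?A + 1*real s)*t s)"
    using qb[of s] t1[of s] G by (intro mult_left_mono mult_right_mono) auto
   finally show ?thesis .
  qed
 qed
 have sum1: "summable (%s. exp (- q s)*q s powr a)"
 proof (rule summable_comparison_test')
  show "summable (%s. exp 1*(t s*Gamma a*q s + Gamma a*t s))"
   by (intro summable_mult summable_add sum2 sums_summable[OF sumt])
  show "norm (exp (- q s)*q s powr a) <= exp 1*(t s*Gamma a*q s + Gamma a*t s)" for s
   using upper_Gamma_ge_exp[OF a q(1)[of s]] by (simp add: q algebra_simps)
 qed
 have F1nn: "F1 (- c - 1 - int s) >= 0" for s
 proof -
  have "truncated_mean a (upper_Gamma a (q s)) >= 0"
   unfolding truncated_mean_def set_lebesgue_integral_def
   using uG_pos[OF a(1)] by (intro integral_nonneg_AE AE_I2) (auto simp: less_imp_le)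
  thus ?thesis by (simp add: F1_def ws)
 qed
 have sumF: "summable (%s. F1 (- c - 1 - int s))"
  unfolding F1s by (intro summable_add summable_diff sum1 sum2 summable_mult sums_summable[OF sumt])
 hence sumFn: "summable (%s. norm (F1 (- c - 1 - int s)))" using F1nn by simp
 have iF1: "integrable (count_space UNIV) F1"
  using count_space_int_below(1)[of "-c" F1] zero sumFn by simp
 have "integral\<^sup>L (count_space UNIV) F1 = (\<Sum>s. F1 (- c - 1 - int s))"
  using count_space_int_below(2)[of "-c" F1] zero sumFn by simp
 also have "... = a*Gamma a * suminf t + (\<Sum>s. exp (- q s)*q s powr a) - (\<Sum>s. t s*Gamma a*q s)"
  unfolding F1s using sum1 sum2 sums_summable[OF sumt]
  by (simp add: suminf_diff[symmetric] suminf_add[symmetric] suminf_mult summable_add summable_mult)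
 also have "suminf t = 2 powr \<theta>" using sums_unique[OF sumt] by simp
 finally have vF1: "integral\<^sup>L (count_space UNIV) F1 = Gamma (1 + a)*2 powr \<theta> + (\<Sum>s. exp (- q s)*q s powr a) - (\<Sum>s. t s*Gamma a*q s)"
  by (simp only: aG)
 define st where "st = (%j::int. (if - c <= j then 1 else 0) - (if 0 <= j then 1 else 0) :: real)"
 have F: "F = (%j. F1 j + Gamma (1 + a) * st j)"
  by (auto simp: F_def F1_def st_def fun_eq_iff)
 note ist = integral_count_space_step[of c, folded st_def]
 show "integrable (count_space UNIV) F"
  unfolding F by (intro bochner_add iF1 integrable_mult_right ist(1))
 have "integral\<^sup>L (count_space UNIV) F = integral\<^sup>L (count_space UNIV) F1 + Gamma (1 + a) * of_int c"
  unfolding F using iF1 ist by (subst bochner_integral_add) auto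
 also have "... = drift k r \<gamma> + Gamma (1 + a)*(\<gamma> + 1)"
 proof -
  have cc: "real_of_int c = \<gamma> - log 2 (Gamma a) - \<theta>" using \<theta>(1) by simp
  show ?thesis
   unfolding vF1 drift_def q_def[symmetric] t_def[symmetric] \<theta>_def[symmetric] a_def[symmetric] cc
   by (simp add: algebra_simps)
 qed
 finally show "integral\<^sup>L (count_space UNIV) F = drift k r \<gamma> + Gamma (1 + a)*(\<gamma> + 1)" .
qed

text \<open>Compensation is decided by the class \<open>j\<close> instead of the size of the jump.
  This is the natural choice for the array, where the mean of a whole class is explicit.\<close>

definition levy_term :: "real => int => real => complex" where
 "levy_term s j x = iexp (s*x) - 1 - (if 0 <= j then \<i> * of_real (s*x) else 0)"

lemma norm_iexp_minus_one: "norm (iexp x - 1) <= 2" "norm (iexp x - 1) <= \<bar>x\<bar>"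
 using iexp_approx1[of x 0] norm_triangle_ineq4[of "iexp x" 1] by auto

lemma norm_iexp_minus_linear: "norm (iexp x - 1 - \<i> * of_real x) <= x\<^sup>2"
proof -
 have "norm (iexp x - 1 - \<i> * of_real x) <= \<bar>x\<bar>\<^sup>2/2"
  using iexp_approx1[of x 1] by (simp add: diff_diff_eq numeral_2_eq_2)
 also have "... <= x\<^sup>2" by simp
 finally show ?thesis .
qed

lemma levy_integrand_bound:
 assumes "0 < x"
 shows "norm (iexp (s*x) - 1 - \<i>*complex_of_real (s*x*indicator {..<1} x)) <= (2 + s\<^sup>2)*min 1 (x\<^sup>2)"
proof (cases "x < 1")
 case True
 have "norm (iexp (s*x) - 1 - \<i>*complex_of_real (s*x)) <= s\<^sup>2*x\<^sup>2"
  using norm_iexp_minus_linear[of "s*x"] by (simp add: power_mult_distrib)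
 also have "... <= (2 + s\<^sup>2)*x\<^sup>2" by (intro mult_right_mono) auto
 finally have "norm (iexp (s*x) - 1 - \<i>*complex_of_real (s*x)) <= (2 + s\<^sup>2)*x\<^sup>2" .
 moreover have "x\<^sup>2 <= 1" using True assms by (simp add: power_le_one)
 hence "min 1 (x\<^sup>2) = x\<^sup>2" by (rule min_absorb2)
 ultimately show ?thesis using True by simp
next
 case False
 have "norm (iexp (s*x) - 1) <= 2" by (rule norm_iexp_minus_one)
 also have "... <= 2 + s\<^sup>2" by simp
 finally have "norm (iexp (s*x) - 1) <= 2 + s\<^sup>2" .
 moreover have "min 1 (x\<^sup>2) = 1" using False by (simp add: min_def)
 ultimately show ?thesis using False by simp
qed

text \<open>The exponent as it comes out of the array; the subtracted constant is the limit of the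
  centering left over after compensation, see \<open>shift_limit\<close>.\<close>

definition limit_exponent :: "real => complex" where
 "limit_exponent s = (LINT j|count_space UNIV. wscale \<gamma> j *\<^sub>R (PINT z. levy_term s j (uG a z/wscale \<gamma> j)))
   - \<i> * of_real (s*(Gamma (1 + a)*(\<gamma> + 1)))"

text \<open>In each class the two compensators differ by a multiple of the jump whose integral is
  the summand of \<open>drift_identity\<close>. Summation yields the drift plus
  \<open>\<Gamma>(1+a)(\<gamma>+1)\<close>, and the latter cancels against the constant in
  \<open>limit_exponent\<close>.\<close>

theorem limit_exponent_eq:
 "limit_exponent s = \<i> * of_real (drift k r \<gamma> * s) +
   (CLINT x|nu k r \<gamma>. iexp (s*x) - 1 - \<i>*complex_of_real (s*x*indicator {..<1} x))"
proof -
 have a: "0 < a" "a <= 1" using k r by (auto simp: a_def)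
 note [measurable] = uG_measurable[OF a(1)]
 let ?G = "%x. iexp (s*x) - 1 - \<i>*complex_of_real (s*x*indicator {..<1} x)"
 have mG: "?G \<in> borel_measurable borel" by measurable
 note sl = nu_integral_slices[OF k r mG levy_integrand_bound, folded a_def, where \<gamma>=\<gamma>]
 let ?F = "%j::int. truncated_mean a (wscale \<gamma> j) - (if 0 <= j then Gamma (1 + a) else 0)"
 have tm: "wscale \<gamma> j *\<^sub>R (PINT z. levy_term s j (uG a z/wscale \<gamma> j))
   = wscale \<gamma> j *\<^sub>R (PINT z. ?G (uG a z/wscale \<gamma> j)) + \<i> * of_real s * of_real (?F j)" for j
 proof -
  define w where "w = wscale \<gamma> j"
  have w: "w > 0" by (simp add: w_def)
  \<comment> \<open>\<open>w\<close> times the jump, weighted by the difference of the indicators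
    "jump below 1" and "class \<open>j >= 0\<close>".\<close>
  let ?t = "%z. (if uG a z < w then uG a z else 0) - (if 0 <= j then uG a z else 0)"
  have it: "pos_integrable ?t"
   using uG_integrable[OF a(1)]
   by (intro set_integral_diff truncated_mean_integrable a) (cases "0 <= j", auto simp: set_integrable_def)
  have vt: "(PINT z. ?t z) = ?F j"
  proof -
   have "(PINT z. ?t z) = (PINT z. (if uG a z < w then uG a z else 0)) - (PINT z. (if 0 <= j then uG a z else 0))"
    using uG_integrable[OF a(1)]
    by (intro set_integral_diff truncated_mean_integrable a) (cases "0 <= j", auto simp: set_integrable_def)
   also have "(PINT z. (if 0 <= j then uG a z else 0)) = (if 0 <= j then Gamma (1 + a) else 0)"
    using uG_integral[OF a(1)] by (simp add: set_lebesgue_integral_def)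
   finally show ?thesis by (simp add: truncated_mean_def w_def)
  qed
  have pt: "levy_term s j (uG a z/w) = ?G (uG a z/w) + (\<i> * of_real (s/w)) * of_real (?t z)" for z
   using w by (auto simp: levy_term_def indicator_def field_simps)
  have it': "pos_integrable (%z. (\<i> * of_real (s/w))*complex_of_real (?t z))"
   by (intro set_integrable_mult_right) (use it in \<open>simp add: set_integrable_def scaleR_conv_of_real of_real_mult[symmetric] del: of_real_mult of_real_diff\<close>)
  have "(PINT z. levy_term s j (uG a z/w)) = (PINT z. ?G (uG a z/w)) + (PINT z. (\<i> * of_real (s/w))*complex_of_real (?t z))"
   unfolding pt using sl(1)[where j=j] it' by (intro set_integral_add(2)) (auto simp: w_def)
  also have "(PINT z. (\<i> * of_real (s/w))*complex_of_real (?t z)) = (\<i> * of_real (s/w)) * of_real (PINT z. ?t z)"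
   by (simp only: set_integral_mult_right set_integral_complex_of_real)
  finally have e: "(PINT z. levy_term s j (uG a z/w)) = (PINT z. ?G (uG a z/w)) + (\<i> * of_real (s/w)) * of_real (?F j)"
   unfolding vt .
  have alg: "w *\<^sub>R (X + (\<i> * of_real (s/w))*V) = w *\<^sub>R X + \<i> * of_real s*V" for X V :: complex
   using w by (simp add: scaleR_conv_of_real field_simps)
  show ?thesis unfolding w_def[symmetric] e alg ..
 qed
 note dr = drift_identity
 have "(LINT j|count_space UNIV. wscale \<gamma> j *\<^sub>R (PINT z. levy_term s j (uG a z/wscale \<gamma> j)))
   = (LINT j|count_space UNIV. wscale \<gamma> j *\<^sub>R (PINT z. ?G (uG a z/wscale \<gamma> j))) + (LINT j|count_space UNIV. \<i> * of_real s*complex_of_real (?F j))"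
  unfolding tm
 proof (intro bochner_integral_add sl(2))
  show "integrable (count_space UNIV) (%j. \<i> * of_real s*complex_of_real (?F j))"
   by (intro integrable_mult_right integrable_of_real dr(1))
 qed
 also have "(LINT j|count_space UNIV. \<i> * of_real s*complex_of_real (?F j)) = \<i> * of_real s * of_real (drift k r \<gamma> + Gamma (1 + a)*(\<gamma> + 1))"
  unfolding dr(2)[symmetric] by (subst integral_mult_right_zero, subst integral_complex_of_real) simp
 also have "(LINT j|count_space UNIV. wscale \<gamma> j *\<^sub>R (PINT z. ?G (uG a z/wscale \<gamma> j))) = (CLINT x|nu k r \<gamma>. ?G x)"
  by (rule sl(3))
 finally have e: "(LINT j|count_space UNIV. wscale \<gamma> j *\<^sub>R (PINT z. levy_term s j (uG a z/wscale \<gamma> j)))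
   = (CLINT x|nu k r \<gamma>. ?G x) + \<i> * of_real s * of_real (drift k r \<gamma> + Gamma (1 + a)*(\<gamma> + 1))" .
 show ?thesis unfolding limit_exponent_def e by (simp add: algebra_simps)
qed

lemma isCont_limit_exponent: "isCont limit_exponent 0"
proof -
 let ?G = "%s x. iexp (s*x) - 1 - \<i>*complex_of_real (s*x*indicator {..<1} x)"
 have "(%n. CLINT x|nu k r \<gamma>. ?G (X n) x) ----> (CLINT x|nu k r \<gamma>. ?G 0 x)" if X: "X ----> 0" for X
 proof -
  obtain B where B: "!!n. \<bar>X n\<bar> <= B"
   using X convergent_imp_Bseq[of X] by (auto simp: convergent_def Bseq_def)
  have m: "?G s \<in> borel_measurable (nu k r \<gamma>)" for s
   by (simp add: nu_def)
  show ?thesis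
  proof (rule integral_dominated_convergence[where w="%x. (2 + B\<^sup>2)*min 1 (x\<^sup>2)"])
   show "integrable (nu k r \<gamma>) (%x. (2 + B\<^sup>2)*min 1 (x\<^sup>2))"
    by (rule nu_integrable(1)[OF k r, where C="2 + B\<^sup>2"]) auto
   have "AE x in nu k r \<gamma>. 0 < x"
   proof -
    note [measurable] = nu_density_measurable[OF k r, of \<gamma>]
    have m: "(%x. ennreal (indicator {0<..} x*nu_density k r \<gamma> x)) \<in> borel_measurable lborel" by measurable
    show ?thesis unfolding nu_def AE_density[OF m] by (auto simp: indicator_def)
   qed
   thus "AE x in nu k r \<gamma>. norm (?G (X n) x) <= (2 + B\<^sup>2)*min 1 (x\<^sup>2)" for n
   proof eventually_elim
    case (elim x)
    have "norm (?G (X n) x) <= (2 + (X n)\<^sup>2)*min 1 (x\<^sup>2)" by (rule levy_integrand_bound[OF elim])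
    also have "... <= (2 + B\<^sup>2)*min 1 (x\<^sup>2)"
     using B[of n] by (intro mult_right_mono add_left_mono) (auto simp: abs_le_square_iff[symmetric])
    finally show ?case .
   qed
   have "(%n. ?G (X n) x) ----> ?G 0 x" for x
    by (intro tendsto_intros X)
   thus "AE x in nu k r \<gamma>. (%n. ?G (X n) x) ----> ?G 0 x" by simp
  qed (use m in auto)
 qed
 hence "isCont (%s. CLINT x|nu k r \<gamma>. ?G s x) 0"
  unfolding isCont_def tendsto_at_iff_sequentially comp_def by blast
 thus ?thesis unfolding limit_exponent_eq[abs_def] by (intro continuous_intros)
qed

end

section \<open>The Erlang tail\<close>

definition exp_trunc :: "nat => 'a => 'a::{banach,real_normed_field}" where
 "exp_trunc k x = (\<Sum>i<k. x^i/fact i)"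

text \<open>The Erlang tail, that is, the probability that the \<open>k\<close>-th alarm of a node
  exceeds \<open>x\<close>. For positive \<open>x\<close> it equals
  \<open>Gamma_Q (real k) x\<close>, and it extends to an entire function.\<close>

definition Qk :: "nat => real => real" where
 "Qk k x = exp_trunc k x*exp (- x)"

lemma Qk_measurable [measurable]: "Qk k \<in> borel_measurable borel"
 unfolding Qk_def exp_trunc_def by measurable

lemma Qk_has_deriv:
 assumes "k >= 1"
 shows "(Qk k has_real_derivative - (x^(k - 1)*exp (- x)/fact (k - 1))) (at x)"
proof -
 obtain m where k: "k = Suc m" using assms by (cases k) auto
 have "(Qk (Suc m) has_real_derivative - (x^m*exp (- x)/fact m)) (at x)"
 proof (induction m)
  case 0
  have "Qk (Suc 0) = (%x. exp (- x))" by (auto simp: Qk_def exp_trunc_def)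
  thus ?case by (auto intro!: derivative_eq_intros)
 next
  case (Suc m)
  have e: "Qk (Suc (Suc m)) = (%x. Qk (Suc m) x + x^Suc m/fact (Suc m)*exp (- x))"
   by (auto simp: Qk_def exp_trunc_def algebra_simps simp del: fact_Suc)
  have d: "((%x. x^Suc m/fact (Suc m)*exp (- x)) has_real_derivative
    x^m/fact m*exp (- x) - x^Suc m/fact (Suc m)*exp (- x)) (at x)"
   by (rule derivative_eq_intros refl | simp)+
  show ?case unfolding e using DERIV_add[OF Suc.IH d] by (simp add: algebra_simps)
 qed
 thus ?thesis by (simp add: k)
qed

lemma Qk_0: "k >= 1 ==> Qk k 0 = 1"
 by (cases k) (auto simp: Qk_def exp_trunc_def sum.lessThan_Suc_shift simp del: sum.lessThan_Suc)

lemma exp_trunc_pos: "k >= 1 ==> 0 <= x ==> 1 <= (exp_trunc k x :: real)"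
 using sum_mono2[of "{..<k}" "{0}" "%i. x^i/fact i"] by (auto simp: exp_trunc_def)

lemma Qk_pos: "k >= 1 ==> 0 <= x ==> 0 < Qk k x"
 using exp_trunc_pos[of k x] by (simp add: Qk_def)

lemma power_div_fact_le_exp: "0 <= x ==> x^n/fact n <= exp (x::real)"
proof -
 assume x: "0 <= x"
 have "(\<Sum>i\<in>{n}. x^i/fact i) <= (\<Sum>i. x^i/fact i)"
  using x summable_exp[of x] by (intro sum_le_suminf) (auto simp: field_simps)
 thus ?thesis by (simp add: exp_def field_simps)
qed

lemma exp_trunc_plus_le_exp: "0 <= x ==> exp_trunc k x + x^k/fact k <= exp (x::real)"
proof -
 assume x: "0 <= x"
 have "(\<Sum>i\<in>{..k}. x^i/fact i) <= (\<Sum>i. x^i/fact i)"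
  using x summable_exp[of x] by (intro sum_le_suminf) (auto simp: field_simps)
 thus ?thesis by (simp add: exp_def exp_trunc_def field_simps lessThan_Suc_atMost[symmetric])
qed

lemma Qk_le_1: "0 <= x ==> Qk k x <= 1"
proof -
 assume x: "0 <= x"
 have "exp_trunc k x*exp (- x) <= exp x*exp (- x)"
  using exp_trunc_plus_le_exp[OF x, of k] x by (intro mult_right_mono) (auto intro: order_trans[rotated])
 thus ?thesis by (simp add: Qk_def exp_add[symmetric])
qed

lemma Qk_nonneg: "0 <= x ==> 0 <= Qk k x"
 by (auto simp: Qk_def exp_trunc_def intro!: mult_nonneg_nonneg sum_nonneg)

lemma one_minus_Qk_le:
 assumes k: "k >= 1" and x: "0 <= x"
 shows "1 - Qk k x <= x^k/fact k"
proof -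
 have "0^k/fact k - 1 + Qk k 0 <= x^k/fact k - 1 + Qk k x"
 proof (rule DERIV_nonneg_imp_nondecreasing[OF x])
  fix y :: real assume y: "0 <= y"
  have f: "real k/fact k = 1/fact (k - 1)" using k by (cases k) (auto simp del: of_nat_Suc)
  have "((%y. y^k/fact k) has_real_derivative (real k*y^(k - 1)/fact k)) (at y)"
   using k by (auto intro!: derivative_eq_intros)
  hence "((%y. y^k/fact k - 1 + Qk k y) has_real_derivative
    (real k*y^(k - 1)/fact k - 0 + - (y^(k - 1)*exp (- y)/fact (k - 1)))) (at y)"
   by (intro DERIV_add DERIV_diff Qk_has_deriv k) auto
  moreover have "real k*y^(k - 1)/fact k - 0 + - (y^(k - 1)*exp (- y)/fact (k - 1)) >= 0"
  proof -
   have "real k*y^(k - 1)/fact k = (real k/fact k)*y^(k - 1)" by simp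
   also have "... = y^(k - 1)/fact (k - 1)" by (simp only: f) simp
   moreover have "y^(k - 1)*exp (- y) <= y^(k - 1)*1" using y by (intro mult_left_mono) auto
   ultimately show ?thesis by (simp add: divide_right_mono)
  qed
  ultimately show "\<exists>d. ((%y. y^k/fact k - 1 + Qk k y) has_real_derivative d) (at y) & 0 <= d" by blast
 qed
 thus ?thesis using k by (simp add: Qk_0 power_0_left)
qed

text \<open>Both functions have the same derivative up to the factor \<open>\<Gamma>(k)\<close> and
  vanish at infinity.\<close>

lemma Gamma_Q_eq_Qk:
 assumes k: "k >= 1" and x: "0 < x"
 shows "Gamma_Q (real k) x = Qk k x"
proof -
 define G where "G = (fact (k - 1) :: real)"
 have Gk: "Gamma (real k) = G" using Gamma_fact[of "k - 1", where 'a=real] k by (simp add: G_def of_nat_diff add.commute)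
 have G0: "G > 0" by (simp add: G_def)
 let ?D = "%z. upper_Gamma (real k) z - G*Qk k z"
 have der: "(?D has_real_derivative 0) (at z)" if "0 < z" for z
 proof -
  have "(?D has_real_derivative - (exp (- z)*z powr (real k - 1)) - G * - (z^(k - 1)*exp (- z)/fact (k - 1))) (at z)"
   using k that by (intro DERIV_diff DERIV_cmult upper_Gamma_has_deriv Qk_has_deriv) auto
  moreover have "z powr (real k - 1) = z^(k - 1)"
   using that k powr_realpow[of z "k - 1"] by (simp add: of_nat_diff)
  ultimately show ?thesis by (simp add: G_def)
 qed
 have eq: "?D z = ?D x" if "z >= x" for z
 proof (cases "z = x")
  case False
  hence "x < z" using that by simp
  thus ?thesis
  proof (rule DERIV_isconst_end)
   show "continuous_on {x..z} ?D"
    using x by (intro continuous_at_imp_continuous_on ballI DERIV_isCont[OF der]) auto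
  qed (use x der in auto)
 qed simp
 have "((%z::real. exp_trunc k z*exp (- z)) ---> 0) at_top"
 proof -
  have "((%z::real. z^i/exp z) ---> 0) at_top" for i :: nat by (rule tendsto_power_div_exp_0)
  hence "((%z::real. \<Sum>i<k. (1/fact i)*(z^i/exp z)) ---> (\<Sum>i<k. (1/fact i)*0)) at_top"
   by (intro tendsto_sum tendsto_mult_left)
  thus ?thesis by (simp add: exp_trunc_def sum_distrib_right sum_divide_distrib exp_minus field_simps)
 qed
 hence l1: "(?D ---> 0 - G*0) at_top"
  unfolding Qk_def using k by (intro tendsto_diff tendsto_mult_left upper_Gamma_at_top) auto
 have "\<forall>\<^sub>F z in at_top. ?D z = ?D x"
  by (rule eventually_at_top_linorderI[of x]) (rule eq)
 hence l2: "(?D ---> ?D x) at_top" by (rule tendsto_eventually)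
 have "?D x = 0 - G*0" by (rule tendsto_unique[OF trivial_limit_at_top_linorder l2 l1])
 thus ?thesis using G0 by (simp add: Gamma_Q_def Gk)
qed

lemma exp_trunc_le: "0 <= x ==> exp_trunc k x <= 2^k*exp (x/2 :: real)"
proof -
 assume x: "0 <= x"
 have "exp_trunc k x <= (\<Sum>i<k. 2^i*exp (x/2))"
  unfolding exp_trunc_def
 proof (rule sum_mono)
  fix i
  have "x^i/fact i = 2^i*((x/2)^i/fact i)" by (simp add: power_divide)
  also have "... <= 2^i*exp (x/2)" using x by (intro mult_left_mono power_div_fact_le_exp) auto
  finally show "x^i/fact i <= 2^i*exp (x/2)" .
 qed
 also have "... = (2^k - 1)*exp (x/2)"
  using geometric_sum[of "2::real" k] by (simp add: sum_distrib_right[symmetric])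
 also have "... <= 2^k*exp (x/2)" by (intro mult_right_mono) auto
 finally show ?thesis .
qed

text \<open>One constant for two regimes: near 0 the tail is \<open>1 - x^k/k!\<close> to first
  order, far out it decays exponentially.\<close>

lemma Qk_exp_bound:
 assumes k: "k >= 1"
 obtains c where "c > 0" "!!x. 0 <= x ==> Qk k x <= exp (- c*min x (x^k))"
proof -
 \<comment> \<open>Beyond \<open>4k\<close> one has \<open>2^k <= exp (x/4)\<close>, so
   \<open>exp_trunc_le\<close> leaves \<open>exp (- x/4)\<close>.\<close>
 define x0 where "x0 = 4*real k"
 have x0: "x0 >= 4" using k by (simp add: x0_def)
 define B where "B = fact k*exp_trunc k x0"
 have B: "B > 0" using exp_trunc_pos[OF k, of x0] x0 by (simp add: B_def)
 define c1 where "c1 = 1/(B + x0^k)"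
 have c1: "c1 > 0" using B x0 by (auto simp: c1_def intro!: add_pos_nonneg divide_pos_pos)
 define c where "c = min (1/4) c1"
 have "Qk k x <= exp (- c*min x (x^k))" if x: "0 <= x" for x
 proof (cases "x >= x0")
  case True
  have "Qk k x <= 2^k*exp (x/2)*exp (- x)"
   unfolding Qk_def using exp_trunc_le[OF x, of k] by (intro mult_right_mono) auto
  also have "(2::real)^k <= exp 1^k" using exp_ge_add_one_self[of 1] by (intro power_mono) auto
  also have "exp (1::real)^k = exp (real k)" by (simp add: exp_of_nat_mult[symmetric])
  also have "exp (real k) <= exp (x/4)" using True by (simp add: x0_def)
  finally have "Qk k x <= exp (x/4)*exp (x/2)*exp (- x)" by (simp add: mult_right_mono)
  also have "... = exp (- (1/4)*x)" by (simp add: exp_add[symmetric])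
  also have "... <= exp (- c*min x (x^k))"
  proof -
   have "c*min x (x^k) <= (1/4)*x"
    using x c1 by (intro mult_mono) (auto simp: c_def)
   thus ?thesis by simp
  qed
  finally show ?thesis .
 next
  case False
  have S: "exp_trunc k x <= exp_trunc k x0"
   unfolding exp_trunc_def using x False by (intro sum_mono divide_right_mono power_mono) auto
  have S1: "exp_trunc k x >= 1" by (rule exp_trunc_pos[OF k x])
  define t where "t = x^k/B"
  have t: "0 <= t" using x B by (simp add: t_def)
  \<comment> \<open>\<open>B\<close> is chosen such that the extra term is at most the next Taylor
    term \<open>x^k/k!\<close> of the exponential, as long as \<open>x <= x0\<close>.\<close>
  have "exp_trunc k x*(1 + t) <= exp_trunc k x + x^k/fact k"
  proof -
   have "exp_trunc k x*t <= exp_trunc k x0*t" using S t by (intro mult_right_mono)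
   also have "... = x^k/fact k" using exp_trunc_pos[OF k, of x0] x0 by (simp add: t_def B_def)
   finally show ?thesis by (simp add: algebra_simps)
  qed
  also have "... <= exp x" by (rule exp_trunc_plus_le_exp[OF x])
  finally have "exp_trunc k x <= exp x/(1 + t)" using t by (simp add: field_simps)
  hence "Qk k x <= exp x/(1 + t)*exp (- x)" unfolding Qk_def by (intro mult_right_mono) auto
  also have "... = 1/(1 + t)" by (simp add: exp_minus)
  also have "... = 1 - t/(1 + t)" using t by (simp add: field_simps)
  also have "... <= exp (- (t/(1 + t)))" using exp_ge_add_one_self[of "- (t/(1 + t))"] by simp
  also have "... <= exp (- c*min x (x^k))"
  proof -
   have "c*min x (x^k) <= c1*x^k" using x c1 by (intro mult_mono) (auto simp: c_def)
   also have "... = x^k/(B + x0^k)" by (simp add: c1_def)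
   also have "... <= x^k/(B + x^k)"
    using B x False by (intro divide_left_mono add_left_mono power_mono mult_pos_pos add_pos_nonneg) auto
   also have "... = t/(1 + t)" using B x by (simp add: t_def field_simps)
   finally show ?thesis by simp
  qed
  finally show ?thesis .
 qed
 moreover have "c > 0" using c1 by (simp add: c_def)
 ultimately show thesis using that by blast
qed

lemma le_one_plus_power:
 assumes "0 <= (y::real)" "k >= 1" shows "y <= 1 + y^k"
proof (cases "y <= 1")
 case False
 hence "y^1 <= y^k" using assms by (intro power_increasing) auto
 thus ?thesis by simp
qed (use assms in \<open>auto intro: order_trans[of y 1]\<close>)

lemma root_scale:
 assumes "k >= 1" "d >= 1" "0 <= x"
 shows "(real d powr (1/real k)*x)^k = real d*x^k"
  and "real d powr (1/real k)*x <= real d*x"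
  and "real d powr (1/real k) >= 1"
proof -
 have "(real d powr (1/real k))^k = real d powr (real k*(1/real k))"
  using assms by (subst powr_power) auto
 thus "(real d powr (1/real k)*x)^k = real d*x^k"
  using assms by (simp add: power_mult_distrib)
 have "real d powr (1/real k) <= real d powr 1" using assms by (intro powr_mono) auto
 thus "real d powr (1/real k)*x <= real d*x" using assms by (intro mult_right_mono) auto
 show "real d powr (1/real k) >= 1" using assms by (intro ge_one_powr_ge_zero) auto
qed

text \<open>The natural scale is \<open>s = d^(1/k) * x\<close>: \<open>d * min x (x^k)\<close> is
  either \<open>d*x >= s\<close> or \<open>s^k >= s - 1\<close>. This is the majorant behind all
  later dominated convergence arguments.\<close>

lemma Qk_power_bound:
 assumes k: "k >= 1"
 obtains c where "c > 0" "!!x d. 0 <= x ==> d >= 1 ==> Qk k x^d <= exp (c - c*(real d powr (1/real k)*x))"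
proof -
 obtain c where c: "c > 0" "!!x. 0 <= x ==> Qk k x <= exp (- c*min x (x^k))"
  using Qk_exp_bound[OF k] by blast
 have "Qk k x^d <= exp (c - c*(real d powr (1/real k)*x))" if x: "0 <= x" and d: "d >= 1" for x and d :: nat
 proof -
  let ?s = "real d powr (1/real k)*x"
  have "Qk k x^d <= exp (- c*min x (x^k))^d"
   using c(2)[OF x] Qk_nonneg[OF x] by (intro power_mono)
  also have "... = exp (- c*(real d*min x (x^k)))"
   by (simp add: exp_of_nat_mult[symmetric] mult_ac)
  also have "... <= exp (c - c*?s)"
  proof -
   have "?s - 1 <= real d*min x (x^k)"
   proof (cases "x <= x^k")
    case True
    thus ?thesis using root_scale(2)[OF k d x] by (simp add: min_def)
   next
    case False
    have "?s <= 1 + ?s^k" using x k by (intro le_one_plus_power) auto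
    thus ?thesis using root_scale(1)[OF k d x] False by (simp add: min_def)
   qed
   hence "c*(?s - 1) <= c*(real d*min x (x^k))" using c(1) by (intro mult_left_mono) auto
   thus ?thesis by (simp add: algebra_simps)
  qed
  finally show ?thesis .
 qed
 thus thesis using that c(1) by blast
qed

section \<open>The expansion coefficients\<close>

text \<open>The remainder is \<open>z^N\<close> times the shifted power series, which is continuous
  and hence bounded near 0.\<close>

lemma has_fps_expansion_remainder:
 fixes f :: "complex => complex"
 assumes "f has_fps_expansion F"
 obtains C \<delta> where "C >= 0" "\<delta> > 0" "!!z. norm z <= \<delta> ==> norm (f z - (\<Sum>i<N. fps_nth F i*z^i)) <= C*norm z^N"
proof -
 define S where "S = fps_shift N F"
 have rad: "fps_conv_radius F > 0" using assms by (simp add: has_fps_expansion_def)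
 have rS: "fps_conv_radius S > 0" using rad by (simp add: S_def)
 have "isCont (eval_fps S) 0"
  using rS by (intro continuous_eval_fps) (auto simp: zero_ereal_def)
 hence "\<forall>\<^sub>F z in nhds 0. dist (eval_fps S z) (eval_fps S 0) < 1"
  unfolding isCont_def tendsto_at_iff_tendsto_nhds by (rule tendstoD) simp
 moreover have "\<forall>\<^sub>F z in nhds 0. eval_fps F z = f z" using assms by (simp add: has_fps_expansion_def)
 moreover have "\<forall>\<^sub>F z in nhds 0. z \<in> eball 0 (fps_conv_radius F)"
  using rad by (intro eventually_nhds_in_open) (auto simp: zero_ereal_def)
 ultimately have "\<forall>\<^sub>F z in nhds 0. norm (f z - (\<Sum>i<N. fps_nth F i*z^i)) <= (norm (eval_fps S 0) + 1)*norm z^N"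
 proof eventually_elim
  case (elim z)
  have zr: "ereal (norm z) < fps_conv_radius F" using elim(3) by (simp add: in_eball_iff)
  have s1: "(%n. fps_nth F n*z^n) sums f z" using sums_eval_fps[OF zr] elim by simp
  have "(%n. fps_nth S n*z^n) sums eval_fps S z"
   by (rule sums_eval_fps) (use zr in \<open>simp add: S_def\<close>)
  hence "(%n. z^N*(fps_nth S n*z^n)) sums (z^N*eval_fps S z)" by (rule sums_mult)
  hence "(%n. fps_nth F (n + N)*z^(n + N)) sums (z^N*eval_fps S z)"
   by (simp add: S_def power_add mult_ac)
  moreover have "(%n. fps_nth F (n + N)*z^(n + N)) sums (f z - (\<Sum>i<N. fps_nth F i*z^i))"
   using sums_split_initial_segment[OF s1, of N] by simp
  ultimately have "f z - (\<Sum>i<N. fps_nth F i*z^i) = z^N*eval_fps S z" by (rule sums_unique2[rotated])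
  hence "norm (f z - (\<Sum>i<N. fps_nth F i*z^i)) = norm (eval_fps S z)*norm z^N"
   by (simp add: norm_mult norm_power mult.commute)
  also have "norm (eval_fps S z) <= norm (eval_fps S 0) + 1"
   using elim(1) norm_triangle_ineq2[of "eval_fps S z" "eval_fps S 0"] by (simp add: dist_norm)
  finally show ?case by (simp add: mult_right_mono)
 qed
 then obtain \<delta> where "\<delta> > 0" "!!z. dist z 0 < \<delta> ==> norm (f z - (\<Sum>i<N. fps_nth F i*z^i)) <= (norm (eval_fps S 0) + 1)*norm z^N"
  by (auto simp: eventually_nhds_metric)
 thus thesis using that[of "norm (eval_fps S 0) + 1" "\<delta>/2"] by auto
qed

context
 fixes k :: nat
 assumes k: "k >= 1"
begin

definition Qc :: "complex => complex" where "Qc z = exp_trunc k z*exp (- z)"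

text \<open>Logarithm of \<open>exp (z^k/k!) * Q(k,z)\<close>, taken over the complex numbers to
  have power series available. It vanishes to order \<open>k + 1\<close> at 0, so it is the
  correction to \<open>Q(k,x)^d = exp (- d*x^k/k!)\<close>.\<close>

definition hc :: "complex => complex" where "hc z = z^k/fact k + Ln (Qc z)"

definition Sfps :: "complex fps" where "Sfps = (\<Sum>i<k. fps_const (1/fact i)*fps_X^i)"

definition Hfps :: "complex fps" where "Hfps = fps_expansion hc 0"

definition Afps :: "complex fps" where
 "Afps = fps_exp (- 1)*inverse (2*(Sfps*fps_exp (- 1)) - 1)"

lemma Sfps_nth: "fps_nth Sfps n = (if n < k then 1/fact n else 0)"
 by (auto simp: Sfps_def fps_sum_nth fps_X_power_nth if_distrib[of "(*) _"] cong: if_cong)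

lemma exp_trunc_has_fps: "exp_trunc k has_fps_expansion Sfps"
proof -
 have "(%z::complex. \<Sum>i<k. 1/fact i*z^i) has_fps_expansion (\<Sum>i<k. fps_const (1/fact i)*fps_X^i)"
  by (intro has_fps_expansion_sum has_fps_expansion_cmult_left has_fps_expansion_fps_X_power)
 thus ?thesis by (simp add: Sfps_def exp_trunc_def[abs_def])
qed

lemma Qc_has_fps: "Qc has_fps_expansion Sfps*fps_exp (- 1)"
 unfolding Qc_def[abs_def] by (intro has_fps_expansion_mult exp_trunc_has_fps has_fps_expansion_exp_neg1)

lemma exp_trunc_0: "exp_trunc k (0::'a::{banach,real_normed_field}) = 1"
 using k by (cases k) (auto simp: exp_trunc_def sum.lessThan_Suc_shift simp del: sum.lessThan_Suc)

lemma exp_trunc_analytic [analytic_intros]: "exp_trunc k analytic_on (A :: complex set)"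
 unfolding exp_trunc_def[abs_def] by (intro analytic_intros) auto

lemma hc_has_fps: "hc has_fps_expansion Hfps"
 unfolding Hfps_def
proof (rule analytic_at_imp_has_fps_expansion_0)
 have e: "exp_trunc k analytic_on {0::complex}" by (rule exp_trunc_analytic)
 show "hc analytic_on {0}"
  unfolding hc_def[abs_def] Qc_def by (intro analytic_intros e) (auto simp: exp_trunc_0)
qed

text \<open>Differentiating the logarithm gives
  \<open>Q'/Q = - z^(k-1)/((k-1)! * exp_trunc k z)\<close>. Since \<open>1 - inverse Sfps\<close>
  has no constant term, the order of vanishing of \<open>Hfps\<close> can be read off.\<close>

lemma Hfps_deriv: "fps_deriv Hfps = fps_const (1/fact (k - 1))*fps_X^(k - 1)*(1 - inverse Sfps)"
proof (rule fps_expansion_unique_complex)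
 show "deriv hc has_fps_expansion fps_deriv Hfps" by (rule has_fps_expansion_deriv[OF hc_has_fps])
 have S0: "fps_nth Sfps 0 ~= 0" using k by (simp add: Sfps_nth)
 let ?g = "%z::complex. 1/fact (k - 1)*z^(k - 1)*(1 - inverse (exp_trunc k z))"
 have g: "?g has_fps_expansion fps_const (1/fact (k - 1))*fps_X^(k - 1)*(1 - inverse Sfps)"
  by (intro has_fps_expansion_mult has_fps_expansion_const has_fps_expansion_fps_X_power has_fps_expansion_diff
     has_fps_expansion_1 has_fps_expansion_inverse exp_trunc_has_fps S0)
 have cont: "isCont Qc 0" using has_fps_expansion_imp_continuous[OF Qc_has_fps] .
 have cont2: "isCont (exp_trunc k :: complex => complex) 0"
  using has_fps_expansion_imp_continuous[OF exp_trunc_has_fps] .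
 have "\<forall>\<^sub>F z in nhds 0. dist (Qc z) 1 < 1"
 proof -
  have "(Qc ---> 1) (nhds 0)"
   using cont by (simp add: continuous_at_imp_continuous_within isCont_def tendsto_nhds_iff Qc_def exp_trunc_0)
  thus ?thesis by (rule tendstoD) simp
 qed
 moreover have "\<forall>\<^sub>F z in nhds 0. dist (exp_trunc k z) (1::complex) < 1"
 proof -
  have "(exp_trunc k ---> (1::complex)) (nhds 0)"
   using cont2 by (simp add: continuous_at_imp_continuous_within isCont_def tendsto_nhds_iff exp_trunc_0)
  thus ?thesis by (rule tendstoD) simp
 qed
 ultimately have "\<forall>\<^sub>F z in nhds 0. deriv hc z = ?g z"
 proof eventually_elim
  case (elim z)
  have S: "exp_trunc k z ~= 0" using elim(2) by auto
  have "Re (1 - Qc z) <= norm (1 - Qc z)" by (rule complex_Re_le_cmod)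
  hence "Re (Qc z) > 0" using elim(1) by (simp add: dist_norm norm_minus_commute)
  hence nn: "Qc z \<notin> \<real>\<^sub>\<le>\<^sub>0" by (auto simp: complex_nonpos_Reals_iff)
  obtain m where m: "k = Suc m" using k by (cases k) auto
  have km: "k - Suc 0 = m" using m by simp
  have dS: "(exp_trunc k has_field_derivative exp_trunc m z) (at z)"
  proof -
   have "((%z::complex. \<Sum>i<Suc m. z^i/fact i) has_field_derivative (\<Sum>i<Suc m. of_nat i*z^(i - 1)/fact i)) (at z)"
    by (auto intro!: derivative_eq_intros sum.cong)
   also have "(\<Sum>i<Suc m. of_nat i*z^(i - 1)/fact i) = (\<Sum>i<m. z^i/fact i)"
    by (subst sum.lessThan_Suc_shift) (auto intro!: sum.cong simp: divide_simps simp del: of_nat_Suc)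
   finally show ?thesis by (simp add: exp_trunc_def[abs_def] m)
  qed
  have S': "exp_trunc m z = exp_trunc k z - z^m/fact m" by (simp add: m exp_trunc_def)
  have dQ: "(Qc has_field_derivative exp_trunc m z*exp (- z) - exp_trunc k z*exp (- z)) (at z)"
   unfolding Qc_def[abs_def] by (auto intro!: derivative_eq_intros dS)
  have dp: "((%z. z^k/fact k) has_field_derivative z^m/fact m) (at z)"
   unfolding m by (auto intro!: derivative_eq_intros simp: divide_simps simp del: of_nat_Suc power_Suc)
  have "(hc has_field_derivative z^m/fact m + inverse (Qc z)*(exp_trunc m z*exp (- z) - exp_trunc k z*exp (- z))) (at z)"
   unfolding hc_def[abs_def] by (intro DERIV_add dp DERIV_chain2[OF has_field_derivative_Ln[OF nn] dQ])
  also have "z^m/fact m + inverse (Qc z)*(exp_trunc m z*exp (- z) - exp_trunc k z*exp (- z))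
    = 1/fact (k - 1)*z^(k - 1)*(1 - inverse (exp_trunc k z))"
   using S km by (simp add: S' Qc_def field_simps)
  finally show ?case by (rule DERIV_imp_deriv)
 qed
 thus "deriv hc has_fps_expansion fps_const (1/fact (k - 1))*fps_X^(k - 1)*(1 - inverse Sfps)"
  using g has_fps_expansion_cong[of "deriv hc" ?g] by simp
qed

lemma hc_0: "hc 0 = 0" using k by (simp add: hc_def Qc_def exp_trunc_0 power_0_left)

lemma Hfps_nth_0: "n <= k ==> fps_nth Hfps n = 0"
proof (cases n)
 case 0
 show ?thesis using has_fps_expansion_imp_0_eq_fps_nth_0[OF hc_has_fps] 0 by (simp add: hc_0)
next
 case (Suc i)
 assume "n <= k"
 hence i: "i < k" using Suc by simp
 have "of_nat (Suc i)*fps_nth Hfps (Suc i) = fps_nth (fps_deriv Hfps) i" by (simp add: fps_deriv_nth)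
 also have "... = (1/fact (k - 1))*fps_nth (fps_X^(k - 1)*(1 - inverse Sfps)) i"
  unfolding Hfps_deriv by (simp add: mult.assoc)
 also have "fps_nth (fps_X^(k - 1)*(1 - inverse Sfps)) i = 0"
  using i k by (auto simp: fps_X_power_mult_nth Sfps_nth)
 finally show ?thesis using Suc by (simp del: of_nat_Suc)
qed

lemma Hfps_power_nth_0: "n < j*(k + 1) ==> fps_nth (Hfps^j) n = 0"
proof (cases "Hfps = 0")
 case True
 assume "n < j*(k + 1)"
 thus ?thesis using True by (cases j) auto
next
 case False
 assume n: "n < j*(k + 1)"
 have "k + 1 <= subdegree Hfps" using False Hfps_nth_0 by (intro subdegree_geI) auto
 hence "j*(k + 1) <= j * subdegree Hfps" by (rule mult_le_mono2)
 hence "j*(k + 1) <= subdegree (Hfps^j)" by simp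
 thus ?thesis using n by (intro nth_less_subdegree_zero) auto
qed

text \<open>From \<open>exp (m*h)\<close>, the sum of \<open>m^j h^j/j!\<close>: this is the
  coefficient of \<open>m^j x^b\<close> in the expansion that defines \<open>C6\<close>.\<close>

definition pcoef :: "nat => nat => real" where
 "pcoef b j = Re (fps_nth (Afps*Hfps^j) b)/fact j"

lemma Re_of_real_mult: "Re (of_real r*z) = r * Re z" by simp

text \<open>Since \<open>Hfps^j\<close> starts at order \<open>j*(k+1)\<close>, only finitely many
  \<open>j\<close> contribute to each coefficient, which is therefore a polynomial in
  \<open>m\<close>.\<close>

lemma expansion_fps_nth:
 "Re (fps_nth (Afps*(fps_exp (of_nat m) oo Hfps)) b) = (\<Sum>j\<le>b. pcoef b j*real m^j)"
proof -
 have "fps_nth (Afps*(fps_exp (of_nat m) oo Hfps)) b = (\<Sum>j\<le>b. of_real (real m^j/fact j)*fps_nth (Afps*Hfps^j) b)"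
 proof -
  have "fps_nth (Afps*(fps_exp (of_nat m) oo Hfps)) b
    = (\<Sum>i=0..b. fps_nth Afps i*(\<Sum>j=0..b - i. of_nat m^j/fact j*fps_nth (Hfps^j) (b - i)))"
   by (simp add: fps_mult_nth fps_compose_nth)
  also have "... = (\<Sum>i=0..b. \<Sum>j=0..b. fps_nth Afps i*(of_nat m^j/fact j*fps_nth (Hfps^j) (b - i)))"
  proof (intro sum.cong refl)
   fix i assume i: "i \<in> {0..b}"
   have "fps_nth (Hfps^j) (b - i) = 0" if "j > b - i" for j
    using that k by (intro Hfps_power_nth_0) (auto intro: less_le_trans)
   hence "(\<Sum>j=0..b - i. of_nat m^j/fact j*fps_nth (Hfps^j) (b - i)) = (\<Sum>j=0..b. of_nat m^j/fact j*fps_nth (Hfps^j) (b - i))"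
    by (intro sum.mono_neutral_left) auto
   thus "fps_nth Afps i*(\<Sum>j=0..b - i. of_nat m^j/fact j*fps_nth (Hfps^j) (b - i)) = (\<Sum>j=0..b. fps_nth Afps i*(of_nat m^j/fact j*fps_nth (Hfps^j) (b - i)))"
    by (simp only: sum_distrib_left)
  qed
  also have "... = (\<Sum>j=0..b. \<Sum>i=0..b. fps_nth Afps i*(of_nat m^j/fact j*fps_nth (Hfps^j) (b - i)))"
   by (rule sum.swap)
  also have "... = (\<Sum>j\<le>b. of_real (real m^j/fact j)*fps_nth (Afps*Hfps^j) b)"
   by (simp add: fps_mult_nth sum_distrib_left atLeast0AtMost mult_ac)
  finally show ?thesis .
 qed
 hence "Re (fps_nth (Afps*(fps_exp (of_nat m) oo Hfps)) b) = (\<Sum>j\<le>b. real m^j/fact j * Re (fps_nth (Afps*Hfps^j) b))"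
  by (simp only: Re_sum Re_of_real_mult)
 thus ?thesis by (simp add: pcoef_def mult.commute)
qed

end

text \<open>Uniqueness from a right neighbourhood only: once the first \<open>n\<close> differences
  vanish, divide by \<open>x^n\<close> and let \<open>x\<close> tend to 0 from the right.\<close>

lemma powser_at_right_unique:
 fixes c c' :: "nat => real"
 assumes "\<forall>\<^sub>F x in at_right 0. (%b. c b*x^b) sums f x"
  and "\<forall>\<^sub>F x in at_right 0. (%b. c' b*x^b) sums f x"
 shows "c = c'"
proof -
 define e where "e b = c b - c' b" for b
 have "\<forall>\<^sub>F x in at_right (0::real). (%b. e b*x^b) sums 0"
  using assms
 proof eventually_elim
  case (elim x)
  show ?case using sums_diff[OF elim] by (simp add: e_def algebra_simps)
 qed
 then obtain x0 where x0: "x0 > 0" "!!x. 0 < x ==> x < x0 ==> (%b. e b*x^b) sums 0"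
  by (auto simp: eventually_at_right_field)
 define E where "E = Abs_fps e"
 define r where "r = x0/2"
 have r: "0 < r" "r < x0" using x0 by (auto simp: r_def)
 have sm: "summable (%n. e n*x^n)" if "norm x < r" for x
  using powser_inside[of e r x] sums_summable[OF x0(2)[OF r]] that r by simp
 have "e n = 0" for n
 proof (induction n rule: less_induct)
  case (less n)
  define d where "d i = e (i + n)" for i
  have sd: "(%i. d i*x^i) sums 0" if "0 < x" "x < x0" for x
  proof -
   have "(%i. e (i + n)*x^(i + n)) sums (0 - (\<Sum>i<n. e i*x^i))"
    by (rule sums_split_initial_segment[OF x0(2)[OF that]])
   also have "(\<Sum>i<n. e i*x^i) = 0" using less by (intro sum.neutral) auto
   finally have "(%i. e (i + n)*x^(i + n)*inverse (x^n)) sums (0*inverse (x^n))"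
    by (intro sums_mult2) simp
   moreover have "e (i + n)*x^(i + n)*inverse (x^n) = d i*x^i" for i
    using that by (simp add: d_def power_add field_simps)
   ultimately show ?thesis by simp
  qed
  have sdr: "summable (%i. d i*r^i)" using sums_summable[OF sd[OF r]] .
  have sdx: "summable (%i. d i*x^i)" if "norm x < r" for x
   using powser_inside[OF sdr, of x] that r by simp
  let ?g = "%x. \<Sum>i. d i*x^i"
  have "isCont ?g 0" using isCont_powser[OF sdr, of 0] r by simp
  hence l1: "(?g ---> ?g 0) (at_right 0)"
   unfolding isCont_def filterlim_at_split by blast
  have "?g x = 0" if "0 < x" "x < x0" for x
   using sums_unique[OF sd[OF that]] by simp
  hence "\<forall>\<^sub>F x in at_right 0. ?g x = 0"
   unfolding eventually_at_right_field using x0(1) by blast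
  hence l2: "(?g ---> 0) (at_right 0)" by (rule tendsto_eventually)
  have "?g 0 = 0" by (rule tendsto_unique[OF trivial_limit_at_right_real l1 l2])
  moreover have "?g 0 = d 0" by (rule powser_zero)
  ultimately show ?case by (simp add: d_def)
 qed
 thus ?thesis by (auto simp: e_def fun_eq_iff)
qed

lemma exp_trunc_of_real: "exp_trunc k (complex_of_real x) = of_real (exp_trunc k x)"
 by (simp add: exp_trunc_def)

definition hr :: "nat => real => real" where "hr k x = x^k/fact k + ln (Qk k x)"

context
 fixes k :: nat
 assumes k: "k >= 1"
begin

lemma Qc_of_real: "Qc k (of_real x) = of_real (Qk k x)"
 unfolding Qc_def[OF k] Qk_def exp_trunc_of_real by (simp add: exp_of_real[symmetric])

lemma hc_of_real: "0 <= x ==> hc k (of_real x) = of_real (hr k x)"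
 unfolding hc_def[OF k] hr_def Qc_of_real using Qk_pos[OF k, of x] by (simp add: Ln_of_real)

lemma Qk_power_eq: "0 <= x ==> Qk k x^d = exp (- (real d*x^k/fact k))*exp (real d*hr k x)"
proof -
 assume x: "0 <= x"
 have "Qk k x^d = exp (real d*ln (Qk k x))" using Qk_pos[OF k x] by (simp add: exp_of_nat_mult)
 also have "real d*ln (Qk k x) = - (real d*x^k/fact k) + real d*hr k x"
  by (simp add: hr_def algebra_simps)
 finally show ?thesis by (simp add: exp_add[symmetric])
qed

definition ppoly :: "nat => real poly" where "ppoly b = (\<Sum>j\<le>b. monom (pcoef k b j) j)"

lemma poly_ppoly: "poly (ppoly b) (real m) = Re (fps_nth (Afps k*(fps_exp (of_nat m) oo Hfps k)) b)"
 unfolding expansion_fps_nth[OF k] ppoly_def by (simp add: poly_sum poly_monom)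

lemma expansion_sums:
 "\<forall>\<^sub>F x in at_right 0. (%b. poly (ppoly b) (real m)*x^b) sums
   (exp (- x)/(2*Gamma_Q (real k) x - 1)*(exp (x^k/fact k)*Gamma_Q (real k) x)^m)"
proof -
 let ?F = "Afps k*(fps_exp (of_nat m) oo Hfps k)"
 let ?f = "%z. (exp (- z)*inverse (2*Qc k z - 1))*exp (of_nat m*hc k z)"
 have S0: "fps_nth (2*(Sfps k*fps_exp (- 1)) - 1) 0 ~= 0"
  using k by (simp add: Sfps_nth[OF k] numeral_fps_const)
 have c: "((%z. exp (of_nat m*z)) \<circ> hc k) has_fps_expansion (fps_exp (of_nat m) oo Hfps k)"
  by (rule has_fps_expansion_compose[OF has_fps_expansion_exp hc_has_fps[OF k]]) (rule Hfps_nth_0[OF k], simp)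
 have "?f has_fps_expansion ?F"
  unfolding Afps_def[OF k]
  by (intro has_fps_expansion_mult has_fps_expansion_exp_neg1 has_fps_expansion_inverse has_fps_expansion_diff
    has_fps_expansion_1 has_fps_expansion_numeral Qc_has_fps[OF k] S0 c[unfolded comp_def])
 hence rad: "fps_conv_radius ?F > 0" and ev: "\<forall>\<^sub>F z in nhds 0. eval_fps ?F z = ?f z"
  by (auto simp: has_fps_expansion_def)
 have "\<forall>\<^sub>F z in nhds 0. z \<in> eball 0 (fps_conv_radius ?F)"
  using rad by (intro eventually_nhds_in_open) (auto simp: zero_ereal_def)
 with ev have "\<forall>\<^sub>F z in nhds 0. (%b. fps_nth ?F b*z^b) sums ?f z"
 proof eventually_elim
  case (elim z)
  thus ?case using sums_eval_fps[of z ?F] by (simp add: in_eball_iff)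
 qed
 moreover have "filterlim (%x. complex_of_real x) (nhds 0) (at_right 0)"
  using tendsto_of_real[OF tendsto_ident_at[of 0 "{0<..}"]] by simp
 ultimately have "\<forall>\<^sub>F x in at_right 0. (%b. fps_nth ?F b * of_real x^b) sums ?f (of_real x)"
  by (rule eventually_compose_filterlim)
 moreover have "\<forall>\<^sub>F x in at_right (0::real). 0 < x" by (simp add: eventually_at_right_less)
 ultimately show ?thesis
 proof eventually_elim
  case (elim x)
  have x: "0 <= x" using elim by simp
  have "(%b. Re (fps_nth ?F b * of_real x^b)) sums Re (?f (of_real x))"
   by (rule sums_Re[OF elim(1)])
  moreover have "Re (fps_nth ?F b * of_real x^b) = poly (ppoly b) (real m)*x^b" for b
   unfolding poly_ppoly by (simp add: of_real_power[symmetric] del: of_real_power)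
  moreover have "?f (of_real x) = of_real (exp (- x)/(2*Qk k x - 1)*(exp (x^k/fact k)*Qk k x)^m)"
  proof -
   have "exp (real m*hr k x) = (exp (x^k/fact k)*Qk k x)^m"
    using Qk_pos[OF k x] by (simp add: hr_def exp_of_nat_mult exp_add)
   hence e: "exp (of_nat m*hc k (of_real x)) = of_real ((exp (x^k/fact k)*Qk k x)^m)"
    unfolding hc_of_real[OF x] by (metis exp_of_real of_real_mult of_real_of_nat_eq)
   have e2: "exp (- complex_of_real x) = of_real (exp (- x))" by (simp add: exp_of_real[symmetric])
   show ?thesis unfolding e e2 Qc_of_real by (simp add: divide_inverse)
  qed
  ultimately show ?case using Gamma_Q_eq_Qk[OF k, of x] elim by (simp del: of_real_mult of_real_power)
 qed
qed

text \<open>For every natural \<open>m\<close> the coefficients are unique by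
  \<open>powser_at_right_unique\<close>, and polynomials agreeing at all naturals are equal; so the
  definite description is met by \<open>ppoly\<close>.\<close>

lemma expansion_coeffs_eq: "expansion_coeffs k = ppoly"
 unfolding expansion_coeffs_def
proof (rule the_equality)
 show "\<forall>m. \<forall>\<^sub>F x in at_right 0. (%b. poly (ppoly b) (real m)*x^b) sums
   (exp (- x)/(2*Gamma_Q (real k) x - 1)*(exp (x^k/fact k)*Gamma_Q (real k) x)^m)"
  using expansion_sums by blast
 fix p :: "nat => real poly"
 assume p: "\<forall>m. \<forall>\<^sub>F x in at_right 0. (%b. poly (p b) (real m)*x^b) sums
   (exp (- x)/(2*Gamma_Q (real k) x - 1)*(exp (x^k/fact k)*Gamma_Q (real k) x)^m)"
 have "(%b. poly (p b) (real m)) = (%b. poly (ppoly b) (real m))" for m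
  by (rule powser_at_right_unique[OF p[rule_format] expansion_sums])
 hence eq: "poly (p b) (real m) = poly (ppoly b) (real m)" for b m by (rule fun_cong)
 show "p = ppoly"
 proof
  fix b
  have "infinite (range real)" by (rule range_inj_infinite) (auto simp: inj_on_def)
  hence "infinite {x. poly (p b - ppoly b) x = 0}"
   using eq by (rule_tac infinite_super[of "range real"]) auto
  hence "p b - ppoly b = 0" using poly_roots_finite by blast
  thus "p b = ppoly b" by simp
 qed
qed

lemma C6_eq: "C6 k j b = (if j <= b then pcoef k b j else 0)"
 unfolding C6_def expansion_coeffs_eq ppoly_def by (simp add: coeff_sum coeff_monom)

text \<open>The coefficients that record probabilities lead to: prefactor \<open>exp (- x)\<close>
  alone, indexed by the offset \<open>i\<close> from order \<open>j*k\<close>.\<close>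

definition kappa :: "nat => nat => real" where
 "kappa j i = Re (fps_nth (fps_exp (- 1)*Hfps k^j) (j*k + i))/fact j"

lemma kappa_0: "kappa 0 i = (- 1)^i/fact i"
proof -
 have "fps_nth (fps_exp (- 1) :: complex fps) i = of_real ((- 1)^i/fact i)" by simp
 thus ?thesis unfolding kappa_def by (simp only: Re_complex_of_real power_0 mult_1_right mult_0 add_0) simp
qed

lemma fps_mult_Hfps_power_nth_0:
 assumes "!!i. i < l ==> fps_nth F i = 0" "b < l + j*(k + 1)"
 shows "fps_nth (F*Hfps k^j) b = 0"
 unfolding fps_mult_nth
proof (rule sum.neutral, rule ballI)
 fix i assume "i \<in> {0..b}"
 thus "fps_nth F i*fps_nth (Hfps k^j) (b - i) = 0"
  using assms Hfps_power_nth_0[OF k, of "b - i" j] by (cases "i < l") auto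
qed

lemma kappa_small: "i < j ==> kappa j i = 0"
 unfolding kappa_def by (subst fps_mult_Hfps_power_nth_0[of 0]) auto

text \<open>\<open>1/(2Q - 1)\<close> is 1 plus terms of order at least \<open>k\<close>, while
  \<open>Hfps^j\<close> starts at order \<open>j*(k+1)\<close>. The two prefactors thus give the
  same coefficients below order \<open>jk + j + k\<close>, which exceeds \<open>jk + i\<close> for
  \<open>j >= 1\<close> and \<open>i <= k\<close>.\<close>

lemma kappa_eq_C6:
 assumes "1 <= j" "i <= k"
 shows "kappa j i = C6 k j (j*k + i)"
proof -
 have kj: "j <= j*k + i" using k by (simp add: trans_le_add1)
 let ?G = "2*(Sfps k*fps_exp (- 1)) - 1 :: complex fps"
 have G0: "fps_nth ?G 0 ~= 0"
  using k by (simp add: Sfps_nth[OF k] numeral_fps_const)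
 define R where "R = fps_exp 1 - Sfps k"
 have R: "fps_nth R i = 0" if "i < k" for i using that by (simp add: R_def Sfps_nth[OF k])
 have ee: "fps_exp 1*fps_exp (- 1) = (1 :: complex fps)"
  by (metis add.right_inverse fps_exp_0 fps_exp_add_mult)
 have "1 - ?G = 2*(fps_exp 1*fps_exp (- 1) - Sfps k*fps_exp (- 1))" by (simp add: ee)
 also have "... = R*(2*fps_exp (- 1))" by (simp add: R_def algebra_simps)
 finally have G1: "1 - ?G = R*(2*fps_exp (- 1))" .
 have "inverse ?G*?G = 1" using G0 by (rule inverse_mult_eq_1)
 hence "inverse ?G - 1 = inverse ?G*(1 - ?G)" by (simp only: right_diff_distrib mult_1_right)
 hence iG: "inverse ?G - 1 = inverse ?G*(R*(2*fps_exp (- 1)))" unfolding G1 .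
 have "Afps k - fps_exp (- 1) = fps_exp (- 1)*(inverse ?G - 1)"
  by (simp only: Afps_def[OF k] right_diff_distrib mult_1_right)
 also have "... = R*(fps_exp (- 1)*inverse ?G*(2*fps_exp (- 1)))"
  unfolding iG by (simp only: mult_ac)
 finally have "Afps k - fps_exp (- 1) = R*(fps_exp (- 1)*inverse ?G*(2*fps_exp (- 1)))" .
 hence D: "fps_nth (Afps k - fps_exp (- 1)) n = 0" if "n < k" for n
  using that R by (simp add: fps_mult_nth)
 have "fps_nth ((Afps k - fps_exp (- 1))*Hfps k^j) (j*k + i) = 0"
 proof (rule fps_mult_Hfps_power_nth_0[OF D])
  show "j*k + i < k + j*(k + 1)" using assms by simp
 qed simp
 hence "fps_nth (fps_exp (- 1)*Hfps k^j) (j*k + i) = fps_nth (Afps k*Hfps k^j) (j*k + i)"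
  by (simp add: left_diff_distrib)
 thus ?thesis using kj by (simp add: kappa_def C6_eq pcoef_def[OF k])
qed

lemma hr_bound:
 obtains C \<delta> where "C >= 0" "\<delta> > 0" "!!x. 0 <= x ==> x <= \<delta> ==> \<bar>hr k x\<bar> <= C*x^(k + 1)"
proof -
 obtain C \<delta> where C: "C >= 0" "\<delta> > 0" "!!z. norm z <= \<delta> ==> norm (hc k z - (\<Sum>i<k+1. fps_nth (Hfps k) i*z^i)) <= C*norm z^(k + 1)"
  using has_fps_expansion_remainder[OF hc_has_fps[OF k], of "k+1"] by blast
 have z: "(\<Sum>i<k+1. fps_nth (Hfps k) i*z^i) = 0" for z
  using Hfps_nth_0[OF k] by (intro sum.neutral) auto
 have "\<bar>hr k x\<bar> <= C*x^(k + 1)" if x: "0 <= x" "x <= \<delta>" for x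
  using C(3)[of "of_real x"] x unfolding z hc_of_real[OF x(1)] by simp
 thus thesis using that C by blast
qed

text \<open>All coefficients of order below \<open>j*k\<close> vanish because \<open>Hfps^j\<close>
  starts at \<open>j*(k+1)\<close>; the window of \<open>k + 1\<close> coefficients from
  \<open>j*k\<close> on is the whole Taylor polynomial.\<close>

lemma hr_power_remainder:
 obtains C \<delta> where "C >= 0" "\<delta> > 0" "!!x. 0 <= x ==> x <= \<delta> ==>
  \<bar>exp (- x)*hr k x^j/fact j - (\<Sum>i\<le>k. kappa j i*x^(j*k + i))\<bar> <= C*x^(j*k + k + 1)"
proof -
 let ?F = "fps_exp (- 1)*Hfps k^j"
 have "(%z. exp (- z)*hc k z^j) has_fps_expansion ?F"
  by (intro has_fps_expansion_mult has_fps_expansion_exp_neg1 has_fps_expansion_power hc_has_fps[OF k])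
 then obtain C \<delta> where C: "C >= 0" "\<delta> > 0" "!!z. norm z <= \<delta> ==>
   norm (exp (- z)*hc k z^j - (\<Sum>i<j*k+k+1. fps_nth ?F i*z^i)) <= C*norm z^(j*k + k + 1)"
  using has_fps_expansion_remainder[of _ ?F "j*k + k + 1"] by blast
 have "\<bar>exp (- x)*hr k x^j/fact j - (\<Sum>i\<le>k. kappa j i*x^(j*k + i))\<bar> <= C*x^(j*k + k + 1)"
  if x: "0 <= x" "x <= \<delta>" for x
 proof -
  have "(\<Sum>i<j*k+k+1. fps_nth ?F i*z^i) = (\<Sum>i\<le>k. fps_nth ?F (j*k+i)*z^(j*k+i))" for z
  proof -
   have "(\<Sum>i<j*k+k+1. fps_nth ?F i*z^i) = (\<Sum>i\<in>{j*k..j*k+k}. fps_nth ?F i*z^i)"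
   proof (rule sum.mono_neutral_right)
    show "\<forall>i\<in>{..<j*k + k + 1} - {j*k..j*k + k}. fps_nth ?F i*z^i = 0"
    proof
     fix i assume "i \<in> {..<j*k + k + 1} - {j*k..j*k + k}"
     hence "i < 0 + j*(k + 1)" by auto
     hence "fps_nth ?F i = 0" by (intro fps_mult_Hfps_power_nth_0[of 0]) auto
     thus "fps_nth ?F i*z^i = 0" by simp
    qed
   qed auto
   also have "... = (\<Sum>i\<in>{0..k}. fps_nth ?F (i+j*k)*z^(i+j*k))"
    using sum.shift_bounds_cl_nat_ivl[of "%i. fps_nth ?F i*z^i" 0 "j*k" k] by (simp add: add.commute)
   finally show ?thesis by (simp add: add.commute atLeast0AtMost)
  qed
  hence "norm (exp (- complex_of_real x)*hc k (of_real x)^j - (\<Sum>i\<le>k. fps_nth ?F (j*k+i) * of_real x^(j*k+i))) <= C*x^(j*k + k + 1)"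
   using C(3)[of "of_real x"] x by simp
  moreover have "exp (- complex_of_real x)*hc k (of_real x)^j = of_real (exp (- x)*hr k x^j)"
   unfolding hc_of_real[OF x(1)] by (simp add: exp_of_real[symmetric])
  ultimately have n: "norm (of_real (exp (- x)*hr k x^j) - (\<Sum>i\<le>k. fps_nth ?F (j*k+i) * of_real x^(j*k+i))) <= C*x^(j*k + k + 1)"
   by simp
  have "\<bar>exp (- x)*hr k x^j - (\<Sum>i\<le>k. Re (fps_nth ?F (j*k+i))*x^(j*k+i))\<bar>
    = \<bar>Re (of_real (exp (- x)*hr k x^j) - (\<Sum>i\<le>k. fps_nth ?F (j*k+i) * of_real x^(j*k+i)))\<bar>"
   by (simp add: Re_sum of_real_power[symmetric] del: of_real_power)
  also have "... <= C*x^(j*k + k + 1)" using abs_Re_le_cmod n order_trans by blast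
  finally have m: "\<bar>exp (- x)*hr k x^j - (\<Sum>i\<le>k. Re (fps_nth ?F (j*k+i))*x^(j*k+i))\<bar> <= C*x^(j*k + k + 1)" .
  have "exp (- x)*hr k x^j/fact j - (\<Sum>i\<le>k. kappa j i*x^(j*k + i))
    = (exp (- x)*hr k x^j - (\<Sum>i\<le>k. Re (fps_nth ?F (j*k+i))*x^(j*k+i)))/fact j"
   by (simp add: kappa_def diff_divide_distrib sum_divide_distrib)
  hence "\<bar>exp (- x)*hr k x^j/fact j - (\<Sum>i\<le>k. kappa j i*x^(j*k + i))\<bar>
    = \<bar>exp (- x)*hr k x^j - (\<Sum>i\<le>k. Re (fps_nth ?F (j*k+i))*x^(j*k+i))\<bar>/fact j"
   by simp
  also have "... <= C*x^(j*k + k + 1)/fact j" using m by (intro divide_right_mono) auto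
  also have "... <= C*x^(j*k + k + 1)/1" using C(1) x by (intro divide_left_mono) auto
  finally show ?thesis by simp
 qed
 thus thesis using that C by blast
qed

text \<open>Double expansion of \<open>exp (- x) * exp (d * hr k x)\<close>. On the scale
  \<open>x = d^(-1/k)\<close> the term with indices \<open>j\<close>, \<open>i\<close> has order
  \<open>d^(-i/k)\<close>, so cutting at \<open>i = k\<close> leaves an error of relative order
  \<open>d^(-(k+1)/k)\<close>.\<close>

definition main_term :: "nat => real => real" where
 "main_term d x = (\<Sum>j\<le>k. \<Sum>i\<le>k. kappa j i*real d^j*x^(j*k + i))"

text \<open>Taylor's formula for the exponential at \<open>y = d * hr k x\<close>. Near 0 one has
  \<open>\<bar>y\<bar> <= d*x^k/(2 k!)\<close>, so half of the exponent \<open>- d*x^k/k!\<close>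
  survives in the error bound.\<close>

lemma near_bound:
 obtains C \<delta> where "C >= 0" "\<delta> > 0" "\<delta> <= 1" "!!x d. 0 <= x ==> x <= \<delta> ==>
  \<bar>exp (- x)*Qk k x^d - exp (- (real d*x^k/fact k))*main_term d x\<bar>
   <= C*x^(k + 1)*(1 + real d*x^k)^(k + 1)*exp (- (real d*x^k/(2*fact k)))"
proof -
 obtain Ch \<delta>h where h: "Ch >= 0" "\<delta>h > 0" "!!x. 0 <= x ==> x <= \<delta>h ==> \<bar>hr k x\<bar> <= Ch*x^(k + 1)"
  using hr_bound by blast
 define P where "P j C \<delta> \<longleftrightarrow> C >= 0 & \<delta> > 0 & (\<forall>x. 0 <= x --> x <= \<delta> -->
  \<bar>exp (- x)*hr k x^j/fact j - (\<Sum>i\<le>k. kappa j i*x^(j*k + i))\<bar> <= C*x^(j*k + k + 1))"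
  for j and C \<delta> :: real
 have "\<exists>p. P j (fst p) (snd p)" for j
 proof -
  obtain C \<delta> where "C >= 0" "\<delta> > 0" "!!x. 0 <= x ==> x <= \<delta> ==>
   \<bar>exp (- x)*hr k x^j/fact j - (\<Sum>i\<le>k. kappa j i*x^(j*k + i))\<bar> <= C*x^(j*k + k + 1)"
   using hr_power_remainder[of j] by blast
  hence "P j C \<delta>" unfolding P_def by blast
  thus ?thesis by (intro exI[of _ "(C, \<delta>)"]) simp
 qed
 hence "\<exists>p. \<forall>j. P j (fst (p j)) (snd (p j))" by (intro choice allI)
 then obtain p where p: "!!j. P j (fst (p j)) (snd (p j))" by blast
 define Cj \<delta>j where "Cj j = fst (p j)" and "\<delta>j j = snd (p j)" for j
 have j: "Cj j >= 0" "\<delta>j j > 0" "0 <= x ==> x <= \<delta>j j ==>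
  \<bar>exp (- x)*hr k x^j/fact j - (\<Sum>i\<le>k. kappa j i*x^(j*k + i))\<bar> <= Cj j*x^(j*k + k + 1)" for j x
  using p[of j] unfolding P_def Cj_def \<delta>j_def by blast+
 define b where "b = 1/(2*fact k :: real)"
 have b: "b > 0" by (simp add: b_def)
 \<comment> \<open>The bound \<open>b/(Ch + 1)\<close> makes \<open>Ch*x <= b\<close>, which is what
   gives \<open>\<bar>y\<bar> <= b*u\<close>; the other entries keep \<open>x\<close> in the range
   of all remainder estimates.\<close>
 define \<delta> where "\<delta> = Min (insert 1 (insert \<delta>h (insert (b/(Ch + 1)) (\<delta>j ` {..k}))))"
 have \<delta>: "\<delta> > 0" "\<delta> <= 1" "\<delta> <= \<delta>h" "\<delta> <= b/(Ch + 1)"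
  using j(2) h b by (auto simp: \<delta>_def)
 have \<delta>5: "\<delta> <= \<delta>j i" if "i <= k" for i
  unfolding \<delta>_def by (rule Min_le) (use that in auto)
 define C where "C = Ch^(k + 1) + (\<Sum>j\<le>k. Cj j)"
 have C0: "C >= 0" using h(1) j(1) by (auto simp: C_def intro!: add_nonneg_nonneg sum_nonneg)
 have "\<bar>exp (- x)*Qk k x^d - exp (- (real d*x^k/fact k))*main_term d x\<bar>
   <= C*x^(k + 1)*(1 + real d*x^k)^(k + 1)*exp (- (real d*x^k/(2*fact k)))"
  if x: "0 <= x" "x <= \<delta>" for x and d :: nat
 proof -
  define u where "u = real d*x^k"
  have u: "0 <= u" using x by (simp add: u_def)
  define y where "y = real d*hr k x"
  have "\<bar>y\<bar> = real d*\<bar>hr k x\<bar>" by (simp add: y_def abs_mult)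
  also have "... <= real d*(Ch*x^(k + 1))" using h(3)[of x] x \<delta> by (intro mult_left_mono) auto
  also have "... = Ch*x*u" by (simp add: u_def)
  finally have y1: "\<bar>y\<bar> <= Ch*x*u" .
  have "Ch*x <= (Ch + 1)*(b/(Ch + 1))" using x \<delta> h(1) by (intro mult_mono) auto
  hence "Ch*x <= b" using h(1) by simp
  hence "Ch*x*u <= b*u" using u by (intro mult_right_mono)
  hence y2: "\<bar>y\<bar> <= b*u" using y1 by simp
  obtain t where t: "\<bar>t\<bar> <= \<bar>y\<bar>" "exp y = (\<Sum>j<k+1. y^j/fact j) + exp t/fact (k + 1)*y^(k + 1)"
   using Maclaurin_exp_le[of y "k+1"] by blast
  have r1: "\<bar>exp (- x)*exp y - exp (- x)*(\<Sum>j\<le>k. y^j/fact j)\<bar> <= exp (b*u)*(Ch^(k + 1)*x^(k + 1)*u^(k + 1))"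
  proof -
   have "\<bar>exp (- x)*exp y - exp (- x)*(\<Sum>j\<le>k. y^j/fact j)\<bar> = \<bar>exp (- x)*(exp t/fact (k + 1)*y^(k + 1))\<bar>"
    by (simp add: t(2) lessThan_Suc_atMost algebra_simps)
   also have "... = exp (- x)*(exp t/fact (k + 1))*\<bar>y\<bar>^(k + 1)" by (simp add: abs_mult power_abs)
   also have "... <= 1*(exp (b*u)/1)*(Ch*x*u)^(k + 1)"
    using x t(1) y1 y2 h(1) u fact_ge_1[of "k+1", where 'a=real]
    by (intro mult_mono power_mono frac_le) (auto simp del: fact_Suc)
   finally show ?thesis by (simp only: power_mult_distrib mult_1 div_by_1)
  qed
  have r2: "\<bar>exp (- x)*(\<Sum>j\<le>k. y^j/fact j) - main_term d x\<bar> <= (\<Sum>j\<le>k. Cj j)*x^(k + 1)*(1 + u)^(k + 1)"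
  proof -
   have "exp (- x)*(\<Sum>j\<le>k. y^j/fact j) - main_term d x =
    (\<Sum>j\<le>k. real d^j*(exp (- x)*hr k x^j/fact j - (\<Sum>i\<le>k. kappa j i*x^(j*k + i))))"
    by (simp add: main_term_def sum_distrib_left sum_subtractf[symmetric] y_def power_mult_distrib algebra_simps)
   also have "\<bar>...\<bar> <= (\<Sum>j\<le>k. Cj j*(x^(k + 1)*(1 + u)^(k + 1)))"
   proof (rule order_trans[OF sum_abs], rule sum_mono)
    fix i assume i: "i \<in> {..k}"
    have "\<bar>real d^i*(exp (- x)*hr k x^i/fact i - (\<Sum>l\<le>k. kappa i l*x^(i*k + l)))\<bar>
      = real d^i*\<bar>exp (- x)*hr k x^i/fact i - (\<Sum>l\<le>k. kappa i l*x^(i*k + l))\<bar>"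
     by (simp add: abs_mult)
    also have "... <= real d^i*(Cj i*x^(i*k + k + 1))"
     using j(3)[of x i] x \<delta>5[of i] i by (intro mult_left_mono) auto
    also have "... = Cj i*(x^(k + 1)*u^i)"
    proof -
     have "x^(i*k + k + 1) = (x^k)^i*x^(k + 1)"
      by (simp add: power_mult[symmetric] power_add mult.commute mult_ac)
     thus ?thesis by (simp only: u_def power_mult_distrib mult_ac)
    qed
    also have "... <= Cj i*(x^(k + 1)*(1 + u)^(k + 1))"
    proof -
     have "u^i <= (1 + u)^i" using u by (intro power_mono) auto
     also have "... <= (1 + u)^(k + 1)" using u i by (intro power_increasing) auto
     finally show ?thesis using j(1)[of i] x by (intro mult_left_mono) auto
    qed
    finally show "\<bar>real d^i*(exp (- x)*hr k x^i/fact i - (\<Sum>l\<le>k. kappa i l*x^(i*k + l)))\<bar> <= Cj i*(x^(k + 1)*(1 + u)^(k + 1))" .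
   qed
   also have "... = (\<Sum>j\<le>k. Cj j)*x^(k + 1)*(1 + u)^(k + 1)" by (simp add: sum_distrib_right mult.assoc)
   finally show ?thesis .
  qed
  have "\<bar>exp (- x)*exp y - main_term d x\<bar> <= exp (b*u)*(Ch^(k + 1)*x^(k + 1)*u^(k + 1)) + (\<Sum>j\<le>k. Cj j)*x^(k + 1)*(1 + u)^(k + 1)"
   using r1 r2 by linarith
  also have "... <= exp (b*u)*(Ch^(k + 1)*x^(k + 1)*(1 + u)^(k + 1)) + exp (b*u)*((\<Sum>j\<le>k. Cj j)*x^(k + 1)*(1 + u)^(k + 1))"
  proof (rule add_mono)
   show "exp (b*u)*(Ch^(k + 1)*x^(k + 1)*u^(k + 1)) <= exp (b*u)*(Ch^(k + 1)*x^(k + 1)*(1 + u)^(k + 1))"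
    using u h(1) x by (intro mult_left_mono power_mono) auto
   have "1*((\<Sum>j\<le>k. Cj j)*x^(k + 1)*(1 + u)^(k + 1)) <= exp (b*u)*((\<Sum>j\<le>k. Cj j)*x^(k + 1)*(1 + u)^(k + 1))"
    using u b j(1) x by (intro mult_right_mono) (auto intro!: mult_nonneg_nonneg sum_nonneg)
   thus "(\<Sum>j\<le>k. Cj j)*x^(k + 1)*(1 + u)^(k + 1) <= exp (b*u)*((\<Sum>j\<le>k. Cj j)*x^(k + 1)*(1 + u)^(k + 1))" by simp
  qed
  also have "... = C*x^(k + 1)*(1 + u)^(k + 1)*exp (b*u)" by (simp add: C_def algebra_simps)
  finally have r3: "\<bar>exp (- x)*exp y - main_term d x\<bar> <= C*x^(k + 1)*(1 + u)^(k + 1)*exp (b*u)" .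
  have bu: "u/fact k = 2*(b*u)" by (simp add: b_def)
  have "exp (- x)*Qk k x^d - exp (- (real d*x^k/fact k))*main_term d x = exp (- (u/fact k))*(exp (- x)*exp y - main_term d x)"
   unfolding Qk_power_eq[OF x(1)] by (simp add: u_def y_def algebra_simps)
  hence "\<bar>exp (- x)*Qk k x^d - exp (- (real d*x^k/fact k))*main_term d x\<bar> = exp (- (u/fact k))*\<bar>exp (- x)*exp y - main_term d x\<bar>"
   by (simp add: abs_mult)
  also have "... <= exp (- (u/fact k))*(C*x^(k + 1)*(1 + u)^(k + 1)*exp (b*u))"
   using r3 by (intro mult_left_mono) auto
  also have "... = C*x^(k + 1)*(1 + u)^(k + 1)*(exp (- (u/fact k))*exp (b*u))" by (simp only: mult_ac)
  also have "exp (- (u/fact k))*exp (b*u) = exp (- (u/(2*fact k)))"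
   unfolding bu by (simp add: exp_add[symmetric] b_def)
  finally show ?thesis by (simp add: u_def)
 qed
 thus thesis using that C0 \<delta>(1,2) by blast
qed

text \<open>Away from 0 nothing is compared: the two terms are each exponentially small on the scale
  \<open>d^(-1/k)\<close>, and powers of \<open>x/\<delta> >= 1\<close> supply the factor
  \<open>x^(k+1)\<close>.\<close>

lemma global_bound:
 obtains C c where "C >= 0" "c > 0" "!!x d. 0 <= x ==> d >= 1 ==>
  \<bar>exp (- x)*Qk k x^d - exp (- (real d*x^k/fact k))*main_term d x\<bar>
   <= C*(x^(k + 1)*(1 + real d*x^k)^(k + 1)*exp (- (c*(real d powr (1/real k)*x))))"
proof -
 obtain C \<delta> where n: "C >= 0" "\<delta> > 0" "\<delta> <= 1" "!!x d. 0 <= x ==> x <= \<delta> ==>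
  \<bar>exp (- x)*Qk k x^d - exp (- (real d*x^k/fact k))*main_term d x\<bar>
   <= C*x^(k + 1)*(1 + real d*x^k)^(k + 1)*exp (- (real d*x^k/(2*fact k)))"
  using near_bound by blast
 obtain c1 where c1: "c1 > 0" "!!x d. 0 <= x ==> d >= 1 ==> Qk k x^d <= exp (c1 - c1*(real d powr (1/real k)*x))"
  using Qk_power_bound[OF k] by blast
 define b where "b = 1/(2*fact k :: real)"
 have b: "b > 0" by (simp add: b_def)
 define c where "c = min b c1"
 have c: "c > 0" "c <= b" "c <= c1" using b c1 by (auto simp: c_def)
 define K where "K = (\<Sum>j\<le>k. \<Sum>i\<le>k. \<bar>kappa j i\<bar>)"
 have K: "K >= 0" by (auto simp: K_def intro!: sum_nonneg)
 define D where "D = 1/\<delta>^(k + 1)"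
 have "\<delta>^(k + 1) <= 1" "\<delta>^(k + 1) > 0" using n by (auto intro!: power_le_one simp del: power_Suc)
 hence D: "D >= 1" by (simp add: D_def)
 define C' where "C' = (C + D*(1 + K))*exp (b + c1)"
 have C': "C' >= 0" using n D K by (simp add: C'_def)
 have "\<bar>exp (- x)*Qk k x^d - exp (- (real d*x^k/fact k))*main_term d x\<bar>
   <= C'*(x^(k + 1)*(1 + real d*x^k)^(k + 1)*exp (- (c*(real d powr (1/real k)*x))))"
  if x: "0 <= x" and d: "d >= 1" for x and d :: nat
 proof -
  define u where "u = real d*x^k"
  define s where "s = real d powr (1/real k)*x"
  have u: "0 <= u" using x by (simp add: u_def)
  have s: "0 <= s" using x by (simp add: s_def)
  have su: "s <= 1 + u" using le_one_plus_power[OF s k] root_scale(1)[OF k d x] by (simp add: s_def u_def)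
  have e1: "exp (- (b*u)) <= exp (b + c1)*exp (- (c * s))"
  proof -
   have "c * s <= b*(1 + u)" using su c b s u by (intro mult_mono) auto
   thus ?thesis using c1 by (simp add: exp_add[symmetric] algebra_simps)
  qed
  have e2: "exp (c1 - c1 * s) <= exp (b + c1)*exp (- (c * s))"
  proof -
   have "c * s <= c1 * s" using c s by (intro mult_right_mono) auto
   thus ?thesis using b by (simp add: exp_add[symmetric])
  qed
  define U where "U = (1 + u)^(k + 1)"
  have U: "U >= 1" using u by (simp add: U_def one_le_power del: power_Suc)
  show ?thesis
  proof (cases "x <= \<delta>")
   case True
   have "\<bar>exp (- x)*Qk k x^d - exp (- (real d*x^k/fact k))*main_term d x\<bar> <= C*x^(k + 1)*U*exp (- (b*u))"
    using n(4)[OF x True, of d] by (simp add: u_def U_def b_def)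
   also have "... <= C*x^(k + 1)*U*(exp (b + c1)*exp (- (c * s)))"
    using e1 n(1) x U by (intro mult_left_mono) auto
   also have "... = (C*exp (b + c1))*(x^(k + 1)*U*exp (- (c * s)))" by (simp only: mult_ac)
   also have "... <= C'*(x^(k + 1)*U*exp (- (c * s)))"
    using D K x U by (intro mult_right_mono) (auto simp: C'_def)
   finally show ?thesis by (simp add: U_def u_def s_def)
  next
   case False
   \<comment> \<open>Missing powers of \<open>x\<close> are paid for by \<open>\<delta> < x\<close>;
     hence the constant \<open>D = 1/\<delta>^(k+1)\<close>.\<close>
   have xi: "x^i <= D*x^(k + 1)" if "i <= k + 1" for i
   proof -
    have "x^i*\<delta>^(k + 1) <= x^i*\<delta>^(k + 1 - i)"
     using n x by (intro mult_left_mono power_decreasing) auto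
    also have "... <= x^i*x^(k + 1 - i)"
     using n x False by (intro mult_left_mono power_mono) auto
    also have "... = x^(k + 1)" using that by (simp add: power_add[symmetric] del: power_Suc)
    finally show ?thesis using n by (simp add: D_def field_simps)
   qed
   have q: "\<bar>exp (- x)*Qk k x^d\<bar> <= D*(x^(k + 1)*U*(exp (b + c1)*exp (- (c * s))))"
   proof -
    have "\<bar>exp (- x)*Qk k x^d\<bar> = exp (- x)*Qk k x^d" using Qk_nonneg[OF x] by simp
    also have "... <= 1*exp (c1 - c1 * s)" using c1(2)[OF x d] x Qk_nonneg[OF x] by (intro mult_mono) (auto simp: s_def)
    also have "... <= 1*(exp (b + c1)*exp (- (c * s)))" using e2 by simp
    also have "... <= (D*x^(k + 1)*U)*(exp (b + c1)*exp (- (c * s)))"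
    proof (rule mult_right_mono)
     have "1*1 <= (D*x^(k + 1))*U" using xi[of 0] U by (intro mult_mono) auto
     thus "1 <= D*x^(k + 1)*U" by simp
    qed simp
    finally show ?thesis by (simp only: mult_ac)
   qed
   have mt: "\<bar>main_term d x\<bar> <= K*(D*x^(k + 1)*U)"
   proof -
    have "\<bar>main_term d x\<bar> <= (\<Sum>j\<le>k. \<Sum>i\<le>k. \<bar>kappa j i\<bar>*(D*x^(k + 1)*U))"
     unfolding main_term_def
    proof (rule order_trans[OF sum_abs], rule sum_mono, rule order_trans[OF sum_abs], rule sum_mono)
     fix j i assume ji: "j \<in> {..k}" "i \<in> {..k}"
     have "\<bar>kappa j i*real d^j*x^(j*k + i)\<bar> = \<bar>kappa j i\<bar>*(u^j*x^i)"
      using x by (simp add: abs_mult u_def power_mult_distrib power_add power_mult[symmetric] mult_ac)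
     also have "... <= \<bar>kappa j i\<bar>*(U*(D*x^(k + 1)))"
     proof (rule mult_left_mono, rule mult_mono)
      have "u^j <= (1 + u)^j" using u by (intro power_mono) auto
      also have "... <= U" unfolding U_def using u ji by (intro power_increasing) auto
      finally show "u^j <= U" .
     qed (use xi ji U x in auto)
     finally show "\<bar>kappa j i*real d^j*x^(j*k + i)\<bar> <= \<bar>kappa j i\<bar>*(D*x^(k + 1)*U)" by (simp add: mult_ac)
    qed
    thus ?thesis by (simp add: K_def sum_distrib_right)
   qed
   have m: "\<bar>exp (- (real d*x^k/fact k))*main_term d x\<bar> <= K*D*(x^(k + 1)*U*(exp (b + c1)*exp (- (c * s))))"
   proof -
    have "exp (- (u/fact k)) <= exp (- (b*u))" using u by (simp add: b_def field_simps)
    also note e1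
    finally have "exp (- (u/fact k)) <= exp (b + c1)*exp (- (c * s))" .
    hence "exp (- (u/fact k))*\<bar>main_term d x\<bar> <= (exp (b + c1)*exp (- (c * s)))*(K*(D*x^(k + 1)*U))"
     using mt by (intro mult_mono) auto
    thus ?thesis by (simp add: abs_mult u_def mult_ac)
   qed
   let ?M = "x^(k + 1)*U*(exp (b + c1)*exp (- (c * s)))"
   have M: "?M >= 0" using x U by simp
   have "\<bar>exp (- x)*Qk k x^d - exp (- (real d*x^k/fact k))*main_term d x\<bar> <= D*?M + K*D*?M"
    using q m by linarith
   also have "... = (D*(1 + K))*?M" by (simp only: distrib_left distrib_right mult_ac mult_1_right)
   also have "... <= (C + D*(1 + K))*?M" using M n(1) by (intro mult_right_mono) auto
   also have "... = C'*(x^(k + 1)*U*exp (- (c * s)))" by (simp only: C'_def mult_ac)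
   finally show ?thesis by (simp add: U_def u_def s_def)
  qed
 qed
 thus thesis using that C' c(1) by blast
qed

end

section \<open>Laplace-type integrals\<close>

lemma set_integral_scale:
 fixes f :: "real => real"
 assumes s: "s > 0" and f [measurable]: "f \<in> borel_measurable borel"
 shows "pos_integrable (%x. f (s*x)) \<longleftrightarrow> pos_integrable f"
  and "(PINT x. f (s*x)) = (PINT y. f y)/s"
proof -
 have img: "(%x. s*x) ` {0<..} = {0<..}"
 proof (intro equalityI subsetI)
  fix y :: real assume "y \<in> {0<..}"
  thus "y \<in> (%x. s*x) ` {0<..}" using s by (intro image_eqI[of _ _ "y/s"]) auto
 qed (use s in auto)
 have der: "((%x. s*x) has_real_derivative s) (at x)" for x
  by (auto intro!: derivative_eq_intros)
 note cv = change_of_variables_lborel[of "{0<..}" "%x. s*x" "%_. s" f, unfolded img]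
 have 1: "pos_integrable (%x. \<bar>s\<bar> *\<^sub>R f (s*x)) \<longleftrightarrow> pos_integrable f"
  by (rule cv(1)) (use s der in \<open>auto simp: set_borel_measurable_def inj_on_def\<close>)
 have 2: "(PINT x. \<bar>s\<bar> *\<^sub>R f (s*x)) = (PINT y. f y)"
  by (rule cv(2)) (use s der in \<open>auto simp: set_borel_measurable_def inj_on_def\<close>)
 show "pos_integrable (%x. f (s*x)) \<longleftrightarrow> pos_integrable f"
  using 1 s by simp
 show "(PINT x. f (s*x)) = (PINT y. f y)/s"
  using 2 s by (simp add: field_simps)
qed

lemma set_integrable_exp: "b > 0 ==> pos_integrable (%x::real. exp (- (b*x)))"
proof -
 assume b: "b > 0"
 have "pos_integrable (%t::real. exp (- t)*t powr (1 - 1))"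
  by (rule Gamma_integrand_sub[of 1]) auto
 also have "?this \<longleftrightarrow> pos_integrable (%t::real. exp (- t))"
  by (rule set_integrable_cong) auto
 finally show ?thesis using set_integral_scale(1)[OF b, of "%t. exp (- t)"] by simp
qed

lemma power_le_exp:
 assumes "b > 0" "0 <= (y::real)"
 shows "(1 + y)^n <= (fact n/b^n*exp b)*exp (b*y)"
proof -
 have "(b*(1 + y))^n/fact n <= exp (b*(1 + y))"
  using assms by (intro power_div_fact_le_exp) auto
 moreover have "(b*(1 + y))^n = b^n*(1 + y)^n" by (rule power_mult_distrib)
 moreover have "exp (b*(1 + y)) = exp b*exp (b*y)" by (simp add: exp_add[symmetric] algebra_simps)
 ultimately have *: "b^n*(1 + y)^n/fact n <= exp b*exp (b*y)" by simp
 define z where "z = (1 + y)^n"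
 show ?thesis using * assms unfolding z_def[symmetric] by (simp add: field_simps)
qed

lemma poly_exp_integrable:
 assumes c: "c > 0" and k: "k >= 1"
 shows "pos_integrable (%y::real. y^q*(1 + y^k)^N*exp (- (c*y)))"
proof (rule set_integrable_bound)
 define b where "b = c/2"
 have b: "b > 0" using c by (simp add: b_def)
 define n where "n = q + k*N"
 show "pos_integrable (%y::real. (fact n/b^n*exp b)*exp (- (b*y)))"
  using set_integrable_exp[OF b] by simp
 show "AE y::real in lborel. y \<in> {0<..} --> norm (y^q*(1 + y^k)^N*exp (- (c*y))) <= norm ((fact n/b^n*exp b)*exp (- (b*y)))"
 proof (intro AE_I2 impI)
  fix y :: real assume "y \<in> {0<..}"
  hence y: "0 < y" by simp
  have "y^q*(1 + y^k)^N <= (1 + y)^q*((1 + y)^k)^N"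
  proof (intro mult_mono power_mono)
   show "1 + y^k <= (1 + y)^k"
    using k
   proof (induction k rule: nat_induct_at_least)
    case (Suc k)
    have "1 + y^Suc k <= (1 + y)*(1 + y^k)" using y by (simp add: algebra_simps)
    also have "... <= (1 + y)*(1 + y)^k" using Suc.IH y by (intro mult_left_mono) auto
    finally show ?case by simp
   qed (use y in simp)
  qed (use y in auto)
  also have "... = (1 + y)^n" by (simp add: n_def power_add power_mult)
  also have "... <= (fact n/b^n*exp b)*exp (b*y)" using b y by (intro power_le_exp) auto
  finally have "y^q*(1 + y^k)^N*exp (- (c*y)) <= (fact n/b^n*exp b)*exp (b*y)*exp (- (c*y))"
   by (rule mult_right_mono) simp
  also have "... = (fact n/b^n*exp b)*exp (- (b*y))"
  proof -
   have "exp (b*y)*exp (- (c*y)) = exp (- (b*y))" by (simp add: exp_add[symmetric] b_def)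
   thus ?thesis by (simp only: mult.assoc)
  qed
  finally show "norm (y^q*(1 + y^k)^N*exp (- (c*y))) <= norm ((fact n/b^n*exp b)*exp (- (b*y)))"
   using y b by (simp add: abs_mult)
 qed
qed (auto simp: set_borel_measurable_def)

text \<open>Substitution \<open>y = d^(1/k) * x\<close>; the constant is the same integral for
  \<open>d = 1\<close>.\<close>

lemma majorant_scaled:
 fixes k q N :: nat
 assumes k: "k >= 1" and c: "c > 0"
 obtains C where "C >= 0"
  "!!d. d >= 1 ==> pos_integrable (%x. x^q*(1 + real d*x^k)^N*exp (- (c*(real d powr (1/real k)*x))))"
  "!!d. d >= 1 ==> (PINT x. x^q*(1 + real d*x^k)^N*exp (- (c*(real d powr (1/real k)*x))))
    <= C*real d powr (- (real (q + 1)/real k))"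
proof -
 let ?F = "%y::real. y^q*(1 + y^k)^N*exp (- (c*y))"
 define C where "C = (PINT y. ?F y)"
 have C0: "C >= 0" unfolding C_def set_lebesgue_integral_def
  by (intro integral_nonneg_AE AE_I2) (auto simp: indicator_def)
 have F: "pos_integrable (%x. x^q*(1 + real d*x^k)^N*exp (- (c*(real d powr (1/real k)*x))))
  & (PINT x. x^q*(1 + real d*x^k)^N*exp (- (c*(real d powr (1/real k)*x))))
    <= C*real d powr (- (real (q + 1)/real k))" if d: "d >= 1" for d
 proof -
  define s where "s = real d powr (1/real k)"
  have s: "s > 0" using d by (simp add: s_def)
  have e: "x^q*(1 + real d*x^k)^N*exp (- (c*(s*x))) = inverse (s^q)*?F (s*x)" if "x \<in> {0<..}" for x
   using root_scale(1)[OF k d, of x] that s by (simp add: s_def power_mult_distrib)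
  have i: "pos_integrable (%x. ?F (s*x))"
   using poly_exp_integrable[OF c k] by (subst set_integral_scale(1)[OF s]) auto
  hence "pos_integrable (%x. inverse (s^q)*?F (s*x))" by simp
  hence 1: "pos_integrable (%x. x^q*(1 + real d*x^k)^N*exp (- (c*(s*x))))"
   by (subst set_integrable_cong[OF refl refl e]) auto
  have "(PINT x. x^q*(1 + real d*x^k)^N*exp (- (c*(s*x)))) = (PINT x. inverse (s^q)*?F (s*x))"
   using e by (intro set_lebesgue_integral_cong) auto
  also have "... = inverse (s^q)*(PINT x. ?F (s*x))" by simp
  also have "... = inverse (s^q)*(C/s)"
   unfolding C_def by (subst set_integral_scale(2)[OF s]) auto
  also have "... = C*inverse (s^(q + 1))" by (simp add: field_simps)
  also have "s^(q + 1) = real d powr (real (q + 1)/real k)"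
   unfolding s_def using d by (subst powr_power) (auto simp: field_simps)
  finally show ?thesis using 1 unfolding s_def by (simp add: powr_minus)
 qed
 show thesis by (rule that[OF C0]) (use F in blast)+
qed

section \<open>Record probabilities\<close>

definition gr :: "nat => real => real" where
 "gr r x = x^(r - 1)*exp (- x)/fact (r - 1)"

lemma gr_measurable [measurable]: "gr r \<in> borel_measurable borel"
 unfolding gr_def by measurable

lemma gr_nonneg: "0 <= x ==> 0 <= gr r x" by (simp add: gr_def)

text \<open>Solution \<open>x\<close> of \<open>\<mu> * x^k/k! = s\<close>. Small alarms satisfy
  \<open>P(T <= x) = x^k/k!\<close> to leading order, so in the coordinate \<open>s\<close> they
  have intensity about \<open>1/\<mu>\<close>.\<close>

definition yy :: "nat => real => real => real" where
 "yy k \<mu> s = (fact k * s/\<mu>) powr (1/real k)"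

lemma yy_measurable [measurable]: "yy k \<mu> \<in> borel_measurable borel"
 unfolding yy_def by measurable

lemma yy_nonneg [simp]: "0 <= yy k \<mu> s" by (simp add: yy_def)

lemma yy_pos: "0 < \<mu> ==> 0 < s ==> 0 < yy k \<mu> s" by (simp add: yy_def)

lemma yy_le_iff:
 assumes "1 <= k" "0 < \<mu>" "0 < s" "0 < t"
 shows "yy k \<mu> s <= yy k \<mu> t \<longleftrightarrow> s <= t"
proof
 assume "s <= t"
 thus "yy k \<mu> s <= yy k \<mu> t" unfolding yy_def using assms by (intro powr_mono2 divide_right_mono mult_left_mono) auto
next
 assume le: "yy k \<mu> s <= yy k \<mu> t"
 show "s <= t"
 proof (rule ccontr)
  assume "~ s <= t"
  hence "yy k \<mu> t < yy k \<mu> s" unfolding yy_def using assms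
   by (intro powr_less_mono2 divide_strict_right_mono mult_strict_left_mono) auto
  thus False using le by simp
 qed
qed

lemma yy_power:
 assumes "0 < \<mu>" "0 < s"
 shows "yy k \<mu> s^p = (fact k * s/\<mu>) powr (real p/real k)"
 using assms by (simp add: yy_def powr_realpow[symmetric] powr_powr)

lemma yy_has_deriv:
 assumes "1 <= k" "0 < \<mu>" "0 < s"
 shows "(yy k \<mu> has_real_derivative yy k \<mu> s/(real k * s)) (at s)"
proof -
 have "(yy k \<mu> has_real_derivative (1/real k)*(fact k * s/\<mu>) powr (1/real k - 1)*(fact k/\<mu>)) (at s)"
  unfolding yy_def using assms by (auto intro!: derivative_eq_intros)
 also have "(1/real k)*(fact k * s/\<mu>) powr (1/real k - 1)*(fact k/\<mu>) = yy k \<mu> s/(real k * s)"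
  using assms unfolding yy_def by (subst powr_diff) (simp add: field_simps)
 finally show ?thesis .
qed

lemma yy_image:
 assumes "1 <= k" "0 < \<mu>"
 shows "yy k \<mu> ` {0<..} = {0<..}"
proof
 show "{0<..} \<subseteq> yy k \<mu> ` {0<..}"
 proof
  fix x :: real assume "x \<in> {0<..}"
  hence "x = yy k \<mu> (\<mu>*x^k/fact k)" "\<mu>*x^k/fact k > 0"
   using assms by (auto simp: yy_def powr_realpow[symmetric] powr_powr)
  thus "x \<in> yy k \<mu> ` {0<..}" by blast
 qed
qed (use assms yy_pos in auto)

text \<open>Density of the Erlang law of order \<open>p\<close> in the coordinate \<open>s\<close>;
  for \<open>p = k\<close> the power of \<open>s\<close> disappears
  (\<open>yweight_self\<close>).\<close>

definition yweight :: "nat => nat => real => real => real" where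
 "yweight k p \<mu> s = (fact k/\<mu>) powr (real p/real k)/(real k*fact (p - 1))*(s powr (real p/real k - 1)*exp (- yy k \<mu> s))"

lemma yweight_eq:
 assumes k: "1 <= k" and p: "1 <= p" and \<mu>: "0 < \<mu>" and s: "0 < s"
 shows "yy k \<mu> s/(real k * s)*gr p (yy k \<mu> s) = yweight k p \<mu> s"
proof -
 have "yy k \<mu> s*yy k \<mu> s^(p - 1) = yy k \<mu> s^p" using p by (cases p) auto
 hence "yy k \<mu> s*yy k \<mu> s^(p - 1) = (fact k/\<mu>) powr (real p/real k) * s powr (real p/real k)"
  using yy_power[OF \<mu> s, of k p] \<mu> s by (simp add: powr_mult[symmetric])
 moreover have "s powr (real p/real k - 1) = s powr (real p/real k)/s" using s by (simp add: powr_diff)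
 moreover have "yy k \<mu> s/(real k * s)*gr p (yy k \<mu> s) = (yy k \<mu> s*yy k \<mu> s^(p - 1))*exp (- yy k \<mu> s)/(real k * s*fact (p - 1))"
  by (simp add: gr_def)
 ultimately show ?thesis unfolding yweight_def using s by (simp only:) (simp add: field_simps)
qed

lemma gr_substitution:
 fixes f :: "real => 'b::euclidean_space"
 assumes k: "1 <= k" and p: "1 <= p" and \<mu>: "0 < \<mu>" and f [measurable]: "f \<in> borel_measurable borel"
 shows "pos_integrable (%s. yweight k p \<mu> s *\<^sub>R f (yy k \<mu> s)) \<longleftrightarrow> pos_integrable (%x. gr p x *\<^sub>R f x)"
  and "(PINT x. gr p x *\<^sub>R f x) = (PINT s. yweight k p \<mu> s *\<^sub>R f (yy k \<mu> s))"
proof -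
 let ?g' = "%s. yy k \<mu> s/(real k * s)"
 have im: "yy k \<mu> ` {0<..} = {0<..}" by (rule yy_image[OF k \<mu>])
 have inj: "inj_on (yy k \<mu>) {0<..}"
 proof (rule inj_onI)
  fix s t :: real assume "s \<in> {0<..}" "t \<in> {0<..}" "yy k \<mu> s = yy k \<mu> t"
  thus "s = t" using yy_le_iff[OF k \<mu>, of s t] yy_le_iff[OF k \<mu>, of t s] by auto
 qed
 have m1: "set_borel_measurable borel (yy k \<mu> ` {0<..}) (%x. gr p x *\<^sub>R f x)"
  unfolding im set_borel_measurable_def by measurable
 have m2: "set_borel_measurable borel {0<..} (%s. \<bar>?g' s\<bar> *\<^sub>R (gr p (yy k \<mu> s) *\<^sub>R f (yy k \<mu> s)))"
  unfolding set_borel_measurable_def by measurable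
 note cv = change_of_variables_lborel[where S="{0<..}" and g="yy k \<mu>" and g'="?g'" and f="%x. gr p x *\<^sub>R f x", OF _ _ _ inj m1 m2]
 have eq: "\<bar>?g' s\<bar> *\<^sub>R (gr p (yy k \<mu> s) *\<^sub>R f (yy k \<mu> s)) = yweight k p \<mu> s *\<^sub>R f (yy k \<mu> s)" if "s \<in> {0<..}" for s
  using that yweight_eq[OF k p \<mu>, of s] by simp
 have A: "pos_integrable (%s. \<bar>?g' s\<bar> *\<^sub>R (gr p (yy k \<mu> s) *\<^sub>R f (yy k \<mu> s))) \<longleftrightarrow> pos_integrable (%x. gr p x *\<^sub>R f x)"
  using cv(1) im yy_has_deriv[OF k \<mu>] by auto
 show "pos_integrable (%s. yweight k p \<mu> s *\<^sub>R f (yy k \<mu> s)) \<longleftrightarrow> pos_integrable (%x. gr p x *\<^sub>R f x)"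
  using A eq by (subst set_integrable_cong[OF refl refl eq[symmetric]]) auto
 have "(PINT s. \<bar>?g' s\<bar> *\<^sub>R (gr p (yy k \<mu> s) *\<^sub>R f (yy k \<mu> s))) = (PINT x. gr p x *\<^sub>R f x)"
  using cv(2) im yy_has_deriv[OF k \<mu>] by auto
 moreover have "(PINT s. \<bar>?g' s\<bar> *\<^sub>R (gr p (yy k \<mu> s) *\<^sub>R f (yy k \<mu> s))) = (PINT s. yweight k p \<mu> s *\<^sub>R f (yy k \<mu> s))"
  using eq by (intro set_lebesgue_integral_cong) auto
 ultimately show "(PINT x. gr p x *\<^sub>R f x) = (PINT s. yweight k p \<mu> s *\<^sub>R f (yy k \<mu> s))" by simp
qed

lemma stretched_exp_integral:
 assumes k: "k >= 1" and p: "p >= 1" and d: "d >= 1"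
 shows "pos_integrable (%x. x^(p - 1)*exp (- (real d*x^k/fact k)))"
  and "(PINT x. x^(p - 1)*exp (- (real d*x^k/fact k)))
    = real d powr (- (real p/real k))*(fact k powr (real p/real k)*Gamma (real p/real k)/real k)"
proof -
 define e where "e = real p/real k"
 have e: "e > 0" using k p by (simp add: e_def)
 have d0: "0 < real d" using d by simp
 define c where "c = (fact k/real d) powr e/real k"
 \<comment> \<open>Chosen to cancel the factor \<open>exp (- x)/(p-1)!\<close> of
   \<open>gr p\<close>, so that the substitution turns the integral into a Gamma integral.\<close>
 let ?f = "%x. fact (p - 1)*exp (x - real d*x^k/fact k)"
 let ?g = "%z::real. exp (- z)*z powr (e - 1)"
 have f: "?f \<in> borel_measurable borel" by measurable
 have gf: "gr p x *\<^sub>R ?f x = x^(p - 1)*exp (- (real d*x^k/fact k))" for x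
 proof -
  have "exp (- x)*exp (x - B) = exp (- B)" for B by (simp add: exp_add[symmetric])
  thus ?thesis by (simp only: gr_def) (simp add: mult.assoc)
 qed
 have eq: "yweight k p (real d) s *\<^sub>R ?f (yy k (real d) s) = c*?g s" if "s \<in> {0<..}" for s
 proof -
  have "real d*yy k (real d) s^k/fact k = s" using yy_power[OF d0, of s k k] that k d by simp
  thus ?thesis by (simp add: yweight_def c_def e_def exp_diff exp_minus field_simps)
 qed
 have if0: "pos_integrable ?g" using e by (intro Gamma_integrand_sub) auto
 have "(PINT z. ?g z) = (LINT z:{0..}|lborel. ?g z)"
  unfolding set_lebesgue_integral_def
  by (intro integral_cong_AE) (auto intro!: AE_I[where N="{0}"] simp: indicator_def split: if_splits)
 hence vf: "(PINT z. ?g z) = Gamma e" using Gamma_integrand(2)[OF e] by (simp add: upper_Gamma_def)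
 have "pos_integrable (%s. yweight k p (real d) s *\<^sub>R ?f (yy k (real d) s))"
  using set_integrable_mult_right[OF if0, of c] by (subst set_integrable_cong[OF refl refl eq]) auto
 thus "pos_integrable (%x. x^(p - 1)*exp (- (real d*x^k/fact k)))"
  unfolding gr_substitution(1)[OF k p d0 f] gf .
 have "(PINT x. x^(p - 1)*exp (- (real d*x^k/fact k))) = (PINT s. c*?g s)"
  unfolding gf[symmetric] gr_substitution(2)[OF k p d0 f] by (rule set_lebesgue_integral_cong) (use eq in auto)
 also have "... = c*Gamma e" unfolding vf[symmetric] by (rule set_integral_mult_right)
 also have "... = real d powr (- e)*(fact k powr e*Gamma e/real k)"
  using d by (simp add: c_def powr_divide powr_minus field_simps)
 finally show "(PINT x. x^(p - 1)*exp (- (real d*x^k/fact k)))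
    = real d powr (- (real p/real k))*(fact k powr (real p/real k)*Gamma (real p/real k)/real k)"
  by (simp add: e_def)
qed

text \<open>Probability that a node with \<open>d\<close> strict ancestors is an
  \<open>r\<close>-record.\<close>

definition psi :: "nat => nat => nat => real" where
 "psi k r d = (PINT x. gr r x*Qk k x^d)"

lemma gr_integral:
 assumes "r >= 1"
 shows "pos_integrable (gr r)" "(PINT x. gr r x) = 1"
proof -
 have "pos_integrable (%x. x^(r - 1)*exp (- (real 1*x^1/fact 1)))"
  by (rule stretched_exp_integral(1)) (use assms in auto)
 hence i: "pos_integrable (%x::real. x^(r - 1)*exp (- x))" by simp
 have "(PINT x. x^(r - 1)*exp (- (real 1*x^1/fact 1))) = real 1 powr (- (real r/real 1))*(fact 1 powr (real r/real 1)*Gamma (real r/real 1)/real 1)"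
  by (rule stretched_exp_integral(2)) (use assms in auto)
 hence v: "(PINT x. x^(r - 1)*exp (- x :: real)) = fact (r - 1)"
  using Gamma_fact[of "r - 1", where 'a=real] assms by (simp add: of_nat_diff add.commute)
 have "pos_integrable (%x::real. 1/fact (r - 1)*(x^(r - 1)*exp (- x)))"
  by (rule set_integrable_mult_right) (rule i)
 also have "(%x::real. 1/fact (r - 1)*(x^(r - 1)*exp (- x))) = gr r" by (auto simp: gr_def)
 finally show "pos_integrable (gr r)" .
 show "(PINT x. gr r x) = 1" unfolding gr_def using v by simp
qed

lemma gr_weighted_integrable:
 assumes "r >= 1" "f \<in> borel_measurable borel" "!!x. 0 < x ==> \<bar>f x\<bar> <= 1"
 shows "pos_integrable (%x. gr r x*f x)"
proof (rule set_integrable_bound[OF gr_integral(1)[OF assms(1)]])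
 note [measurable] = assms(2)
 show "set_borel_measurable lborel {0<..} (%x. gr r x*f x)"
  unfolding set_borel_measurable_def by measurable
 show "AE x in lborel. x \<in> {0<..} --> norm (gr r x*f x) <= norm (gr r x)"
  using assms(3) by (auto simp: abs_mult intro!: mult_left_le)
qed

text \<open>Laplace's method: integrate \<open>global_bound\<close> against
  \<open>x^(r-1)/(r-1)!\<close>; every monomial of \<open>main_term\<close> gives a Gamma value by
  \<open>stretched_exp_integral\<close>.\<close>

lemma psi_remainder:
 assumes k: "k >= 1" and r: "r >= 1"
 obtains C where "C >= 0" "!!d. d >= 1 ==>
  \<bar>psi k r d - (\<Sum>j\<le>k. \<Sum>i\<le>k. kappa k j i/fact (r - 1)*real d^j *
    (real d powr (- (real (r + j*k + i)/real k))*(fact k powr (real (r + j*k + i)/real k)*Gamma (real (r + j*k + i)/real k)/real k)))\<bar>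
   <= C*real d powr (- (real (r + k + 1)/real k))"
proof -
 obtain C c where C: "C >= 0" "c > 0" "!!x d. 0 <= x ==> d >= 1 ==>
  \<bar>exp (- x)*Qk k x^d - exp (- (real d*x^k/fact k))*main_term k d x\<bar>
   <= C*(x^(k + 1)*(1 + real d*x^k)^(k + 1)*exp (- (c*(real d powr (1/real k)*x))))"
  using global_bound[OF k] by blast
 obtain D where D: "D >= 0"
  "!!d. d >= 1 ==> pos_integrable (%x. x^(r + k)*(1 + real d*x^k)^(k + 1)*exp (- (c*(real d powr (1/real k)*x))))"
  "!!d. d >= 1 ==> (PINT x. x^(r + k)*(1 + real d*x^k)^(k + 1)*exp (- (c*(real d powr (1/real k)*x))))
    <= D*real d powr (- (real (r + k + 1)/real k))"
  using majorant_scaled[OF k C(2), of "r + k" "k + 1"] by blast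
 have "\<bar>psi k r d - (\<Sum>j\<le>k. \<Sum>i\<le>k. kappa k j i/fact (r - 1)*real d^j *
    (real d powr (- (real (r + j*k + i)/real k))*(fact k powr (real (r + j*k + i)/real k)*Gamma (real (r + j*k + i)/real k)/real k)))\<bar>
   <= (C*D)*real d powr (- (real (r + k + 1)/real k))" if d: "d >= 1" for d
 proof -
  let ?T = "%x. exp (- (real d*x^k/fact k))"
  let ?m = "%j i x. x^(r + j*k + i - 1)*?T x"
  have im: "pos_integrable (?m j i)" for j i
   by (rule stretched_exp_integral(1)) (use k r d in auto)
  have vm: "(PINT x. ?m j i x) = real d powr (- (real (r + j*k + i)/real k))*(fact k powr (real (r + j*k + i)/real k)*Gamma (real (r + j*k + i)/real k)/real k)" for j i
   by (rule stretched_exp_integral(2)) (use k r d in auto)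
  let ?M = "%x. \<Sum>j\<le>k. \<Sum>i\<le>k. (kappa k j i/fact (r - 1)*real d^j)*?m j i x"
  have iM: "pos_integrable ?M"
  proof -
   have i0: "integrable lborel (%x. indicator {0<..} x *\<^sub>R ((kappa k j i/fact (r - 1)*real d^j)*?m j i x))" for j i
    using set_integrable_mult_right[of "kappa k j i/fact (r - 1)*real d^j" lborel "{0<..}" "?m j i"] im[of j i]
    unfolding set_integrable_def by blast
   show ?thesis
    unfolding set_integrable_def scaleR_sum_right by (intro bochner_sum i0)
  qed
  have vM: "(PINT x. ?M x) = (\<Sum>j\<le>k. \<Sum>i\<le>k. kappa k j i/fact (r - 1)*real d^j*(PINT x. ?m j i x))"
  proof -
   have i0: "integrable lborel (%x. indicator {0<..} x *\<^sub>R ((kappa k j i/fact (r - 1)*real d^j)*?m j i x))" for j i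
    using set_integrable_mult_right[of "kappa k j i/fact (r - 1)*real d^j" lborel "{0<..}" "?m j i"] im[of j i]
    unfolding set_integrable_def by blast
   have "(PINT x. ?M x) = (LINT x|lborel. (\<Sum>j\<le>k. \<Sum>i\<le>k. indicator {0<..} x *\<^sub>R ((kappa k j i/fact (r - 1)*real d^j)*?m j i x)))"
    unfolding set_lebesgue_integral_def by (simp only: scaleR_sum_right)
   also have "... = (\<Sum>j\<le>k. \<Sum>i\<le>k. (LINT x|lborel. indicator {0<..} x *\<^sub>R ((kappa k j i/fact (r - 1)*real d^j)*?m j i x)))"
    by (rule trans[OF bochner_integral_sum])
      (intro bochner_sum i0, intro sum.cong refl bochner_integral_sum i0)
   also have "... = (\<Sum>j\<le>k. \<Sum>i\<le>k. kappa k j i/fact (r - 1)*real d^j*(PINT x. ?m j i x))"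
    unfolding set_lebesgue_integral_def[symmetric] by simp
   finally show ?thesis .
  qed
  have iq: "pos_integrable (%x. gr r x*Qk k x^d)"
   using r by (rule gr_weighted_integrable) (auto simp: Qk_nonneg Qk_le_1 power_le_one abs_of_nonneg)
  have bound: "\<bar>gr r x*Qk k x^d - ?M x\<bar> <= C*(x^(r + k)*(1 + real d*x^k)^(k + 1)*exp (- (c*(real d powr (1/real k)*x))))" if x: "0 < x" for x
  proof -
   have e1: "?M x = x^(r - 1)/fact (r - 1)*(?T x*main_term k d x)"
   proof -
    have "x^(r + j*k + i - 1) = x^(r - 1)*x^(j*k + i)" for j i
    proof -
     have "r + j*k + i - 1 = (r - 1) + (j*k + i)" using r by simp
     thus ?thesis by (simp only: power_add)
    qed
    thus ?thesis
     unfolding main_term_def[OF k] sum_distrib_left by (intro sum.cong refl) (simp add: mult_ac)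
   qed
   have "gr r x*Qk k x^d - ?M x = x^(r - 1)/fact (r - 1)*(exp (- x)*Qk k x^d - ?T x*main_term k d x)"
    unfolding e1 by (simp add: gr_def algebra_simps)
   hence "\<bar>gr r x*Qk k x^d - ?M x\<bar> = x^(r - 1)/fact (r - 1)*\<bar>exp (- x)*Qk k x^d - ?T x*main_term k d x\<bar>"
    using x by (simp add: abs_mult)
   also have "... <= (x^(r - 1)/1)*(C*(x^(k + 1)*(1 + real d*x^k)^(k + 1)*exp (- (c*(real d powr (1/real k)*x)))))"
    using C x d by (intro mult_mono divide_left_mono) auto
   also have "... = C*((x^(r - 1)*x^(k + 1))*(1 + real d*x^k)^(k + 1)*exp (- (c*(real d powr (1/real k)*x))))"
    by simp
   also have "x^(r - 1)*x^(k + 1) = x^(r + k)" using r by (simp add: power_add[symmetric] del: power_Suc)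
   finally show ?thesis .
  qed
  have A: "psi k r d - (PINT x. ?M x) = (PINT x. gr r x*Qk k x^d - ?M x)"
   unfolding psi_def by (rule set_integral_diff(2)[OF iq iM, symmetric])
  define G where "G x = C*(x^(r + k)*(1 + real d*x^k)^(k + 1)*exp (- (c*(real d powr (1/real k)*x))))" for x
  have iG: "pos_integrable G"
   unfolding G_def by (rule set_integrable_mult_right) (rule D(2)[OF d])
  have "norm (PINT x. gr r x*Qk k x^d - ?M x) <= (PINT x. norm (gr r x*Qk k x^d - ?M x))"
   by (rule set_integral_norm_bound) (rule set_integral_diff(1)[OF iq iM])
  also have "... <= (PINT x. G x)"
  proof (rule set_integral_mono)
   show "pos_integrable (%x. norm (gr r x*Qk k x^d - ?M x))"
    by (rule set_integrable_norm) (rule set_integral_diff(1)[OF iq iM])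
   show "pos_integrable G" by (rule iG)
   show "norm (gr r x*Qk k x^d - ?M x) <= G x" if "x \<in> {0<..}" for x
    unfolding real_norm_def G_def using that by (intro bound) simp
  qed
  also have "(PINT x. G x) = C*(PINT x. (x^(r + k)*(1 + real d*x^k)^(k + 1)*exp (- (c*(real d powr (1/real k)*x)))))"
   unfolding G_def by (rule set_integral_mult_right)
  also have "... <= C*(D*real d powr (- (real (r + k + 1)/real k)))"
   using D(3)[OF d] C(1) by (rule mult_left_mono)
  also have "C*(D*real d powr (- (real (r + k + 1)/real k))) = (C*D)*real d powr (- (real (r + k + 1)/real k))"
   by (rule mult.assoc[symmetric])
  finally have "norm (psi k r d - (PINT x. ?M x)) <= (C*D)*real d powr (- (real (r + k + 1)/real k))"
   unfolding A .
  thus ?thesis unfolding vM vm real_norm_def .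
 qed
 from that[OF mult_nonneg_nonneg[OF C(1) D(1)] this] show thesis .
qed

definition psi_coeff :: "nat => nat => nat => real" where
 "psi_coeff k r i = (if i = 0 then real k/real r else C1 k r i)"

text \<open>The powers of \<open>d\<close> depend on \<open>i\<close> only, so the sum over
  \<open>j\<close> collapses. The term \<open>j = 0\<close> is \<open>C7\<close>, the terms
  \<open>1 <= j <= i\<close> are \<open>C8\<close>, those with \<open>j > i\<close> vanish, and
  division by \<open>C2\<close> turns the leading coefficient into \<open>k/r\<close>.\<close>

theorem psi_expansion:
 assumes k: "k >= 1" and r: "r >= 1"
 obtains C where "C >= 0" "!!d. d >= 1 ==>
  \<bar>psi k r d/C2 k r - (\<Sum>i\<le>k. psi_coeff k r i*real d powr (- (real (r + i)/real k)))\<bar>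
   <= C*real d powr (- (real (r + k + 1)/real k))"
proof -
 obtain C where C: "C >= 0" "!!d. d >= 1 ==>
  \<bar>psi k r d - (\<Sum>j\<le>k. \<Sum>i\<le>k. kappa k j i/fact (r - 1)*real d^j *
    (real d powr (- (real (r + j*k + i)/real k))*(fact k powr (real (r + j*k + i)/real k)*Gamma (real (r + j*k + i)/real k)/real k)))\<bar>
   <= C*real d powr (- (real (r + k + 1)/real k))"
  using psi_remainder[OF k r] by blast
 have Gr: "Gamma (real r) = fact (r - 1)"
  using Gamma_fact[of "r - 1", where 'a=real] r by (simp add: of_nat_diff add.commute)
 have Ga: "Gamma (real r/real k) > 0" using k r by (intro Gamma_pos) auto
 have C2p: "C2 k r > 0" unfolding C2_def Gr using k r Ga by simp
 define B where "B j i = kappa k j i/fact (r - 1)*(fact k powr (real (r + j*k + i)/real k)*Gamma (real (r + j*k + i)/real k)/real k)/C2 k r" for j i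
 have B: "B j i = kappa k j i*real k*fact k powr (real (j*k + i)/real k)*Gamma (real (j*k + i + r)/real k)/(real r*Gamma (real r/real k))" for j i
 proof -
  have "fact k powr (real (r + j*k + i)/real k) = fact k powr (real r/real k)*fact k powr (real (j*k + i)/real k)"
  proof -
   have "real (r + j*k + i)/real k = real r/real k + real (j*k + i)/real k" by (simp add: add_divide_distrib)
   thus ?thesis by (simp only: powr_add)
  qed
  thus ?thesis
   unfolding B_def C2_def Gr using k r Ga by (simp add: field_simps power2_eq_square add_ac)
 qed
 have sumB: "(\<Sum>j\<le>k. B j i) = psi_coeff k r i" if i: "i <= k" for i
 proof -
  have B0: "B 0 i = C7 k r i"
   unfolding B C7_def kappa_0[OF k] by (simp add: mult_ac)
  have Bj: "B j i = C8 k r j (j*k + i)" if "1 <= j" for j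
   unfolding B C8_def kappa_eq_C6[OF k that i] by (simp add: mult_ac)
  have Bz: "B j i = 0" if "i < j" for j unfolding B kappa_small[OF k that] by simp
  have "(\<Sum>j\<le>k. B j i) = (\<Sum>j\<in>{0..i}. B j i)"
   using i Bz by (intro sum.mono_neutral_right) auto
  also have "... = B 0 i + (\<Sum>j=1..i. B j i)" by (simp add: sum.atLeast_Suc_atMost)
  also have "(\<Sum>j=1..i. B j i) = (\<Sum>j=1..i. C8 k r j (j*k + i))" using Bj by (intro sum.cong) auto
  finally have e: "(\<Sum>j\<le>k. B j i) = C1 k r i" using B0 by (simp add: C1_def)
  show ?thesis
  proof (cases "i = 0")
   case True
   thus ?thesis using e Ga r by (simp add: psi_coeff_def C1_def C7_def)
  qed (use e in \<open>simp add: psi_coeff_def\<close>)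
 qed
 have "\<bar>psi k r d/C2 k r - (\<Sum>i\<le>k. psi_coeff k r i*real d powr (- (real (r + i)/real k)))\<bar>
   <= (C/C2 k r)*real d powr (- (real (r + k + 1)/real k))" if d: "d >= 1" for d
 proof -
  \<comment> \<open>The factor \<open>d^j\<close> compensates exactly the \<open>j*k\<close> extra
    powers of \<open>x\<close>.\<close>
  have pd: "real d^j*real d powr (- (real (r + j*k + i)/real k)) = real d powr (- (real (r + i)/real k))" for j i
  proof -
   have "- (real (r + j*k + i)/real k) = - real j - real (r + i)/real k" using k by (simp add: field_simps)
   hence "real d powr (- (real (r + j*k + i)/real k)) = real d powr (- real j)*real d powr (- (real (r + i)/real k))"
    by (simp add: powr_add[symmetric])
   moreover have "real d^j*real d powr (- real j) = 1" using d by (simp add: powr_realpow powr_minus)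
   ultimately show ?thesis by (simp add: mult.assoc[symmetric])
  qed
  have "(\<Sum>j\<le>k. \<Sum>i\<le>k. kappa k j i/fact (r - 1)*real d^j *
    (real d powr (- (real (r + j*k + i)/real k))*(fact k powr (real (r + j*k + i)/real k)*Gamma (real (r + j*k + i)/real k)/real k)))
   = (\<Sum>j\<le>k. \<Sum>i\<le>k. C2 k r*(B j i*(real d^j*real d powr (- (real (r + j*k + i)/real k)))))"
   using C2p by (intro sum.cong refl) (simp add: B_def)
  also have "... = C2 k r*(\<Sum>j\<le>k. \<Sum>i\<le>k. B j i*real d powr (- (real (r + i)/real k)))"
   unfolding pd sum_distrib_left ..
  also have "(\<Sum>j\<le>k. \<Sum>i\<le>k. B j i*real d powr (- (real (r + i)/real k))) = (\<Sum>i\<le>k. (\<Sum>j\<le>k. B j i)*real d powr (- (real (r + i)/real k)))"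
   by (subst sum.swap) (simp add: sum_distrib_right)
  also have "... = (\<Sum>i\<le>k. psi_coeff k r i*real d powr (- (real (r + i)/real k)))"
   using sumB by (intro sum.cong) auto
  finally have e: "(\<Sum>j\<le>k. \<Sum>i\<le>k. kappa k j i/fact (r - 1)*real d^j *
    (real d powr (- (real (r + j*k + i)/real k))*(fact k powr (real (r + j*k + i)/real k)*Gamma (real (r + j*k + i)/real k)/real k)))
   = C2 k r*(\<Sum>i\<le>k. psi_coeff k r i*real d powr (- (real (r + i)/real k)))" .
  let ?S = "\<Sum>i\<le>k. psi_coeff k r i*real d powr (- (real (r + i)/real k))"
  have "psi k r d/C2 k r - ?S = (psi k r d - C2 k r*?S)/C2 k r" using C2p by (simp add: field_simps)
  hence "\<bar>psi k r d/C2 k r - ?S\<bar> = \<bar>psi k r d - C2 k r*?S\<bar>/C2 k r" using C2p by (simp add: abs_divide)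
  also have "... <= (C*real d powr (- (real (r + k + 1)/real k)))/C2 k r"
   using C(2)[OF d] C2p unfolding e by (intro divide_right_mono) auto
  finally show ?thesis by simp
 qed
 from that[OF divide_nonneg_pos[OF C(1) C2p] this] show thesis .
qed

text \<open>Second-order errors of the linearisation carry \<open>(1 - Q)^2 <= x^(2k)\<close>, which
  gains a factor \<open>d^(-2)\<close> over \<open>psi\<close>.\<close>

lemma rho_bound:
 assumes k: "k >= 1" and r: "r >= 1"
 obtains C where "C >= 0" "!!d. d >= 1 ==>
  (PINT x. gr r x*(Qk k x^d*(1 - Qk k x)\<^sup>2)) <= C*real d powr (- (real (r + 2*k)/real k))"
proof -
 obtain c where c: "c > 0" "!!x d. 0 <= x ==> d >= 1 ==> Qk k x^d <= exp (c - c*(real d powr (1/real k)*x))"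
  using Qk_power_bound[OF k] by blast
 obtain D where D: "D >= 0"
  "!!d. d >= 1 ==> pos_integrable (%x. x^(r - 1 + 2*k)*(1 + real d*x^k)^0*exp (- (c*(real d powr (1/real k)*x))))"
  "!!d. d >= 1 ==> (PINT x. x^(r - 1 + 2*k)*(1 + real d*x^k)^0*exp (- (c*(real d powr (1/real k)*x))))
    <= D*real d powr (- (real (r - 1 + 2*k + 1)/real k))"
  using majorant_scaled[OF k c(1), of "r - 1 + 2*k" 0] by blast
 have "(PINT x. gr r x*(Qk k x^d*(1 - Qk k x)\<^sup>2)) <= (exp c*D)*real d powr (- (real (r + 2*k)/real k))" if d: "d >= 1" for d
 proof -
  let ?g = "%x. x^(r - 1 + 2*k)*(1 + real d*x^k)^0*exp (- (c*(real d powr (1/real k)*x)))"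
  have "(PINT x. gr r x*(Qk k x^d*(1 - Qk k x)\<^sup>2)) <= (PINT x. exp c*?g x)"
  proof (rule set_integral_mono)
   show "pos_integrable (%x. gr r x*(Qk k x^d*(1 - Qk k x)\<^sup>2))"
    using r
   proof (rule gr_weighted_integrable)
    fix x :: real assume x: "0 < x"
    have "0 <= Qk k x^d*(1 - Qk k x)\<^sup>2" using x by (simp add: Qk_nonneg)
    moreover have "Qk k x^d*(1 - Qk k x)\<^sup>2 <= 1*1"
     using x by (intro mult_mono power_le_one) (auto simp: Qk_nonneg Qk_le_1)
    ultimately show "\<bar>Qk k x^d*(1 - Qk k x)\<^sup>2\<bar> <= 1" by simp
   qed measurable
   show "pos_integrable (%x. exp c*?g x)" using D(2)[OF d] by simp
   fix x :: real assume "x \<in> {0<..}"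
   hence x: "0 < x" by simp
   have "gr r x <= x^(r - 1)*1/1" unfolding gr_def using x by (intro frac_le mult_mono) auto
   moreover have "Qk k x^d*(1 - Qk k x)\<^sup>2 <= exp (c - c*(real d powr (1/real k)*x))*(x^k)\<^sup>2"
   proof (intro mult_mono[OF _ power_mono])
    have "x^k/fact k <= x^k/1" using x by (intro divide_left_mono) auto
    thus "1 - Qk k x <= x^k" using one_minus_Qk_le[OF k, of x] x by simp
   qed (use c(2)[OF _ d] x Qk_le_1 in auto)
   ultimately have "gr r x*(Qk k x^d*(1 - Qk k x)\<^sup>2) <= (x^(r - 1))*(exp (c - c*(real d powr (1/real k)*x))*(x^k)\<^sup>2)"
    using x by (intro mult_mono[of "gr r x"]) (auto simp: Qk_nonneg)
   also have "... = exp c*?g x"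
    by (simp add: exp_diff exp_minus power_add power_mult[symmetric] divide_inverse mult_ac)
   finally show "gr r x*(Qk k x^d*(1 - Qk k x)\<^sup>2) <= exp c*?g x" .
  qed
  also have "... = exp c*(PINT x. ?g x)" by (rule set_integral_mult_right)
  also have "... <= exp c*(D*real d powr (- (real (r - 1 + 2*k + 1)/real k)))"
   using D(3)[OF d] by (rule mult_left_mono) simp
  finally show ?thesis using r by simp
 qed
 from that[OF mult_nonneg_nonneg[OF exp_ge_zero D(1)] this] show thesis .
qed

section \<open>Ancestors and subtrees\<close>

lemma ancestor_iff: "ancestor u v \<longleftrightarrow> 1 <= u & (\<exists>i\<ge>1. u = v div 2^i)"
proof
 assume "ancestor u v"
 hence "(u, v) \<in> parent_child\<^sup>+" by (simp add: ancestor_def)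
 thus "1 <= u & (\<exists>i\<ge>1. u = v div 2^i)"
 proof (induction rule: trancl_induct)
  case (base y)
  thus ?case by (auto simp: parent_child_def intro!: exI[of _ 1])
 next
  case (step y z)
  then obtain i where i: "i >= 1" "u = y div 2^i" by auto
  have "y = z div 2" using step(2) by (auto simp: parent_child_def)
  hence "u = z div 2^Suc i" using i by (simp add: div_mult2_eq)
  thus ?case using step by (intro conjI exI[of _ "Suc i"]) auto
 qed
next
 assume "1 <= u & (\<exists>i\<ge>1. u = v div 2^i)"
 then obtain i where u: "1 <= u" and i: "i >= 1" "u = v div 2^i" by auto
 have "(u, v) \<in> parent_child\<^sup>+" using i u
 proof (induction i arbitrary: v rule: nat_induct_at_least)
  case base
  thus ?case by (intro r_into_trancl) (auto simp: parent_child_def)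
 next
  case (Suc i)
  have e: "u = (v div 2) div 2^i" using Suc.prems by (simp add: div_mult2_eq)
  hence "(u, v div 2) \<in> parent_child\<^sup>+" using Suc by auto
  moreover have "1 <= v div 2" using e Suc.prems by (cases "v div 2 = 0") auto
  hence "(v div 2, v) \<in> parent_child" by (auto simp: parent_child_def)
  ultimately show ?case by (rule trancl_into_trancl)
 qed
 thus "ancestor u v" by (simp add: ancestor_def)
qed

definition ancs :: "nat => nat set" where "ancs v = {u. ancestor u v}"

lemma ancestor_less: "ancestor u v ==> u < v"
proof -
 assume "ancestor u v"
 then obtain i where i: "1 <= u" "i >= 1" "u = v div 2^i" by (auto simp: ancestor_iff)
 have "v > 0" using i by (cases v) auto
 moreover have "(2::nat)^i > 1" using i(2) by (intro one_less_power) auto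
 ultimately show "u < v" using i by simp
qed

lemma ancestor_ge_1: "ancestor u v ==> 1 <= u" by (simp add: ancestor_iff)

lemma ancs_subset: "ancs v \<subseteq> {1..<v}"
 using ancestor_less ancestor_ge_1 by (auto simp: ancs_def)

lemma finite_ancs [simp]: "finite (ancs v)"
 by (rule finite_subset[OF ancs_subset]) simp

lemma ancestor_chain:
 assumes "ancestor u v" "ancestor w v" "u < w"
 shows "ancestor u w"
proof -
 obtain i where i: "1 <= u" "i >= 1" "u = v div 2^i" using assms by (auto simp: ancestor_iff)
 obtain j where j: "1 <= w" "j >= 1" "w = v div 2^j" using assms by (auto simp: ancestor_iff)
 have "j < i"
 proof (rule ccontr)
  assume "~ j < i"
  hence "w <= u" unfolding i(3) j(3) by (intro div_le_mono2 power_increasing) auto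
  thus False using assms by simp
 qed
 hence "u = w div 2^(i - j)" unfolding i(3) j(3) by (simp add: div_mult2_eq[symmetric] power_add[symmetric])
 thus ?thesis using i \<open>j < i\<close> by (auto simp: ancestor_iff intro!: exI[of _ "i - j"])
qed

lemma ancestor_trans: "ancestor u w ==> ancestor w v ==> ancestor u v"
 by (auto simp: ancestor_def intro: trancl_trans)

lemma ancs_1: "ancs 1 = {}" using ancs_subset[of 1] by auto

lemma ancs_half:
 assumes "v >= 2"
 shows "ancs v = insert (v div 2) (ancs (v div 2))"
proof (intro equalityI subsetI)
 have h: "ancestor (v div 2) v" using assms by (auto simp: ancestor_iff intro!: exI[of _ 1])
 fix u
 {
  assume "u \<in> ancs v"
  hence u: "ancestor u v" by (simp add: ancs_def)
  then obtain i where i: "1 <= u" "i >= 1" "u = v div 2^i" by (auto simp: ancestor_iff)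
  show "u \<in> insert (v div 2) (ancs (v div 2))"
  proof (cases "i = 1")
   case False
   hence "u = (v div 2) div 2^(i - 1)" using i by (simp add: div_mult2_eq[symmetric] power_Suc[symmetric] del: power_Suc)
   hence "ancestor u (v div 2)" using i False by (auto simp: ancestor_iff intro!: exI[of _ "i - 1"])
   thus ?thesis by (simp add: ancs_def)
  qed (use i in simp)
 next
  assume "u \<in> insert (v div 2) (ancs (v div 2))"
  thus "u \<in> ancs v" using h ancestor_trans by (auto simp: ancs_def)
 }
qed

definition depth :: "nat => nat" where "depth v = card (ancs v)"

lemma depth_bounds: "v >= 1 ==> 2^depth v <= v & v < 2^(depth v + 1)"
proof (induction v rule: less_induct)
 case (less v)
 show ?case
 proof (cases "v = 1")
  case True
  thus ?thesis by (simp add: depth_def ancs_1[simplified])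
 next
  case False
  hence v: "v >= 2" using less by simp
  have "v div 2 \<notin> ancs (v div 2)" using ancs_subset[of "v div 2"] by auto
  hence d: "depth v = Suc (depth (v div 2))" unfolding depth_def ancs_half[OF v] by simp
  have IH: "2^depth (v div 2) <= v div 2 & v div 2 < 2^(depth (v div 2) + 1)"
   using less.IH[of "v div 2"] v by simp
  show ?thesis unfolding d using IH by auto
 qed
qed

lemma depth_log:
 assumes "v >= 1"
 shows "real (depth v) <= log 2 (real v)" "log 2 (real v) < real (depth v) + 1"
proof -
 have "real (2^depth v) <= real v" "real v < real (2^(depth v + 1))"
  using depth_bounds[OF assms] by (simp_all only: of_nat_le_iff of_nat_less_iff)
 thus "real (depth v) <= log 2 (real v)" "log 2 (real v) < real (depth v) + 1"
  using assms by (simp_all add: le_log_iff log_less_iff powr_realpow powr_add mult.commute)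
qed

text \<open>The ancestors up to \<open>J\<close> form a chain below the largest of them, whose own
  depth is at most \<open>lg J\<close>.\<close>

lemma card_ancs_le:
 assumes "J >= 1"
 shows "real (card (ancs v \<inter> {1..J})) <= log 2 (real J) + 1"
proof (cases "ancs v \<inter> {1..J} = {}")
 case False
 define w where "w = Max (ancs v \<inter> {1..J})"
 have w: "w \<in> ancs v \<inter> {1..J}" unfolding w_def by (rule Max_in) (use False in auto)
 have "ancs v \<inter> {1..J} \<subseteq> insert w (ancs w)"
 proof
  fix u assume u: "u \<in> ancs v \<inter> {1..J}"
  hence "u <= w" unfolding w_def by (intro Max_ge) auto
  thus "u \<in> insert w (ancs w)"
   using ancestor_chain[of u v w] u w by (cases "u = w") (auto simp: ancs_def)
 qed
 hence "card (ancs v \<inter> {1..J}) <= card (insert w (ancs w))" by (intro card_mono) auto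
 also have "... <= depth w + 1" unfolding depth_def by (simp add: card_insert_if)
 finally have "real (card (ancs v \<inter> {1..J})) <= real (depth w) + 1" by simp
 also have "real (depth w) <= log 2 (real w)" using w by (intro depth_log) auto
 also have "log 2 (real w) <= log 2 (real J)" using w by (intro log_mono) auto
 finally show ?thesis by simp
qed (use assms in simp)

definition subtree :: "nat => nat => nat set" where
 "subtree n u = {v \<in> {1..n}. v = u \<or> ancestor u v}"

lemma finite_subtree [simp]: "finite (subtree n u)" by (simp add: subtree_def)

lemma subtree_iff: "u >= 1 ==> v \<in> subtree n u \<longleftrightarrow> v \<in> {1..n} & (\<exists>i. v div 2^i = u)"
proof -
 assume u: "u >= 1"
 have "(v = u \<or> ancestor u v) \<longleftrightarrow> (\<exists>i. v div 2^i = u)"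
 proof
  assume "v = u \<or> ancestor u v"
  thus "\<exists>i. v div 2^i = u" by (auto simp: ancestor_iff intro: exI[of _ 0])
 next
  assume "\<exists>i. v div 2^i = u"
  then obtain i where i: "v div 2^i = u" ..
  show "v = u \<or> ancestor u v"
   using i u by (cases "i = 0") (auto simp: ancestor_iff intro!: exI[of _ i])
 qed
 thus ?thesis by (simp add: subtree_def)
qed

lemma div_power_eq_iff: "(v::nat) div 2^i = u \<longleftrightarrow> v \<in> {u*2^i..<(u + 1)*2^i}"
proof -
 have p: "(2::nat)^i > 0" by simp
 show ?thesis
 proof
  assume "v div 2^i = u"
  thus "v \<in> {u*2^i..<(u + 1)*2^i}"
   using div_times_less_eq_dividend[of v "2^i"] dividend_less_times_div[OF p, of v] by (auto simp: algebra_simps)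
 next
  assume "v \<in> {u*2^i..<(u + 1)*2^i}"
  thus "v div 2^i = u" using p
   by (intro div_nat_eqI) (auto simp: algebra_simps)
 qed
qed

lemma subtree_levels:
 assumes "u >= 1" "n < u*2^h"
 shows "subtree n u = (\<Union>i<h. {u*2^i..<(u + 1)*2^i} \<inter> {..n})"
proof (intro equalityI subsetI)
 fix v assume "v \<in> subtree n u"
 then obtain i where v: "v \<in> {1..n}" "v div 2^i = u" using assms by (auto simp: subtree_iff)
 have "i < h"
 proof (rule ccontr)
  assume "~ i < h"
  hence "u*2^h <= u*2^i" by (intro mult_left_mono power_increasing) auto
  moreover have "u*2^i <= v" using v(2) by (simp add: div_power_eq_iff)
  moreover have "v <= n" using v(1) by simp
  ultimately show False using assms(2) by linarith
 qed
 thus "v \<in> (\<Union>i<h. {u*2^i..<(u + 1)*2^i} \<inter> {..n})"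
  using v by (auto simp: div_power_eq_iff)
next
 fix v assume "v \<in> (\<Union>i<h. {u*2^i..<(u + 1)*2^i} \<inter> {..n})"
 then obtain i where i: "v \<in> {u*2^i..<(u + 1)*2^i}" "v <= n" by auto
 hence "v div 2^i = u" by (simp only: div_power_eq_iff)
 moreover have "v >= 1"
 proof -
  have "0 < u*2^i" using assms(1) by simp
  moreover have "u*2^i <= v" using i by simp
  ultimately show ?thesis by linarith
 qed
 ultimately show "v \<in> subtree n u" using i assms by (auto simp: subtree_iff)
qed

lemma card_subtree_le:
 assumes "u >= 1" "n < u*2^h"
 shows "card (subtree n u) <= 2^h - 1"
proof -
 have "card (subtree n u) <= (\<Sum>i<h. card ({u*2^i..<(u + 1)*2^i} \<inter> {..n}))"
  unfolding subtree_levels[OF assms] by (rule card_UN_le) simp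
 also have "... <= (\<Sum>i<h. 2^i)"
 proof (rule sum_mono)
  fix i
  have "card ({u*2^i..<(u + 1)*2^i} \<inter> {..n}) <= card {u*2^i..<(u + 1)*2^i}"
   by (intro card_mono) auto
  thus "card ({u*2^i..<(u + 1)*2^i} \<inter> {..n}) <= 2^i" by (simp add: algebra_simps)
 qed
 also have "... = 2^h - 1" using sum_power2[of h] by (simp add: atLeast0LessThan)
 finally show ?thesis .
qed

lemma card_subtree_full:
 assumes u: "u >= 1" "n < u*2^h" and h: "h >= 1" and full: "(u + 1)*2^(h - 1) <= n"
 shows "card (subtree n u) = 2^h - 1"
proof -
 have e: "{u*2^i..<(u + 1)*2^i} \<inter> {..n} = {u*2^i..<(u + 1)*2^i}" if "i < h" for i
 proof -
  have "(u + 1)*2^i <= (u + 1)*2^(h - 1)" using that by (intro mult_left_mono power_increasing) auto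
  thus ?thesis using full by auto
 qed
 have dis: "{u*2^i..<(u + 1)*2^i} \<inter> {u*2^j..<(u + 1)*2^j} = {}" if "i < j" for i j
 proof -
  have "(u + 1)*2^i <= (2*u)*2^i" using u by (intro mult_right_mono) auto
  also have "... = u*2^Suc i" by simp
  also have "... <= u*2^j" using that by (intro mult_left_mono power_increasing) auto
  finally show ?thesis by auto
 qed
 have "card (subtree n u) = card (\<Union>i<h. {u*2^i..<(u + 1)*2^i})"
  unfolding subtree_levels[OF u] using e by (intro arg_cong[of _ _ card] SUP_cong) auto
 also have "... = (\<Sum>i<h. card {u*2^i..<(u + 1)*2^i})"
  using dis by (intro card_UN_disjoint) (auto, metis Int_commute dis disjoint_iff linorder_neqE_nat)
 also have "... = (\<Sum>i<h. 2^i)" by (simp add: algebra_simps)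
 also have "... = 2^h - 1" using sum_power2[of h] by (simp add: atLeast0LessThan)
 finally show ?thesis .
qed

lemma height_exists:
 fixes u n :: nat
 assumes "1 <= u" "u <= n"
 obtains h where "h >= 1" "u*2^(h - 1) <= n" "n < u*2^h"
proof -
 define h where "h = (LEAST h. n < u*2^h)"
 have "n < u*2^n" using assms by (intro less_le_trans[OF less_exp[of n]]) auto
 hence h: "n < u*2^h" unfolding h_def by (rule LeastI)
 have h1: "h >= 1" using h assms by (cases h) auto
 have "~ n < u*2^(h - 1)" using not_less_Least[of "h - 1" "%h. n < u*2^h"] h1 unfolding h_def[symmetric] by simp
 thus thesis using that h h1 by (auto simp: not_less)
qed

lemma card_subtree_mult_le:
 assumes "u >= 1"
 shows "card (subtree n u)*u <= 2*n"
proof (cases "u <= n")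
 case True
 obtain h where h: "h >= 1" "u*2^(h - 1) <= n" "n < u*2^h"
  using height_exists[OF assms True] .
 have "card (subtree n u)*u <= 2^h*u"
  using card_subtree_le[OF assms h(3)] by (intro mult_right_mono) auto
 also have "... = 2*(u*2^(h - 1))" using h(1) by (cases h) auto
 also have "... <= 2*n" using h by simp
 finally show ?thesis .
next
 case False
 hence "subtree n u = {}" using ancestor_less by (fastforce simp: subtree_def)
 thus ?thesis by simp
qed

lemma sum_card_subtree:
 assumes "finite A" "finite B"
 shows "(\<Sum>v\<in>B. card {u \<in> A. R u v}) = (\<Sum>u\<in>A. card {v \<in> B. R u v})"
proof -
 have "(\<Sum>v\<in>B. card {u \<in> A. R u v}) = (\<Sum>v\<in>B. \<Sum>u\<in>A. if R u v then 1 else 0)"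
  using assms by (intro sum.cong refl) (simp add: sum.If_cases Int_def)
 also have "... = (\<Sum>u\<in>A. \<Sum>v\<in>B. if R u v then 1 else 0)" by (rule sum.swap)
 also have "... = (\<Sum>u\<in>A. card {v \<in> B. R u v})"
  using assms by (intro sum.cong refl) (simp add: sum.If_cases Int_def)
 finally show ?thesis .
qed

text \<open>Double counting of pairs consisting of a node and a descendant, the node itself
  included.\<close>

lemma sum_depth: "(\<Sum>v\<in>{1..n}. depth v + 1) = (\<Sum>u\<in>{1..n}. card (subtree n u))"
proof -
 have "depth v + 1 = card {u \<in> {1..n}. v = u \<or> ancestor u v}" if v: "v \<in> {1..n}" for v
 proof -
  have "{u \<in> {1..n}. v = u \<or> ancestor u v} = insert v (ancs v)"
   using v ancs_subset[of v] by (auto simp: ancs_def)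
  moreover have "v \<notin> ancs v" using ancs_subset[of v] by auto
  ultimately show ?thesis by (simp add: depth_def)
 qed
 thus ?thesis using sum_card_subtree[of "{1..n}" "{1..n}" "%u v. v = u \<or> ancestor u v"]
  by (simp add: subtree_def)
qed

section \<open>Size classes\<close>

text \<open>The nodes whose subtree has exactly \<open>h\<close> levels: the leftmost descendant
  \<open>h - 1\<close> generations below is in the tree, the one \<open>h\<close> generations below
  is not. Only the last node, \<open>n div 2^(h-1)\<close>, may have an incomplete subtree.\<close>

definition size_class :: "nat => nat => nat set" where
 "size_class n h = {n div 2^h<..n div 2^(h - 1)}"

lemma size_class_iff:
 assumes "h >= 1"
 shows "u \<in> size_class n h \<longleftrightarrow> n < u*2^h & u*2^(h - 1) <= n"
 unfolding size_class_def by (auto simp: div_less_iff_less_mult less_eq_div_iff_mult_less_eq)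

lemma size_class_card:
 assumes h: "h >= 1" and u: "u \<in> size_class n h"
 shows "card (subtree n u) <= 2^h - 1"
  and "u ~= n div 2^(h - 1) ==> card (subtree n u) = 2^h - 1"
proof -
 have u1: "u >= 1" using u by (auto simp: size_class_def)
 note iff = size_class_iff[OF h, THEN iffD1, OF u]
 show "card (subtree n u) <= 2^h - 1" using card_subtree_le[OF u1] iff by blast
 assume "u ~= n div 2^(h - 1)"
 hence "u + 1 <= n div 2^(h - 1)" using u by (auto simp: size_class_def)
 hence "(u + 1)*2^(h - 1) <= n" by (simp add: less_eq_div_iff_mult_less_eq)
 thus "card (subtree n u) = 2^h - 1" using card_subtree_full[OF u1 _ h] iff by blast
qed

lemma size_class_disjoint: "1 <= h ==> h < h' ==> size_class n h \<inter> size_class n h' = {}"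
proof -
 assume "1 <= h" "h < h'"
 hence "n div 2^(h' - 1) <= n div 2^h" by (intro div_le_mono2 power_increasing) auto
 thus ?thesis by (auto simp: size_class_def)
qed

lemma finite_size_class [simp]: "finite (size_class n h)" by (simp add: size_class_def)

lemma size_class_union:
 assumes "l <= h"
 shows "{n div 2^h<..n div 2^l} = (\<Union>i\<in>{l<..h}. size_class n i)"
 using assms
proof (induction h rule: dec_induct)
 case (step h)
 have "{n div 2^Suc h<..n div 2^l} = {n div 2^Suc h<..n div 2^h} \<union> {n div 2^h<..n div 2^l}"
 proof -
  have "n div 2^Suc h <= n div 2^h" by (intro div_le_mono2 power_increasing) auto
  moreover have "n div 2^h <= n div 2^l" using step by (intro div_le_mono2 power_increasing) auto
  ultimately show ?thesis by auto
 qed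
 moreover have "{l<..Suc h} = insert (Suc h) {l<..h}" using step by auto
 ultimately show ?case using step.IH by (auto simp: size_class_def)
qed simp

lemma sum_size_classes:
 fixes f :: "nat => 'b::comm_monoid_add"
 assumes "l <= h"
 shows "(\<Sum>u\<in>{n div 2^h<..n div 2^l}. f u) = (\<Sum>i\<in>{l<..h}. \<Sum>u\<in>size_class n i. f u)"
 unfolding size_class_union[OF assms]
 by (rule sum.UNION_disjoint) (auto, metis disjoint_iff linorder_neqE_nat size_class_disjoint Suc_leI le_trans less_imp_Suc_add le_add1 One_nat_def not_less_eq_eq zero_le)

lemma card_size_class:
 assumes "h >= 1"
 shows "\<bar>real (card (size_class n h)) - real n/2^h\<bar> <= 1"
proof -
 have "n div 2^h <= n div 2^(h - 1)" by (intro div_le_mono2 power_increasing) auto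
 hence c: "real (card (size_class n h)) = real (n div 2^(h - 1)) - real (n div 2^h)"
  by (simp add: size_class_def of_nat_diff)
 have fl: "real n/2^i - 1 < real (n div 2^i)" "real (n div 2^i) <= real n/2^i" for i
 proof -
  have "real n = real (n div 2^i*2^i + n mod 2^i)" by (simp only: div_mult_mod_eq)
  hence "real n = real (n div 2^i)*2^i + real (n mod 2^i)"
   by (simp only: of_nat_add of_nat_mult of_nat_power of_nat_numeral)
  moreover have "n mod 2^i < 2^i" by simp
  hence "real (n mod 2^i) < real (2^i)" by (simp only: of_nat_less_iff)
  hence "real (n mod 2^i) < 2^i" by simp
  ultimately show "real n/2^i - 1 < real (n div 2^i)" "real (n div 2^i) <= real n/2^i"
   by (simp_all add: field_simps)
 qed
 have "(2::real)^h = 2*2^(h - 1)" using assms by (cases h) auto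
 hence "real n/2^(h - 1) = 2*(real n/2^h)" by simp
 thus ?thesis using fl[of h] fl[of "h - 1"] unfolding c by linarith
qed

text \<open>A class contains about \<open>n/2^h\<close> nodes with \<open>2^h - 1\<close>
  descendants, a total of \<open>n - n/2^h\<close>. Rounding and the incomplete subtree cost
  \<open>2*2^h\<close> per class, and these costs sum geometrically to at most
  \<open>4*2^H\<close>.\<close>

lemma sum_deep_subtrees:
 assumes n: "n >= 1"
 shows "\<bar>(\<Sum>u\<in>{n div 2^H<..n}. real (card (subtree n u)))/real n - (real H - 1)\<bar> <= 4*2^H/real n + 1/2^H"
proof -
 let ?N = "%u. real (card (subtree n u))"
 have cl: "\<bar>(\<Sum>u\<in>size_class n h. ?N u) - (real n - real n/2^h)\<bar> <= 2*2^h" if h: "h >= 1" for h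
 proof -
  let ?c = "real (card (size_class n h))"
  have p: "(2::real)^h >= 1" by simp
  have up: "(\<Sum>u\<in>size_class n h. ?N u) <= ?c*(2^h - 1)"
  proof -
   have "?N u <= 2^h - 1" if "u \<in> size_class n h" for u
   proof -
    have "?N u <= real (2^h - 1)" using size_class_card(1)[OF h that] by (simp only: of_nat_le_iff)
    thus ?thesis by (simp add: of_nat_diff)
   qed
   hence "(\<Sum>u\<in>size_class n h. ?N u) <= of_nat (card (size_class n h))*(2^h - 1)"
    by (rule sum_bounded_above)
   thus ?thesis by simp
  qed
  have lo: "(?c - 1)*(2^h - 1) <= (\<Sum>u\<in>size_class n h. ?N u)"
  proof -
   let ?A = "size_class n h - {n div 2^(h - 1)}"
   have "?c - 1 <= real (card ?A)"
    by (auto simp: card_Diff_singleton_if)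
   hence "(?c - 1)*(2^h - 1) <= real (card ?A)*(2^h - 1)" using p by (intro mult_right_mono) auto
   also have "... = (\<Sum>u\<in>?A. ?N u)"
   proof -
    have "?N u = 2^h - 1" if "u \<in> ?A" for u
     using size_class_card(2)[OF h, of u n] that by (simp add: of_nat_diff)
    thus ?thesis by simp
   qed
   also have "... <= (\<Sum>u\<in>size_class n h. ?N u)" by (intro sum_mono2) auto
   finally show ?thesis .
  qed
  have c: "\<bar>?c - real n/2^h\<bar> <= 1" by (rule card_size_class[OF h])
  have e: "real n/2^h*(2^h - 1) = real n - real n/2^h" by (simp add: field_simps)
  have "?c*(2^h - 1) <= (real n/2^h + 1)*(2^h - 1)" using c p by (intro mult_right_mono) auto
  moreover have "(real n/2^h - 2)*(2^h - 1) <= (?c - 1)*(2^h - 1)" using c p by (intro mult_right_mono) auto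
  ultimately show ?thesis using up lo e p by (simp add: abs_le_iff left_diff_distrib distrib_right)
 qed
 have "(\<Sum>u\<in>{n div 2^H<..n}. ?N u) = (\<Sum>h\<in>{0<..H}. \<Sum>u\<in>size_class n h. ?N u)"
  using sum_size_classes[of 0 H ?N n] by simp
 moreover have "{0<..H} = {1..H}" by auto
 ultimately have s: "(\<Sum>u\<in>{n div 2^H<..n}. ?N u) = (\<Sum>h\<in>{1..H}. \<Sum>u\<in>size_class n h. ?N u)" by simp
 have "\<bar>(\<Sum>u\<in>{n div 2^H<..n}. ?N u) - (\<Sum>h\<in>{1..H}. real n - real n/2^h)\<bar> <= (\<Sum>h\<in>{1..H}. 2*2^h)"
  unfolding s sum_subtractf[symmetric] using cl by (intro order_trans[OF sum_abs] sum_mono) auto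
 also have "(\<Sum>h\<in>{1..H}. 2*2^h) <= 4*(2::real)^H" by (induction H) auto
 finally have b: "\<bar>(\<Sum>u\<in>{n div 2^H<..n}. ?N u) - (\<Sum>h\<in>{1..H}. real n - real n/2^h)\<bar> <= 4*2^H" .
 have v: "(\<Sum>h\<in>{1..H}. real n - real n/2^h) = real n*(real H - 1 + 1/2^H)"
  by (induction H) (auto simp: field_simps)
 have n0: "real n > 0" using n by simp
 let ?S = "\<Sum>u\<in>{n div 2^H<..n}. ?N u"
 have "?S/real n - (real H - 1) = (?S - real n*(real H - 1 + 1/2^H))/real n + 1/2^H"
  using n0 by (simp add: field_simps)
 also have "\<bar>...\<bar> <= \<bar>(?S - real n*(real H - 1 + 1/2^H))/real n\<bar> + \<bar>1/2^H\<bar>" by (rule abs_triangle_ineq)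
 also have "\<bar>(?S - real n*(real H - 1 + 1/2^H))/real n\<bar> <= 4*2^H/real n"
  using b n0 unfolding v by (simp add: abs_divide divide_right_mono)
 finally show ?thesis by simp
qed

section \<open>Nodes sharing an ancestor outside the top of the tree\<close>

text \<open>The part of the path from the root to \<open>v\<close> whose alarms remain random after
  conditioning on the nodes up to \<open>J\<close>.\<close>

definition outer :: "nat => nat => nat set" where
 "outer J v = insert v (ancs v) - {1..J}"

text \<open>The smallest common outer node must have its parent among \<open>1..J\<close>, hence
  lies between \<open>J + 1\<close> and \<open>2*J + 1\<close>.\<close>

lemma outer_conflict:
 assumes "outer J v \<inter> outer J v' ~= {}" "v \<in> {1..n}" "v' \<in> {1..n}"
 shows "\<exists>w\<in>{J+1..2*J+1}. v \<in> subtree n w & v' \<in> subtree n w"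
proof -
 define C where "C = outer J v \<inter> outer J v'"
 have fin: "finite C" by (simp add: C_def outer_def)
 define w where "w = Min C"
 have w: "w \<in> C" unfolding w_def by (rule Min_in) (use fin assms C_def in auto)
 have min: "x \<in> C ==> w <= x" for x unfolding w_def using fin by (rule Min_le)
 have w0: "w >= 1" using w assms ancs_subset[of v] by (auto simp: C_def outer_def)
 hence wJ: "w > J" using w by (auto simp: C_def outer_def)
 have wv: "v = w \<or> ancestor w v" "v' = w \<or> ancestor w v'" using w by (auto simp: C_def outer_def ancs_def)
 have "w <= 2*J + 1"
 proof (rule ccontr)
  assume "~ w <= 2*J + 1"
  hence h: "w div 2 > J" "w >= 2" by auto
  hence a: "ancestor (w div 2) w" by (auto simp: ancestor_iff intro!: exI[of _ 1])
  have "w div 2 \<in> C" using wv a ancestor_trans[OF a] h by (auto simp: C_def outer_def ancs_def)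
  thus False using min[of "w div 2"] w0 by simp
 qed
 thus ?thesis using wJ wv assms by (intro bexI[of _ w]) (auto simp: subtree_def)
qed

text \<open>Conflicting pairs lie in a common subtree of one of \<open>J + 1\<close> nodes, each of
  size at most \<open>2n/(J + 1)\<close>.\<close>

lemma card_conflicts:
 "real (card {(v, v'). v \<in> {1..n} & v' \<in> {1..n} & outer J v \<inter> outer J v' ~= {}}) <= 4*(real n)\<^sup>2/real (J + 1)"
proof -
 let ?N = "%w. real (card (subtree n w))"
 let ?P = "{(v, v'). v \<in> {1..n} & v' \<in> {1..n} & outer J v \<inter> outer J v' ~= {}}"
 have "?P \<subseteq> (\<Union>w\<in>{J+1..2*J+1}. subtree n w \<times> subtree n w)"
  using outer_conflict by fastforce
 hence "card ?P <= card (\<Union>w\<in>{J+1..2*J+1}. subtree n w \<times> subtree n w)"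
  by (intro card_mono) auto
 also have "... <= (\<Sum>w\<in>{J+1..2*J+1}. card (subtree n w \<times> subtree n w))" by (rule card_UN_le) simp
 finally have "real (card ?P) <= real (\<Sum>w\<in>{J+1..2*J+1}. card (subtree n w \<times> subtree n w))"
  by (simp only: of_nat_le_iff)
 also have "... = (\<Sum>w\<in>{J+1..2*J+1}. (?N w)\<^sup>2)" by (simp add: card_cartesian_product power2_eq_square)
 also have "... <= (\<Sum>w\<in>{J+1..2*J+1}. (2*real n/real (J + 1))\<^sup>2)"
 proof (rule sum_mono, rule power_mono)
  fix w assume w: "w \<in> {J+1..2*J+1}"
  have "real (card (subtree n w)*w) <= real (2*n)" using card_subtree_mult_le[of w n] w unfolding of_nat_le_iff by auto
  hence "?N w*real w <= 2*real n" by simp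
  moreover have "?N w*real (J + 1) <= ?N w*real w" using w by (intro mult_left_mono) auto
  ultimately show "?N w <= 2*real n/real (J + 1)" by (simp add: field_simps)
 qed simp
 also have "... = real (J + 1)*(2*real n/real (J + 1))\<^sup>2" by simp
 also have "... = 4*(real n)\<^sup>2/real (J + 1)"
 proof -
  have "x*(2*y/x)\<^sup>2 = 4*y\<^sup>2/x" if "x ~= 0" for x y :: real
   using that by (simp add: power2_eq_square)
  thus ?thesis by (simp del: of_nat_add of_nat_Suc)
 qed
 finally show ?thesis .
qed

section \<open>Measurability, conditioning on independent variables, and elementary power
  bounds\<close>

lemma of_bool_borel_measurable [measurable (raw)]:
 "Measurable.pred M P ==> (%x. of_bool (P x) :: real) \<in> borel_measurable M"
 unfolding of_bool_def by measurable

lemma fst_snd_borel [measurable]: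
 "fst \<in> borel_measurable (borel :: (real \<times> real) measure)"
 "snd \<in> borel_measurable (borel :: (real \<times> real) measure)"
 by (simp_all add: borel_prod[symmetric])

lemma indep_var_expectation_fubini:
 fixes f :: "'b => 'b => real"
 assumes M: "prob_space M" and ind: "prob_space.indep_var M S P T Q"
  and f: "(%(p, q). f p q) \<in> borel_measurable (S \<Otimes>\<^sub>M T)" and B: "!!p q. \<bar>f p q\<bar> <= B"
 shows "(LINT w|M. f (P w) (Q w)) = (LINT w|M. (LINT w'|M. f (P w) (Q w')))"
proof -
 interpret M: prob_space M by fact
 have rv [measurable]: "P \<in> measurable M S" "Q \<in> measurable M T"
  using M.indep_var_rv1[OF ind] M.indep_var_rv2[OF ind] by auto
 interpret PP: prob_space "distr M S P" by (rule M.prob_space_distr) simp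
 interpret QQ: prob_space "distr M T Q" by (rule M.prob_space_distr) simp
 interpret PQ: pair_prob_space "distr M S P" "distr M T Q" ..
 have eq: "distr M S P \<Otimes>\<^sub>M distr M T Q = distr M (S \<Otimes>\<^sub>M T) (%w. (P w, Q w))"
  using ind by (simp add: M.indep_var_distribution_eq)
 note [measurable] = f
 have fm: "(%x. f (fst x) (snd x)) \<in> borel_measurable (S \<Otimes>\<^sub>M T)"
  using f by (simp add: case_prod_beta')
 have fm': "(%x. f (fst x) (snd x)) \<in> borel_measurable (distr M S P \<Otimes>\<^sub>M distr M T Q)"
  using fm by (simp cong: measurable_cong_sets)
 have "(LINT w|M. f (P w) (Q w)) = (LINT x|distr M (S \<Otimes>\<^sub>M T) (%w. (P w, Q w)). f (fst x) (snd x))"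
  using fm by (subst integral_distr) auto
 also have "... = (LINT x|(distr M S P \<Otimes>\<^sub>M distr M T Q). f (fst x) (snd x))" by (simp only: eq)
 also have "... = (LINT p|distr M S P. LINT q|distr M T Q. f (fst (p, q)) (snd (p, q)))"
  by (rule PQ.integral_fst'[symmetric], rule PQ.integrable_const_bound[of _ B]) (use B fm' in auto)
 also have "... = (LINT p|distr M S P. LINT w'|M. f p (Q w'))"
 proof (rule bochner_integral_cong[OF refl])
  fix p assume p: "p \<in> space (distr M S P)"
  hence "f p \<in> borel_measurable T" using measurable_Pair2[OF f, of p] by simp
  thus "(LINT q|distr M T Q. f (fst (p, q)) (snd (p, q))) = (LINT w'|M. f p (Q w'))"
   by (simp add: integral_distr)
 qed
 also have "... = (LINT w|M. (LINT w'|M. f (P w) (Q w')))"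
 proof (rule integral_distr)
  have "(%(p, w'). f p (Q w')) = (%(p, q). f p q) \<circ> (%(p, w'). (p, Q w'))" by auto
  also have "... \<in> borel_measurable (S \<Otimes>\<^sub>M M)" by (rule measurable_comp[OF _ f]) measurable
  finally show "(%p. LINT w'|M. f p (Q w')) \<in> borel_measurable S"
   by (rule M.borel_measurable_lebesgue_integral)
 qed simp
 finally show ?thesis .
qed

text \<open>\<open>zero\<close> says that \<open>f\<close> has conditional mean zero given
  \<open>P\<close>; such a variable is orthogonal to every bounded function of
  \<open>P\<close>.\<close>

lemma indep_var_orthogonal:
 fixes f :: "'b => 'b => real" and g :: "'b => real"
 assumes M: "prob_space M" and ind: "prob_space.indep_var M S P T Q"
  and f: "(%(p, q). f p q) \<in> borel_measurable (S \<Otimes>\<^sub>M T)" and B: "!!p q. \<bar>f p q\<bar> <= B"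
  and g: "g \<in> borel_measurable S" and C: "!!p. \<bar>g p\<bar> <= C"
  and zero: "!!p. (LINT w|M. f p (Q w)) = 0"
 shows "(LINT w|M. f (P w) (Q w)*g (P w)) = 0"
proof -
 have "(LINT w|M. f (P w) (Q w)*g (P w)) = (LINT w|M. (LINT w'|M. f (P w) (Q w')*g (P w)))"
 proof (rule indep_var_expectation_fubini[OF M ind, where B="B*C" and f="%p q. f p q*g p"])
  note [measurable] = g
  have "(%x. (%(p, q). f p q) x*g (fst x)) \<in> borel_measurable (S \<Otimes>\<^sub>M T)"
   by (intro borel_measurable_times f) measurable
  thus "(%(p, q). f p q*g p) \<in> borel_measurable (S \<Otimes>\<^sub>M T)" by (simp add: case_prod_beta')
  have "0 <= B" using B abs_ge_zero order_trans by blast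
  thus "\<bar>f p q*g p\<bar> <= B*C" for p q using B[of p q] C[of p] by (simp add: abs_mult mult_mono)
 qed
 also have "... = 0" by (simp add: zero)
 finally show ?thesis .
qed

lemma one_minus_power_bounds:
 fixes t :: real
 assumes t: "0 <= t" "t <= 1"
 shows "0 <= (1 - t)^a - 1 + real a*t" "(1 - t)^a - 1 + real a*t <= (real a)\<^sup>2*t\<^sup>2"
  "1 - (1 - t)^a <= real a*t"
proof -
 show *: "0 <= (1 - t)^a - 1 + real a*t"
  using Bernoulli_inequality[of "- t" a] t by simp
 thus "1 - (1 - t)^a <= real a*t" by simp
 show "(1 - t)^a - 1 + real a*t <= (real a)\<^sup>2*t\<^sup>2"
 proof (induction a)
  case (Suc a)
  have "(1 - t)^Suc a <= (1 - t)*(1 - real a*t + (real a)\<^sup>2*t\<^sup>2)"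
   using Suc t by (simp, intro mult_left_mono) auto
  also have "... = 1 - real (Suc a)*t + ((real a)\<^sup>2 + real a)*t\<^sup>2 - (real a)\<^sup>2*t^3"
   by (simp add: algebra_simps power2_eq_square power3_eq_cube)
  also have "... <= 1 - real (Suc a)*t + (real (Suc a))\<^sup>2*t\<^sup>2 - 0"
   using t by (intro diff_mono add_left_mono mult_right_mono) (auto simp: power2_eq_square algebra_simps)
  finally show ?case by simp
 qed simp
qed

section \<open>Records in one tree: conditional probabilities given the top nodes, and
  orthogonality\<close>

locale alarm_tree =
 fixes M :: "'a measure" and n k r :: nat and E :: "nat => nat => 'a => real"
 assumes iid: "iid_exponential M n E" and k: "1 <= k" and r: "1 <= r" "r <= k"
begin

sublocale prob_space M using iid by (simp add: iid_exponential_def)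

definition T :: "nat => 'a => real" where "T v = alarm E k v"
definition S :: "nat => 'a => real" where "S v = alarm E r v"

text \<open>The \<open>r\<close>-th and \<open>k\<close>-th alarms of one node are dependent;
  independence across nodes is therefore stated for the pairs.\<close>

definition Z :: "nat => 'a => real \<times> real" where "Z v w = (S v w, T v w)"

lemma indep_E: "indep_vars (%_. borel) (%(j, v). E j v) ({1..} \<times> {1..n})"
 using iid by (simp add: iid_exponential_def bin_tree_def)

lemma E_dist: "j >= 1 ==> v \<in> {1..n} ==> distributed M lborel (E j v) (exponential_density 1)"
 using iid by (auto simp: iid_exponential_def bin_tree_def)

lemma E_measurable [measurable]: "j >= 1 ==> v \<in> {1..n} ==> E j v \<in> borel_measurable M"
 using E_dist distributed_measurable by fastforce

lemma alarm_measurable: "v \<in> {1..n} ==> alarm E s v \<in> borel_measurable M"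
 unfolding alarm_def by (intro borel_measurable_sum E_measurable) auto

lemma S_measurable [measurable]: "v \<in> {1..n} ==> S v \<in> borel_measurable M"
 and T_measurable [measurable]: "v \<in> {1..n} ==> T v \<in> borel_measurable M"
 unfolding S_def T_def by (rule alarm_measurable; assumption)+

lemma indep_Z: "indep_vars (%_. borel) Z {1..n}"
proof -
 let ?K = "%v. {1..k} \<times> {v}"
 let ?X = "%(j, v). E j v"
 have "indep_vars (%v. PiM (?K v) (%_. borel)) (%v w. restrict (%i. ?X i w) (?K v)) {1..n}"
  by (rule indep_vars_restrict[OF indep_E]) (auto simp: disjoint_family_on_def)
 hence "indep_vars (%_. borel) (%v w. (%f. (\<Sum>j=1..r. f (j, v), \<Sum>j=1..k. f (j, v))) (restrict (%i. ?X i w) (?K v))) {1..n}"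
 proof (rule indep_vars_compose2)
  fix v assume "v \<in> {1..n}"
  have c: "(%f. f (j, v)) \<in> borel_measurable (PiM (?K v) (%_. borel))" if "j \<in> {1..k}" for j
   using that by (intro measurable_component_singleton) auto
  show "(%f. (\<Sum>j=1..r. f (j, v), \<Sum>j=1..k. f (j, v))) \<in> measurable (PiM (?K v) (%_. borel)) (borel :: (real \<times> real) measure)"
   by (intro borel_measurable_Pair borel_measurable_sum c) (use r in auto)
 qed
 also have "?this \<longleftrightarrow> ?thesis"
  by (rule indep_vars_cong) (use r in \<open>auto simp: Z_def S_def T_def alarm_def fun_eq_iff intro!: sum.cong\<close>)
 finally show ?thesis .
qed

lemma alarm_distributed:
 assumes s: "1 <= s" and v: "v \<in> {1..n}"
 shows "distributed M lborel (alarm E s v) (erlang_density (s - 1) 1)"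
proof -
 let ?I = "{1..s} \<times> {v}"
 have "indep_vars (%_. borel) (%(j, v). E j v) ?I"
  by (rule indep_vars_subset[OF indep_E]) (use v in auto)
 hence "distributed M lborel (%x. \<Sum>i\<in>?I. (%(j, v). E j v) i x) (erlang_density (card ?I - 1) 1)"
  by (intro exponential_distributed_sum) (use s v E_dist in auto)
 moreover have "(%x. \<Sum>i\<in>?I. (%(j, v). E j v) i x) = alarm E s v"
 proof
  fix x
  show "(\<Sum>i\<in>?I. (%(j, v). E j v) i x) = alarm E s v x"
   unfolding alarm_def by (rule sum.reindex_bij_witness[where i="%j. (j, v)" and j=fst]) auto
 qed
 ultimately show ?thesis by simp
qed

lemma prob_T_gt:
 assumes v: "v \<in> {1..n}" and x: "0 <= x"
 shows "\<P>(w in M. x < T v w) = Qk k x"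
proof -
 have "\<P>(w in M. x < T v w) = 1 - erlang_CDF (k - 1) 1 x"
  unfolding T_def by (rule erlang_distributed_gt[OF alarm_distributed[OF k v]]) (use x in auto)
 also have "... = (\<Sum>i\<le>k - 1. x^i*exp (- x)/fact i)" using x by (simp add: erlang_CDF_def)
 also have "{..k - 1} = {..<k}" using k by auto
 also have "(\<Sum>i<k. x^i*exp (- x)/fact i) = Qk k x"
  by (simp add: Qk_def exp_trunc_def sum_distrib_right)
 finally show ?thesis .
qed

lemma expectation_alarm:
 assumes s: "1 <= s" and v: "v \<in> {1..n}" and f: "f \<in> borel_measurable borel"
 shows "(LINT w|M. f (alarm E s v w)) = (PINT x. gr s x *\<^sub>R (f x :: 'b::{banach, second_countable_topology}))"
proof -
 have "(LINT w|M. f (alarm E s v w)) = (LINT x|distr M lborel (alarm E s v). f x)"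
  using f alarm_measurable[OF v] by (subst integral_distr) auto
 also have "... = (LINT x|density lborel (%x. ennreal (erlang_density (s - 1) 1 x)). f x)"
  using distributed_distr_eq_density[OF alarm_distributed[OF s v]] by simp
 also have "... = (LINT x|lborel. erlang_density (s - 1) 1 x *\<^sub>R f x)"
  using f by (subst integral_density) auto
 also have "... = (PINT x. gr s x *\<^sub>R f x)"
  unfolding set_lebesgue_integral_def
 proof (rule integral_cong_AE)
  have [measurable]: "f \<in> borel_measurable lborel" using f by simp
  show "(%x. erlang_density (s - 1) 1 x *\<^sub>R f x) \<in> borel_measurable lborel" by measurable
  show "(%x. indicator {0<..} x *\<^sub>R gr s x *\<^sub>R f x) \<in> borel_measurable lborel" by measurable
  show "AE x in lborel. erlang_density (s - 1) 1 x *\<^sub>R f x = indicator {0<..} x *\<^sub>R gr s x *\<^sub>R f x"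
   by (rule AE_I[where N="{0}"]) (auto simp: erlang_density_def gr_def indicator_def split: if_splits)
 qed
 finally show ?thesis .
qed

lemma prob_all_gt:
 assumes L: "L \<subseteq> {1..n}" and x: "0 <= x"
 shows "(LINT w|M. of_bool (\<forall>u\<in>L. x < T u w)) = Qk k x^card L"
proof -
 have fin: "finite L" using L by (rule finite_subset) simp
 have e: "(LINT w|M. of_bool (\<forall>u\<in>L. x < T u w)) = prob {w \<in> space M. \<forall>u\<in>L. x < T u w}"
 proof -
  have [measurable]: "{w \<in> space M. \<forall>u\<in>L. x < T u w} \<in> sets M"
   using L fin T_measurable by (intro sets.sets_Collect_finite_All) (auto intro!: borel_measurable_less)
  have "(LINT w|M. of_bool (\<forall>u\<in>L. x < T u w)) = (LINT w|M. indicator {w \<in> space M. \<forall>u\<in>L. x < T u w} w :: real)"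
   by (intro bochner_integral_cong) (auto simp: indicator_def)
  thus ?thesis by simp
 qed
 show ?thesis
 proof (cases "L = {}")
  case False
  have ind: "indep_vars (%_. borel) (%v w. snd (Z v w)) L"
   by (rule indep_vars_compose2[OF indep_vars_subset[OF indep_Z L]]) auto
  have "prob (\<Inter>u\<in>L. (%w. snd (Z u w)) -` {x<..} \<inter> space M) = (\<Prod>u\<in>L. prob ((%w. snd (Z u w)) -` {x<..} \<inter> space M))"
   by (rule indep_varsD_finite[OF ind False fin]) auto
  also have "(\<Inter>u\<in>L. (%w. snd (Z u w)) -` {x<..} \<inter> space M) = {w \<in> space M. \<forall>u\<in>L. x < T u w}"
   using False by (auto simp: Z_def)
  also have "(\<Prod>u\<in>L. prob ((%w. snd (Z u w)) -` {x<..} \<inter> space M)) = (\<Prod>u\<in>L. Qk k x)"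
  proof (rule prod.cong[OF refl])
   fix u assume "u \<in> L"
   have "(%w. snd (Z u w)) -` {x<..} \<inter> space M = {w \<in> space M. x < T u w}" by (auto simp: Z_def)
   thus "prob ((%w. snd (Z u w)) -` {x<..} \<inter> space M) = Qk k x"
    using prob_T_gt[of u x] \<open>u \<in> L\<close> L x by auto
  qed
  finally show ?thesis unfolding e by simp
 qed (simp add: prob_space)
qed

lemma record_prob:
 assumes v: "v \<in> {1..n}" and L: "L \<subseteq> {1..n}" "v \<notin> L" and B: "B \<in> sets borel"
 shows "(LINT w|M. of_bool (S v w \<in> B & (\<forall>u\<in>L. S v w < T u w)))
  = (PINT x. gr r x*(of_bool (x \<in> B)*Qk k x^card L))"
proof -
 have fin: "finite L" using L by (intro finite_subset[OF L(1)]) simp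
 have ind0: "indep_var (PiM {v} (%_. borel)) (%w. restrict (%i. Z i w) {v}) (PiM L (%_. borel)) (%w. restrict (%i. Z i w) L)"
  by (rule indep_var_restrict[OF indep_Z]) (use v L in auto)
 let ?P1 = "PiM {v} (%_. borel :: (real \<times> real) measure)"
 let ?P2 = "PiM L (%_. borel :: (real \<times> real) measure)"
 let ?f = "%p q. of_bool (fst (p v) \<in> B & (\<forall>u\<in>L. fst (p v) < snd (q u))) :: real"
 let ?h = "%s. LINT w'|M. of_bool (s \<in> B & (\<forall>u\<in>L. s < T u w')) :: real"
 note [measurable] = B fin
 have meas: "(%(p, q). ?f p q) \<in> borel_measurable (?P1 \<Otimes>\<^sub>M ?P2)" by measurable
 have "(LINT w|M. of_bool (S v w \<in> B & (\<forall>u\<in>L. S v w < T u w))) = (LINT w|M. ?f (restrict (%i. Z i w) {v}) (restrict (%i. Z i w) L))"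
  by (intro bochner_integral_cong) (auto simp: Z_def)
 also have "... = (LINT w|M. (LINT w'|M. ?f (restrict (%i. Z i w) {v}) (restrict (%i. Z i w') L)))"
  by (rule indep_var_expectation_fubini[OF prob_space_axioms ind0 meas, where B=1]) auto
 also have "... = (LINT w|M. ?h (alarm E r v w))"
  by (intro bochner_integral_cong refl) (auto simp: Z_def S_def[symmetric])
 also have "... = (PINT x. gr r x *\<^sub>R ?h x)"
 proof (rule expectation_alarm[OF r(1) v])
  have [measurable]: "u \<in> L ==> T u \<in> borel_measurable M" for u using L by auto
  show "?h \<in> borel_measurable borel" by measurable
 qed
 also have "... = (PINT x. gr r x*(of_bool (x \<in> B)*Qk k x^card L))"
 proof (rule set_lebesgue_integral_cong)
  show "\<forall>x. x \<in> {0<..} --> gr r x *\<^sub>R ?h x = gr r x*(of_bool (x \<in> B)*Qk k x^card L)"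
  proof (intro allI impI)
   fix x :: real assume "x \<in> {0<..}"
   hence x: "0 <= x" by simp
   have "?h x = (LINT w'|M. of_bool (x \<in> B) * of_bool (\<forall>u\<in>L. x < T u w'))"
    by (intro bochner_integral_cong) auto
   also have "... = of_bool (x \<in> B)*Qk k x^card L"
    using prob_all_gt[OF L(1) x] by simp
   finally show "gr r x *\<^sub>R ?h x = gr r x*(of_bool (x \<in> B)*Qk k x^card L)" by simp
  qed
 qed simp
 finally show ?thesis .
qed

definition top :: "nat => nat => nat set" where "top J v = ancs v \<inter> {1..J}"
definition low :: "nat => nat => nat set" where "low J v = ancs v - {1..J}"

definition I :: "nat => 'a => real" where "I v w = of_bool (is_record E k r v w)"

text \<open>For \<open>v > J\<close>, the conditional probability that \<open>v\<close> is a record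
  given the alarms of the nodes up to \<open>J\<close>: the alarm of \<open>v\<close> is integrated
  with density \<open>gr r\<close>, and the lower ancestors contribute one factor \<open>Qk\<close>
  each.\<close>

definition Y :: "nat => nat => 'a => real" where
 "Y J v w = (PINT x. gr r x*(of_bool (x \<in> {x. \<forall>u\<in>top J v. x < T u w})*Qk k x^card (low J v)))"

lemma I_eq: "I v w = of_bool (\<forall>u\<in>ancs v. S v w < T u w)"
 by (simp add: I_def is_record_def ancs_def S_def T_def)

lemma Y_integrand_bounds:
 fixes x :: real
 assumes "0 < x"
 shows "0 <= of_bool b*Qk k x^e" "of_bool b*Qk k x^e <= (1::real)"
 using assms by (auto simp: Qk_nonneg Qk_le_1 power_le_one)

lemma gr_Q_integrable:
 assumes "B \<in> sets borel"
 shows "pos_integrable (%x. gr r x*(of_bool (x \<in> B)*Qk k x^e))"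
proof (rule gr_weighted_integrable[OF r(1)])
 have "(%x. indicator B x*Qk k x^e) \<in> borel_measurable borel" using assms by measurable
 thus "(%x. of_bool (x \<in> B)*Qk k x^e) \<in> borel_measurable borel"
  by (simp add: indicator_def of_bool_def)
 show "\<bar>of_bool (x \<in> B)*Qk k x^e\<bar> <= 1" if "0 < x" for x
  using Y_integrand_bounds[OF that, of "x \<in> B" e] by (simp only: abs_of_nonneg)
qed

lemma gr_Q_bounds:
 assumes "B \<in> sets borel"
 shows "0 <= (PINT x. gr r x*(of_bool (x \<in> B)*Qk k x^e))"
  "(PINT x. gr r x*(of_bool (x \<in> B)*Qk k x^e)) <= 1"
proof -
 show "0 <= (PINT x. gr r x*(of_bool (x \<in> B)*Qk k x^e))"
  unfolding set_lebesgue_integral_def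
  by (intro integral_nonneg_AE AE_I2) (auto simp: indicator_def gr_nonneg Qk_nonneg)
 have "(PINT x. gr r x*(of_bool (x \<in> B)*Qk k x^e)) <= (PINT x. gr r x)"
 proof (rule set_integral_mono[OF gr_Q_integrable[OF assms] gr_integral(1)[OF r(1)]])
  fix x :: real assume "x \<in> {0<..}"
  thus "gr r x*(of_bool (x \<in> B)*Qk k x^e) <= gr r x"
   using Y_integrand_bounds[of x "x \<in> B" e] gr_nonneg[of x r] by (intro mult_left_le) auto
 qed
 thus "(PINT x. gr r x*(of_bool (x \<in> B)*Qk k x^e)) <= 1"
  using gr_integral(2)[OF r(1)] by simp
qed

lemma gt_set_borel: "finite A ==> {x. \<forall>u\<in>A. x < (c u :: real)} \<in> sets borel"
proof -
 assume "finite A"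
 hence "{x \<in> space borel. \<forall>u\<in>A. x < c u} \<in> sets borel" by (intro sets.sets_Collect_finite_All) auto
 thus ?thesis by simp
qed

lemma Y_bounds: "0 <= Y J v w" "Y J v w <= 1"
 unfolding Y_def by (intro gr_Q_bounds gt_set_borel, simp add: top_def)+

text \<open>Condition on all nodes outside \<open>outer J v\<close>. They determine the factor of
  \<open>v'\<close>, since the outer parts are disjoint, and the conditional mean of
  \<open>I v\<close> given them is \<open>Y J v\<close>.\<close>

lemma orthogonal:
 assumes v: "v \<in> {1..n}" "J < v" and v': "v' \<in> {1..n}" "J < v'"
  and dis: "outer J v \<inter> outer J v' = {}"
 shows "(LINT w|M. (I v w - Y J v w)*(I v' w - Y J v' w)) = 0"
proof -
 define K2 where "K2 = outer J v"
 define K1 where "K1 = {1..n} - K2"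
 have K2e: "K2 = insert v (low J v)" using v by (auto simp: K2_def outer_def low_def)
 have sub: "K2 \<subseteq> {1..n}" using ancs_subset[of v] v by (auto simp: K2_def outer_def)
 have top1: "top J v \<subseteq> K1" using ancs_subset[of v] v by (auto simp: K1_def K2_def outer_def top_def)
 have anc1: "insert v' (ancs v') \<subseteq> K1"
 proof
  fix u assume u: "u \<in> insert v' (ancs v')"
  hence "u \<in> {1..n}" using ancs_subset[of v'] v' by auto
  moreover have "u \<notin> K2"
  proof
   assume "u \<in> K2"
   hence "u \<in> outer J v'" using u by (auto simp: K2_def outer_def)
   thus False using dis \<open>u \<in> K2\<close> by (auto simp: K2_def)
  qed
  ultimately show "u \<in> K1" by (simp add: K1_def)
 qed
 have fin: "finite K1" "finite K2" using sub finite_subset by (auto simp: K1_def)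
 let ?P1 = "PiM K1 (%_. borel :: (real \<times> real) measure)"
 let ?P2 = "PiM K2 (%_. borel :: (real \<times> real) measure)"
 let ?P = "%w. restrict (%i. Z i w) K1"
 let ?Q = "%w. restrict (%i. Z i w) K2"
 have ind: "indep_var ?P1 ?P ?P2 ?Q"
  by (rule indep_var_restrict[OF indep_Z]) (use sub in \<open>auto simp: K1_def\<close>)
 define y where "y A e p = (PINT x. gr r x*(of_bool (x \<in> {x. \<forall>u\<in>A. x < snd (p u)})*Qk k x^e))"
  for A :: "nat set" and e and p :: "nat => real \<times> real"
 have y_meas: "y A e \<in> borel_measurable ?P1" if A: "A \<subseteq> K1" for A e
 proof -
  have [measurable]: "finite A" "!!u. u \<in> A ==> u \<in> K1" using A fin finite_subset by auto
  show ?thesis unfolding y_def[abs_def] mem_Collect_eq set_lebesgue_integral_def by measurable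
 qed
 have y_bd: "0 <= y A e p & y A e p <= 1" if "finite A" for A e p
  unfolding y_def using gr_Q_bounds[OF gt_set_borel[OF that]] by simp
 have Yv: "Y J v w = y (top J v) (card (low J v)) (?P w)" for w
 proof -
  have "{x. \<forall>u\<in>top J v. x < T u w} = {x. \<forall>u\<in>top J v. x < snd (?P w u)}"
   using top1 by (auto simp: Z_def)
  thus ?thesis by (simp add: Y_def y_def)
 qed
 have top1': "top J v' \<subseteq> K1" using anc1 by (auto simp: top_def)
 have Yv': "Y J v' w = y (top J v') (card (low J v')) (?P w)" for w
 proof -
  have "{x. \<forall>u\<in>top J v'. x < T u w} = {x. \<forall>u\<in>top J v'. x < snd (?P w u)}"
   using top1' by (auto simp: Z_def)
  thus ?thesis by (simp add: Y_def y_def)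
 qed
 \<comment> \<open>The record indicator of \<open>v\<close> as a function of both groups of alarms:
   \<open>p\<close> outside and \<open>q\<close> inside \<open>outer J v\<close>.\<close>
 define \<iota> where "\<iota> p q = (of_bool ((\<forall>u\<in>top J v. fst (q v) < snd (p u)) & (\<forall>u\<in>low J v. fst (q v) < snd (q u))) :: real)"
  for p q :: "nat => real \<times> real"
 have Iv: "I v w = \<iota> (?P w) (?Q w)" for w
 proof -
  have "ancs v = top J v \<union> low J v" by (auto simp: top_def low_def)
  thus ?thesis unfolding I_eq \<iota>_def using top1 K2e by (auto simp: Z_def)
 qed
 define g where "g p = of_bool (\<forall>u\<in>ancs v'. fst (p v') < snd (p u)) - y (top J v') (card (low J v')) p"
  for p :: "nat => real \<times> real"
 have gI: "I v' w - Y J v' w = g (?P w)" for w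
  unfolding I_eq Yv' g_def using anc1 by (auto simp: Z_def)
 have g_meas: "g \<in> borel_measurable ?P1"
 proof -
  have [measurable]: "v' \<in> K1" "!!u. u \<in> ancs v' ==> u \<in> K1" using anc1 by auto
  show ?thesis unfolding g_def[abs_def] by (intro borel_measurable_diff y_meas top1') measurable
 qed
 have \<iota>_meas: "(%(p, q). \<iota> p q - y (top J v) (card (low J v)) p) \<in> borel_measurable (?P1 \<Otimes>\<^sub>M ?P2)"
 proof -
  have [measurable]: "v \<in> K2" "!!u. u \<in> low J v ==> u \<in> K2" "!!u. u \<in> top J v ==> u \<in> K1"
   "finite (top J v)" "finite (low J v)" "y (top J v) (card (low J v)) \<in> borel_measurable ?P1"
   using K2e top1 y_meas by (auto simp: top_def low_def)
  show ?thesis unfolding \<iota>_def by measurable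
 qed
 have "(LINT w|M. (\<iota> (?P w) (?Q w) - y (top J v) (card (low J v)) (?P w))*g (?P w)) = 0"
 proof (rule indep_var_orthogonal[OF prob_space_axioms ind \<iota>_meas _ g_meas])
  have ft: "finite (top J v)" "finite (top J v')" by (auto simp: top_def)
  show "\<bar>\<iota> p q - y (top J v) (card (low J v)) p\<bar> <= 1" for p q
   using y_bd[OF ft(1), of "card (low J v)" p] by (auto simp: \<iota>_def of_bool_def)
  show "\<bar>g p\<bar> <= 1" for p
   using y_bd[OF ft(2), of "card (low J v')" p] by (auto simp: g_def of_bool_def)
  fix p
  have vL: "v \<notin> low J v" "low J v \<subseteq> {1..n}" using ancs_subset[of v] sub K2e by (auto simp: low_def)
  have im: "(%w. \<iota> p (?Q w)) = (%w. of_bool (S v w \<in> {x. \<forall>u\<in>top J v. x < snd (p u)} & (\<forall>u\<in>low J v. S v w < T u w)))"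
   using K2e by (auto simp: \<iota>_def Z_def fun_eq_iff)
  have mI: "(%w. \<iota> p (?Q w)) \<in> borel_measurable M"
  proof -
   have [measurable]: "S v \<in> borel_measurable M" "!!u. u \<in> low J v ==> T u \<in> borel_measurable M" "finite (top J v)" "finite (low J v)"
    using v vL by (auto simp: top_def low_def)
   show ?thesis unfolding im by measurable
  qed
  have int: "integrable M (%w. \<iota> p (?Q w))"
   by (rule integrable_const_bound[of _ 1]) (use mI in \<open>auto simp: \<iota>_def\<close>)
  have "(LINT w|M. \<iota> p (?Q w)) = y (top J v) (card (low J v)) p"
   unfolding im y_def by (rule record_prob[OF v(1) vL(2,1)]) (rule gt_set_borel, simp add: top_def)
  thus "(LINT w|M. \<iota> p (?Q w) - y (top J v) (card (low J v)) p) = 0"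
   using int by (simp add: prob_space)
 qed
 thus ?thesis by (simp only: Iv Yv gI)
qed

end

text \<open>Four sources of error: the records among the first \<open>n0\<close> nodes, the
  fluctuation of indicators around conditional probabilities, the linearisation, and the first
  \<open>n0\<close> nodes counted in subtree sizes. Stated without reference to a probability space
  so that its asymptotics are a matter of analysis.\<close>

definition approx_error :: "nat => nat => nat => nat => nat => nat => real" where
 "approx_error k r n J n0 m = real n0 + 2*real n/sqrt (real (J + 1))
  + (\<Sum>v\<in>{n0<..n}. (2*(real (card (ancs v \<inter> {1..J})))\<^sup>2 + 2*real (card (ancs v \<inter> {1..J}))*real (m - card (ancs v - {1..J})))
    * (PINT x. gr r x*(Qk k x^card (ancs v - {1..J})*(1 - Qk k x)\<^sup>2)))
  + 2*(psi k r m - psi k r (m + 1))*(real n0*(log 2 (real J) + 2))"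

section \<open>Linearisation of the conditional probabilities\<close>

context alarm_tree
begin

text \<open>The loss caused by an ancestor with alarm at \<open>t\<close>: the probability of
  beating \<open>m\<close> other ancestors but ringing no earlier than \<open>t\<close>.\<close>

definition L :: "nat => real => real" where
 "L m t = (PINT x. gr r x*(Qk k x^m * of_bool (t <= x)))"

lemma gr_fubini:
 fixes h :: "'a => real => real"
 assumes h: "(%(w, x). h w x) \<in> borel_measurable (M \<Otimes>\<^sub>M lborel)"
  and B: "!!w x. w \<in> space M ==> 0 < x ==> \<bar>h w x\<bar> <= B"
 shows "w \<in> space M ==> pos_integrable (%x. gr r x*h w x)"
  and "integrable M (%w. (PINT x. gr r x*h w x))"
  and "(LINT w|M. (PINT x. gr r x*h w x)) = (PINT x. gr r x*(LINT w|M. h w x))"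
  and "pos_integrable (%x. gr r x*(LINT w|M. h w x))"
proof -
 interpret P: pair_sigma_finite M lborel ..
 have hx: "h w \<in> borel_measurable lborel" if "w \<in> space M" for w
  using measurable_Pair2[OF h that] by simp
 show i1: "pos_integrable (%x. gr r x*h w x)" if "w \<in> space M" for w
 proof (rule set_integrable_bound)
  show "pos_integrable (%x. B*gr r x)" using gr_integral(1)[OF r(1)] by simp
  show "set_borel_measurable lborel {0<..} (%x. gr r x*h w x)"
   using hx[OF that] unfolding set_borel_measurable_def by measurable
  have "norm (gr r x*h w x) <= norm (B*gr r x)" if "x \<in> {0<..}" for x
  proof -
   have "\<bar>h w x\<bar> <= \<bar>B\<bar>" using B[OF \<open>w \<in> space M\<close>, of x] that by simp
   thus ?thesis using mult_right_mono[of "\<bar>h w x\<bar>" "\<bar>B\<bar>" "\<bar>gr r x\<bar>"] by (simp add: abs_mult mult.commute)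
  qed
  thus "AE x in lborel. x \<in> {0<..} --> norm (gr r x*h w x) <= norm (B*gr r x)" by simp
 qed
 let ?F = "%p. indicator {0<..} (snd p) *\<^sub>R (gr r (snd p)*(%(w, x). h w x) p)"
 have Fm: "?F \<in> borel_measurable (M \<Otimes>\<^sub>M lborel)" using h by measurable
 have int: "integrable (M \<Otimes>\<^sub>M lborel) ?F"
 proof (rule P.Fubini_integrable[OF Fm])
  show "AE w in M. integrable lborel (%x. ?F (w, x))" using i1 by (auto simp: set_integrable_def)
  show "integrable M (%w. LINT x|lborel. norm (?F (w, x)))"
  proof (rule integrable_const_bound[of _ "\<bar>B\<bar>"])
   show "AE w in M. norm (LINT x|lborel. norm (?F (w, x))) <= \<bar>B\<bar>"
   proof (rule AE_I2)
    fix w assume w: "w \<in> space M"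
    have "(LINT x|lborel. norm (?F (w, x))) <= (LINT x|lborel. \<bar>B\<bar>*(indicator {0<..} x *\<^sub>R gr r x))"
    proof (rule integral_mono)
     show "integrable lborel (%x. norm (?F (w, x)))" using i1[OF w] by (auto simp: set_integrable_def)
     show "integrable lborel (%x. \<bar>B\<bar>*(indicator {0<..} x *\<^sub>R gr r x))"
      using gr_integral(1)[OF r(1)] by (auto simp: set_integrable_def)
     fix x :: real
     have "\<bar>h w x\<bar> <= \<bar>B\<bar>" if "0 < x" using B[OF w that] by simp
     thus "norm (?F (w, x)) <= \<bar>B\<bar>*(indicator {0<..} x *\<^sub>R gr r x)"
      using gr_nonneg[of x r] mult_right_mono[of "\<bar>h w x\<bar>" "\<bar>B\<bar>" "gr r x"]
      by (auto simp: indicator_def abs_mult mult.commute)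
    qed
    also have "... = \<bar>B\<bar>*(PINT x. gr r x)" by (simp add: set_lebesgue_integral_def)
    finally show "norm (LINT x|lborel. norm (?F (w, x))) <= \<bar>B\<bar>" using gr_integral(2)[OF r(1)] by simp
   qed
   show "(%w. LINT x|lborel. norm (?F (w, x))) \<in> borel_measurable M"
    using Fm by (intro lborel.borel_measurable_lebesgue_integral) (simp add: case_prod_beta')
  qed
 qed
 have eq: "?F = (%(w, x). indicator {0<..} x *\<^sub>R (gr r x*h w x))" by auto
 note int' = int[unfolded eq]
 show "integrable M (%w. (PINT x. gr r x*h w x))"
  using P.integrable_fst[OF int'] by (simp add: set_lebesgue_integral_def)
 have pull: "(LINT w|M. indicator {0<..} x *\<^sub>R (gr r x*h w x)) = indicator {0<..} x *\<^sub>R (gr r x*(LINT w|M. h w x))" for x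
  by simp
 have "(LINT x|lborel. LINT w|M. indicator {0<..} x *\<^sub>R (gr r x*h w x)) = (LINT w|M. LINT x|lborel. indicator {0<..} x *\<^sub>R (gr r x*h w x))"
  by (rule P.Fubini_integral[OF int'])
 thus "(LINT w|M. (PINT x. gr r x*h w x)) = (PINT x. gr r x*(LINT w|M. h w x))"
  unfolding pull set_lebesgue_integral_def ..
 show "pos_integrable (%x. gr r x*(LINT w|M. h w x))"
  using P.integrable_snd[OF int'] unfolding pull set_integrable_def .
qed

lemma meas_all_gt:
 assumes "A \<subseteq> {1..n}"
 shows "(%p. of_bool (\<forall>u\<in>A. snd p < T u (fst p)) :: real) \<in> borel_measurable (M \<Otimes>\<^sub>M lborel)"
proof -
 have [measurable]: "finite A" "!!u. u \<in> A ==> T u \<in> borel_measurable M" using assms finite_subset by auto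
 show ?thesis by measurable
qed

lemma meas_Q: "(%p. Qk k (snd p)^e) \<in> borel_measurable (M \<Otimes>\<^sub>M lborel)" by measurable

lemma expectation_T_le:
 assumes "u \<in> {1..n}" "0 <= x"
 shows "(LINT w|M. of_bool (T u w <= x)) = 1 - Qk k x" "integrable M (%w. of_bool (T u w <= x) :: real)"
proof -
 have e: "(%w. of_bool (T u w <= x) :: real) = (%w. 1 - of_bool (\<forall>u\<in>{u}. x < T u w))" by (auto simp: fun_eq_iff)
 have [measurable]: "T u \<in> borel_measurable M" using assms by simp
 have i: "integrable M (%w. of_bool (\<forall>u\<in>{u}. x < T u w) :: real)"
  by (intro integrable_const_bound[of _ 1]) auto
 show "integrable M (%w. of_bool (T u w <= x) :: real)" unfolding e using i by simp
 show "(LINT w|M. of_bool (T u w <= x)) = 1 - Qk k x"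
  unfolding e using i prob_all_gt[of "{u}" x] assms by (simp add: prob_space)
qed

lemma L_integrand:
 assumes u: "u \<in> {1..n}"
 shows "(%(w, x). Qk k x^m * of_bool (T u w <= x)) \<in> borel_measurable (M \<Otimes>\<^sub>M lborel)"
  and "0 < x ==> \<bar>Qk k x^m * of_bool (T u w <= x)\<bar> <= 1"
proof -
 show "(%(w, x). Qk k x^m * of_bool (T u w <= x)) \<in> borel_measurable (M \<Otimes>\<^sub>M lborel)"
  using T_measurable[OF u, measurable] by measurable
 assume "0 < x"
 thus "\<bar>Qk k x^m * of_bool (T u w <= x)\<bar> <= 1"
  by (auto simp: Qk_nonneg Qk_le_1 power_le_one)
qed

lemma gr_Q_power_integrable: "pos_integrable (%x. gr r x*Qk k x^m)"
 by (rule gr_weighted_integrable[OF r(1)]) (auto simp: Qk_nonneg Qk_le_1 power_le_one)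

lemma L_nonneg: "0 <= L m t"
 unfolding L_def set_lebesgue_integral_def
 by (intro integral_nonneg_AE AE_I2) (auto simp: indicator_def gr_nonneg Qk_nonneg)

lemma L_integral:
 assumes u: "u \<in> {1..n}"
 shows "integrable M (%w. L m (T u w))" "(LINT w|M. L m (T u w)) = psi k r m - psi k r (m + 1)"
proof -
 note F = gr_fubini[OF L_integrand(1)[OF u, of m] L_integrand(2)[OF u, of _ m], simplified]
 show "integrable M (%w. L m (T u w))" unfolding L_def using F(2) .
 have "(LINT w|M. L m (T u w)) = (PINT x. gr r x*(LINT w|M. Qk k x^m * of_bool (T u w <= x)))"
  unfolding L_def by (subst gr_fubini(3)[OF L_integrand(1)[OF u, of m] L_integrand(2)[OF u, of _ m]]) auto
 also have "... = (PINT x. gr r x*Qk k x^m - gr r x*Qk k x^(m + 1))"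
 proof (intro set_lebesgue_integral_cong allI impI)
  fix x :: real assume "x \<in> {0<..}"
  hence "(LINT w|M. Qk k x^m * of_bool (T u w <= x)) = Qk k x^m*(1 - Qk k x)"
   using expectation_T_le(1)[OF u, of x] by (simp only: integral_mult_right_zero) simp
  thus "gr r x*(LINT w|M. Qk k x^m * of_bool (T u w <= x)) = gr r x*Qk k x^m - gr r x*Qk k x^(m + 1)"
   by (simp only:) (simp add: algebra_simps)
 qed simp
 also have "... = psi k r m - psi k r (m + 1)"
  unfolding psi_def by (rule set_integral_diff(2)[OF gr_Q_power_integrable gr_Q_power_integrable])
 finally show "(LINT w|M. L m (T u w)) = psi k r m - psi k r (m + 1)" .
qed

definition rho :: "nat => real" where
 "rho e = (PINT x. gr r x*(Qk k x^e*(1 - Qk k x)\<^sup>2))"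

lemma rho_integrable: "pos_integrable (%x. gr r x*(Qk k x^e*(1 - Qk k x)\<^sup>2))"
proof (rule gr_weighted_integrable[OF r(1)])
 fix x :: real assume x: "0 < x"
 have "0 <= Qk k x^e*(1 - Qk k x)\<^sup>2" using x by (simp add: Qk_nonneg)
 moreover have "Qk k x^e*(1 - Qk k x)\<^sup>2 <= 1*1"
  using x by (intro mult_mono power_le_one) (auto simp: Qk_nonneg Qk_le_1)
 ultimately show "\<bar>Qk k x^e*(1 - Qk k x)\<^sup>2\<bar> <= 1" by simp
qed measurable

text \<open>For fixed \<open>x\<close> let \<open>z u\<close> indicate \<open>T u <= x\<close>, with
  mean \<open>t = 1 - Q\<close>. The survival product of the top ancestors is replaced by 1 minus
  the sum of the \<open>z u\<close>, at a cost of order \<open>a^2 t^2\<close>. The weight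
  \<open>Q^e\<close> of the linear part is replaced by the common \<open>Q^m\<close>, at a cost of
  order \<open>(m - e) t\<close> times \<open>2 a t\<close>. Integrating \<open>Q^e t^2\<close>
  gives \<open>rho e\<close>.\<close>

lemma Y_linearization:
 assumes v: "v \<in> {1..n}" and m: "card (low J v) <= m"
 defines "a \<equiv> card (top J v)" and "e \<equiv> card (low J v)"
 shows "integrable M (%w. Y J v w)"
  and "(LINT w|M. \<bar>Y J v w - (psi k r (depth v) - (\<Sum>u\<in>top J v. L m (T u w) - (psi k r m - psi k r (m + 1))))\<bar>)
   <= (2*(real a)\<^sup>2 + 2*real a*real (m - e))*rho e"
proof -
 have top: "top J v \<subseteq> {1..n}" "finite (top J v)" using ancs_subset[of v] v by (auto simp: top_def)
 have dep: "depth v = e + a"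
 proof -
  have "card (ancs v) = card (top J v \<union> low J v)" by (rule arg_cong[of _ _ card]) (auto simp: top_def low_def)
  also have "... = card (top J v) + card (low J v)" by (rule card_Un_disjoint) (auto simp: top_def low_def)
  finally show ?thesis by (simp add: depth_def a_def e_def)
 qed
 let ?p = "%w x. of_bool (\<forall>u\<in>top J v. x < T u w) :: real"
 \<comment> \<open>Integrand of the error: conditional probability minus its mean plus the centred
   linear losses.\<close>
 define h where "h w x = Qk k x^e*?p w x - Qk k x^(e + a) + Qk k x^m*(\<Sum>u\<in>top J v. of_bool (T u w <= x) - (1 - Qk k x))" for w x
 have m1: "(%p. h (fst p) (snd p)) \<in> borel_measurable (M \<Otimes>\<^sub>M lborel)"
 proof -
  note [measurable] = top(2)
  have [measurable]: "!!u. u \<in> top J v ==> T u \<in> borel_measurable M" using top by auto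
  show ?thesis unfolding h_def by measurable
 qed
 have Q01: "0 <= Qk k x" "Qk k x <= 1" "0 <= Qk k x^i" "Qk k x^i <= 1" if "0 < x" for x i
  using that by (auto simp: Qk_nonneg Qk_le_1 power_le_one)
 have sb: "\<bar>\<Sum>u\<in>top J v. of_bool (T u w <= x) - (1 - Qk k x)\<bar> <= real a" if x: "0 < x" for w x
 proof -
  have "\<bar>\<Sum>u\<in>top J v. of_bool (T u w <= x) - (1 - Qk k x)\<bar> <= (\<Sum>u\<in>top J v. 1)"
   using Q01[OF x] by (intro order_trans[OF sum_abs] sum_mono) (auto simp: of_bool_def)
  thus ?thesis by (simp add: a_def)
 qed
 have hb: "\<bar>h w x\<bar> <= 2 + real a" if x: "0 < x" for w x
 proof -
  have "\<bar>Qk k x^m*(\<Sum>u\<in>top J v. of_bool (T u w <= x) - (1 - Qk k x))\<bar> <= 1*real a"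
   unfolding abs_mult using Q01[OF x] sb[OF x] by (intro mult_mono) auto
  moreover have "\<bar>Qk k x^e*?p w x\<bar> <= 1" using Q01[OF x] by (auto simp: of_bool_def)
  moreover have "\<bar>Qk k x^(e + a)\<bar> <= 1" using Q01(3,4)[OF x, of "e + a"] by (simp only: abs_of_nonneg)
  ultimately show ?thesis unfolding h_def by linarith
 qed
 have m1': "(%(w, x). h w x) \<in> borel_measurable (M \<Otimes>\<^sub>M lborel)" using m1 by (simp add: case_prod_beta')
 have mabs: "(%(w, x). \<bar>h w x\<bar>) \<in> borel_measurable (M \<Otimes>\<^sub>M lborel)"
  using borel_measurable_abs[OF m1] by (simp add: case_prod_beta')
 have mp: "(%(w, x). Qk k x^e*?p w x) \<in> borel_measurable (M \<Otimes>\<^sub>M lborel)"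
  using borel_measurable_times[OF meas_Q[of e] meas_all_gt[OF top(1)]] by (simp add: case_prod_beta')
 have bp: "\<bar>Qk k x^e*?p w x\<bar> <= 1" if "0 < x" for w x using Q01[OF that] by (auto simp: of_bool_def)
 have Ye: "Y J v w = (PINT x. gr r x*(Qk k x^e*?p w x))" for w
  unfolding Y_def e_def by (simp add: mult.commute)
 show iY: "integrable M (%w. Y J v w)"
  unfolding Ye by (rule gr_fubini(2)[OF mp bp])
 have Lsum: "(PINT x. gr r x*h w x) = Y J v w - (psi k r (depth v) - (\<Sum>u\<in>top J v. L m (T u w) - (psi k r m - psi k r (m + 1))))"
  if w: "w \<in> space M" for w
 proof -
  have iA: "pos_integrable (%x. gr r x*(Qk k x^e*?p w x))"
   by (rule gr_fubini(1)[OF mp bp w])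
  have iB: "pos_integrable (%x. gr r x*Qk k x^(e + a))" by (rule gr_Q_power_integrable)
  have iL: "pos_integrable (%x. gr r x*(Qk k x^m * of_bool (T u w <= x)))" if "u \<in> top J v" for u
  proof -
   have u: "u \<in> {1..n}" using that top by auto
   show ?thesis by (rule gr_fubini(1)[OF L_integrand(1)[OF u] L_integrand(2)[OF u] w])
  qed
  let ?c = "%u x. gr r x*(Qk k x^m * of_bool (T u w <= x)) - (gr r x*Qk k x^m - gr r x*Qk k x^(m + 1))"
  have ic: "pos_integrable (?c u)" if "u \<in> top J v" for u
   by (intro set_integral_diff(1) iL that gr_Q_power_integrable)
  have vc: "(PINT x. ?c u x) = L m (T u w) - (psi k r m - psi k r (m + 1))" if "u \<in> top J v" for u
  proof -
   have "(PINT x. ?c u x) = L m (T u w) - (PINT x. gr r x*Qk k x^m - gr r x*Qk k x^(m + 1))"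
    unfolding L_def by (intro set_integral_diff(2) iL that set_integral_diff(1) gr_Q_power_integrable)
   also have "(PINT x. gr r x*Qk k x^m - gr r x*Qk k x^(m + 1)) = psi k r m - psi k r (m + 1)"
    unfolding psi_def by (intro set_integral_diff(2) gr_Q_power_integrable)
   finally show ?thesis .
  qed
  have iS: "pos_integrable (%x. \<Sum>u\<in>top J v. ?c u x)"
   using ic unfolding set_integrable_def scaleR_sum_right by (intro bochner_sum) auto
  have vS: "(PINT x. (\<Sum>u\<in>top J v. ?c u x)) = (\<Sum>u\<in>top J v. (PINT x. ?c u x))"
   using ic unfolding set_lebesgue_integral_def set_integrable_def scaleR_sum_right
   by (intro bochner_integral_sum) auto
  have "(PINT x. gr r x*h w x) = (PINT x. (gr r x*(Qk k x^e*?p w x) - gr r x*Qk k x^(e + a)) + (\<Sum>u\<in>top J v. ?c u x))"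
   by (intro set_lebesgue_integral_cong) (auto simp: h_def sum_distrib_left algebra_simps sum_subtractf sum.distrib)
  also have "... = ((PINT x. gr r x*(Qk k x^e*?p w x)) - (PINT x. gr r x*Qk k x^(e + a))) + (\<Sum>u\<in>top J v. (PINT x. ?c u x))"
   unfolding vS[symmetric] set_integral_diff(2)[OF iA iB, symmetric]
   by (rule set_integral_add(2)[OF set_integral_diff(1)[OF iA iB] iS])
  also have "(\<Sum>u\<in>top J v. (PINT x. ?c u x)) = (\<Sum>u\<in>top J v. L m (T u w) - (psi k r m - psi k r (m + 1)))"
   by (rule sum.cong[OF refl vc])
  finally show ?thesis by (simp add: Ye psi_def dep)
 qed
 have inner: "(LINT w|M. \<bar>h w x\<bar>) <= (2*(real a)\<^sup>2 + 2*real a*real (m - e))*(Qk k x^e*(1 - Qk k x)\<^sup>2)" if x: "0 < x" for x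
 proof -
  define q where "q = Qk k x"
  define t where "t = 1 - q"
  have q: "0 <= q" "q <= 1" using Q01[OF x] by (auto simp: q_def)
  have t: "0 <= t" "t <= 1" "q = 1 - t" using q by (auto simp: t_def)
  \<comment> \<open>The mean of the nonnegative Bonferroni error \<open>?e1\<close>, so that
    bounding \<open>B\<close> bounds \<open>?e1\<close> in L1.\<close>
  define B where "B = q^a - 1 + real a*t"
  have B: "0 <= B" "B <= (real a)\<^sup>2*t\<^sup>2" using one_minus_power_bounds[OF t(1,2), of a] by (auto simp: B_def t(3))
  let ?z = "%u w. of_bool (T u w <= x) :: real"
  have iz: "integrable M (?z u)" "(LINT w|M. ?z u w) = t" if "u \<in> top J v" for u
   using expectation_T_le[of u x] that top x by (auto simp: t_def q_def)
  have ip: "integrable M (%w. ?p w x)"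
  proof (rule integrable_const_bound[of _ 1])
   have [measurable]: "finite (top J v)" "!!u. u \<in> top J v ==> T u \<in> borel_measurable M" using top by auto
   show "(%w. ?p w x) \<in> borel_measurable M" by measurable
  qed auto
  have vp: "(LINT w|M. ?p w x) = q^a" using prob_all_gt[OF top(1), of x] x by (simp add: q_def a_def)
  have pn: "?p w x - 1 + (\<Sum>u\<in>top J v. ?z u w) >= 0" for w
  proof (cases "\<forall>u\<in>top J v. x < T u w")
   case False
   then obtain u where "u \<in> top J v" "~ x < T u w" by blast
   hence "(1::real) <= (\<Sum>u\<in>top J v. ?z u w)"
    using member_le_sum[of u "top J v" "%u. ?z u w"] top(2) by auto
   thus ?thesis by (simp add: of_bool_def)
  qed (auto intro!: sum_nonneg)
  let ?e1 = "%w. ?p w x - 1 + (\<Sum>u\<in>top J v. ?z u w)"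
  let ?e3 = "%w. \<Sum>u\<in>top J v. ?z u w + t"
  have qm: "q^e - q^m >= 0" "q^e - q^m <= q^e*(real (m - e)*t)"
  proof -
   have qe: "q^e - q^m = q^e*(1 - q^(m - e))"
    using m by (simp add: right_diff_distrib power_add[symmetric] e_def)
   show "q^e - q^m >= 0" unfolding qe using q by (simp add: power_le_one)
   show "q^e - q^m <= q^e*(real (m - e)*t)"
    unfolding qe using q one_minus_power_bounds(3)[OF t(1,2), of "m - e"] by (intro mult_left_mono) (auto simp: t(3))
  qed
  \<comment> \<open>Exactly, \<open>h = q^e*?e1 - q^e*B - (q^e - q^m) * (sum of the centred
    indicators)\<close>; the three terms are estimated separately.\<close>
  have pt: "\<bar>h w x\<bar> <= q^e*?e1 w + q^e*B + q^e*(real (m - e)*t)*?e3 w" for w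
  proof -
   have s: "(\<Sum>u\<in>top J v. ?z u w - (1 - q)) = (\<Sum>u\<in>top J v. ?z u w) - real a*t"
    by (simp add: sum_subtractf a_def t_def)
   have "h w x = q^e*?e1 w - q^e*B - (q^e - q^m)*((\<Sum>u\<in>top J v. ?z u w) - real a*t)"
    unfolding h_def q_def[symmetric] s B_def by (simp add: power_add algebra_simps)
   moreover have "\<bar>(q^e - q^m)*((\<Sum>u\<in>top J v. ?z u w) - real a*t)\<bar> <= q^e*(real (m - e)*t)*?e3 w"
    unfolding abs_mult
   proof (rule mult_mono)
    have "0 <= (\<Sum>u\<in>top J v. ?z u w)" "0 <= real a*t" using t by (auto intro: sum_nonneg)
    thus "\<bar>(\<Sum>u\<in>top J v. ?z u w) - real a*t\<bar> <= ?e3 w" by (simp add: sum.distrib a_def)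
   qed (use qm q t in auto)
   moreover have "\<bar>q^e*?e1 w\<bar> = q^e*?e1 w" by (rule abs_of_nonneg[OF mult_nonneg_nonneg[OF zero_le_power[OF q(1)] pn]])
   moreover have "\<bar>q^e*B\<bar> = q^e*B" by (rule abs_of_nonneg[OF mult_nonneg_nonneg[OF zero_le_power[OF q(1)] B(1)]])
   ultimately show ?thesis by linarith
  qed
  have ie1: "integrable M ?e1" using ip iz(1) by (intro bochner_add bochner_diff bochner_sum) auto
  have ve1: "(LINT w|M. ?e1 w) = B"
  proof -
   have "(LINT w|M. ?e1 w) = (LINT w|M. ?p w x - 1) + (LINT w|M. (\<Sum>u\<in>top J v. ?z u w))"
    using ip iz(1) by (intro bochner_integral_add bochner_diff bochner_sum) auto
   also have "(LINT w|M. ?p w x - 1) = q^a - 1" using ip vp by (simp add: prob_space)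
   also have "(LINT w|M. (\<Sum>u\<in>top J v. ?z u w)) = (\<Sum>u\<in>top J v. t)"
    using iz by (subst bochner_integral_sum) auto
   finally show ?thesis by (simp add: B_def a_def)
  qed
  have ie3: "integrable M ?e3" using iz(1) by (intro bochner_add bochner_sum) auto
  have ve3: "(LINT w|M. ?e3 w) = 2*real a*t"
  proof -
   have "(LINT w|M. ?e3 w) = (\<Sum>u\<in>top J v. (LINT w|M. ?z u w + t))"
    using iz by (intro bochner_integral_sum) auto
   also have "... = (\<Sum>u\<in>top J v. 2*t)" using iz by (intro sum.cong refl) (simp add: prob_space)
   finally show ?thesis by (simp add: a_def)
  qed
  have mh: "(%w. h w x) \<in> borel_measurable M"
   using measurable_compose[OF measurable_Pair2'[of x lborel M] m1] by simp
  have "(LINT w|M. \<bar>h w x\<bar>) <= (LINT w|M. q^e*?e1 w + q^e*B + q^e*(real (m - e)*t)*?e3 w)"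
  proof (rule integral_mono)
   show "integrable M (%w. \<bar>h w x\<bar>)"
    by (rule integrable_const_bound[of _ "2 + real a"]) (use hb[OF x] mh in auto)
   show "integrable M (%w. q^e*?e1 w + q^e*B + q^e*(real (m - e)*t)*?e3 w)"
    by (intro bochner_add integrable_mult_right ie1 ie3) simp
  qed (rule pt)
  also have "... = (LINT w|M. q^e*?e1 w + q^e*B) + (LINT w|M. q^e*(real (m - e)*t)*?e3 w)"
   by (intro bochner_integral_add bochner_add integrable_mult_right ie1 ie3) simp
  also have "(LINT w|M. q^e*?e1 w + q^e*B) = q^e*B + q^e*B"
   by (subst bochner_integral_add) (use ie1 ve1 in \<open>auto simp: prob_space\<close>)
  also have "(LINT w|M. q^e*(real (m - e)*t)*?e3 w) = q^e*(real (m - e)*t)*(2*real a*t)"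
   by (simp only: integral_mult_right_zero ve3)
  also have "q^e*B + q^e*B + q^e*(real (m - e)*t)*(2*real a*t)
    <= q^e*((real a)\<^sup>2*t\<^sup>2) + q^e*((real a)\<^sup>2*t\<^sup>2) + q^e*(real (m - e)*t)*(2*real a*t)"
   using B q by (intro add_mono mult_left_mono order_refl) auto
  also have "... = (2*(real a)\<^sup>2 + 2*real a*real (m - e))*(q^e*t\<^sup>2)"
   by (simp add: power2_eq_square algebra_simps)
  finally show ?thesis by (simp add: t_def q_def)
 qed
 have "(LINT w|M. \<bar>Y J v w - (psi k r (depth v) - (\<Sum>u\<in>top J v. L m (T u w) - (psi k r m - psi k r (m + 1))))\<bar>)
   = (LINT w|M. \<bar>(PINT x. gr r x*h w x)\<bar>)"
  by (intro bochner_integral_cong refl) (simp add: Lsum)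
 also have "... <= (LINT w|M. (PINT x. gr r x*\<bar>h w x\<bar>))"
 proof (rule integral_mono)
  show "integrable M (%w. \<bar>(PINT x. gr r x*h w x)\<bar>)"
   by (intro integrable_abs gr_fubini(2)[OF m1' hb])
  show "integrable M (%w. (PINT x. gr r x*\<bar>h w x\<bar>))"
   by (rule gr_fubini(2)[OF mabs, of "2 + real a"]) (use hb in auto)
  fix w assume w: "w \<in> space M"
  have ih: "pos_integrable (%x. gr r x*h w x)" by (rule gr_fubini(1)[OF m1' hb w])
  have "norm (PINT x. gr r x*h w x) <= (PINT x. norm (gr r x*h w x))"
   by (rule set_integral_norm_bound[OF ih])
  also have "... = (PINT x. gr r x*\<bar>h w x\<bar>)"
   by (intro set_lebesgue_integral_cong) (auto simp: abs_mult gr_nonneg)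
  finally show "\<bar>(PINT x. gr r x*h w x)\<bar> <= (PINT x. gr r x*\<bar>h w x\<bar>)" by simp
 qed
 also have "... = (PINT x. gr r x*(LINT w|M. \<bar>h w x\<bar>))"
  by (rule gr_fubini(3)[OF mabs, of "2 + real a"]) (use hb in auto)
 also have "... <= (PINT x. (2*(real a)\<^sup>2 + 2*real a*real (m - e))*(gr r x*(Qk k x^e*(1 - Qk k x)\<^sup>2)))"
 proof (rule set_integral_mono)
  show "pos_integrable (%x. gr r x*(LINT w|M. \<bar>h w x\<bar>))"
   by (rule gr_fubini(4)[OF mabs, of "2 + real a"]) (use hb in auto)
  show "pos_integrable (%x. (2*(real a)\<^sup>2 + 2*real a*real (m - e))*(gr r x*(Qk k x^e*(1 - Qk k x)\<^sup>2)))"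
   by (intro set_integrable_mult_right rho_integrable)
  fix x :: real assume "x \<in> {0<..}"
  hence x: "0 < x" by simp
  have "gr r x*(LINT w|M. \<bar>h w x\<bar>) <= gr r x*((2*(real a)\<^sup>2 + 2*real a*real (m - e))*(Qk k x^e*(1 - Qk k x)\<^sup>2))"
   using inner[OF x] gr_nonneg[of x r] x by (intro mult_left_mono) auto
  thus "gr r x*(LINT w|M. \<bar>h w x\<bar>) <= (2*(real a)\<^sup>2 + 2*real a*real (m - e))*(gr r x*(Qk k x^e*(1 - Qk k x)\<^sup>2))"
   by (simp add: mult_ac)
 qed
 also have "... = (2*(real a)\<^sup>2 + 2*real a*real (m - e))*rho e"
  unfolding rho_def by (rule set_integral_mult_right)
 finally show "(LINT w|M. \<bar>Y J v w - (psi k r (depth v) - (\<Sum>u\<in>top J v. L m (T u w) - (psi k r m - psi k r (m + 1))))\<bar>)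
   <= (2*(real a)\<^sup>2 + 2*real a*real (m - e))*rho e" .
qed

lemma I_measurable: "v \<in> {1..n} ==> I v \<in> borel_measurable M"
proof -
 assume v: "v \<in> {1..n}"
 have [measurable]: "S v \<in> borel_measurable M" "!!u. u \<in> ancs v ==> T u \<in> borel_measurable M"
  using v ancs_subset[of v] by auto
 show ?thesis unfolding I_eq[abs_def] by measurable
qed

lemma I_bounds: "0 <= I v w" "I v w <= 1" by (auto simp: I_def)

text \<open>In the second moment only conflicting pairs survive, each contributing at most 1;
  \<open>card_conflicts\<close> counts them.\<close>

lemma record_sum_variance:
 assumes V: "V \<subseteq> {1..n}" "!!v. v \<in> V ==> J < v"
 shows "integrable M (%w. \<Sum>v\<in>V. I v w - Y J v w)"
  "(LINT w|M. \<bar>\<Sum>v\<in>V. I v w - Y J v w\<bar>) <= 2*real n/sqrt (real (J + 1))"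
proof -
 have fin: "finite V" using V by (intro finite_subset[OF V(1)]) simp
 let ?D = "%v w. I v w - Y J v w"
 have Db: "\<bar>?D v w\<bar> <= 1" for v w using I_bounds[of v w] Y_bounds[of J v w] by (simp add: abs_le_iff)
 have Dm: "?D v \<in> borel_measurable M" if "v \<in> V" for v
 proof -
  have v: "v \<in> {1..n}" using that V by auto
  have "integrable M (Y J v)" using Y_linearization(1)[OF v order_refl] .
  thus ?thesis using I_measurable[OF v] by (intro borel_measurable_diff) auto
 qed
 have Sm: "(%w. \<Sum>v\<in>V. ?D v w) \<in> borel_measurable M" by (intro borel_measurable_sum Dm)
 have Sb: "\<bar>\<Sum>v\<in>V. ?D v w\<bar> <= real (card V)" for w
  using order_trans[OF sum_abs sum_mono[of V "%v. \<bar>?D v w\<bar>" "%_. 1"]] Db by simp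
 show iS: "integrable M (%w. \<Sum>v\<in>V. ?D v w)"
  by (rule integrable_const_bound[of _ "real (card V)"]) (use Sb Sm in auto)
 have iP: "integrable M (%w. ?D v w*?D v' w)" if "v \<in> V" "v' \<in> V" for v v'
 proof (rule integrable_const_bound[of _ 1])
  show "AE w in M. norm (?D v w*?D v' w) <= 1"
   using Db by (intro AE_I2) (simp add: abs_mult mult_le_one)
 qed (use Dm that in auto)
 have "(LINT w|M. (\<Sum>v\<in>V. ?D v w)\<^sup>2) = (LINT w|M. (\<Sum>v\<in>V. \<Sum>v'\<in>V. ?D v w*?D v' w))"
  by (simp add: power2_eq_square sum_product)
 also have "... = (\<Sum>v\<in>V. \<Sum>v'\<in>V. (LINT w|M. ?D v w*?D v' w))"
  by (rule trans[OF bochner_integral_sum])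
    (intro bochner_sum iP, assumption+, intro sum.cong refl bochner_integral_sum iP)
 also have "... <= (\<Sum>v\<in>V. \<Sum>v'\<in>V. of_bool (outer J v \<inter> outer J v' ~= {}))"
 proof (intro sum_mono)
  fix v v' assume vv: "v \<in> V" "v' \<in> V"
  show "(LINT w|M. ?D v w*?D v' w) <= of_bool (outer J v \<inter> outer J v' ~= {})"
  proof (cases "outer J v \<inter> outer J v' = {}")
   case True
   moreover have "v \<in> {1..n}" "v' \<in> {1..n}" using vv V(1) by auto
   ultimately show ?thesis using orthogonal[of v J v'] vv V(2) by simp
  next
   case False
   have "(LINT w|M. ?D v w*?D v' w) <= (LINT w|M. 1)"
   proof (rule integral_mono[OF iP[OF vv]])
    fix w
    have "\<bar>?D v w*?D v' w\<bar> <= 1" using Db by (simp add: abs_mult mult_le_one)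
    thus "?D v w*?D v' w <= 1" by simp
   qed simp
   thus ?thesis using False by (simp add: prob_space)
  qed
 qed
 also have "... = real (card {(v, v'). v \<in> V & v' \<in> V & outer J v \<inter> outer J v' ~= {}})"
 proof -
  have "(\<Sum>v\<in>V. \<Sum>w\<in>V. of_bool (outer J v \<inter> outer J w ~= {})) = (\<Sum>x\<in>V\<times>V. of_bool (outer J (fst x) \<inter> outer J (snd x) ~= {}) :: real)"
   by (simp add: sum.cartesian_product case_prod_beta')
  also have "... = real (card {x \<in> V \<times> V. outer J (fst x) \<inter> outer J (snd x) ~= {}})"
   using fin by (simp add: of_bool_def sum.If_cases Int_def)
  also have "{x \<in> V \<times> V. outer J (fst x) \<inter> outer J (snd x) ~= {}} = {(v, w). v \<in> V & w \<in> V & outer J v \<inter> outer J w ~= {}}"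
   by auto
  finally show ?thesis .
 qed
 also have "... <= real (card {(v, v'). v \<in> {1..n} & v' \<in> {1..n} & outer J v \<inter> outer J v' ~= {}})"
 proof -
  have "finite {(v, v'). v \<in> {1..n} & v' \<in> {1..n} & outer J v \<inter> outer J v' ~= {}}"
   by (rule finite_subset[of _ "{1..n} \<times> {1..n}"]) auto
  hence "card {(v, w). v \<in> V & w \<in> V & outer J v \<inter> outer J w ~= {}} <= card {(v, v'). v \<in> {1..n} & v' \<in> {1..n} & outer J v \<inter> outer J v' ~= {}}"
   using V by (intro card_mono) auto
  thus ?thesis by (simp only: of_nat_le_iff)
 qed
 also have "... <= 4*(real n)\<^sup>2/real (J + 1)" by (rule card_conflicts)
 finally have v2: "(LINT w|M. (\<Sum>v\<in>V. ?D v w)\<^sup>2) <= 4*(real n)\<^sup>2/real (J + 1)" .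
 let ?X = "%w. \<bar>\<Sum>v\<in>V. ?D v w\<bar>"
 have iX: "integrable M ?X" using iS by simp
 have iX2: "integrable M (%w. (?X w)\<^sup>2)"
 proof (rule integrable_const_bound[of _ "(real (card V))\<^sup>2"])
  show "AE w in M. norm ((?X w)\<^sup>2) <= (real (card V))\<^sup>2"
   using Sb by (intro AE_I2) (simp add: abs_le_square_iff[symmetric])
 qed (use Sm in auto)
 \<comment> \<open>Nonnegativity of the variance bounds the squared first moment by the
   second.\<close>
 have "0 <= variance ?X" by (rule variance_positive)
 also have "variance ?X = (LINT w|M. (?X w)\<^sup>2) - (LINT w|M. ?X w)\<^sup>2" by (rule variance_eq[OF iX iX2])
 finally have "(LINT w|M. ?X w)\<^sup>2 <= (LINT w|M. (?X w)\<^sup>2)" by simp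
 also have "... <= 4*(real n)\<^sup>2/real (J + 1)" using v2 by simp
 also have "... = (2*real n/sqrt (real (J + 1)))\<^sup>2"
  by (simp add: power_divide power_mult_distrib)
 finally show "(LINT w|M. ?X w) <= 2*real n/sqrt (real (J + 1))"
  by (rule power2_le_imp_le) simp
qed

definition linearized :: "nat => nat => nat => 'a => real" where
 "linearized J n0 m w = (\<Sum>v\<in>{n0<..n}. psi k r (depth v)) - (\<Sum>u\<in>{1..J}. real (card (subtree n u))*(L m (T u w) - (psi k r m - psi k r (m + 1))))"

text \<open>The difference splits as \<open>X1 + X2 + X3 + X4\<close>, one part for each term of
  \<open>approx_error\<close>. Summing the linear losses over nodes turns the loss of
  \<open>u\<close> into a multiple of the number of its descendants.\<close>

theorem num_records_approx:
 assumes J: "1 <= J" "J <= n0" "n0 <= n" and m: "!!v. v \<in> {1..n} ==> depth v <= m"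
 shows "integrable M (%w. real (num_records E k r n w) - linearized J n0 m w)" (is "integrable M ?R")
  and "(LINT w|M. \<bar>real (num_records E k r n w) - linearized J n0 m w\<bar>) <= approx_error k r n J n0 m"
proof -
 define EL where "EL = psi k r m - psi k r (m + 1)"
 let ?V = "{n0<..n}"
 have V: "?V \<subseteq> {1..n}" "!!v. v \<in> ?V ==> J < v" using J by auto
 have lowm: "card (low J v) <= m" if "v \<in> {1..n}" for v
  using m[OF that] card_mono[of "ancs v" "low J v"] by (auto simp: low_def depth_def)
 have JT: "u \<in> {1..n}" if "u \<in> {1..J}" for u using that J by auto
 let ?Lc = "%u w. L m (T u w) - EL"
 have iL: "integrable M (?Lc u)" if "u \<in> {1..J}" for u using L_integral(1)[OF JT[OF that]] by simp
 have EL0: "0 <= EL"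
 proof -
  have "0 <= (LINT w|M. L m (T 1 w))" by (intro integral_nonneg_AE AE_I2 L_nonneg)
  also have "... = EL" unfolding EL_def by (rule L_integral(2)[OF JT]) (use J in simp)
  finally show ?thesis .
 qed
 have Labs: "(LINT w|M. \<bar>?Lc u w\<bar>) <= 2*EL" if u: "u \<in> {1..J}" for u
 proof -
  have "(LINT w|M. \<bar>?Lc u w\<bar>) <= (LINT w|M. L m (T u w) + EL)"
  proof (rule integral_mono)
   show "integrable M (%w. \<bar>?Lc u w\<bar>)" using iL[OF u] by simp
   show "integrable M (%w. L m (T u w) + EL)" using L_integral(1)[OF JT[OF u]] by simp
   show "\<bar>?Lc u w\<bar> <= L m (T u w) + EL" for w using L_nonneg[of m "T u w"] EL0 by simp
  qed
  also have "... = 2*EL" using L_integral[OF JT[OF u], of m] by (simp add: prob_space EL_def)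
  finally show ?thesis .
 qed
 define X1 where "X1 w = (\<Sum>v\<in>{1..n0}. I v w)" for w
 define X2 where "X2 w = (\<Sum>v\<in>?V. I v w - Y J v w)" for w
 define X3 where "X3 v w = Y J v w - (psi k r (depth v) - (\<Sum>u\<in>top J v. ?Lc u w))" for v w
 define c where "c u = card {v \<in> {1..n0}. v = u \<or> ancestor u v}" for u
 define X4 where "X4 w = (\<Sum>u\<in>{1..J}. real (c u)*?Lc u w)" for w
 have num: "real (num_records E k r n w) = (\<Sum>v\<in>{1..n}. I v w)" for w
  unfolding num_records_def I_def bin_tree_def by (simp add: of_bool_def sum.If_cases Int_def)
 have split: "(\<Sum>v\<in>{1..n}. f v) = (\<Sum>v\<in>{1..n0}. f v) + (\<Sum>v\<in>?V. f v)" for f :: "nat => real"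
 proof -
  have "{1..n} = {1..n0} \<union> ?V" using J by auto
  thus ?thesis by (simp only:) (rule sum.union_disjoint, auto)
 qed
 \<comment> \<open>Interchanging the sums counts the descendants of \<open>u\<close> beyond
   \<open>n0\<close>; \<open>X4\<close> makes up for replacing this count by the full subtree
   size.\<close>
 have dbl: "(\<Sum>v\<in>?V. \<Sum>u\<in>top J v. ?Lc u w) = (\<Sum>u\<in>{1..J}. real (card (subtree n u))*?Lc u w) - X4 w" for w
 proof -
  have "(\<Sum>v\<in>?V. \<Sum>u\<in>top J v. ?Lc u w) = (\<Sum>v\<in>?V. \<Sum>u\<in>{1..J}. if ancestor u v then ?Lc u w else 0)"
  proof (rule sum.cong[OF refl])
   fix v
   have "top J v = {u \<in> {1..J}. ancestor u v}" by (auto simp: top_def ancs_def)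
   thus "(\<Sum>u\<in>top J v. ?Lc u w) = (\<Sum>u\<in>{1..J}. if ancestor u v then ?Lc u w else 0)"
    by (simp add: sum.inter_filter[symmetric])
  qed
  also have "... = (\<Sum>u\<in>{1..J}. \<Sum>v\<in>?V. if ancestor u v then ?Lc u w else 0)" by (rule sum.swap)
  also have "... = (\<Sum>u\<in>{1..J}. real (card {v \<in> ?V. ancestor u v})*?Lc u w)"
   by (intro sum.cong refl) (simp add: sum.If_cases Int_def)
  also have "... = (\<Sum>u\<in>{1..J}. real (card (subtree n u))*?Lc u w - real (c u)*?Lc u w)"
  proof (rule sum.cong[OF refl])
   fix u assume u: "u \<in> {1..J}"
   have "subtree n u = {v \<in> {1..n0}. v = u \<or> ancestor u v} \<union> {v \<in> ?V. ancestor u v}"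
    using u J by (auto simp: subtree_def)
   moreover have "card ({v \<in> {1..n0}. v = u \<or> ancestor u v} \<union> {v \<in> ?V. ancestor u v})
     = card {v \<in> {1..n0}. v = u \<or> ancestor u v} + card {v \<in> ?V. ancestor u v}"
    by (rule card_Un_disjoint) auto
   ultimately have "card (subtree n u) = c u + card {v \<in> ?V. ancestor u v}"
    unfolding c_def by argo
   thus "real (card {v \<in> ?V. ancestor u v})*?Lc u w = real (card (subtree n u))*?Lc u w - real (c u)*?Lc u w"
    by (simp add: algebra_simps)
  qed
  finally show ?thesis by (simp add: sum_subtractf X4_def)
 qed
 have dec: "?R w
   = X1 w + X2 w + (\<Sum>v\<in>?V. X3 v w) + X4 w" for w
 proof -
  have "(\<Sum>v\<in>?V. X3 v w) = (\<Sum>v\<in>?V. Y J v w) - ((\<Sum>v\<in>?V. psi k r (depth v)) - (\<Sum>v\<in>?V. \<Sum>u\<in>top J v. ?Lc u w))"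
   unfolding X3_def by (simp only: sum_subtractf)
  moreover have "X2 w = (\<Sum>v\<in>?V. I v w) - (\<Sum>v\<in>?V. Y J v w)" unfolding X2_def by (rule sum_subtractf)
  ultimately show ?thesis unfolding num split X1_def linearized_def EL_def[symmetric] dbl by linarith
 qed
 have i1: "integrable M X1" "(LINT w|M. \<bar>X1 w\<bar>) <= real n0"
 proof -
  have m1: "X1 \<in> borel_measurable M" unfolding X1_def using J by (intro borel_measurable_sum I_measurable) auto
  have b: "\<bar>X1 w\<bar> <= real n0" for w
  proof -
   have "\<bar>X1 w\<bar> <= (\<Sum>v\<in>{1..n0}. 1)" unfolding X1_def
    using I_bounds by (intro order_trans[OF sum_abs] sum_mono) auto
   thus ?thesis by simp
  qed
  show i: "integrable M X1" by (rule integrable_const_bound[of _ "real n0"]) (use b m1 in auto)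
  have "(LINT w|M. \<bar>X1 w\<bar>) <= (LINT w|M. real n0)" by (rule integral_mono) (use i b in auto)
  thus "(LINT w|M. \<bar>X1 w\<bar>) <= real n0" by (simp add: prob_space)
 qed
 have i2: "integrable M X2" "(LINT w|M. \<bar>X2 w\<bar>) <= 2*real n/sqrt (real (J + 1))"
  unfolding X2_def by (rule record_sum_variance[OF V], assumption)+
 have i3: "integrable M (X3 v)" "(LINT w|M. \<bar>X3 v w\<bar>) <= (2*(real (card (top J v)))\<^sup>2 + 2*real (card (top J v))*real (m - card (low J v)))*rho (card (low J v))"
  if "v \<in> ?V" for v
 proof -
  have v: "v \<in> {1..n}" using that J by auto
  show "(LINT w|M. \<bar>X3 v w\<bar>) <= (2*(real (card (top J v)))\<^sup>2 + 2*real (card (top J v))*real (m - card (low J v)))*rho (card (low J v))"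
   unfolding X3_def EL_def by (rule Y_linearization(2)[OF v lowm[OF v]])
  show "integrable M (X3 v)"
   unfolding X3_def
   by (intro bochner_diff bochner_sum Y_linearization(1)[OF v order_refl] iL integrable_const)
     (auto simp: top_def)
 qed
 have i4: "integrable M X4" "(LINT w|M. \<bar>X4 w\<bar>) <= 2*EL*(real n0*(log 2 (real J) + 2))"
 proof -
  have it: "integrable M (%w. real (c u)*?Lc u w)" if "u \<in> {1..J}" for u by (intro integrable_mult_right iL that)
  show i: "integrable M X4" unfolding X4_def by (intro bochner_sum it)
  have "(LINT w|M. \<bar>X4 w\<bar>) <= (LINT w|M. (\<Sum>u\<in>{1..J}. real (c u)*\<bar>?Lc u w\<bar>))"
  proof (rule integral_mono)
   show "integrable M (%w. \<bar>X4 w\<bar>)" using i by simp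
   show "integrable M (%w. \<Sum>u\<in>{1..J}. real (c u)*\<bar>?Lc u w\<bar>)"
    by (intro bochner_sum integrable_mult_right integrable_abs iL)
   show "\<bar>X4 w\<bar> <= (\<Sum>u\<in>{1..J}. real (c u)*\<bar>?Lc u w\<bar>)" for w
    unfolding X4_def by (rule order_trans[OF sum_abs]) (simp add: abs_mult)
  qed
  also have "... = (\<Sum>u\<in>{1..J}. real (c u)*(LINT w|M. \<bar>?Lc u w\<bar>))"
   by (subst bochner_integral_sum) (auto intro!: integrable_mult_right integrable_abs iL)
  also have "... <= (\<Sum>u\<in>{1..J}. real (c u)*(2*EL))"
   using Labs by (intro sum_mono mult_left_mono) auto
  also have "... = 2*EL*real (\<Sum>u\<in>{1..J}. c u)" unfolding of_nat_sum sum_distrib_left by (intro sum.cong) auto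
  also have "(\<Sum>u\<in>{1..J}. c u) = (\<Sum>v\<in>{1..n0}. card {u \<in> {1..J}. v = u \<or> ancestor u v})"
   unfolding c_def by (rule sum_card_subtree[symmetric]) auto
  also have "real ... <= real n0*(log 2 (real J) + 2)"
  proof -
   have "real (card {u \<in> {1..J}. v = u \<or> ancestor u v}) <= log 2 (real J) + 2" for v
   proof -
    have "{u \<in> {1..J}. v = u \<or> ancestor u v} \<subseteq> insert v (ancs v \<inter> {1..J})" by (auto simp: ancs_def)
    hence "card {u \<in> {1..J}. v = u \<or> ancestor u v} <= card (insert v (ancs v \<inter> {1..J}))"
     by (intro card_mono) auto
    also have "... <= card (ancs v \<inter> {1..J}) + 1" by (simp add: card_insert_if)
    finally show ?thesis using card_ancs_le[OF J(1), of v] by simp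
   qed
   hence "real (\<Sum>v\<in>{1..n0}. card {u \<in> {1..J}. v = u \<or> ancestor u v}) <= (\<Sum>v\<in>{1..n0}. log 2 (real J) + 2)"
    unfolding of_nat_sum by (intro sum_mono)
   thus ?thesis by simp
  qed
  finally show "(LINT w|M. \<bar>X4 w\<bar>) <= 2*EL*(real n0*(log 2 (real J) + 2))"
   using EL0 by (simp add: mult_left_mono)
 qed
 have iX3: "integrable M (%w. \<Sum>v\<in>?V. X3 v w)" by (intro bochner_sum i3(1))
 show int: "integrable M ?R"
  unfolding dec by (intro bochner_add i1 i2 iX3 i4)
 have "(LINT w|M. \<bar>?R w\<bar>)
   <= (LINT w|M. \<bar>X1 w\<bar> + \<bar>X2 w\<bar> + (\<Sum>v\<in>?V. \<bar>X3 v w\<bar>) + \<bar>X4 w\<bar>)"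
 proof (rule integral_mono)
  show "integrable M (%w. \<bar>?R w\<bar>)"
   using int by (rule integrable_abs)
  show "integrable M (%w. \<bar>X1 w\<bar> + \<bar>X2 w\<bar> + (\<Sum>v\<in>?V. \<bar>X3 v w\<bar>) + \<bar>X4 w\<bar>)"
   by (intro bochner_add bochner_sum integrable_abs i1 i2 i3 i4)
  fix w
  have "\<bar>\<Sum>v\<in>?V. X3 v w\<bar> <= (\<Sum>v\<in>?V. \<bar>X3 v w\<bar>)" by (rule sum_abs)
  thus "\<bar>?R w\<bar>
    <= \<bar>X1 w\<bar> + \<bar>X2 w\<bar> + (\<Sum>v\<in>?V. \<bar>X3 v w\<bar>) + \<bar>X4 w\<bar>"
   unfolding dec by linarith
 qed
 also have "... = (LINT w|M. \<bar>X1 w\<bar>) + (LINT w|M. \<bar>X2 w\<bar>) + (\<Sum>v\<in>?V. (LINT w|M. \<bar>X3 v w\<bar>)) + (LINT w|M. \<bar>X4 w\<bar>)"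
 proof -
  note a = integrable_abs[OF i1(1)] integrable_abs[OF i2(1)] integrable_abs[OF i4(1)]
  have b: "integrable M (%w. \<Sum>v\<in>?V. \<bar>X3 v w\<bar>)"
   by (intro bochner_sum integrable_abs i3(1))
  have c: "(LINT w|M. (\<Sum>v\<in>?V. \<bar>X3 v w\<bar>)) = (\<Sum>v\<in>?V. (LINT w|M. \<bar>X3 v w\<bar>))"
   by (intro bochner_integral_sum integrable_abs i3(1))
  note ab = bochner_add[OF a(1,2)]
  note abb = bochner_add[OF ab b]
  show ?thesis
   unfolding bochner_integral_add[OF abb a(3)] bochner_integral_add[OF ab b]
    bochner_integral_add[OF a(1,2)] c ..
 qed
 also have "... <= approx_error k r n J n0 m"
  using i1(2) i2(2) i3(2) i4(2) unfolding approx_error_def EL_def[symmetric] top_def low_def rho_def mult.assoc[of 2]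
  by (intro add_mono sum_mono)
 finally show "(LINT w|M. \<bar>?R w\<bar>) <= approx_error k r n J n0 m" .
qed

end

section \<open>Rescaled losses and their limit\<close>

lemma yweight_self:
 assumes "1 <= k" "0 < \<mu>" "0 < s"
 shows "yweight k k \<mu> s = exp (- yy k \<mu> s)/\<mu>"
proof -
 have "fact k = real k*fact (k - 1)" using assms by (cases k) auto
 thus ?thesis using assms by (simp add: yweight_def)
qed

lemma stretched_integrable:
 fixes k p :: nat and b :: real
 assumes k: "1 <= k" and p: "1 <= p" and b: "0 < b"
 shows "pos_integrable (%s. s powr (real p/real k - 1)*exp (- (b * s powr (1/real k))))"
proof -
 have yf: "yy k (fact k) s = s powr (1/real k)" for s by (simp add: yy_def)
 have i: "pos_integrable (%x. gr p x *\<^sub>R exp (x - b*x))"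
 proof -
  have "pos_integrable (%y::real. 1/fact (p - 1)*(y^(p - 1)*(1 + y^k)^0*exp (- (b*y))))"
   by (rule set_integrable_mult_right[OF poly_exp_integrable[OF b k]])
  also have "?this \<longleftrightarrow> ?thesis"
   by (rule set_integrable_cong) (auto simp: gr_def exp_diff exp_minus field_simps)
  finally show ?thesis .
 qed
 have "pos_integrable (%s. yweight k p (fact k) s *\<^sub>R exp (yy k (fact k) s - b*yy k (fact k) s))"
  using i by (subst gr_substitution(1)[OF k p]) auto
 hence "pos_integrable (%s. (real k*fact (p - 1))*(yweight k p (fact k) s *\<^sub>R exp (yy k (fact k) s - b*yy k (fact k) s)))"
  by (rule set_integrable_mult_right)
 also have "?this \<longleftrightarrow> ?thesis"
  using k by (intro set_integrable_cong) (auto simp: yweight_def yf exp_diff exp_minus field_simps)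
 finally show ?thesis .
qed

lemma stretched_exp_integrable:
 assumes "1 <= k" "0 < b"
 shows "pos_integrable (%s::real. exp (- (b * s powr (1/real k))))"
proof -
 have "pos_integrable (%s. s powr (real k/real k - 1)*exp (- (b * s powr (1/real k))))"
  by (rule stretched_integrable) (use assms in auto)
 also have "?this \<longleftrightarrow> ?thesis" using assms by (intro set_integrable_cong) auto
 finally show ?thesis .
qed

definition gL_integrand :: "nat => nat => nat => real => real => real" where
 "gL_integrand k r m z s = s powr (real r/real k - 1)*exp (- yy k (real m) s)*(Qk k (yy k (real m) s)^m * of_bool (z <= s))"

text \<open>The loss \<open>L m\<close> at the alarm with coordinate \<open>z\<close>, normalised as
  in \<open>L_rescaled\<close>; its limit for growing \<open>m\<close> is
  \<open>\<Gamma>(a,z)\<close>.\<close>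

definition gL :: "nat => nat => nat => real => real" where
 "gL k r m z = (PINT s. gL_integrand k r m z s)"

lemma gL_integrand_measurable [measurable]: "gL_integrand k r m z \<in> borel_measurable borel"
 unfolding gL_integrand_def by measurable

lemma gL_integrand_nonneg: "0 <= gL_integrand k r m z s"
 by (simp add: gL_integrand_def Qk_nonneg)

lemma gL_nonneg: "0 <= gL k r m z"
 unfolding gL_def set_lebesgue_integral_def
 by (intro integral_nonneg_AE AE_I2) (simp add: gL_integrand_nonneg)

text \<open>The constant \<open>1/(C2*C3)\<close> equals \<open>k (r-1)!/(k!)^a\<close>, the inverse
  of the factor that the substitution produces.\<close>

lemma (in alarm_tree) L_rescaled:
 assumes m: "1 <= m" and z: "0 < z"
 shows "1/(C2 k r*C3 k r)*real m powr (real r/real k)*L m (yy k (real m) z) = gL k r m z"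
proof -
 have m0: "0 < real m" using m by simp
 define a where "a = real r/real k"
 have a: "0 < a" using k r by (simp add: a_def)
 have "L m (yy k (real m) z) = (PINT x. gr r x *\<^sub>R (Qk k x^m * of_bool (yy k (real m) z <= x)))"
  by (simp add: L_def)
 also have "... = (PINT s. yweight k r (real m) s *\<^sub>R (Qk k (yy k (real m) s)^m * of_bool (yy k (real m) z <= yy k (real m) s)))"
  by (rule gr_substitution(2)[OF k r(1) m0]) measurable
 also have "... = (PINT s. ((fact k/real m) powr a/(real k*fact (r - 1)))*gL_integrand k r m z s)"
  by (intro set_lebesgue_integral_cong) (auto simp: yweight_def gL_integrand_def a_def yy_le_iff[OF k m0 z])
 also have "... = ((fact k/real m) powr a/(real k*fact (r - 1)))*gL k r m z"
  unfolding gL_def by (rule set_integral_mult_right)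
 finally have e: "L m (yy k (real m) z) = ((fact k/real m) powr a/(real k*fact (r - 1)))*gL k r m z" .
 have "a \<notin> \<int>\<^sub>\<le>\<^sub>0" using a nonpos_Ints_nonpos[of a] by auto
 hence G: "Gamma (1 + a) = a*Gamma a" using Gamma_plus1[of a] by (simp add: add.commute)
 have Gr: "Gamma (real r) = fact (r - 1)" using r(1) Gamma_fact[of "r - 1", where 'a=real] by (simp add: of_nat_diff)
 have "Gamma (real r/real k) ~= 0" using Gamma_pos[OF a] by (simp add: a_def)
 hence "1/(C2 k r*C3 k r) = real k*fact (r - 1)/fact k powr a"
  using k r a unfolding C2_def C3_def a_def[symmetric] G Gr
  by (simp add: a_def field_simps power2_eq_square)
 thus ?thesis unfolding e a_def[symmetric] using m0 k by (simp add: powr_divide)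
qed

lemma gL_integrand_bound:
 assumes k: "1 <= k"
 obtains c where "0 < c"
  "!!m z s. 1 <= m ==> 0 < s ==> gL_integrand k r m z s <= exp (2*c)*(s powr (real r/real k - 1)*exp (- (2*c * s powr (1/real k))))"
proof -
 obtain c0 where c0: "c0 > 0" "!!x d. 0 <= x ==> d >= 1 ==> Qk k x^d <= exp (c0 - c0*(real d powr (1/real k)*x))"
  using Qk_power_bound[OF k] by metis
 \<comment> \<open>Half of the decay rate, so that \<open>gL_bound\<close> can spend one half on
   decay in \<open>z\<close> and keep the other half for integrability in \<open>s\<close>.\<close>
 define c where "c = c0/2"
 have c: "0 < c" "c0 = 2*c" using c0 by (auto simp: c_def)
 let ?a = "real r/real k"
 let ?h = "%c s. s powr (?a - 1)*exp (- (c * s powr (1/real k)))"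
 have Q: "Qk k (yy k (real m) s)^m <= exp (2*c - 2*c * s powr (1/real k))" if m: "1 <= m" and s: "0 < s" for m s
 proof -
  have "real m powr (1/real k)*yy k (real m) s = (fact k * s) powr (1/real k)"
   using m s by (simp add: yy_def powr_divide)
  moreover have "s powr (1/real k) <= (fact k * s) powr (1/real k)"
   using s by (intro powr_mono2) (auto simp: fact_ge_1)
  ultimately have "2*c - 2*c*(real m powr (1/real k)*yy k (real m) s) <= 2*c - 2*c * s powr (1/real k)"
   using c by simp
  thus ?thesis using c0(2)[of "yy k (real m) s" m] m unfolding c(2) by (meson exp_le_cancel_iff order_trans yy_nonneg)
 qed
 have b2: "gL_integrand k r m z s <= exp (2*c)*?h (2*c) s" if m: "1 <= m" and s: "0 < s" for m z s
 proof -
  have "gL_integrand k r m z s <= s powr (?a - 1)*1*(exp (2*c - 2*c * s powr (1/real k))*1)"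
   unfolding gL_integrand_def using Q[OF m s] by (intro mult_mono) (auto simp: Qk_nonneg)
  thus ?thesis by (simp add: exp_diff exp_minus field_simps)
 qed
 from that[OF c(1) b2] show thesis .
qed

lemma gL_bound:
 assumes k: "1 <= k" and r: "1 <= r"
 obtains B c where "0 <= B" "0 < c" "!!m z. 1 <= m ==> 0 < z ==> gL k r m z <= B*exp (- (c*z powr (1/real k)))"
proof -
 let ?a = "real r/real k"
 let ?h = "%c s. s powr (?a - 1)*exp (- (c * s powr (1/real k)))"
 obtain c where c: "0 < c" and b2: "!!m z s. 1 <= m ==> 0 < s ==> gL_integrand k r m z s <= exp (2*c)*?h (2*c) s"
  using gL_integrand_bound[OF k] by metis
 have i: "pos_integrable (?h b)" if "0 < b" for b by (rule stretched_integrable[OF k r that])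
 have b3: "pos_integrable (gL_integrand k r m z)" if m: "1 <= m" for m z
 proof (rule set_integrable_bound)
  show "pos_integrable (%s. exp (2*c)*?h (2*c) s)" using i[of "2*c"] c by simp
  show "set_borel_measurable lborel {0<..} (gL_integrand k r m z)" unfolding set_borel_measurable_def by measurable
  show "AE s in lborel. s \<in> {0<..} --> norm (gL_integrand k r m z s) <= norm (exp (2*c)*?h (2*c) s)"
   using b2[OF m] by (auto simp: gL_integrand_nonneg)
 qed
 define B where "B = exp (2*c)*(PINT s. ?h c s)"
 have "0 <= B" unfolding B_def set_lebesgue_integral_def
  by (intro mult_nonneg_nonneg integral_nonneg_AE AE_I2) auto
 moreover have "gL k r m z <= B*exp (- (c*z powr (1/real k)))" if m: "1 <= m" and z: "0 < z" for m z
 proof -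
  have "gL k r m z <= (PINT s. (exp (2*c)*exp (- (c*z powr (1/real k))))*?h c s)"
   unfolding gL_def
  proof (rule set_integral_mono[OF b3[OF m] set_integrable_mult_right[OF i[OF c]]])
   fix s :: real assume s: "s \<in> {0<..}"
   show "gL_integrand k r m z s <= (exp (2*c)*exp (- (c*z powr (1/real k))))*?h c s"
   proof (cases "z <= s")
    case True
    have "z powr (1/real k) <= s powr (1/real k)" using True z by (intro powr_mono2) auto
    hence "exp (- (2*c * s powr (1/real k))) <= exp (- (c*z powr (1/real k)))*exp (- (c * s powr (1/real k)))"
     using c unfolding exp_add[symmetric] by simp
    from this have "exp (2*c)*?h (2*c) s <= exp (2*c)*(s powr (?a - 1)*(exp (- (c*z powr (1/real k)))*exp (- (c * s powr (1/real k)))))"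
     by (intro mult_left_mono) auto
    from order_trans[OF b2[OF m, of s z] this] show ?thesis using s by (simp add: mult_ac)
   next
    case False
    hence "gL_integrand k r m z s = 0" by (simp add: gL_integrand_def)
    thus ?thesis by simp
   qed
  qed
  also have "... = (exp (2*c)*exp (- (c*z powr (1/real k))))*(PINT s. ?h c s)"
   by (rule set_integral_mult_right)
  finally show ?thesis by (simp add: B_def mult_ac)
 qed
 ultimately show thesis by (rule that[OF _ c])
qed

text \<open>In the coordinate \<open>s\<close> the power is
  \<open>exp (- s) * exp (m * hr k y)\<close>, and \<open>m * hr k y\<close> is of order
  \<open>m*y^(k+1)\<close>, a multiple of \<open>s*y\<close>, which tends to 0.\<close>

lemma Qk_power_limit:
 assumes k: "1 <= k" and s: "0 < s" and m: "filterlim (m :: nat => nat) at_top sequentially"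
 shows "(%i. yy k (real (m i)) s) ----> 0"
  and "(%i. Qk k (yy k (real (m i)) s)^m i) ----> exp (- s)"
proof -
 have mr: "filterlim (%i. real (m i)) at_top sequentially"
  by (rule filterlim_compose[OF filterlim_real_sequentially m])
 have q: "(%i. fact k * s/real (m i)) ----> 0"
  by (rule tendsto_divide_0[OF tendsto_const filterlim_at_top_imp_at_infinity[OF mr]])
 have "(%i. (fact k * s/real (m i)) powr (1/real k)) ----> 0 powr (1/real k)"
  by (rule tendsto_powr'[OF q tendsto_const]) (use k s in auto)
 thus y0: "(%i. yy k (real (m i)) s) ----> 0" by (simp add: yy_def)
 obtain C \<delta> where C: "C >= 0" "\<delta> > 0" "!!x. 0 <= x ==> x <= \<delta> ==> \<bar>hr k x\<bar> <= C*x^(k + 1)"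
  using hr_bound[OF k] by metis
 have pos: "\<forall>\<^sub>F i in sequentially. 1 <= m i" using m by (simp add: filterlim_at_top)
 have small: "\<forall>\<^sub>F i in sequentially. yy k (real (m i)) s < \<delta>" by (rule order_tendstoD(2)[OF y0 C(2)])
 have yk: "real (m i)*yy k (real (m i)) s^k = fact k * s" if "1 <= m i" for i
  using yy_power[of "real (m i)" s k k] that s k by simp
 have h0: "(%i. real (m i)*hr k (yy k (real (m i)) s)) ----> 0"
 proof (rule Lim_null_comparison)
  show "\<forall>\<^sub>F i in sequentially. norm (real (m i)*hr k (yy k (real (m i)) s)) <= C*(fact k * s)*yy k (real (m i)) s"
   using pos small
  proof eventually_elim
   case (elim i)
   have "norm (real (m i)*hr k (yy k (real (m i)) s)) <= real (m i)*(C*yy k (real (m i)) s^(k + 1))"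
    using C(3)[of "yy k (real (m i)) s"] elim by (simp add: abs_mult mult_left_mono)
   also have "... = C*(real (m i)*yy k (real (m i)) s^k)*yy k (real (m i)) s" by simp
   finally show ?case using yk[OF elim(1)] by simp
  qed
  show "(%i. C*(fact k * s)*yy k (real (m i)) s) ----> 0" by (rule tendsto_mult_right_zero[OF y0])
 qed
 have "(%i. exp (- s)*exp (real (m i)*hr k (yy k (real (m i)) s))) ----> exp (- s)*exp 0"
  by (intro tendsto_intros h0)
 moreover have "\<forall>\<^sub>F i in sequentially. exp (- s)*exp (real (m i)*hr k (yy k (real (m i)) s)) = Qk k (yy k (real (m i)) s)^m i"
  using pos
 proof eventually_elim
  case (elim i)
  show ?case using Qk_power_eq[OF k, of "yy k (real (m i)) s" "m i"] yk[OF elim] by simp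
 qed
 ultimately show "(%i. Qk k (yy k (real (m i)) s)^m i) ----> exp (- s)"
  by (simp add: tendsto_cong)
qed

lemma gL_limit:
 assumes k: "1 <= k" and r: "1 <= r" and z: "0 < z" and m: "filterlim (m :: nat => nat) at_top sequentially"
  and m1: "!!i. 1 <= m i"
 shows "(%i. gL k r (m i) z) ----> uG (real r/real k) z"
proof -
 let ?a = "real r/real k"
 obtain c where c: "0 < c" and Bc: "!!m z s. 1 <= m ==> 0 < s ==> gL_integrand k r m z s <= exp (2*c)*(s powr (?a - 1)*exp (- (2*c * s powr (1/real k))))"
  using gL_integrand_bound[OF k] by metis
 have "(%i. LINT s|lborel. indicator {0<..} s *\<^sub>R gL_integrand k r (m i) z s) ----> (LINT s|lborel. indicator {z..} s *\<^sub>R (exp (- s) * s powr (?a - 1)))"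
 proof (rule integral_dominated_convergence[where w="%s. indicator {0<..} s *\<^sub>R (exp (2*c)*(s powr (?a - 1)*exp (- (2*c * s powr (1/real k)))))"])
  show "integrable lborel (%s. indicator {0<..} s *\<^sub>R (exp (2*c)*(s powr (?a - 1)*exp (- (2*c * s powr (1/real k))))))"
   using set_integrable_mult_right[OF stretched_integrable[OF k r, of "2*c"], of "exp (2*c)"] c by (simp add: set_integrable_def)
  show "AE s in lborel. norm (indicator {0<..} s *\<^sub>R gL_integrand k r (m i) z s) <= indicator {0<..} s *\<^sub>R (exp (2*c)*(s powr (?a - 1)*exp (- (2*c * s powr (1/real k)))))" for i
   using Bc[OF m1] by (intro AE_I2) (auto simp: indicator_def gL_integrand_nonneg)
  show "AE s in lborel. (%i. indicator {0<..} s *\<^sub>R gL_integrand k r (m i) z s) ----> indicator {z..} s *\<^sub>R (exp (- s) * s powr (?a - 1))"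
  proof (rule AE_I2)
   fix s :: real
   show "(%i. indicator {0<..} s *\<^sub>R gL_integrand k r (m i) z s) ----> indicator {z..} s *\<^sub>R (exp (- s) * s powr (?a - 1))"
   proof (cases "z <= s")
    case True
    hence s: "0 < s" using z by simp
    have "(%i. s powr (?a - 1)*exp (- yy k (real (m i)) s)*(Qk k (yy k (real (m i)) s)^m i*1)) ----> s powr (?a - 1)*exp (- 0)*(exp (- s)*1)"
     by (intro tendsto_intros Qk_power_limit[OF k s m])
    thus ?thesis using True s by (simp add: gL_integrand_def mult.commute)
   qed (simp add: gL_integrand_def)
  qed
 qed measurable
 thus ?thesis using z by (simp add: gL_def set_lebesgue_integral_def uG_def upper_Gamma_def)
qed

lemmas levy_term_eq = levy_term_def[OF order_refl order_refl order_refl]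
lemmas norm_iexp_bounds = norm_iexp_minus_one[OF order_refl order_refl order_refl] norm_iexp_minus_linear[OF order_refl order_refl order_refl]

lemma levy_term_continuous: "continuous_on UNIV (levy_term s j)"
 unfolding levy_term_eq[abs_def] by (cases "0 <= j") (auto intro!: continuous_intros)

lemma levy_term_measurable [measurable]: "levy_term s j \<in> borel_measurable borel"
 by (rule borel_measurable_continuous_onI[OF levy_term_continuous])

text \<open>For large jumps (\<open>j < 0\<close>) the constant bound 2 is not integrable in
  \<open>z\<close>, and the linear bound is not summable over \<open>j\<close>; their geometric
  mean, a square root, is both. For \<open>j >= 0\<close> the compensated term is quadratic.\<close>

lemma norm_levy_term_le:
 assumes "0 <= x"
 shows "norm (levy_term s j x) <= (if j < 0 then sqrt (2*\<bar>s\<bar>) * sqrt x else s\<^sup>2*x\<^sup>2)"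
proof (cases "j < 0")
 case True
 hence e: "levy_term s j x = iexp (s*x) - 1" by (simp add: levy_term_eq)
 let ?n = "norm (levy_term s j x)"
 have "?n*?n <= 2*\<bar>s*x\<bar>"
  unfolding e by (intro mult_mono norm_iexp_bounds(1,2)) auto
 hence "?n\<^sup>2 <= (2*\<bar>s\<bar>)*x" using assms by (simp add: abs_mult power2_eq_square)
 hence "?n <= sqrt ((2*\<bar>s\<bar>)*x)" by (rule real_le_rsqrt)
 thus ?thesis using True by (simp add: real_sqrt_mult)
next
 case False
 thus ?thesis using norm_iexp_bounds(3)[of "s*x"] by (simp add: levy_term_eq power_mult_distrib)
qed

lemma gL_measurable [measurable]: "gL k r m \<in> borel_measurable borel"
 unfolding gL_def[abs_def] gL_integrand_def set_lebesgue_integral_def by measurable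

text \<open>\<open>m\<close> times the expected \<open>levy_term\<close> of a node with jump scale
  \<open>c\<close> (\<open>expectation_levy_term\<close>); the exponential factor is
  \<open>m\<close> times the density of its alarm in the coordinate \<open>z\<close>.\<close>

definition lam :: "nat => nat => nat => real => int => real => complex" where
 "lam k r m s j c = (PINT z. exp (- yy k (real m) z) *\<^sub>R levy_term s j (c*gL k r m z))"

text \<open>One integrable majorant, uniform in \<open>m\<close>, for both powers of
  \<open>gL\<close> occurring in \<open>norm_levy_term_le\<close>.\<close>

lemma gL_envelope:
 assumes k: "1 <= k" and r: "1 <= r"
 obtains h where "!!z. 0 <= h z" "pos_integrable h"
  "!!m z. 1 <= m ==> 0 < z ==> sqrt (gL k r m z) <= h z & (gL k r m z)\<^sup>2 <= h z"
proof -
 obtain B c where B: "0 <= B" and c: "0 < c"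
  and b: "!!m z. 1 <= m ==> 0 < z ==> gL k r m z <= B*exp (- (c*z powr (1/real k)))"
  using gL_bound[OF k r] by metis
 define h where "h z = (sqrt B + B\<^sup>2)*exp (- (c/2*z powr (1/real k)))" for z
 have h0: "0 <= h z" for z using B by (simp add: h_def)
 have hi: "pos_integrable h"
  unfolding h_def by (intro set_integrable_mult_right stretched_exp_integrable k) (use c in auto)
 have hb: "sqrt (gL k r m z) <= h z & (gL k r m z)\<^sup>2 <= h z" if m: "1 <= m" and z: "0 < z" for m z
 proof -
  define e where "e = exp (- (c/2*z powr (1/real k)))"
  have e: "0 < e" "e <= 1" using c by (auto simp: e_def)
  have ee: "exp (- (c*z powr (1/real k))) = e*e" unfolding e_def exp_add[symmetric] by (simp add: field_simps)
  have g: "0 <= gL k r m z" "gL k r m z <= B*(e*e)" using gL_nonneg b[OF m z] unfolding ee by auto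
  have "sqrt (gL k r m z) <= sqrt (B*(e*e))" using g by simp
  also have "... = sqrt B*e" using e by (simp add: real_sqrt_mult)
  also have "... <= h z" unfolding h_def e_def[symmetric] using e by (intro mult_right_mono) auto
  finally have 1: "sqrt (gL k r m z) <= h z" .
  have "(gL k r m z)\<^sup>2 <= (B*(e*e))\<^sup>2" using g by (intro power_mono) auto
  also have "... = B\<^sup>2*(e*(e*e*e))" by (simp add: power2_eq_square)
  also have "... <= B\<^sup>2*(e*1)" using e by (intro mult_left_mono mult_le_one) auto
  also have "... <= h z" unfolding h_def e_def[symmetric] using e B by (simp add: mult_right_mono)
  finally show ?thesis using 1 by simp
 qed
 from that[OF h0 hi hb] show thesis .
qed

lemma lam_envelope:
 assumes k: "1 <= k" and r: "1 <= r"
 obtains h where "!!z. 0 <= h z" "pos_integrable h"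
  "!!m s j c z. 1 <= m ==> 0 <= c ==> 0 < z ==> norm (exp (- yy k (real m) z) *\<^sub>R levy_term s j (c*gL k r m z))
    <= (if j < 0 then sqrt (2*\<bar>s\<bar>) * sqrt c else s\<^sup>2*c\<^sup>2)*h z"
proof -
 obtain h where h: "!!z. 0 <= h z" "pos_integrable h"
  "!!m z. 1 <= m ==> 0 < z ==> sqrt (gL k r m z) <= h z & (gL k r m z)\<^sup>2 <= h z"
  using gL_envelope[OF k r] by metis
 have "norm (exp (- yy k (real m) z) *\<^sub>R levy_term s j (c*gL k r m z)) <= (if j < 0 then sqrt (2*\<bar>s\<bar>) * sqrt c else s\<^sup>2*c\<^sup>2)*h z"
  if m: "1 <= m" and c: "0 <= c" and z: "0 < z" for m s j c z
 proof -
  have "norm (exp (- yy k (real m) z) *\<^sub>R levy_term s j (c*gL k r m z)) <= 1*norm (levy_term s j (c*gL k r m z))"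
   unfolding norm_scaleR by (intro mult_right_mono) auto
  also have "... <= (if j < 0 then (sqrt (2*\<bar>s\<bar>) * sqrt c) * sqrt (gL k r m z) else (s\<^sup>2*c\<^sup>2)*(gL k r m z)\<^sup>2)"
   using norm_levy_term_le[of "c*gL k r m z" s j] c gL_nonneg[of k r m z]
   by (simp add: real_sqrt_mult power_mult_distrib mult_ac split: if_splits)
  also have "... <= (if j < 0 then sqrt (2*\<bar>s\<bar>) * sqrt c else s\<^sup>2*c\<^sup>2)*h z"
   using h(3)[OF m z] c by (auto intro!: mult_left_mono)
  finally show ?thesis .
 qed
 from that[OF h(1,2) this] show thesis .
qed

lemma lam_bound:
 assumes k: "1 <= k" and r: "1 <= r"
 obtains K where "0 <= K"
  "!!m s j c. 1 <= m ==> 0 <= c ==> norm (lam k r m s j c) <= K*(if j < 0 then sqrt (2*\<bar>s\<bar>) * sqrt c else s\<^sup>2*c\<^sup>2)"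
proof -
 obtain h where h: "!!z. 0 <= h z" "pos_integrable h"
  "!!m s j c z. 1 <= m ==> 0 <= c ==> 0 < z ==> norm (exp (- yy k (real m) z) *\<^sub>R levy_term s j (c*gL k r m z))
    <= (if j < 0 then sqrt (2*\<bar>s\<bar>) * sqrt c else s\<^sup>2*c\<^sup>2)*h z"
  using lam_envelope[OF k r] by metis
 have "0 <= (PINT z. h z)"
  unfolding set_lebesgue_integral_def using h(1) by (intro integral_nonneg_AE AE_I2) auto
 moreover have "norm (lam k r m s j c) <= (PINT z. h z)*(if j < 0 then sqrt (2*\<bar>s\<bar>) * sqrt c else s\<^sup>2*c\<^sup>2)" (is "_ <= _*?b")
  if m: "1 <= m" and c: "0 <= c" for m s j c
 proof -
  let ?F = "%z. exp (- yy k (real m) z) *\<^sub>R levy_term s j (c*gL k r m z)"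
  have ib: "pos_integrable (%z. ?b*h z)" by (rule set_integrable_mult_right[OF h(2)])
  have i: "pos_integrable ?F"
  proof (rule set_integrable_bound[OF ib])
   show "set_borel_measurable lborel {0<..} ?F" unfolding set_borel_measurable_def by measurable
   show "AE z in lborel. z \<in> {0<..} --> norm (?F z) <= norm (?b*h z)"
    by (intro AE_I2 impI order_trans[OF h(3)[OF m c]]) auto
  qed
  have "norm (lam k r m s j c) <= (PINT z. norm (?F z))"
   unfolding lam_def by (rule set_integral_norm_bound[OF i])
  also have "... <= (PINT z. ?b*h z)"
   by (rule set_integral_mono[OF set_integrable_norm[OF i] ib]) (use h(3)[OF m c] in simp)
  also have "... = ?b*(PINT z. h z)" by (rule set_integral_mult_right)
  finally show ?thesis by (simp only: mult.commute)
 qed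
 ultimately show thesis by (rule that)
qed

lemma lam_limit:
 assumes k: "1 <= k" and r: "1 <= r" and m: "filterlim (m :: nat => nat) at_top sequentially" and m1: "!!i. 1 <= m i"
  and c: "c ----> c0" "!!i. 0 <= c i"
 shows "(%i. lam k r (m i) s j (c i)) ----> (PINT z. levy_term s j (c0*uG (real r/real k) z))"
proof -
 obtain h where h: "!!z. 0 <= h z" "pos_integrable h"
  "!!m s j c z. 1 <= m ==> 0 <= c ==> 0 < z ==> norm (exp (- yy k (real m) z) *\<^sub>R levy_term s j (c*gL k r m z))
    <= (if j < 0 then sqrt (2*\<bar>s\<bar>) * sqrt c else s\<^sup>2*c\<^sup>2)*h z"
  using lam_envelope[OF k r] by metis
 obtain C where C: "!!i. c i <= C"
  using convergent_imp_Bseq[OF convergentI[OF c(1)]] unfolding Bseq_def by (metis abs_le_D1 real_norm_def)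
 have C0: "0 <= C" using C[of 0] c(2)[of 0] by simp
 have a: "0 < real r/real k" using k r by simp
 note [measurable] = uG_measurable[OF a]
 let ?b = "sqrt (2*\<bar>s\<bar>) * sqrt C + s\<^sup>2*C\<^sup>2"
 show ?thesis
  unfolding lam_def set_lebesgue_integral_def
 proof (rule integral_dominated_convergence[where w="%z. indicator {0<..} z *\<^sub>R (?b*h z)"])
  show "integrable lborel (%z. indicator {0<..} z *\<^sub>R (?b*h z))"
   using set_integrable_mult_right[OF h(2)] by (simp add: set_integrable_def)
  show "AE z in lborel. (%i. indicator {0<..} z *\<^sub>R exp (- yy k (real (m i)) z) *\<^sub>R levy_term s j (c i*gL k r (m i) z))
    ----> indicator {0<..} z *\<^sub>R levy_term s j (c0*uG (real r/real k) z)"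
  proof (rule AE_I2)
   fix z :: real
   show "(%i. indicator {0<..} z *\<^sub>R exp (- yy k (real (m i)) z) *\<^sub>R levy_term s j (c i*gL k r (m i) z))
    ----> indicator {0<..} z *\<^sub>R levy_term s j (c0*uG (real r/real k) z)"
   proof (cases "0 < z")
    case True
    have "isCont (levy_term s j) x" for x using levy_term_continuous continuous_on_eq_continuous_at open_UNIV by blast
    hence "(%i. levy_term s j (c i*gL k r (m i) z)) ----> levy_term s j (c0*uG (real r/real k) z)"
     by (rule isCont_tendsto_compose) (intro tendsto_intros c gL_limit[OF k r True m m1])
    hence "(%i. exp (- yy k (real (m i)) z) *\<^sub>R levy_term s j (c i*gL k r (m i) z))
     ----> exp (- 0) *\<^sub>R levy_term s j (c0*uG (real r/real k) z)"
     by (intro tendsto_intros Qk_power_limit(1)[OF k True m])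
    thus ?thesis using True by simp
   qed simp
  qed
  fix i
  show "AE z in lborel. norm (indicator {0<..} z *\<^sub>R exp (- yy k (real (m i)) z) *\<^sub>R levy_term s j (c i*gL k r (m i) z)) <= indicator {0<..} z *\<^sub>R (?b*h z)"
  proof (rule AE_I2)
   fix z :: real
   show "norm (indicator {0<..} z *\<^sub>R exp (- yy k (real (m i)) z) *\<^sub>R levy_term s j (c i*gL k r (m i) z)) <= indicator {0<..} z *\<^sub>R (?b*h z)"
   proof (cases "0 < z")
    case True
    have "norm (exp (- yy k (real (m i)) z) *\<^sub>R levy_term s j (c i*gL k r (m i) z)) <= (if j < 0 then sqrt (2*\<bar>s\<bar>) * sqrt (c i) else s\<^sup>2*(c i)\<^sup>2)*h z"
     by (rule h(3)[OF m1 c(2) True])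
    also have "... <= ?b*h z"
    proof (rule mult_right_mono[OF _ h(1)])
     have "sqrt (2*\<bar>s\<bar>) * sqrt (c i) <= sqrt (2*\<bar>s\<bar>) * sqrt C" "s\<^sup>2*(c i)\<^sup>2 <= s\<^sup>2*C\<^sup>2"
      using C[of i] c(2)[of i] by (auto intro!: mult_left_mono power_mono)
     thus "(if j < 0 then sqrt (2*\<bar>s\<bar>) * sqrt (c i) else s\<^sup>2*(c i)\<^sup>2) <= ?b" using C0 by (auto intro: add_increasing add_increasing2)
    qed
    finally show ?thesis using True by simp
   qed simp
  qed
 qed measurable
qed

lemma (in alarm_tree) L_measurable: "L m \<in> borel_measurable borel"
 unfolding L_def[abs_def] set_lebesgue_integral_def by measurable

lemma (in alarm_tree) expectation_levy_term:
 assumes u: "u \<in> {1..n}" and m: "1 <= m"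
 defines "\<kappa> \<equiv> 1/(C2 k r*C3 k r)*real m powr (real r/real k)"
 shows "(CLINT w|M. levy_term s j (c*(\<kappa>*L m (T u w)))) = lam k r m s j c/of_nat m"
proof -
 note [measurable] = L_measurable
 let ?f = "%x. levy_term s j (c*(\<kappa>*L m x))"
 have f: "?f \<in> borel_measurable borel" by measurable
 have m0: "0 < real m" using m by simp
 have "(CLINT w|M. ?f (T u w)) = (PINT x. gr k x *\<^sub>R ?f x)"
  unfolding T_def by (rule expectation_alarm[OF k u f])
 also have "... = (PINT z. yweight k k (real m) z *\<^sub>R ?f (yy k (real m) z))"
  by (rule gr_substitution(2)[OF k k m0 f])
 also have "... = (PINT z. (1/real m) *\<^sub>R (exp (- yy k (real m) z) *\<^sub>R levy_term s j (c*gL k r m z)))"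
 proof (intro set_lebesgue_integral_cong allI impI)
  fix z :: real assume "z \<in> {0<..}"
  hence z: "0 < z" by simp
  show "yweight k k (real m) z *\<^sub>R ?f (yy k (real m) z) = (1/real m) *\<^sub>R (exp (- yy k (real m) z) *\<^sub>R levy_term s j (c*gL k r m z))"
   unfolding \<kappa>_def L_rescaled[OF m z] yweight_self[OF k m0 z] by simp
 qed simp
 also have "... = (1/real m) *\<^sub>R lam k r m s j c"
  unfolding lam_def set_lebesgue_integral_def scaleR_left_commute[of _ "1/real m"]
  by (rule bochner_integral_scaleR_right)
 also have "... = lam k r m s j c/of_nat m" by (simp add: scaleR_conv_of_real)
 finally show ?thesis .
qed

section \<open>The array of size classes and the limit of its exponent\<close>

text \<open>Intended reading: \<open>n\<close> is the tree size, \<open>l\<close> its binary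
  logarithm, \<open>m\<close> the floor of \<open>l\<close>, and \<open>H + g\<close> splits
  \<open>lg n - lg lg n\<close> into integer and fractional part. Nodes up to
  \<open>n div 2^h1\<close> are the top nodes, and \<open>2^ht\<close> exceeds \<open>n\<close>. The
  hypotheses let the class index \<open>j = H - h\<close> eventually run through every
  integer.\<close>

locale record_array =
 fixes k r :: nat and \<gamma> :: real and n m H h1 ht :: "nat => nat" and l g :: "nat => real"
 assumes k: "1 <= k" and r: "1 <= r" "r <= k"
  and m_pos: "!!i. 1 <= m i" and m_top: "filterlim m at_top sequentially"
  and l_pos: "!!i. 0 < l i" and l_m: "!!i. l i <= 2*real (m i)" "(%i. l i/real (m i)) ----> 1"
  and g: "!!i. 0 <= g i" "!!i. g i <= 1" "g ----> \<gamma>"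
  and n_scale: "!!i. real (n i) = l i*2 powr (g i + real (H i))"
  and h1: "!!i. h1 i <= H i" "filterlim (%i. H i - h1 i) at_top sequentially"
  and ht: "!!i. n i < 2^ht i" "!!i. H i <= ht i" "filterlim (%i. ht i - H i) at_top sequentially"
   "(%i. real (ht i - h1 i)/real (m i)) ----> 0"
begin

definition a :: real where "a = real r/real k"

lemma a01: "0 < a" "a <= 1" using k r by (auto simp: a_def)

lemma n_pos: "0 < n i"
proof -
 have "0 < real (n i)" unfolding n_scale using l_pos[of i] by simp
 thus ?thesis by simp
qed

text \<open>The jump sizes, in units of \<open>L\<close>, of the contributions of the nodes.\<close>

definition jump :: "nat => nat => real" where
 "jump i u = (l i/real (m i)) powr a*(l i*real (card (subtree (n i) u))/real (n i))"

lemma jump_nonneg: "0 <= jump i u" using l_pos[of i] by (simp add: jump_def)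

lemma scale_eq: "real (n i)/(l i*2^nat (int (H i) - j)) = wscale (g i) j" if "j <= int (H i)"
proof -
 have "(2::real)^nat (int (H i) - j) = 2 powr (real (H i) - real_of_int j)"
  using that by (simp add: powr_realpow[symmetric] of_nat_nat)
 moreover have "wscale (g i) j*2 powr (real (H i) - real_of_int j) = 2 powr (g i + real (H i))"
  by (simp add: wscale_def powr_add[symmetric])
 ultimately show ?thesis using l_pos[of i] by (simp add: n_scale field_simps)
qed

lemma scale_inv: "j <= int (H i) ==> l i*2^nat (int (H i) - j)/real (n i) = 1/wscale (g i) j"
 by (simp add: scale_eq[symmetric])

lemma wscale_bounds: "2 powr real_of_int j <= wscale (g i) j" "wscale (g i) j <= 2*2 powr real_of_int j"
proof -
 have e: "wscale (g i) j = 2 powr g i*2 powr real_of_int j" by (simp add: wscale_def powr_add)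
 have "2 powr 0 <= 2 powr g i" "2 powr g i <= 2 powr 1" using g by (intro powr_mono; simp)+
 hence "1 <= 2 powr g i" "2 powr g i <= 2" by auto
 thus "2 powr real_of_int j <= wscale (g i) j" "wscale (g i) j <= 2*2 powr real_of_int j"
  unfolding e by auto
qed

lemma ratio_bounds: "0 < l i/real (m i)" "l i/real (m i) <= 2" "(l i/real (m i)) powr a <= 2"
proof -
 show 1: "0 < l i/real (m i)" using l_pos[of i] m_pos[of i] by simp
 show 2: "l i/real (m i) <= 2" using l_m(1)[of i] m_pos[of i] by (simp add: field_simps)
 have "(l i/real (m i)) powr a <= 2 powr a" using 1 2 a01 by (intro powr_mono2) auto
 also have "... <= 2 powr 1" using a01 by (intro powr_mono) auto
 finally show "(l i/real (m i)) powr a <= 2" by simp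
qed

text \<open>Indexed relative to \<open>H\<close>: class \<open>j\<close> has about
  \<open>n/2^(H-j) = l * wscale (g i) j\<close> nodes, so each fixed \<open>j\<close> has a
  limit.\<close>

definition cls :: "nat => int => nat set" where "cls i j = size_class (n i) (nat (int (H i) - j))"

lemma jump_le:
 assumes j: "j < int (H i)" and u: "u \<in> cls i j"
 shows "jump i u <= 2*2 powr (- real_of_int j)"
proof -
 let ?h = "nat (int (H i) - j)"
 have "card (subtree (n i) u) <= 2^?h - 1"
  using size_class_card(1)[of ?h u "n i"] u j by (simp add: cls_def)
 hence "real (card (subtree (n i) u)) <= real (2^?h - 1)" by (simp only: of_nat_le_iff)
 also have "... <= 2^?h" by simp
 finally have c: "real (card (subtree (n i) u)) <= 2^?h" .
 have "l i*real (card (subtree (n i) u))/real (n i) <= l i*2^?h/real (n i)"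
  using c l_pos[of i] by (intro divide_right_mono mult_left_mono) auto
 also have "... = 1/wscale (g i) j" by (rule scale_inv) (use j in simp)
 also have "... <= 1/2 powr real_of_int j" using wscale_bounds(1) by (intro divide_left_mono) auto
 finally have b: "l i*real (card (subtree (n i) u))/real (n i) <= 2 powr (- real_of_int j)"
  by (simp add: powr_minus_divide)
 have "0 <= l i*real (card (subtree (n i) u))/real (n i)" using l_pos[of i] by simp
 thus ?thesis unfolding jump_def using b ratio_bounds(3)[of i] by (intro mult_mono) auto
qed

lemma card_cls_le:
 assumes j: "j < int (H i)"
 shows "real (card (cls i j)) <= 12*2 powr real_of_int j*real (m i)"
proof (cases "cls i j = {}")
 case True
 thus ?thesis by simp
next
 case False
 let ?h = "nat (int (H i) - j)"
 have h: "1 <= ?h" using j by simp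
 from False obtain u where "u \<in> size_class (n i) ?h" by (auto simp: cls_def)
 hence u: "u*2^(?h - 1) <= n i" "n i < u*2^?h" using size_class_iff[OF h] by auto
 hence "2^(?h - 1) <= n i" using mult_le_mono1[of 1 u "2^(?h - 1)"] by (cases u) auto
 hence "2^?h <= 2*n i" using h by (cases ?h) auto
 hence "real (2^?h) <= real (2*n i)" by (simp only: of_nat_le_iff)
 \<comment> \<open>A nonempty class forces \<open>n/2^h >= 1/2\<close>, so the rounding error 1 is
   at most twice the main term.\<close>
 hence one: "1 <= 2*(real (n i)/2^?h)" by (simp add: field_simps)
 have "real (card (cls i j)) <= 3*(real (n i)/2^?h)"
  using card_size_class[OF h, of "n i"] one unfolding cls_def by linarith
 also have "real (n i)/2^?h = l i*wscale (g i) j"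
  using scale_eq[of j i] j l_pos[of i] by (simp add: field_simps)
 also have "3*(l i*wscale (g i) j) <= 3*((2*real (m i))*(2*2 powr real_of_int j))"
  using l_m(1)[of i] wscale_bounds(2)[of i j] l_pos[of i] by (intro mult_left_mono mult_mono) (auto intro: less_imp_le)
 finally show ?thesis by (simp add: mult_ac)
qed

text \<open>Contribution of class \<open>j\<close>, extended by 0 to all integers so that the sum
  over classes becomes an integral over the fixed space of integers.\<close>

definition block :: "real => nat => int => complex" where
 "block s i j = (if int (H i) - int (ht i) <= j & j < int (H i) - int (h1 i)
   then (\<Sum>u\<in>cls i j. lam k r (m i) s j (jump i u)/of_nat (m i)) else 0)"

lemma lam_cls_bound:
 obtains K where "0 <= K"
  "!!i j u. j < int (H i) ==> u \<in> cls i j ==> norm (lam k r (m i) s j (jump i u)) <= K*(if j < 0 then 2 powr (- (real_of_int j/2)) else 2 powr (- (2*real_of_int j)))"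
  "!!i j u. j < int (H i) ==> u \<in> cls i j ==> (norm (lam k r (m i) s (-1) (jump i u)))\<^sup>2 <= K*2 powr (- real_of_int j)"
proof -
 obtain K where K: "0 <= K"
  "!!m s j c. 1 <= m ==> 0 <= c ==> norm (lam k r m s j c) <= K*(if j < 0 then sqrt (2*\<bar>s\<bar>) * sqrt c else s\<^sup>2*c\<^sup>2)"
  using lam_bound[OF k r(1)] by metis
 define K' where "K' = K*(2 * sqrt \<bar>s\<bar>) + K*(4 * s\<^sup>2) + K\<^sup>2*(4*\<bar>s\<bar>)"
 have K'0: "0 <= K'" using K(1) by (simp add: K'_def)
 have rt: "sqrt (2*2 powr (- real_of_int j)) = sqrt 2*2 powr (- (real_of_int j/2))" for j
  by (simp add: real_sqrt_mult powr_half_sqrt[symmetric] powr_powr)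
 have 1: "norm (lam k r (m i) s j (jump i u)) <= K'*(if j < 0 then 2 powr (- (real_of_int j/2)) else 2 powr (- (2*real_of_int j)))"
  if j: "j < int (H i)" and u: "u \<in> cls i j" for i j u
 proof -
  note b = K(2)[OF m_pos jump_nonneg, of i s j i u]
  show ?thesis
  proof (cases "j < 0")
   case True
   have "sqrt (2*\<bar>s\<bar>) * sqrt (jump i u) <= sqrt (2*\<bar>s\<bar>)*(sqrt 2*2 powr (- (real_of_int j/2)))"
    unfolding rt[symmetric] using jump_le[OF j u] by (intro mult_left_mono real_sqrt_le_mono) auto
   also have "... = (2 * sqrt \<bar>s\<bar>)*2 powr (- (real_of_int j/2))" by (simp add: real_sqrt_mult)
   finally have "norm (lam k r (m i) s j (jump i u)) <= K*((2 * sqrt \<bar>s\<bar>)*2 powr (- (real_of_int j/2)))"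
    using b True K(1) by (auto intro: order_trans mult_left_mono)
   also have "... = (K*(2 * sqrt \<bar>s\<bar>))*2 powr (- (real_of_int j/2))" by simp
   also have "... <= K'*2 powr (- (real_of_int j/2))" using K(1) by (intro mult_right_mono) (auto simp: K'_def)
   finally show ?thesis using True by simp
  next
   case False
   have "s\<^sup>2*(jump i u)\<^sup>2 <= s\<^sup>2*(2*2 powr (- real_of_int j))\<^sup>2"
    using jump_le[OF j u] jump_nonneg[of i u] by (intro mult_left_mono power_mono) auto
   also have "(2*2 powr (- real_of_int j))\<^sup>2 = 4*2 powr (- (2*real_of_int j))"
    by (simp add: power2_eq_square powr_add[symmetric])
   finally have "norm (lam k r (m i) s j (jump i u)) <= K*(s\<^sup>2*(4*2 powr (- (2*real_of_int j))))"
    using b False K(1) by (auto intro: order_trans mult_left_mono)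
   also have "... = (K*(4 * s\<^sup>2))*2 powr (- (2*real_of_int j))" by simp
   also have "... <= K'*2 powr (- (2*real_of_int j))" using K(1) by (intro mult_right_mono) (auto simp: K'_def)
   finally show ?thesis using False by simp
  qed
 qed
 have 2: "(norm (lam k r (m i) s (-1) (jump i u)))\<^sup>2 <= K'*2 powr (- real_of_int j)"
  if j: "j < int (H i)" and u: "u \<in> cls i j" for i j u
 proof -
  have "norm (lam k r (m i) s (-1) (jump i u)) <= K*(sqrt (2*\<bar>s\<bar>) * sqrt (jump i u))"
   using K(2)[OF m_pos jump_nonneg, of i s "-1" i u] by simp
  hence "(norm (lam k r (m i) s (-1) (jump i u)))\<^sup>2 <= (K*(sqrt (2*\<bar>s\<bar>) * sqrt (jump i u)))\<^sup>2"
   by (intro power_mono) auto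
  also have "... = K\<^sup>2*(2*\<bar>s\<bar>)*jump i u" using jump_nonneg[of i u] by (simp add: power_mult_distrib)
  also have "... <= K\<^sup>2*(2*\<bar>s\<bar>)*(2*2 powr (- real_of_int j))"
   using jump_le[OF j u] by (intro mult_left_mono) auto
  also have "... = (K\<^sup>2*(4*\<bar>s\<bar>))*2 powr (- real_of_int j)" by simp
  also have "... <= K'*2 powr (- real_of_int j)" using K(1) by (intro mult_right_mono) (auto simp: K'_def)
  finally show ?thesis .
 qed
 from that[OF K'0 1 2] show thesis .
qed

text \<open>About \<open>2^j*m\<close> nodes contribute \<open>O(2^(-j/2)/m)\<close> each for
  \<open>j < 0\<close> and \<open>O(2^(-2j)/m)\<close> each for \<open>j >= 0\<close>; either way
  the class is \<open>O(2^(-\<bar>j\<bar>/2))\<close>, uniformly in \<open>i\<close>.\<close>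

lemma block_bound:
 obtains C where "!!i j. norm (block s i j) <= C*(1/sqrt 2)^nat \<bar>j\<bar>"
proof -
 obtain K where K: "0 <= K"
  "!!i j u. j < int (H i) ==> u \<in> cls i j ==> norm (lam k r (m i) s j (jump i u)) <= K*(if j < 0 then 2 powr (- (real_of_int j/2)) else 2 powr (- (2*real_of_int j)))"
  using lam_cls_bound[of s] by metis
 have pw: "2 powr (- (real_of_int \<bar>j\<bar>/2)) = (1/sqrt 2)^nat \<bar>j\<bar>" for j
 proof -
  have "(1/sqrt 2)^nat \<bar>j\<bar> = (2 powr (- 1/2))^nat \<bar>j\<bar>"
   by (simp add: powr_minus_divide powr_half_sqrt)
  also have "... = 2 powr (- (real (nat \<bar>j\<bar>)/2))" by (simp add: powr_realpow[symmetric] powr_powr)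
  finally show ?thesis by (simp add: of_nat_nat)
 qed
 have "norm (block s i j) <= 12*K*(1/sqrt 2)^nat \<bar>j\<bar>" for i j
 proof (cases "int (H i) - int (ht i) <= j & j < int (H i) - int (h1 i)")
  case False
  thus ?thesis using K(1) unfolding block_def by auto
 next
  case True
  hence j: "j < int (H i)" by simp
  have m0: "0 < real (m i)" using m_pos[of i] by simp
  let ?b = "if j < 0 then 2 powr (- (real_of_int j/2)) else 2 powr (- (2*real_of_int j))"
  have "norm (block s i j) <= (\<Sum>u\<in>cls i j. K*?b/real (m i))"
  proof -
   have "block s i j = (\<Sum>u\<in>cls i j. lam k r (m i) s j (jump i u)/of_nat (m i))" using True by (simp add: block_def)
   moreover have "norm (\<Sum>u\<in>cls i j. lam k r (m i) s j (jump i u)/of_nat (m i)) <= (\<Sum>u\<in>cls i j. K*?b/real (m i))"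
   proof (rule sum_norm_le)
    fix u assume "u \<in> cls i j"
    from divide_right_mono[OF K(2)[OF j this], of "real (m i)"]
    show "norm (lam k r (m i) s j (jump i u)/of_nat (m i)) <= K*?b/real (m i)" by (simp add: norm_divide)
   qed
   ultimately show ?thesis by simp
  qed
  also have "... = real (card (cls i j))*(K*?b/real (m i))" by simp
  also have "... <= (12*2 powr real_of_int j*real (m i))*(K*?b/real (m i))"
   using card_cls_le[OF j] K(1) m0 by (intro mult_right_mono) auto
  also have "... = 12*K*(2 powr real_of_int j*?b)" using m0 by simp
  also have "... <= 12*K*2 powr (- (real_of_int \<bar>j\<bar>/2))"
   using K(1) by (intro mult_left_mono) (auto simp: powr_add[symmetric] intro!: powr_mono)
  finally show ?thesis unfolding pw .
 qed
 thus thesis by (rule that)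
qed

lemma regular_jump_limit:
 "(%i. (l i/real (m i)) powr a*(l i*(2^nat (int (H i) - j) - 1)/real (n i))) ----> 1/wscale \<gamma> j"
proof -
 have Htop: "filterlim H at_top sequentially"
  by (rule filterlim_at_top_mono[OF h1(2)]) simp
 have ev: "\<forall>\<^sub>F i in sequentially. j < int (H i)"
  using filterlim_at_top[THEN iffD1, OF Htop, rule_format, of "nat \<bar>j\<bar> + 1"] by eventually_elim linarith
 have w: "(%i. wscale (g i) j) ----> wscale \<gamma> j"
  unfolding wscale_def by (intro tendsto_intros g(3)) auto
 have hh: "filterlim (%i. (2::real)^nat (int (H i) - j)) at_infinity sequentially"
 proof -
  have "filterlim (%i. nat (int (H i) - j)) at_top sequentially"
   unfolding filterlim_at_top
  proof
   fix Z
   show "\<forall>\<^sub>F i in sequentially. Z <= nat (int (H i) - j)"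
    using filterlim_at_top[THEN iffD1, OF Htop, rule_format, of "Z + nat \<bar>j\<bar>"] by eventually_elim linarith
  qed
  thus ?thesis by (rule filterlim_compose[OF filterlim_realpow_sequentially_gt1, rotated]) simp
 qed
 have p: "(%i. (l i/real (m i)) powr a*(1/wscale (g i) j*(1 - 1/2^nat (int (H i) - j)))) ----> 1 powr a*(1/wscale \<gamma> j*(1 - 0))"
  by (intro tendsto_intros l_m(2) w tendsto_divide_0[OF tendsto_const hh]) (auto simp: wscale_def)
 have "\<forall>\<^sub>F i in sequentially. (l i/real (m i)) powr a*(1/wscale (g i) j*(1 - 1/2^nat (int (H i) - j)))
   = (l i/real (m i)) powr a*(l i*(2^nat (int (H i) - j) - 1)/real (n i))"
  using ev
 proof eventually_elim
  case (elim i)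
  have "1/wscale (g i) j*(1 - 1/2^nat (int (H i) - j)) = l i*(2^nat (int (H i) - j) - 1)/real (n i)"
   unfolding scale_eq[OF less_imp_le[OF elim], symmetric] using n_pos[of i] l_pos[of i] by (simp add: field_simps)
  thus ?case by simp
 qed
 from Lim_transform_eventually[OF p this] show ?thesis by simp
qed

text \<open>All nodes of the class except possibly one have the same jump scale, which tends to
  \<open>1/wscale \<gamma> j\<close>, and their number divided by \<open>m\<close> tends to
  \<open>wscale \<gamma> j\<close>. The exceptional node changes the sum by
  \<open>O(1/m)\<close>.\<close>

lemma block_limit:
 "(%i. block s i j) ----> wscale \<gamma> j *\<^sub>R (PINT z. levy_term s j (uG a z/wscale \<gamma> j))"
proof -
 obtain K where K: "0 <= K"
  "!!m s j c. 1 <= m ==> 0 <= c ==> norm (lam k r m s j c) <= K*(if j < 0 then sqrt (2*\<bar>s\<bar>) * sqrt c else s\<^sup>2*c\<^sup>2)"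
  using lam_bound[OF k r(1)] by metis
 have Htop: "filterlim H at_top sequentially"
  by (rule filterlim_at_top_mono[OF h1(2)]) simp
 have ev: "\<forall>\<^sub>F i in sequentially. int (H i) - int (ht i) <= j & j < int (H i) - int (h1 i)"
  using filterlim_at_top[THEN iffD1, OF h1(2), rule_format, of "nat \<bar>j\<bar> + 1"]
   filterlim_at_top[THEN iffD1, OF ht(3), rule_format, of "nat \<bar>j\<bar> + 1"]
  by eventually_elim linarith
 define h where "h i = nat (int (H i) - j)" for i
 define c where "c i = (l i/real (m i)) powr a*(l i*(2^h i - 1)/real (n i))" for i
 have c0: "0 <= c i" for i using l_pos[of i] by (simp add: c_def)
 have clim: "c ----> 1/wscale \<gamma> j" using regular_jump_limit[of j] by (simp add: c_def[abs_def] h_def)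
 let ?C = "2*2 powr (- real_of_int j)"
 let ?B = "K*(sqrt (2*\<bar>s\<bar>) * sqrt ?C + s\<^sup>2*?C\<^sup>2)"
 have lb: "norm (lam k r (m i) s j x) <= ?B" if "0 <= x" "x <= ?C" for i x
 proof -
  have "norm (lam k r (m i) s j x) <= K*(sqrt (2*\<bar>s\<bar>) * sqrt x + s\<^sup>2*x\<^sup>2)"
   using K(2)[OF m_pos that(1), of i s j] K(1) that by (auto intro!: order_trans[OF K(2)[OF m_pos that(1)]] mult_left_mono)
  also have "... <= ?B" using that K(1) by (intro mult_left_mono add_mono mult_left_mono power_mono real_sqrt_le_mono) auto
  finally show ?thesis .
 qed
 have "(%i. lam k r (m i) s j (c i)) ----> (PINT z. levy_term s j (1/wscale \<gamma> j*uG (real r/real k) z))"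
  by (rule lam_limit[OF k r(1) m_top m_pos clim c0])
 hence llim: "(%i. lam k r (m i) s j (c i)) ----> (PINT z. levy_term s j (uG a z/wscale \<gamma> j))"
  by (simp add: a_def)
 have minv: "(%i. 1/real (m i)) ----> 0"
  by (rule tendsto_divide_0[OF tendsto_const filterlim_at_top_imp_at_infinity[OF filterlim_compose[OF filterlim_real_sequentially m_top]]])
 have cardlim: "(%i. real (card (cls i j))/real (m i)) ----> wscale \<gamma> j"
 proof -
  have w: "(%i. wscale (g i) j) ----> wscale \<gamma> j"
   unfolding wscale_def by (intro tendsto_intros g(3)) auto
  have main: "(%i. l i/real (m i)*wscale (g i) j) ----> 1*wscale \<gamma> j" by (intro tendsto_intros l_m(2) w)
  have "(%i. real (card (cls i j))/real (m i) - l i/real (m i)*wscale (g i) j) ----> 0"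
  proof (rule Lim_null_comparison[OF _ minv])
   show "\<forall>\<^sub>F i in sequentially. norm (real (card (cls i j))/real (m i) - l i/real (m i)*wscale (g i) j) <= 1/real (m i)"
    using ev
   proof eventually_elim
    case (elim i)
    hence j: "j < int (H i)" by simp
    have hi: "1 <= nat (int (H i) - j)" using j by simp
    have e: "l i*wscale (g i) j = real (n i)/2^nat (int (H i) - j)"
     using scale_eq[of j i] j l_pos[of i] by (simp add: field_simps)
    have "\<bar>real (card (cls i j)) - l i*wscale (g i) j\<bar> <= 1"
     unfolding e cls_def by (rule card_size_class[OF hi])
    hence "\<bar>real (card (cls i j)) - l i*wscale (g i) j\<bar>/real (m i) <= 1/real (m i)"
     by (intro divide_right_mono) auto
    thus ?case by (simp add: diff_divide_distrib[symmetric])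
   qed
  qed
  from tendsto_add[OF this main] show ?thesis by simp
 qed
 have main: "(%i. of_real (real (card (cls i j))/real (m i))*lam k r (m i) s j (c i))
   ----> of_real (wscale \<gamma> j)*(PINT z. levy_term s j (uG a z/wscale \<gamma> j))"
  by (intro tendsto_intros cardlim llim)
 have "(%i. block s i j - of_real (real (card (cls i j))/real (m i))*lam k r (m i) s j (c i)) ----> 0"
 proof (rule Lim_null_comparison)
  show "(%i. (2*?B)*(1/real (m i))) ----> 0" by (rule tendsto_mult_right_zero[OF minv])
  show "\<forall>\<^sub>F i in sequentially. norm (block s i j - of_real (real (card (cls i j))/real (m i))*lam k r (m i) s j (c i)) <= (2*?B)*(1/real (m i))"
   using ev
  proof eventually_elim
   case (elim i)
   hence j: "j < int (H i)" by simp
   have hi: "1 <= h i" using j by (simp add: h_def)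
   have m0: "0 < real (m i)" using m_pos[of i] by simp
   \<comment> \<open>The last node of the class, the only one whose subtree may be
     incomplete.\<close>
   let ?e = "n i div 2^(h i - 1)"
   have cls: "cls i j = size_class (n i) (h i)" by (simp add: cls_def h_def)
   have reg: "jump i u = c i" if "u \<in> cls i j" "u ~= ?e" for u
   proof -
    have "card (subtree (n i) u) = 2^h i - 1" using size_class_card(2)[OF hi, of u "n i"] that cls by auto
    hence "real (card (subtree (n i) u)) = 2^h i - 1" by (simp add: of_nat_diff)
    thus ?thesis by (simp add: jump_def c_def)
   qed
   let ?d = "%u. lam k r (m i) s j (jump i u) - lam k r (m i) s j (c i)"
   have "block s i j - of_real (real (card (cls i j))/real (m i))*lam k r (m i) s j (c i) = (\<Sum>u\<in>cls i j. ?d u)/of_nat (m i)"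
    using elim by (simp add: block_def sum_subtractf sum_divide_distrib diff_divide_distrib)
   also have "(\<Sum>u\<in>cls i j. ?d u) = (\<Sum>u\<in>cls i j \<inter> {?e}. ?d u)"
    using reg by (intro sum.mono_neutral_right) (auto simp: cls)
   finally have e: "norm (block s i j - of_real (real (card (cls i j))/real (m i))*lam k r (m i) s j (c i)) = norm (\<Sum>u\<in>cls i j \<inter> {?e}. ?d u)/real (m i)"
    by (simp add: norm_divide)
   have "norm (\<Sum>u\<in>cls i j \<inter> {?e}. ?d u) <= 2*?B"
   proof (cases "?e \<in> cls i j")
    case True
    have ce: "c i <= ?C"
    proof -
     have "c i = (l i/real (m i)) powr a*(l i*(2^h i - 1)/real (n i))" by (simp add: c_def)
     also have "... <= 2*(1/wscale (g i) j)"
     proof (intro mult_mono ratio_bounds)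
      have "l i*(2^h i - 1)/real (n i) <= l i*2^h i/real (n i)"
       using l_pos[of i] by (intro divide_right_mono mult_left_mono) auto
      thus "l i*(2^h i - 1)/real (n i) <= 1/wscale (g i) j"
       unfolding scale_inv[OF less_imp_le[OF j], symmetric] h_def .
     qed (use l_pos[of i] in auto)
     also have "... <= 2*(1/2 powr real_of_int j)" using wscale_bounds(1)[of j i] by (intro mult_left_mono divide_left_mono) auto
     finally show ?thesis by (simp add: powr_minus_divide)
    qed
    have "norm (?d ?e) <= ?B + ?B"
     by (rule order_trans[OF norm_triangle_ineq4 add_mono[OF lb lb]]) (use jump_nonneg jump_le[OF j True] c0 ce in auto)
    thus ?thesis using True by simp
   next
    case False
    thus ?thesis using K(1) by simp
   qed
   thus ?case unfolding e using m0 by (simp add: divide_right_mono)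
  qed
 qed
 from tendsto_add[OF this main] show ?thesis by (simp add: scaleR_conv_of_real)
qed

definition nodes :: "nat => nat set" where "nodes i = {1..n i div 2^h1 i}"

lemma sum_nodes:
 fixes f :: "int => nat => 'b::comm_monoid_add"
 assumes "!!j u. j < int (H i) ==> u \<in> cls i j ==> f j u = F u"
 shows "(\<Sum>j\<in>{int (H i) - int (ht i)..<int (H i) - int (h1 i)}. \<Sum>u\<in>cls i j. f j u) = (\<Sum>u\<in>nodes i. F u)"
proof -
 \<comment> \<open>Hence the classes up to \<open>ht\<close> reach all the way to the root.\<close>
 have z: "n i div 2^ht i = 0" using ht(1)[of i] by simp
 have "(\<Sum>u\<in>nodes i. F u) = (\<Sum>u\<in>{n i div 2^ht i<..n i div 2^h1 i}. F u)"
  unfolding nodes_def z by (intro sum.cong) auto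
 also have "... = (\<Sum>h\<in>{h1 i<..ht i}. \<Sum>u\<in>size_class (n i) h. F u)"
  using h1(1)[of i] ht(2)[of i] by (intro sum_size_classes) simp
 also have "... = (\<Sum>j\<in>{int (H i) - int (ht i)..<int (H i) - int (h1 i)}. \<Sum>u\<in>cls i j. F u)"
  by (rule sum.reindex_bij_witness[of _ "%j. nat (int (H i) - j)" "%h. int (H i) - int h"]) (auto simp: cls_def)
 also have "... = (\<Sum>j\<in>{int (H i) - int (ht i)..<int (H i) - int (h1 i)}. \<Sum>u\<in>cls i j. f j u)"
  by (intro sum.cong refl assms[symmetric]) auto
 finally show ?thesis ..
qed

text \<open>Tannery's theorem: convergence of every block under the geometric majorant of
  \<open>block_bound\<close>.\<close>

lemma array_limit:
 "(%i. \<Sum>j\<in>{int (H i) - int (ht i)..<int (H i) - int (h1 i)}. \<Sum>u\<in>cls i j. lam k r (m i) s j (jump i u)/of_nat (m i))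
   ----> (LINT j|count_space UNIV. wscale \<gamma> j *\<^sub>R (PINT z. levy_term s j (uG a z/wscale \<gamma> j)))"
proof -
 obtain C where C: "!!i j. norm (block s i j) <= C*(1/sqrt 2)^nat \<bar>j\<bar>" using block_bound[of s] by metis
 have "(%i. LINT j|count_space UNIV. block s i j) ----> (LINT j|count_space UNIV. wscale \<gamma> j *\<^sub>R (PINT z. levy_term s j (uG a z/wscale \<gamma> j)))"
 proof (rule integral_dominated_convergence[where w="%j. C*(1/sqrt 2)^nat \<bar>j\<bar>"])
  show "integrable (count_space UNIV) (%j::int. C*(1/sqrt 2)^nat \<bar>j\<bar>)"
   by (intro integrable_mult_right integrable_count_space_geometric_int) auto
 qed (auto simp: C block_limit)
 moreover have "(LINT j|count_space UNIV. block s i j) = (\<Sum>j\<in>{int (H i) - int (ht i)..<int (H i) - int (h1 i)}. \<Sum>u\<in>cls i j. lam k r (m i) s j (jump i u)/of_nat (m i))" for i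
 proof -
  let ?J = "{int (H i) - int (ht i)..<int (H i) - int (h1 i)}"
  have sub: "{j. block s i j ~= 0} \<subseteq> ?J" by (auto simp: block_def)
  have "(LINT j|count_space UNIV. block s i j) = (\<Sum>j\<in>{j. block s i j ~= 0}. block s i j)"
   using finite_subset[OF sub] by (subst lebesgue_integral_count_space_finite_support) auto
  also have "... = (\<Sum>j\<in>?J. block s i j)" using sub by (intro sum.mono_neutral_left) auto
  also have "... = (\<Sum>j\<in>?J. \<Sum>u\<in>cls i j. lam k r (m i) s j (jump i u)/of_nat (m i))"
   by (intro sum.cong refl) (auto simp: block_def)
  finally show ?thesis .
 qed
 ultimately show ?thesis by simp
qed

text \<open>Each class contributes \<open>O(1/m)\<close> and there are only
  \<open>ht - h1 = o(m)\<close> classes. This is the error of the Poisson approximation.\<close>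

lemma square_sum_limit:
 "(%i. \<Sum>u\<in>nodes i. (norm (lam k r (m i) s (-1) (jump i u)/of_nat (m i)))\<^sup>2) ----> 0"
proof -
 obtain K where K: "0 <= K"
  "!!i j u. j < int (H i) ==> u \<in> cls i j ==> (norm (lam k r (m i) s (-1) (jump i u)))\<^sup>2 <= K*2 powr (- real_of_int j)"
  using lam_cls_bound[of s] by metis
 show ?thesis
 proof (rule Lim_null_comparison)
  show "(%i. (12*K)*(real (ht i - h1 i)/real (m i))) ----> 0" by (rule tendsto_mult_right_zero[OF ht(4)])
  show "\<forall>\<^sub>F i in sequentially. norm (\<Sum>u\<in>nodes i. (norm (lam k r (m i) s (-1) (jump i u)/of_nat (m i)))\<^sup>2) <= (12*K)*(real (ht i - h1 i)/real (m i))"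
  proof (rule always_eventually, rule allI)
   fix i
   have m0: "0 < real (m i)" using m_pos[of i] by simp
   let ?J = "{int (H i) - int (ht i)..<int (H i) - int (h1 i)}"
   have "(\<Sum>u\<in>nodes i. (norm (lam k r (m i) s (-1) (jump i u)/of_nat (m i)))\<^sup>2)
     = (\<Sum>j\<in>?J. \<Sum>u\<in>cls i j. (norm (lam k r (m i) s (-1) (jump i u)))\<^sup>2/(real (m i))\<^sup>2)"
    by (rule sum_nodes[symmetric]) (simp add: norm_divide power_divide)
   also have "... <= (\<Sum>j\<in>?J. 12*K/real (m i))"
   proof (rule sum_mono)
    fix j assume "j \<in> ?J"
    hence j: "j < int (H i)" by simp
    have "(\<Sum>u\<in>cls i j. (norm (lam k r (m i) s (-1) (jump i u)))\<^sup>2/(real (m i))\<^sup>2) <= (\<Sum>u\<in>cls i j. K*2 powr (- real_of_int j)/(real (m i))\<^sup>2)"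
     using K(2)[OF j] by (intro sum_mono divide_right_mono) auto
    also have "... = real (card (cls i j))*(K*2 powr (- real_of_int j)/(real (m i))\<^sup>2)" by simp
    also have "... <= (12*2 powr real_of_int j*real (m i))*(K*2 powr (- real_of_int j)/(real (m i))\<^sup>2)"
     using card_cls_le[OF j] K(1) by (intro mult_right_mono) auto
    also have "... = 12*K*(2 powr real_of_int j*2 powr (- real_of_int j))/real (m i)"
     using m0 by (simp add: power2_eq_square field_simps)
    also have "2 powr real_of_int j*2 powr (- real_of_int j) = 1" by (simp add: powr_add[symmetric])
    finally show "(\<Sum>u\<in>cls i j. (norm (lam k r (m i) s (-1) (jump i u)))\<^sup>2/(real (m i))\<^sup>2) <= 12*K/real (m i)" by simp
   qed
   also have "... = (12*K)*(real (ht i - h1 i)/real (m i))"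
    using h1(1)[of i] ht(2)[of i] by (simp add: of_nat_diff nat_diff_distrib)
   finally show "norm (\<Sum>u\<in>nodes i. (norm (lam k r (m i) s (-1) (jump i u)/of_nat (m i)))\<^sup>2) <= (12*K)*(real (ht i - h1 i)/real (m i))"
    by (simp add: sum_nonneg)
  qed
 qed
qed

end

section \<open>Characteristic functions of the jump sums\<close>

locale record_sequence = record_array +
 fixes M :: "nat => 'a measure" and E :: "nat => nat => nat => 'a => real"
 assumes tree: "!!i. alarm_tree (M i) (n i) k r (E i)"
begin

definition meanX :: "nat => nat => real" where
 "meanX i u = jump i u*(1/(C2 k r*C3 k r)*real (m i) powr a*(psi k r (m i) - psi k r (m i + 1)))"

definition X :: "nat => nat => 'a => real" where
 "X i u w = jump i u*(1/(C2 k r*C3 k r)*real (m i) powr a*alarm_tree.L k r (m i) (alarm_tree.T k (E i) u w))"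

text \<open>The class index \<open>-1\<close> selects the uncompensated term, so this is the
  characteristic function of \<open>X i u\<close> (\<open>phi_eq_char\<close>).\<close>

definition phi :: "nat => nat => real => complex" where
 "phi i u s = 1 + lam k r (m i) s (-1) (jump i u)/of_nat (m i)"

lemma node_in_tree: "u \<in> nodes i ==> u \<in> {1..n i}"
 using order_trans[OF _ div_le_dividend[of "n i" "2^h1 i"]] by (auto simp: nodes_def)

lemma X_facts:
 assumes u: "u \<in> nodes i"
 shows "X i u \<in> borel_measurable (M i)" "integrable (M i) (X i u)" "(LINT w|M i. X i u w) = meanX i u"
  and "(CLINT w|M i. levy_term s j (X i u w)) = lam k r (m i) s j (jump i u)/of_nat (m i)"
proof -
 interpret A: alarm_tree "M i" "n i" k r "E i" by (rule tree)
 note u' = node_in_tree[OF u]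
 have "(%w. A.L (m i) (A.T u w)) \<in> borel_measurable (M i)"
  by (rule measurable_compose[OF A.T_measurable[OF u'] A.L_measurable])
 thus "X i u \<in> borel_measurable (M i)" unfolding X_def[abs_def] by measurable
 show "integrable (M i) (X i u)" unfolding X_def[abs_def] using A.L_integral(1)[OF u', of "m i"] by simp
 show "(LINT w|M i. X i u w) = meanX i u" unfolding X_def meanX_def by (simp add: A.L_integral(2)[OF u'])
 show "(CLINT w|M i. levy_term s j (X i u w)) = lam k r (m i) s j (jump i u)/of_nat (m i)"
  unfolding X_def using A.expectation_levy_term[OF u' m_pos, of s j "jump i u"] by (simp add: a_def)
qed

lemma levy_term_integrable:
 assumes u: "u \<in> nodes i"
 shows "integrable (M i) (%w. iexp (s*X i u w))"
proof -
 interpret A: alarm_tree "M i" "n i" k r "E i" by (rule tree)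
 show ?thesis using X_facts(1)[OF u] by (intro A.integrable_iexp) auto
qed

lemma phi_eq_char:
 assumes u: "u \<in> nodes i"
 shows "phi i u = char (distr (M i) borel (X i u))"
proof
 fix s
 interpret A: alarm_tree "M i" "n i" k r "E i" by (rule tree)
 have "(CLINT w|M i. levy_term s (-1) (X i u w)) = (CLINT w|M i. iexp (s*X i u w)) - 1"
  using levy_term_integrable[OF u, of s] by (simp add: levy_term_eq A.prob_space)
 hence "phi i u s = (CLINT w|M i. iexp (s*X i u w))"
  using X_facts(4)[OF u, of s "-1"] by (simp add: phi_def)
 also have "... = char (distr (M i) borel (X i u)) s"
  using X_facts(1)[OF u] by (simp add: char_def integral_distr)
 finally show "phi i u s = char (distr (M i) borel (X i u)) s" .
qed

lemma phi_is_char: "u \<in> nodes i ==> is_char (phi i u)"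
 unfolding phi_eq_char using X_facts(1) alarm_tree.iid[OF tree]
 by (intro is_char_distr) (auto simp: iid_exponential_def)

lemma lam_compensated:
 assumes u: "u \<in> nodes i" and j: "0 <= j"
 shows "lam k r (m i) s j (jump i u)/of_nat (m i) = (phi i u s - 1) - \<i> * of_real (s*meanX i u)"
proof -
 interpret A: alarm_tree "M i" "n i" k r "E i" by (rule tree)
 have e: "levy_term s j x = levy_term s (-1) x - (\<i> * of_real s) * of_real x" for x
  using j by (simp add: levy_term_eq)
 have i1: "integrable (M i) (%w. levy_term s (-1) (X i u w))"
  using levy_term_integrable[OF u, of s] by (simp add: levy_term_eq)
 have i2: "integrable (M i) (%w. (\<i> * of_real s)*complex_of_real (X i u w))"
  using X_facts(2)[OF u] by (intro integrable_mult_right integrable_of_real)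
 have "(CLINT w|M i. levy_term s j (X i u w)) = (CLINT w|M i. levy_term s (-1) (X i u w)) - (CLINT w|M i. (\<i> * of_real s)*complex_of_real (X i u w))"
  unfolding e by (rule bochner_integral_diff[OF i1 i2])
 also have "(CLINT w|M i. (\<i> * of_real s)*complex_of_real (X i u w)) = (\<i> * of_real s) * of_real (meanX i u)"
  by (simp only: integral_mult_right_zero integral_complex_of_real X_facts(3)[OF u])
 finally show ?thesis by (simp add: X_facts(4)[OF u] phi_def)
qed

lemma cls_nodes:
 assumes "j \<in> {int (H i) - int (ht i)..<int (H i) - int (h1 i)}" "u \<in> cls i j"
 shows "u \<in> nodes i" "n i div 2^H i < u \<longleftrightarrow> 0 <= j"
proof -
 define h where "h = nat (int (H i) - j)"
 have h: "h1 i < h" "1 <= h" "int h = int (H i) - j" using assms(1) h1(1)[of i] by (auto simp: h_def)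
 have u: "n i div 2^h < u" "u <= n i div 2^(h - 1)" using assms(2) by (auto simp: cls_def size_class_def h_def)
 have mono: "n i div 2^y <= n i div 2^x" if "x <= y" for x y
  using that by (intro div_le_mono2) (auto intro: power_increasing)
 have "n i div 2^(h - 1) <= n i div 2^h1 i" using h by (intro mono) simp
 thus "u \<in> nodes i" using order_trans[OF u(2)] u(1) by (simp add: nodes_def)
 show "n i div 2^H i < u \<longleftrightarrow> 0 <= j"
 proof
  assume "0 <= j"
  thus "n i div 2^H i < u" using mono[of h "H i"] h u by simp
 next
  assume lt: "n i div 2^H i < u"
  show "0 <= j"
  proof (rule ccontr)
   assume "~ 0 <= j"
   hence "H i <= h - 1" using h by linarith
   thus False using mono[of "H i" "h - 1"] u lt by simp
  qed
 qed
qed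

text \<open>Total mean of the jumps in the classes \<open>j >= 0\<close>, which are the top nodes
  beyond \<open>n div 2^H\<close> by \<open>cls_nodes\<close>.\<close>

definition compensator :: "nat => real" where
 "compensator i = (\<Sum>u\<in>{u \<in> nodes i. n i div 2^H i < u}. meanX i u)"

lemma compensated_sum:
 "(\<Sum>j\<in>{int (H i) - int (ht i)..<int (H i) - int (h1 i)}. \<Sum>u\<in>cls i j. lam k r (m i) s j (jump i u)/of_nat (m i))
  = (\<Sum>u\<in>nodes i. phi i u s - 1) - \<i> * of_real (s*compensator i)"
proof -
 let ?F = "%u. (phi i u s - 1) - (if n i div 2^H i < u then \<i> * of_real (s*meanX i u) else 0)"
 let ?J = "{int (H i) - int (ht i)..<int (H i) - int (h1 i)}"
 have "(\<Sum>j\<in>?J. \<Sum>u\<in>cls i j. lam k r (m i) s j (jump i u)/of_nat (m i)) = (\<Sum>j\<in>?J. \<Sum>u\<in>cls i j. ?F u)"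
 proof (intro sum.cong refl)
  fix j u assume ju: "j \<in> ?J" "u \<in> cls i j"
  note c = cls_nodes[OF ju]
  show "lam k r (m i) s j (jump i u)/of_nat (m i) = ?F u"
  proof (cases "0 <= j")
   case True
   thus ?thesis using lam_compensated[OF c(1) True] c(2) by simp
  next
   case False
   hence "levy_term s j x = levy_term s (-1) x" for x by (simp add: levy_term_eq)
   hence "lam k r (m i) s j (jump i u) = lam k r (m i) s (-1) (jump i u)" by (simp add: lam_def)
   thus ?thesis using False c(2) by (simp add: phi_def)
  qed
 qed
 also have "... = (\<Sum>u\<in>nodes i. ?F u)" by (rule sum_nodes) simp
 also have "... = (\<Sum>u\<in>nodes i. phi i u s - 1) - (\<Sum>u\<in>nodes i. if n i div 2^H i < u then \<i> * of_real (s*meanX i u) else 0)"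
  by (rule sum_subtractf)
 also have "(\<Sum>u\<in>nodes i. if n i div 2^H i < u then \<i> * of_real (s*meanX i u) else 0) = \<i> * of_real (s*compensator i)"
  unfolding compensator_def by (simp add: sum.inter_filter[symmetric] sum_distrib_left nodes_def)
 finally show ?thesis .
qed

text \<open>Any centering \<open>b\<close> whose difference to the compensator has the stated limit
  leads to the same exponent; that limit is the constant built into
  \<open>limit_exponent\<close>.\<close>

lemma exponent_limit:
 assumes "(%i. b i - compensator i) ----> Gamma (1 + a)*(\<gamma> + 1)"
 shows "(%i. (\<Sum>u\<in>nodes i. phi i u s - 1) - \<i> * of_real (s*b i)) ----> limit_exponent k r \<gamma> s"
proof -
 have "(%i. ((\<Sum>u\<in>nodes i. phi i u s - 1) - \<i> * of_real (s*compensator i)) - \<i> * of_real (s*(b i - compensator i)))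
   ----> (LINT j|count_space UNIV. wscale \<gamma> j *\<^sub>R (PINT z. levy_term s j (uG a z/wscale \<gamma> j)))
     - \<i> * of_real (s*(Gamma (1 + a)*(\<gamma> + 1)))"
  by (intro tendsto_intros assms array_limit[unfolded compensated_sum])
 thus ?thesis
  by (simp add: limit_exponent_def[OF k r] a_def algebra_simps)
qed

text \<open>Since the characteristic functions \<open>phi i u\<close> are close to one, their product may be replaced
 by the compound Poisson characteristic function with exponent \<open>\<Sum>u. phi i u s - 1\<close>.\<close>

lemma poissonization:
 "(%i. (\<Prod>u\<in>nodes i. phi i u s) - (\<Prod>u\<in>nodes i. exp (phi i u s - 1))) ----> 0"
proof (rule Lim_null_comparison)
 show "(%i. exp 2*(\<Sum>u\<in>nodes i. (norm (lam k r (m i) s (-1) (jump i u)/of_nat (m i)))\<^sup>2)) ----> 0"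
  by (rule tendsto_mult_right_zero[OF square_sum_limit])
 show "\<forall>\<^sub>F i in sequentially. norm ((\<Prod>u\<in>nodes i. phi i u s) - (\<Prod>u\<in>nodes i. exp (phi i u s - 1)))
   <= exp 2*(\<Sum>u\<in>nodes i. (norm (lam k r (m i) s (-1) (jump i u)/of_nat (m i)))\<^sup>2)"
 proof (rule always_eventually, rule allI)
  fix i
  have n1: "norm (phi i u s) <= 1" if "u \<in> nodes i" for u by (rule is_char_norm_le[OF phi_is_char[OF that]])
  have n2: "norm (exp (phi i u s - 1)) <= 1" if "u \<in> nodes i" for u
   using complex_Re_le_cmod[of "phi i u s"] n1[OF that] by simp
  have "norm ((\<Prod>u\<in>nodes i. phi i u s) - (\<Prod>u\<in>nodes i. exp (phi i u s - 1))) <= (\<Sum>u\<in>nodes i. norm (phi i u s - exp (phi i u s - 1)))"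
   by (rule norm_prod_diff[OF n1 n2])
  also have "... <= (\<Sum>u\<in>nodes i. exp 2*(norm (phi i u s - 1))\<^sup>2)"
  proof (rule sum_mono)
   fix u assume u: "u \<in> nodes i"
   have "norm (phi i u s - 1) <= 2" using norm_triangle_ineq4[of "phi i u s" 1] n1[OF u] by simp
   have "norm (phi i u s - exp (phi i u s - 1)) = norm (exp (phi i u s - 1) - 1 - (phi i u s - 1))"
    by (simp add: norm_minus_commute)
   also have "... <= exp (norm (phi i u s - 1))*(norm (phi i u s - 1))\<^sup>2" by (rule norm_exp_minus_linear)
   also have "... <= exp 2*(norm (phi i u s - 1))\<^sup>2"
    using \<open>norm (phi i u s - 1) <= 2\<close> by (intro mult_right_mono) auto
   finally show "norm (phi i u s - exp (phi i u s - 1)) <= exp 2*(norm (phi i u s - 1))\<^sup>2" .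
  qed
  also have "... = exp 2*(\<Sum>u\<in>nodes i. (norm (lam k r (m i) s (-1) (jump i u)/of_nat (m i)))\<^sup>2)"
   by (simp add: phi_def sum_distrib_left)
  finally show "norm ((\<Prod>u\<in>nodes i. phi i u s) - (\<Prod>u\<in>nodes i. exp (phi i u s - 1)))
   <= exp 2*(\<Sum>u\<in>nodes i. (norm (lam k r (m i) s (-1) (jump i u)/of_nat (m i)))\<^sup>2)" .
 qed
qed

lemma char_limit:
 assumes b: "(%i. b i - compensator i) ----> Gamma (1 + a)*(\<gamma> + 1)"
 shows "(%i. char (distr (M i) borel (%w. (\<Sum>u\<in>nodes i. X i u w) - b i)) s) ----> exp (limit_exponent k r \<gamma> s)"
proof -
 have e: "char (distr (M i) borel (%w. (\<Sum>u\<in>nodes i. X i u w) - b i)) s = iexp (- (s*b i))*(\<Prod>u\<in>nodes i. phi i u s)" for i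
 proof -
  interpret A: alarm_tree "M i" "n i" k r "E i" by (rule tree)
  have sub: "nodes i \<subseteq> {1..n i}" using node_in_tree by auto
  have "A.indep_vars (%_. borel) (%u w. jump i u*(1/(C2 k r*C3 k r)*real (m i) powr a*A.L (m i) (snd (A.Z u w)))) (nodes i)"
  proof (rule A.indep_vars_compose2[OF A.indep_vars_subset[OF A.indep_Z sub]])
   note [measurable] = A.L_measurable
   show "(%p. jump i u*(1/(C2 k r*C3 k r)*real (m i) powr a*A.L (m i) (snd p))) \<in> borel_measurable (borel :: (real \<times> real) measure)" for u
    by measurable
  qed
  hence ind: "A.indep_vars (%_. borel) (X i) (nodes i)" by (simp add: X_def[abs_def] A.Z_def)
  note [measurable] = X_facts(1)
  have Sm: "(%w. \<Sum>u\<in>nodes i. X i u w) \<in> borel_measurable (M i)" by (intro borel_measurable_sum X_facts(1))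
  hence "char (distr (M i) borel (%w. (\<Sum>u\<in>nodes i. X i u w) - b i)) s = (CLINT w|M i. iexp (- (s*b i))*iexp (s*(\<Sum>u\<in>nodes i. X i u w)))"
   unfolding char_def by (subst integral_distr) (auto simp: exp_add[symmetric] algebra_simps simp del: of_real_sum)
  also have "... = iexp (- (s*b i))*char (distr (M i) borel (%w. \<Sum>u\<in>nodes i. X i u w)) s"
   using Sm unfolding char_def by (subst integral_distr) (auto simp del: of_real_sum)
  also have "char (distr (M i) borel (%w. \<Sum>u\<in>nodes i. X i u w)) s = (\<Prod>u\<in>nodes i. phi i u s)"
   by (simp add: A.char_distr_sum[OF ind] phi_eq_char)
  finally show ?thesis .
 qed
 have ex: "iexp (- (s*b i))*(\<Prod>u\<in>nodes i. exp (phi i u s - 1)) = exp ((\<Sum>u\<in>nodes i. phi i u s - 1) - \<i> * of_real (s*b i))" for i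
  by (simp add: nodes_def exp_sum[symmetric] exp_add[symmetric])
 have "(%i. iexp (- (s*b i))*((\<Prod>u\<in>nodes i. phi i u s) - (\<Prod>u\<in>nodes i. exp (phi i u s - 1)))) ----> 0"
  by (rule Lim_null_comparison[OF _ tendsto_norm_zero[OF poissonization[of s]]]) (simp add: norm_mult)
 moreover have "(%i. exp ((\<Sum>u\<in>nodes i. phi i u s - 1) - \<i> * of_real (s*b i))) ----> exp (limit_exponent k r \<gamma> s)"
  by (intro tendsto_intros exponent_limit b)
 ultimately have "(%i. iexp (- (s*b i))*((\<Prod>u\<in>nodes i. phi i u s) - (\<Prod>u\<in>nodes i. exp (phi i u s - 1)))
   + exp ((\<Sum>u\<in>nodes i. phi i u s - 1) - \<i> * of_real (s*b i))) ----> 0 + exp (limit_exponent k r \<gamma> s)"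
  by (rule tendsto_add)
 thus ?thesis unfolding e ex[symmetric] by (simp add: algebra_simps)
qed

text \<open>Multiplying the exponents of the compound Poisson approximations by \<open>c\<close>
  only rescales their intensities. General \<open>c\<close> is what provides the roots for infinite
  divisibility.\<close>

lemma limit_law_is_char:
 assumes c: "0 <= c"
 shows "is_char (%s. exp (of_real c*limit_exponent k r \<gamma> s))"
proof (rule is_char_limit)
 define b where "b i = compensator i + Gamma (1 + a)*(\<gamma> + 1)" for i
 let ?f = "%i s. (\<Prod>u\<in>nodes i. exp (of_real c*(phi i u s - 1)))*iexp (s*(- (c*b i)))"
 show "is_char (?f i)" for i
  by (intro is_char_mult is_char_prod is_char_exp phi_is_char c is_char_iexp)
 show "(%i. ?f i s) ----> exp (of_real c*limit_exponent k r \<gamma> s)" for s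
 proof -
  have "(%i. b i - compensator i) ----> Gamma (1 + a)*(\<gamma> + 1)" by (simp add: b_def)
  hence "(%i. exp (of_real c*((\<Sum>u\<in>nodes i. phi i u s - 1) - \<i> * of_real (s*b i)))) ----> exp (of_real c*limit_exponent k r \<gamma> s)"
   by (intro tendsto_intros exponent_limit)
  moreover have "exp (of_real c*((\<Sum>u\<in>nodes i. phi i u s - 1) - \<i> * of_real (s*b i))) = ?f i s" for i
  proof -
   have "(\<Prod>u\<in>nodes i. exp (of_real c*(phi i u s - 1))) = exp (of_real c*(\<Sum>u\<in>nodes i. phi i u s - 1))"
    by (simp add: nodes_def exp_sum[symmetric] sum_distrib_left)
   thus ?thesis by (simp add: exp_add[symmetric] algebra_simps)
  qed
  ultimately show ?thesis by simp
 qed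
 have "isCont (limit_exponent k r \<gamma>) 0" by (rule isCont_limit_exponent[OF k r])
 thus "isCont (%s. exp (of_real c*limit_exponent k r \<gamma> s)) 0" by (intro continuous_intros)
qed

end

section \<open>Asymptotics of the means and of the error terms\<close>

lemma powr_minus_diff_bounds:
 fixes x p :: real
 assumes x: "1 <= x" and p: "0 < p"
 shows "0 <= x powr (- p) - (x + 1) powr (- p)" "x powr (- p) - (x + 1) powr (- p) <= p*x powr (- p - 1)"
  "p*x powr (- p - 1)*(1 - (p + 1)/x) <= x powr (- p) - (x + 1) powr (- p)"
proof -
 have "\<exists>z. x < z & z < x + 1 & (x + 1) powr (- p) - x powr (- p) = (x + 1 - x)*(- p*z powr (- p - 1))"
 proof (rule MVT2)
  show "x < x + 1" by simp
  show "((%y. y powr (- p)) has_real_derivative - p*z powr (- p - 1)) (at z)" if "x <= z" for z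
   using that x by (intro derivative_eq_intros | simp)+
 qed
 then obtain z where z: "x < z" "z < x + 1" "x powr (- p) - (x + 1) powr (- p) = p*z powr (- p - 1)" by auto
 show "0 <= x powr (- p) - (x + 1) powr (- p)" using z p by simp
 have "z powr (- p - 1) <= x powr (- p - 1)" using z x p by (intro powr_mono2') auto
 thus "x powr (- p) - (x + 1) powr (- p) <= p*x powr (- p - 1)" using z p by simp
 have "x powr (- p - 1)*(1 - (p + 1)/x) <= x powr (- p - 1)*((x + 1)/x) powr (- p - 1)"
 proof (rule mult_left_mono)
  have "1 + (p + 1)*ln (x/(x + 1)) <= exp ((p + 1)*ln (x/(x + 1)))" by (rule exp_ge_add_one_self)
  moreover have "exp ((p + 1)*ln (x/(x + 1))) = ((x + 1)/x) powr (- p - 1)"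
   using x by (simp add: powr_def ln_div algebra_simps)
  moreover have "ln (x/(x + 1)) >= - 1/x"
  proof -
   have "ln (1 + 1/x) <= 1/x" using x by (intro ln_add_one_self_le_self) simp
   moreover have "ln (x/(x + 1)) = - ln (1 + 1/x)"
   proof -
    have "x/(x + 1) = inverse (1 + 1/x)" using x by (simp add: field_simps)
    thus ?thesis using x by (simp add: ln_inverse)
   qed
   ultimately show ?thesis by simp
  qed
  hence "(p + 1)*(- 1/x) <= (p + 1)*ln (x/(x + 1))" using p by (intro mult_left_mono) auto
  ultimately show "1 - (p + 1)/x <= ((x + 1)/x) powr (- p - 1)" by simp
 qed simp
 also have "... = (x + 1) powr (- p - 1)" using x by (simp add: powr_mult[symmetric])
 also have "... <= z powr (- p - 1)" using z x p by (intro powr_mono2') auto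
 finally have "p*(x powr (- p - 1)*(1 - (p + 1)/x)) <= p*z powr (- p - 1)" using p by (intro mult_left_mono) auto
 thus "p*x powr (- p - 1)*(1 - (p + 1)/x) <= x powr (- p) - (x + 1) powr (- p)" using z by simp
qed

lemma C2_pos:
 assumes "1 <= k" "1 <= r"
 shows "0 < C2 k r"
proof -
 have "0 < Gamma (real r/real k)" "0 < Gamma (real r)" using assms by (intro Gamma_real_pos; simp)+
 thus ?thesis using assms unfolding C2_def by simp
qed

lemma abs_sum3_le:
 fixes t :: real
 assumes "t = A + B + C" "\<bar>A\<bar> <= x" "\<bar>B\<bar> <= y" "\<bar>C\<bar> <= z"
 shows "\<bar>t\<bar> <= x + y + z"
 using assms by linarith

lemma psi_expansion_ex:
 assumes k: "k >= 1" and r: "r >= 1"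
 shows "\<exists>C\<ge>0. \<forall>d\<ge>1. \<bar>psi k r d/C2 k r - (\<Sum>i\<le>k. psi_coeff k r i*real d powr (- (real (r + i)/real k)))\<bar>
   <= C*real d powr (- (real (r + k + 1)/real k))"
proof (rule psi_expansion[OF k r])
 fix C assume C: "C >= 0" and *: "!!d. d >= 1 ==>
  \<bar>psi k r d/C2 k r - (\<Sum>i\<le>k. psi_coeff k r i*real d powr (- (real (r + i)/real k)))\<bar>
   <= C*real d powr (- (real (r + k + 1)/real k))"
 show ?thesis by (intro exI[of _ C] conjI allI impI C) (rule *)
qed

text \<open>Asymptotics of the mean loss. The leading term \<open>(k/r) d^(-a)\<close> has
  differences \<open>d^(-a-1)\<close> because \<open>(k/r)*a = 1\<close>. The remainder of
  \<open>psi_expansion\<close>, of order \<open>d^(-a-1-1/k)\<close>, is small enough to be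
  estimated without cancellation.\<close>

lemma psi_difference:
 fixes k r :: nat
 assumes k: "1 <= k" and r: "1 <= r"
 defines "a \<equiv> real r/real k"
 shows "\<exists>C\<ge>0. \<forall>m\<ge>1.
  \<bar>(psi k r m - psi k r (m + 1))/C2 k r*real m powr (a + 1) - 1\<bar> <= C*real m powr (- (1/real k))"
proof -
 obtain C0 where C0: "C0 >= 0" and C0': "\<forall>d\<ge>1.
  \<bar>psi k r d/C2 k r - (\<Sum>i\<le>k. psi_coeff k r i*real d powr (- (real (r + i)/real k)))\<bar>
   <= C0*real d powr (- (real (r + k + 1)/real k))"
  using psi_expansion_ex[OF k r] by blast
 note C0 = C0 C0'[rule_format]
 define p where "p i = real (r + i)/real k" for i
 have p: "0 < p i" "p i = a + real i/real k" for i
 proof -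
  show "0 < p i" using k r by (simp add: p_def)
  show "p i = a + real i/real k" by (simp add: p_def a_def add_divide_distrib)
 qed
 define C where "C = (a + 1) + (\<Sum>i\<in>{1..k}. \<bar>psi_coeff k r i\<bar>*p i) + 2*C0"
 have a0: "0 < a" using k r by (simp add: a_def)
 have "0 <= (\<Sum>i\<in>{1..k}. \<bar>psi_coeff k r i\<bar>*p i)"
  by (intro sum_nonneg mult_nonneg_nonneg abs_ge_zero less_imp_le p(1))
 hence "0 <= C" using C0(1) a0 unfolding C_def by linarith
 moreover have "\<bar>(psi k r m - psi k r (m + 1))/C2 k r*real m powr (a + 1) - 1\<bar> <= C*real m powr (- (1/real k))" if m: "1 <= m" for m
 proof -
  define x where "x = real m"
  have x: "1 <= x" using m by (simp add: x_def)
  define D where "D q = x powr (- q) - (x + 1) powr (- q)" for q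
  define y where "y = x powr (- (1/real k))"
  let ?R = "%d. psi k r d/C2 k r - (\<Sum>i\<le>k. psi_coeff k r i*real d powr (- p i))"
  have R: "\<bar>?R m - ?R (m + 1)\<bar>*x powr (a + 1) <= 2*C0*y"
  proof -
   have e: "real (r + k + 1)/real k = a + 1 + 1/real k" using k by (simp add: a_def add_divide_distrib)
   have 1: "\<bar>?R m\<bar> <= C0*x powr (- (a + 1 + 1/real k))" using C0(2)[OF m] unfolding e p_def x_def .
   have "\<bar>?R (m + 1)\<bar> <= C0*real (m + 1) powr (- (a + 1 + 1/real k))"
    using C0(2)[of "m + 1"] unfolding e p_def by simp
   also have "... <= C0*x powr (- (a + 1 + 1/real k))"
   proof (intro mult_left_mono powr_mono2' C0(1))
    have "0 <= 1/real k" by simp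
    thus "- (a + 1 + 1/real k) <= 0" using a0 by linarith
   qed (use x in \<open>auto simp: x_def\<close>)
   finally have 2: "\<bar>?R (m + 1)\<bar> <= C0*x powr (- (a + 1 + 1/real k))" .
   have "\<bar>?R m - ?R (m + 1)\<bar>*x powr (a + 1) <= (2*C0*x powr (- (a + 1 + 1/real k)))*x powr (a + 1)"
    using 1 2 by (intro mult_right_mono) (linarith, simp)
   also have "... = 2*C0*y" using x by (simp add: y_def powr_add[symmetric])
   finally show ?thesis .
  qed
  have sp: "(\<Sum>i\<le>k. f i) = f 0 + (\<Sum>i\<in>{1..k}. f i)" for f :: "nat => real"
   by (simp add: atMost_atLeast0 sum.atLeast_Suc_atMost)
  have split: "(psi k r m - psi k r (m + 1))/C2 k r = (?R m - ?R (m + 1)) + real k/real r*D a + (\<Sum>i\<in>{1..k}. psi_coeff k r i*D (p i))"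
  proof -
   have "(psi k r m - psi k r (m + 1))/C2 k r = (?R m - ?R (m + 1)) + (\<Sum>i\<le>k. psi_coeff k r i*D (p i))"
    by (simp add: D_def x_def diff_divide_distrib right_diff_distrib sum_subtractf add.commute)
   thus ?thesis unfolding sp by (simp add: psi_coeff_def p(2))
  qed
  have main: "\<bar>real k/real r*D a*x powr (a + 1) - 1\<bar> <= (a + 1)*y"
  proof -
   note b = powr_minus_diff_bounds[OF x a0]
   have xx: "x powr (- a - 1)*x powr (a + 1) = 1" using x by (simp add: powr_add[symmetric])
   have kra: "real k/real r*a = 1" using k r by (simp add: a_def)
   have "D a*x powr (a + 1) <= (a*x powr (- a - 1))*x powr (a + 1)" using b(2) by (intro mult_right_mono) (auto simp: D_def)
   hence u: "D a*x powr (a + 1) <= a" unfolding mult.assoc[of a] xx by simp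
   have "(a*x powr (- a - 1)*(1 - (a + 1)/x))*x powr (a + 1) <= D a*x powr (a + 1)"
    using b(3) by (intro mult_right_mono) (auto simp: D_def)
   moreover have "(a*x powr (- a - 1)*(1 - (a + 1)/x))*x powr (a + 1) = a*(1 - (a + 1)/x)*(x powr (- a - 1)*x powr (a + 1))"
    by (simp only: mult_ac)
   ultimately have lo: "a*(1 - (a + 1)/x) <= D a*x powr (a + 1)" using xx by simp
   have kr0: "0 < real k/real r" using k r by simp
   have "real k/real r*(D a*x powr (a + 1)) <= real k/real r*a" using u kr0 by (intro mult_left_mono) auto
   hence u': "real k/real r*D a*x powr (a + 1) <= 1" unfolding kra mult.assoc[symmetric] .
   have "real k/real r*(a*(1 - (a + 1)/x)) <= real k/real r*(D a*x powr (a + 1))" using lo kr0 by (intro mult_left_mono) auto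
   moreover have "real k/real r*(a*(1 - (a + 1)/x)) = 1 - (a + 1)/x"
    unfolding mult.assoc[symmetric] kra by simp
   ultimately have lo': "1 - (a + 1)/x <= real k/real r*D a*x powr (a + 1)" by simp
   have "1/x = x powr (- 1)" using x by (simp add: powr_minus_divide)
   also have "... <= y" unfolding y_def using x k by (intro powr_mono) auto
   finally have "(a + 1)*(1/x) <= (a + 1)*y" using a0 by (intro mult_left_mono) auto
   hence "(a + 1)/x <= (a + 1)*y" by simp
   moreover have "0 <= (a + 1)/x" using a0 x by simp
   moreover have "\<bar>q - 1\<bar> <= Y" if "q <= 1" "1 - z <= q" "z <= Y" "0 <= z" for q z Y :: real
    using that by linarith
   ultimately show ?thesis using u' lo' by blast
  qed
  have rest: "\<bar>(\<Sum>i\<in>{1..k}. psi_coeff k r i*D (p i))*x powr (a + 1)\<bar> <= (\<Sum>i\<in>{1..k}. \<bar>psi_coeff k r i\<bar>*p i)*y"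
   unfolding sum_distrib_right
  proof (rule order_trans[OF sum_abs sum_mono])
   fix i assume i: "i \<in> {1..k}"
   note b = powr_minus_diff_bounds[OF x p(1)[of i]]
   have "D (p i)*x powr (a + 1) <= (p i*x powr (- p i - 1))*x powr (a + 1)" using b(2) by (intro mult_right_mono) (auto simp: D_def)
   also have "... = p i*x powr (- (real i/real k))" using x by (simp add: powr_add[symmetric] p(2))
   also have "... <= p i*y" unfolding y_def using x k i p(1)[of i] by (intro mult_left_mono powr_mono) (auto simp: divide_le_cancel)
   finally have "D (p i)*x powr (a + 1) <= p i*y" .
   hence "\<bar>psi_coeff k r i\<bar>*(D (p i)*x powr (a + 1)) <= \<bar>psi_coeff k r i\<bar>*(p i*y)" by (intro mult_left_mono) auto
   moreover have "0 <= D (p i)" using b(1) by (simp add: D_def)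
   ultimately show "\<bar>psi_coeff k r i*D (p i)*x powr (a + 1)\<bar> <= \<bar>psi_coeff k r i\<bar>*p i*y"
    by (simp add: abs_mult mult.assoc)
  qed
  have "(psi k r m - psi k r (m + 1))/C2 k r*x powr (a + 1) - 1
    = (?R m - ?R (m + 1))*x powr (a + 1) + (real k/real r*D a*x powr (a + 1) - 1) + (\<Sum>i\<in>{1..k}. psi_coeff k r i*D (p i))*x powr (a + 1)"
   unfolding split by (simp add: distrib_right)
  moreover have "\<bar>(?R m - ?R (m + 1))*x powr (a + 1)\<bar> <= 2*C0*y" using R by (simp add: abs_mult)
  ultimately have "\<bar>(psi k r m - psi k r (m + 1))/C2 k r*x powr (a + 1) - 1\<bar> <= 2*C0*y + (a + 1)*y + (\<Sum>i\<in>{1..k}. \<bar>psi_coeff k r i\<bar>*p i)*y"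
   using main rest by (rule abs_sum3_le)
  thus ?thesis by (simp add: C_def x_def y_def algebra_simps)
 qed
 ultimately show ?thesis by (intro exI[of _ C] conjI allI impI)
qed

lemma powr_one_minus_bounds:
 fixes x p :: real
 assumes x: "0 <= x" "x <= 1/2" and p: "0 < p" "p <= 2"
 shows "\<bar>(1 - x) powr (- p) - 1\<bar> <= 16*x" "\<bar>(1 - x) powr (- p) - 1 - p*x\<bar> <= 96*x\<^sup>2"
proof -
 have pw: "(1 - z) powr (- q) <= 2 powr q" if "0 <= z" "z <= 1/2" "0 < q" for z q :: real
 proof -
  have "(1 - z) powr (- q) <= (1/2) powr (- q)" using that by (intro powr_mono2') auto
  thus ?thesis by (simp add: powr_divide powr_minus_divide)
 qed
 have der: "((%y. (1 - y) powr (- q)) has_real_derivative q*(1 - z) powr (- q - 1)) (at z)" if "0 <= z" "z <= 1/2" for z q :: real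
  using that by (auto intro!: derivative_eq_intros)
 have mvt: "\<exists>z. 0 <= z & z <= y & (1 - y) powr (- q) - 1 = y*(q*(1 - z) powr (- q - 1))" if "0 <= y" "y <= 1/2" for y q :: real
 proof (cases "y = 0")
  case False
  hence "0 < y" using that by simp
  hence "\<exists>z. 0 < z & z < y & (1 - y) powr (- q) - (1 - 0) powr (- q) = (y - 0)*(q*(1 - z) powr (- q - 1))"
   by (rule MVT2) (use der that in auto)
  then obtain z where "0 < z" "z < y" "(1 - y) powr (- q) - (1 - 0) powr (- q) = (y - 0)*(q*(1 - z) powr (- q - 1))" by blast
  thus ?thesis by (intro exI[of _ z]) simp
 qed auto
 obtain z where z: "0 <= z" "z <= x" "(1 - x) powr (- p) - 1 = x*(p*(1 - z) powr (- p - 1))" using mvt[OF x, of p] by auto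
 have b1: "(1 - z) powr (- p - 1) <= 8"
  using pw[of z "p + 1"] z x p powr_mono[of "p + 1" 3 "2::real"] by (simp add: minus_diff_commute)
 have "x*(p*(1 - z) powr (- p - 1)) <= x*(2*8)" using b1 p x by (intro mult_left_mono mult_mono) auto
 moreover have "0 <= x*(p*(1 - z) powr (- p - 1))" using x p by simp
 ultimately show "\<bar>(1 - x) powr (- p) - 1\<bar> <= 16*x" unfolding z(3) by simp
 have zz: "z <= 1/2" using z x by simp
 obtain w where w: "0 <= w" "w <= z" "(1 - z) powr (- (p + 1)) - 1 = z*((p + 1)*(1 - w) powr (- (p + 1) - 1))"
  using mvt[OF z(1) zz, of "p + 1"] by auto
 have b2: "(1 - w) powr (- (p + 1) - 1) <= 16"
  using pw[of w "p + 2"] w zz p powr_mono[of "p + 2" 4 "2::real"] by (simp add: algebra_simps)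
 have "z*((p + 1)*(1 - w) powr (- (p + 1) - 1)) <= x*(3*16)" using b2 p z x w by (intro mult_mono) auto
 moreover have "0 <= z*((p + 1)*(1 - w) powr (- (p + 1) - 1))" using z p by simp
 ultimately have "\<bar>(1 - z) powr (- p - 1) - 1\<bar> <= 48*x" using w(3) by (simp add: minus_diff_commute)
 hence "(x*p)*\<bar>(1 - z) powr (- p - 1) - 1\<bar> <= (x*2)*(48*x)" using x p by (intro mult_mono) auto
 moreover have "(1 - x) powr (- p) - 1 - p*x = (x*p)*((1 - z) powr (- p - 1) - 1)" unfolding z(3) by (simp add: algebra_simps)
 ultimately show "\<bar>(1 - x) powr (- p) - 1 - p*x\<bar> <= 96*x\<^sup>2"
  using x p by (simp add: abs_mult power2_eq_square)
qed

text \<open>Recentres the expansion from the depth \<open>d\<close> to \<open>l\<close>. Only the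
  leading term feels the shift to first order and, since \<open>(k/r)*a = 1\<close>, it produces
  precisely \<open>l - d\<close>.\<close>

lemma psi_uniform:
 fixes k r :: nat
 assumes k: "1 <= k" and r: "1 <= r" "r <= k"
 defines "a \<equiv> real r/real k"
 shows "\<exists>C\<ge>0. \<forall>l d. 1 <= l --> l/2 <= real d --> real d <= l --> 1 <= d -->
  \<bar>l powr (a + 1)*(psi k r d/C2 k r) - ((\<Sum>i\<le>k. psi_coeff k r i*l powr (1 - real i/real k)) + (l - real d))\<bar>
   <= C*((l - real d)\<^sup>2/l + (l - real d)*l powr (- (1/real k)) + l powr (- (1/real k)))"
proof -
 obtain C0 where C0: "C0 >= 0" and C0': "\<forall>d\<ge>1.
  \<bar>psi k r d/C2 k r - (\<Sum>i\<le>k. psi_coeff k r i*real d powr (- (real (r + i)/real k)))\<bar>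
   <= C0*real d powr (- (real (r + k + 1)/real k))"
  using psi_expansion_ex[OF k r(1)] by blast
 note C0 = C0 C0'[rule_format]
 define p where "p i = real (r + i)/real k" for i
 have p: "0 < p i" "p i = a + real i/real k" for i
 proof -
  show "0 < p i" using k r by (simp add: p_def)
  show "p i = a + real i/real k" by (simp add: p_def a_def add_divide_distrib)
 qed
 have p2: "p i <= 2" if "i <= k" for i using that k r by (simp add: p_def field_simps)
 define A where "A = (\<Sum>i\<in>{1..k}. \<bar>psi_coeff k r i\<bar>*16)"
 have A0: "0 <= A" by (auto simp: A_def intro: sum_nonneg)
 define C where "C = real k/real r*96 + A + C0*8"
 have C: "0 <= C" using C0(1) A0 by (simp add: C_def)
 have main: "\<bar>l powr (a + 1)*(psi k r d/C2 k r) - ((\<Sum>i\<le>k. psi_coeff k r i*l powr (1 - real i/real k)) + (l - real d))\<bar>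
   <= C*((l - real d)\<^sup>2/l + (l - real d)*l powr (- (1/real k)) + l powr (- (1/real k)))"
  if l: "1 <= l" and d: "l/2 <= real d" "real d <= l" "1 <= d" for l :: real and d :: nat
 proof -
  define \<delta> where "\<delta> = l - real d"
  define x where "x = \<delta>/l"
  define y where "y = l powr (- (1/real k))"
  have \<delta>: "0 <= \<delta>" "\<delta> <= l/2" using d by (auto simp: \<delta>_def)
  have x: "0 <= x" "x <= 1/2" using \<delta> l by (auto simp: x_def field_simps)
  have d1x: "real d = l*(1 - x)" using l by (simp add: x_def \<delta>_def field_simps)
  have trm: "l powr (a + 1)*real d powr (- p i) = l powr (1 - real i/real k)*(1 - x) powr (- p i)" for i
   using l x unfolding d1x by (simp add: powr_mult mult.assoc[symmetric] powr_add[symmetric] p(2))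
  let ?R = "psi k r d/C2 k r - (\<Sum>i\<le>k. psi_coeff k r i*real d powr (- p i))"
  have R: "\<bar>l powr (a + 1)*?R\<bar> <= C0*8*y"
  proof -
   have e: "real (r + k + 1)/real k = a + 1 + 1/real k" using k by (simp add: a_def add_divide_distrib)
   have ex: "a + 1 + 1/real k <= 3" using k r by (simp add: a_def field_simps)
   have ax: "0 < a + 1 + 1/real k" using k r by (simp add: a_def add_pos_nonneg)
   have "real d powr (- (a + 1 + 1/real k)) <= (l/2) powr (- (a + 1 + 1/real k))" using l d ax by (intro powr_mono2') auto
   also have "... = l powr (- (a + 1 + 1/real k))*2 powr (a + 1 + 1/real k)"
    using l powr_minus[of 2 "a + 1 + 1/real k"] by (simp only: powr_divide) (simp add: divide_inverse)
   also have "... <= l powr (- (a + 1 + 1/real k))*8"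
    using powr_mono[OF ex, of 2] by (intro mult_left_mono) auto
   finally have "C0*real d powr (- (a + 1 + 1/real k)) <= C0*(l powr (- (a + 1 + 1/real k))*8)"
    using C0(1) by (intro mult_left_mono)
   hence "\<bar>?R\<bar> <= C0*(l powr (- (a + 1 + 1/real k))*8)"
    using C0(2)[OF d(3)] unfolding e p_def by linarith
   hence "l powr (a + 1)*\<bar>?R\<bar> <= l powr (a + 1)*(C0*(l powr (- (a + 1 + 1/real k))*8))"
    by (intro mult_left_mono) auto
   also have "... = C0*8*(l powr (a + 1)*l powr (- (a + 1 + 1/real k)))" by simp
   also have "l powr (a + 1)*l powr (- (a + 1 + 1/real k)) = y" by (simp add: y_def powr_add[symmetric])
   finally show ?thesis by (simp add: abs_mult)
  qed
  have sp: "(\<Sum>i\<le>k. f i) = f 0 + (\<Sum>i\<in>{1..k}. f i)" for f :: "nat => real"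
   by (simp add: atMost_atLeast0 sum.atLeast_Suc_atMost)
  let ?t = "%i. psi_coeff k r i*(l powr (1 - real i/real k)*((1 - x) powr (- p i) - 1))"
  have kra: "real k/real r*a = 1" using k r by (simp add: a_def)
  have decomp: "l powr (a + 1)*(psi k r d/C2 k r) - ((\<Sum>i\<le>k. psi_coeff k r i*l powr (1 - real i/real k)) + \<delta>)
    = l powr (a + 1)*?R + (?t 0 - \<delta>) + (\<Sum>i\<in>{1..k}. ?t i)"
  proof -
   have "l powr (a + 1)*(psi k r d/C2 k r) = l powr (a + 1)*?R + (\<Sum>i\<le>k. psi_coeff k r i*(l powr (a + 1)*real d powr (- p i)))"
    by (simp add: algebra_simps sum_distrib_left)
   also have "(\<Sum>i\<le>k. psi_coeff k r i*(l powr (a + 1)*real d powr (- p i))) = (\<Sum>i\<le>k. psi_coeff k r i*l powr (1 - real i/real k)) + (\<Sum>i\<le>k. ?t i)"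
    unfolding trm by (simp add: sum.distrib[symmetric] algebra_simps)
   finally show ?thesis unfolding sp[of ?t] by linarith
  qed
  have t0: "\<bar>?t 0 - \<delta>\<bar> <= real k/real r*96*(\<delta>\<^sup>2/l)"
  proof -
   have p0: "p 0 = a" by (simp add: p(2))
   have "\<bar>(1 - x) powr (- a) - 1 - a*x\<bar> <= 96*x\<^sup>2"
    using powr_one_minus_bounds(2)[OF x p(1) p2[of 0]] by (simp add: p0)
   hence "(real k/real r*l)*\<bar>(1 - x) powr (- a) - 1 - a*x\<bar> <= (real k/real r*l)*(96*x\<^sup>2)"
    using l by (intro mult_left_mono) auto
   moreover have "?t 0 - \<delta> = (real k/real r*l)*((1 - x) powr (- a) - 1 - a*x)"
   proof -
    have "(real k/real r*l)*(a*x) = (real k/real r*a)*(l*x)" by (simp only: mult_ac)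
    hence "(real k/real r*l)*(a*x) = \<delta>" using l unfolding kra by (simp add: x_def)
    thus ?thesis using l by (simp add: psi_coeff_def p0 right_diff_distrib)
   qed
   ultimately have "\<bar>?t 0 - \<delta>\<bar> <= (real k/real r*l)*(96*x\<^sup>2)" using l by (simp add: abs_mult)
   also have "... = real k/real r*96*(\<delta>\<^sup>2/l)" using l by (simp add: x_def power2_eq_square field_simps)
   finally show ?thesis .
  qed
  have ti: "\<bar>\<Sum>i\<in>{1..k}. ?t i\<bar> <= A*(\<delta>*y)"
   unfolding A_def sum_distrib_right
  proof (rule order_trans[OF sum_abs sum_mono])
   fix i assume i: "i \<in> {1..k}"
   have "\<bar>(1 - x) powr (- p i) - 1\<bar> <= 16*x" using powr_one_minus_bounds(1)[OF x p(1) p2] i by simp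
   hence "\<bar>psi_coeff k r i\<bar>*(l powr (1 - real i/real k)*\<bar>(1 - x) powr (- p i) - 1\<bar>) <= \<bar>psi_coeff k r i\<bar>*(l powr (1 - real i/real k)*(16*x))"
    by (intro mult_left_mono) auto
   also have "... <= \<bar>psi_coeff k r i\<bar>*(16*(\<delta>*y))"
   proof (rule mult_left_mono)
    have "l powr (1 - real i/real k)*(16*x) = 16*\<delta>*l powr (- (real i/real k))"
     using l by (simp add: x_def powr_diff powr_minus_divide)
    also have "... <= 16*\<delta>*y" unfolding y_def using l k i \<delta> by (intro mult_left_mono powr_mono) (auto simp: divide_le_cancel)
    finally show "l powr (1 - real i/real k)*(16*x) <= 16*(\<delta>*y)" by simp
   qed simp
   finally show "\<bar>?t i\<bar> <= \<bar>psi_coeff k r i\<bar>*16*(\<delta>*y)" by (simp add: abs_mult)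
  qed
  have y0: "0 <= y" "0 <= \<delta>*y" "0 <= \<delta>\<^sup>2/l" using \<delta> l by (auto simp: y_def)
  have "\<bar>l powr (a + 1)*(psi k r d/C2 k r) - ((\<Sum>i\<le>k. psi_coeff k r i*l powr (1 - real i/real k)) + \<delta>)\<bar>
    <= C0*8*y + real k/real r*96*(\<delta>\<^sup>2/l) + A*(\<delta>*y)"
   using decomp R t0 ti by (rule abs_sum3_le)
  also have "... <= C*y + C*(\<delta>\<^sup>2/l) + C*(\<delta>*y)"
   using y0 C0(1) A0 by (intro add_mono mult_right_mono) (auto simp: C_def)
  finally show ?thesis by (simp add: \<delta>_def y_def algebra_simps)
 qed
 show ?thesis by (intro exI[of _ C] conjI allI impI C) (rule main)
qed

text \<open>What the average of \<open>lg n - depth\<close> adds to the mean beyond the summand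
  \<open>lg lg n\<close> already contained in \<open>centering\<close>; it is cancelled in
  \<open>shift_limit\<close>.\<close>

definition mean_height :: "nat => real" where
 "mean_height n = (\<Sum>v\<in>{1..n}. log 2 (real n) - real (depth v))/real n - log 2 (log 2 (real n))"

text \<open>Low enough that the discarded nodes are negligible even after multiplication by
  \<open>l^2/n\<close>, and high enough that all remaining nodes have depth
  \<open>l - O(lg l)\<close>.\<close>

definition cutoff :: "nat => nat" where
 "cutoff n = nat \<lfloor>real n/log 2 (real n)^3\<rfloor>"

lemma cutoff_le:
 assumes "1 < log 2 (real n)"
 shows "real (cutoff n) <= real n/log 2 (real n)^3" "cutoff n <= n"
  "real n/log 2 (real n)^3 < real (cutoff n) + 1"
proof -
 have 0: "0 <= real n/log 2 (real n)^3" using assms by simp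
 show 1: "real (cutoff n) <= real n/log 2 (real n)^3" unfolding cutoff_def using 0 by linarith
 show "real n/log 2 (real n)^3 < real (cutoff n) + 1" unfolding cutoff_def using 0 by linarith
 have "1 <= log 2 (real n)^3" using assms by simp
 hence "real n/log 2 (real n)^3 <= real n/1" using assms by (intro divide_left_mono) auto
 hence "real (cutoff n) <= real n" using 1 by simp
 thus "cutoff n <= n" by simp
qed

lemma depth_le_log: "v \<in> {1..n} ==> real (depth v) <= log 2 (real n)"
 by (rule order_trans[OF depth_log(1) log_mono]) auto

lemma depth_above_cutoff:
 assumes l: "1 < log 2 (real n)" and v: "v \<in> {cutoff n<..n}"
 shows "log 2 (real n) - (3*log 2 (log 2 (real n)) + 1) <= real (depth v)"
proof -
 let ?l = "log 2 (real n)"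
 have n: "0 < n" using l by (cases "n = 0") (auto simp: log_def)
 have "real n/?l^3 < real (cutoff n) + 1" by (rule cutoff_le(3)[OF l])
 also have "... <= real v" using v by simp
 finally have "log 2 (real n/?l^3) <= log 2 (real v)" using n l by (intro log_mono) auto
 moreover have "log 2 (real n/x^3) = ?l - 3*log 2 x" if "0 < x" for x :: real
  using n that by (simp add: log_divide log_nat_power)
 hence "log 2 (real n/?l^3) = ?l - 3*log 2 ?l" using l by simp
 ultimately show ?thesis using depth_log(2)[of v] v by simp
qed

lemma centering_eq:
 assumes "0 < log 2 (real n)"
 shows "centering k r n = (\<Sum>i\<le>k. psi_coeff k r i*log 2 (real n) powr (1 - real i/real k)) + log 2 (log 2 (real n))"
proof -
 have "(\<Sum>i\<le>k. f i) = f 0 + (\<Sum>i\<in>{1..k}. f i)" for f :: "nat => real"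
  by (simp add: atMost_atLeast0 sum.atLeast_Suc_atMost)
 thus ?thesis using assms by (simp add: centering_def psi_coeff_def)
qed

lemma eventually_from:
 assumes "eventually P (at_top :: real filter)"
 obtains L where "!!l. L <= l ==> P l"
 using assms unfolding eventually_at_top_linorder by blast

text \<open>\<open>psi_uniform\<close> at every node beyond the cutoff, averaged over the tree. The
  error is a function of \<open>lg n\<close> alone so that it can be composed with any sequence of
  sizes.\<close>

lemma mean_record_sum:
 fixes k r :: nat
 assumes k: "1 <= k" and r: "1 <= r" "r <= k"
 defines "a \<equiv> real r/real k"
 shows "\<exists>\<epsilon> L. (\<epsilon> ---> 0) at_top & (\<forall>n. L <= log 2 (real n) -->
  \<bar>log 2 (real n) powr (a + 1)/(C2 k r*real n)*(\<Sum>v\<in>{cutoff n<..n}. psi k r (depth v)) - centering k r n - mean_height n\<bar> <= \<epsilon> (log 2 (real n)))"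
proof -
 obtain C where C: "0 <= C" and C': "\<forall>l d. 1 <= l --> l/2 <= real d --> real d <= l --> 1 <= d -->
  \<bar>l powr (a + 1)*(psi k r d/C2 k r) - ((\<Sum>i\<le>k. psi_coeff k r i*l powr (1 - real i/real k)) + (l - real d))\<bar>
   <= C*((l - real d)\<^sup>2/l + (l - real d)*l powr (- (1/real k)) + l powr (- (1/real k)))"
  using psi_uniform[OF k r] unfolding a_def by blast
 note C' = C'[rule_format]
 define Q where "Q = (\<Sum>i\<le>k. \<bar>psi_coeff k r i\<bar>)"
 have Q0: "0 <= Q" by (auto simp: Q_def intro: sum_nonneg)
 define c where "c = 1/real k"
 have c: "0 < c" using k by (simp add: c_def)
 define \<epsilon>1 where "\<epsilon>1 l = C*((3*log 2 l + 1)\<^sup>2/l + (3*log 2 l + 1)*l powr (- c) + l powr (- c))" for l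
 define \<epsilon> where "\<epsilon> l = (Q + 1)/l\<^sup>2 + \<epsilon>1 l" for l
 have lim: "(\<epsilon> ---> 0) at_top"
 proof -
  have "((%l::real. (3*log 2 l + 1)\<^sup>2/l + (3*log 2 l + 1)*l powr (- c) + l powr (- c)) ---> 0) at_top"
  proof (intro tendsto_add_zero)
   show "((%l::real. (3*log 2 l + 1)\<^sup>2/l) ---> 0) at_top" by real_asymp
   show "((%l::real. (3*log 2 l + 1)*l powr (- c)) ---> 0) at_top" using c by real_asymp
   show "((%l::real. l powr (- c)) ---> 0) at_top" using c by real_asymp
  qed
  from tendsto_mult_right_zero[OF this, of C] have e1: "(\<epsilon>1 ---> 0) at_top" unfolding \<epsilon>1_def .
  have "((%l::real. 1/l\<^sup>2) ---> 0) at_top" by real_asymp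
  from tendsto_add[OF tendsto_mult_right_zero[OF this, of "Q + 1"] e1] show ?thesis by (simp add: \<epsilon>_def[abs_def])
 qed
 have "eventually (%l::real. 2 <= l & 3*log 2 l + 1 <= l/2) at_top"
  by (intro eventually_conj eventually_ge_at_top) real_asymp
 then obtain L where L: "!!l. L <= l ==> 2 <= l & 3*log 2 l + 1 <= l/2" using eventually_from by blast
 have "\<bar>log 2 (real n) powr (a + 1)/(C2 k r*real n)*(\<Sum>v\<in>{cutoff n<..n}. psi k r (depth v)) - centering k r n - mean_height n\<bar> <= \<epsilon> (log 2 (real n))"
  if n: "L <= log 2 (real n)" for n
 proof -
  define l where "l = log 2 (real n)"
  have l: "2 <= l" "3*log 2 l + 1 <= l/2" using L n by (auto simp: l_def)
  have l1: "1 < log 2 (real n)" using l by (simp add: l_def)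
  have n0: "0 < n" using l by (cases "n = 0") (auto simp: l_def log_def)
  define P where "P = (\<Sum>i\<le>k. psi_coeff k r i*l powr (1 - real i/real k))"
  let ?V = "{cutoff n<..n}"
  \<comment> \<open>Deviation of one normalised record probability from the expansion at
    \<open>l\<close> plus its height term; all depths beyond the cutoff are close enough to
    \<open>l\<close> for \<open>psi_uniform\<close>.\<close>
  define err where "err v = l powr (a + 1)*(psi k r (depth v)/C2 k r) - (P + (l - real (depth v)))" for v
  have log0: "0 <= log 2 l" using l by simp
  have e1: "\<bar>err v\<bar> <= \<epsilon>1 l" if v: "v \<in> ?V" for v
  proof -
   define \<delta> where "\<delta> = l - real (depth v)"
   have v1: "v \<in> {1..n}" using v by auto
   have d: "real (depth v) <= l" using depth_le_log[OF v1] by (simp add: l_def)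
   have d2: "\<delta> <= 3*log 2 l + 1" using depth_above_cutoff[OF l1 v] by (simp add: l_def \<delta>_def)
   have d3: "l/2 <= real (depth v)" using d2 l by (simp add: \<delta>_def)
   hence d4: "1 <= depth v" using l by linarith
   have \<delta>0: "0 <= \<delta>" using d by (simp add: \<delta>_def)
   have "\<bar>err v\<bar> <= C*(\<delta>\<^sup>2/l + \<delta>*l powr (- c) + l powr (- c))"
    using C'[of l "depth v"] l d d3 d4 by (simp add: err_def P_def \<delta>_def c_def)
   also have "... <= \<epsilon>1 l" unfolding \<epsilon>1_def
    using C d2 \<delta>0 l by (intro mult_left_mono add_mono divide_right_mono mult_right_mono power_mono) auto
   finally show ?thesis .
  qed
  have \<epsilon>1_0: "0 <= \<epsilon>1 l" using C log0 l unfolding \<epsilon>1_def by (intro mult_nonneg_nonneg add_nonneg_nonneg divide_nonneg_nonneg) auto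
  have cut: "real (cutoff n)/real n <= 1/l^3"
   using cutoff_le(1)[OF l1] n0 l by (simp add: l_def field_simps)
  have cV: "real (card ?V) = real n - real (cutoff n)" using cutoff_le(2)[OF l1] by (simp add: of_nat_diff)
  have split: "(\<Sum>v\<in>{1..n}. f v) = (\<Sum>v\<in>{1..cutoff n}. f v) + (\<Sum>v\<in>?V. f v)" for f :: "nat => real"
  proof -
   have "{1..n} = {1..cutoff n} \<union> ?V" using cutoff_le(2)[OF l1] by auto
   thus ?thesis by (simp only:) (rule sum.union_disjoint, auto)
  qed
  define S0 where "S0 = (\<Sum>v\<in>{1..cutoff n}. l - real (depth v))"
  have "l powr (a + 1)/(C2 k r*real n)*(\<Sum>v\<in>?V. psi k r (depth v)) = (\<Sum>v\<in>?V. l powr (a + 1)*(psi k r (depth v)/C2 k r))/real n"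
   by (simp add: sum_distrib_left sum_divide_distrib)
  also have "... = (\<Sum>v\<in>?V. err v + (P + (l - real (depth v))))/real n" by (simp add: err_def)
  also have "... = ((\<Sum>v\<in>?V. err v) + real (card ?V)*P + (\<Sum>v\<in>?V. l - real (depth v)))/real n"
   by (simp add: sum.distrib)
  also have "(\<Sum>v\<in>?V. l - real (depth v)) = (\<Sum>v\<in>{1..n}. l - real (depth v)) - S0" unfolding S0_def split by simp
  finally have E: "l powr (a + 1)/(C2 k r*real n)*(\<Sum>v\<in>?V. psi k r (depth v))
   = (\<Sum>v\<in>?V. err v)/real n + (P - real (cutoff n)/real n*P) + (\<Sum>v\<in>{1..n}. l - real (depth v))/real n - S0/real n"
   unfolding cV using n0 by (simp add: add_divide_distrib diff_divide_distrib left_diff_distrib)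
  have "l powr (a + 1)/(C2 k r*real n)*(\<Sum>v\<in>?V. psi k r (depth v)) - centering k r n - mean_height n
   = (\<Sum>v\<in>?V. err v)/real n + (- (real (cutoff n)/real n*P)) + (- (S0/real n))"
   unfolding E using l by (subst centering_eq) (auto simp: l_def P_def mean_height_def)
  moreover have "\<bar>(\<Sum>v\<in>?V. err v)/real n\<bar> <= \<epsilon>1 l"
  proof -
   have "\<bar>\<Sum>v\<in>?V. err v\<bar> <= (\<Sum>v\<in>?V. \<epsilon>1 l)" by (rule order_trans[OF sum_abs sum_mono]) (rule e1)
   also have "... = real (card ?V)*\<epsilon>1 l" by (simp only: sum_constant)
   also have "... <= real n*\<epsilon>1 l" unfolding cV using \<epsilon>1_0 by (intro mult_right_mono) auto
   finally show ?thesis using n0 by (simp add: field_simps)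
  qed
  moreover have "\<bar>- (real (cutoff n)/real n*P)\<bar> <= Q/l\<^sup>2"
  proof -
   have "\<bar>P\<bar> <= (\<Sum>i\<le>k. \<bar>psi_coeff k r i\<bar>*l)"
    unfolding P_def
   proof (rule order_trans[OF sum_abs sum_mono])
    fix i
    have "l powr (1 - real i/real k) <= l powr 1" using l by (intro powr_mono) auto
    hence "l powr (1 - real i/real k) <= l" using l by simp
    thus "\<bar>psi_coeff k r i*l powr (1 - real i/real k)\<bar> <= \<bar>psi_coeff k r i\<bar>*l"
     by (simp add: abs_mult mult_left_mono)
   qed
   hence PQ: "\<bar>P\<bar> <= Q*l" by (simp add: Q_def sum_distrib_right)
   have "\<bar>- (real (cutoff n)/real n*P)\<bar> = real (cutoff n)/real n*\<bar>P\<bar>" by (simp add: abs_mult)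
   also have "... <= 1/l^3*(Q*l)" using cut PQ l by (intro mult_mono) auto
   also have "... = Q/l\<^sup>2" using l by (simp add: power2_eq_square power3_eq_cube)
   finally show ?thesis .
  qed
  moreover have "\<bar>- (S0/real n)\<bar> <= 1/l\<^sup>2"
  proof -
   have "\<bar>S0\<bar> <= (\<Sum>v\<in>{1..cutoff n}. l)"
    unfolding S0_def
   proof (rule order_trans[OF sum_abs sum_mono])
    fix v assume "v \<in> {1..cutoff n}"
    hence "v \<in> {1..n}" using cutoff_le(2)[OF l1] by auto
    from depth_le_log[OF this] show "\<bar>l - real (depth v)\<bar> <= l" by (simp add: l_def)
   qed
   hence "\<bar>S0\<bar>/real n <= real (cutoff n)/real n*l" by (simp add: divide_right_mono)
   also have "... <= 1/l^3*l" using cut l by (intro mult_right_mono) auto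
   also have "... = 1/l\<^sup>2" using l by (simp add: power2_eq_square power3_eq_cube)
   finally show ?thesis by simp
  qed
  ultimately have "\<bar>l powr (a + 1)/(C2 k r*real n)*(\<Sum>v\<in>?V. psi k r (depth v)) - centering k r n - mean_height n\<bar> <= \<epsilon>1 l + Q/l\<^sup>2 + 1/l\<^sup>2"
   by (rule abs_sum3_le)
  also have "... = \<epsilon> l" by (simp add: \<epsilon>_def add_divide_distrib)
  finally show ?thesis by (simp add: l_def)
 qed
 thus ?thesis by (intro exI[of _ \<epsilon>] exI[of _ L] conjI allI impI lim)
qed

text \<open>All subtree sizes together sum to the depths plus \<open>n\<close>
  (\<open>sum_depth\<close>), and the deep ones are known from \<open>sum_deep_subtrees\<close>.
  Subtraction leaves the shallow ones, which is how \<open>mean_height\<close> enters the mean of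
  the jumps.\<close>

lemma shallow_subtrees:
 fixes H n :: nat
 assumes n: "1 <= n"
 shows "\<bar>(\<Sum>u\<in>{1..n div 2^H}. real (card (subtree n u)))/real n - (log 2 (real n) - log 2 (log 2 (real n)) - real H + 2 - mean_height n)\<bar> <= 4*2^H/real n + 1/2^H"
proof -
 have "(\<Sum>u\<in>{1..n}. real (card (subtree n u))) = (\<Sum>u\<in>{1..n div 2^H}. real (card (subtree n u))) + (\<Sum>u\<in>{n div 2^H<..n}. real (card (subtree n u)))"
 proof -
  have "n div 2^H <= n" by simp
  hence "{1..n} = {1..n div 2^H} \<union> {n div 2^H<..n}" using order_trans[of _ "n div 2^H" n] by auto
  thus ?thesis by (simp only:) (rule sum.union_disjoint, auto)
 qed
 moreover have "(\<Sum>u\<in>{1..n}. real (card (subtree n u))) = (\<Sum>v\<in>{1..n}. real (depth v) + 1)"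
  using arg_cong[OF sum_depth[of n], of real] by (simp add: add.commute)
 moreover have "(\<Sum>v\<in>{1..n}. real (depth v) + 1) = real n*(log 2 (real n) + 1 - (mean_height n + log 2 (log 2 (real n))))"
  using n by (simp add: mean_height_def sum.distrib sum_subtractf field_simps)
 ultimately have "(\<Sum>u\<in>{1..n div 2^H}. real (card (subtree n u)))/real n
   = (log 2 (real n) + 1 - (mean_height n + log 2 (log 2 (real n)))) - (\<Sum>u\<in>{n div 2^H<..n}. real (card (subtree n u)))/real n"
  using n by (simp add: field_simps)
 thus ?thesis using sum_deep_subtrees[OF n, of H] by linarith
qed

lemma mean_height_ge:
 assumes "1 <= n"
 shows "- log 2 (log 2 (real n)) <= mean_height n"
proof -
 have "0 <= (\<Sum>v\<in>{1..n}. log 2 (real n) - real (depth v))" by (intro sum_nonneg) (use depth_le_log in auto)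
 thus ?thesis by (simp add: mean_height_def)
qed

lemma rho_bound_ex:
 assumes k: "k >= 1" and r: "r >= 1"
 shows "\<exists>C\<ge>0. \<forall>d\<ge>1.
  (PINT x. gr r x*(Qk k x^d*(1 - Qk k x)\<^sup>2)) <= C*real d powr (- (real (r + 2*k)/real k))"
proof (rule rho_bound[OF k r])
 fix C assume C: "C >= 0" and *: "!!d. d >= 1 ==>
  (PINT x. gr r x*(Qk k x^d*(1 - Qk k x)\<^sup>2)) <= C*real d powr (- (real (r + 2*k)/real k))"
 show ?thesis by (intro exI[of _ C] conjI allI impI C) (rule *)
qed

text \<open>The prefactor is at most a constant times \<open>l^2/n\<close>. With \<open>J\<close> of
  order \<open>l^5\<close> and cutoff \<open>n/l^3\<close>, the four parts are of order
  \<open>1/l\<close>, \<open>1/sqrt l\<close>, \<open>(lg l)^2/l\<close> and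
  \<open>(lg l)/l^3\<close>.\<close>

lemma error_terms:
 fixes k r :: nat
 assumes k: "1 <= k" and r: "1 <= r" "r <= k"
 defines "a \<equiv> real r/real k"
 shows "\<exists>\<epsilon> L. (\<epsilon> ---> 0) at_top & (\<forall>n J m. L <= log 2 (real n) --> 1 <= J -->
   log 2 (real n)^5 <= real (J + 1) --> real J <= 4*log 2 (real n)^5 --> m = nat \<lfloor>log 2 (real n)\<rfloor> -->
  log 2 (real n) powr (a + 1)/(C2 k r*real n) *
   approx_error k r n J (cutoff n) m
   <= \<epsilon> (log 2 (real n)))"
proof -
 obtain Cr where Cr: "Cr >= 0" and Cr': "\<forall>d\<ge>1.
  (PINT x. gr r x*(Qk k x^d*(1 - Qk k x)\<^sup>2)) <= Cr*real d powr (- (real (r + 2*k)/real k))"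
  using rho_bound_ex[OF k r(1)] by blast
 note Cr' = Cr'[rule_format]
 obtain Cd where Cd: "0 <= Cd" and Cd': "\<forall>m\<ge>1.
  \<bar>(psi k r m - psi k r (m + 1))/C2 k r*real m powr (a + 1) - 1\<bar> <= Cd*real m powr (- (1/real k))"
  using psi_difference[OF k r(1)] unfolding a_def by blast
 note Cd' = Cd'[rule_format]
 have a: "0 < a" "a <= 1" using k r by (auto simp: a_def)
 have c2: "0 < C2 k r" by (rule C2_pos[OF k r(1)])
 define B where "B l = 5*log 2 l + 3" for l :: real
 define \<epsilon> where "\<epsilon> l = 1/C2 k r*(1/l) + 2/C2 k r*(1/sqrt l) + 8*Cr/C2 k r*((2*(B l)\<^sup>2 + 2*B l*(8*log 2 l + 4))/l)
   + 8*(1 + Cd)*((5*log 2 l + 4)/l^3)" for l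
 have lim: "(\<epsilon> ---> 0) at_top"
 proof -
  have 1: "((%l::real. 1/l) ---> 0) at_top" "((%l::real. 1/sqrt l) ---> 0) at_top"
   "((%l::real. (2*(B l)\<^sup>2 + 2*B l*(8*log 2 l + 4))/l) ---> 0) at_top" "((%l::real. (5*log 2 l + 4)/l^3) ---> 0) at_top"
   unfolding B_def by real_asymp+
  show ?thesis unfolding \<epsilon>_def[abs_def]
   by (intro tendsto_add_zero tendsto_mult_right_zero 1)
 qed
 have "eventually (%l::real. 2 <= l & 8*log 2 l + 4 <= l/2) at_top"
  by (intro eventually_conj eventually_ge_at_top) real_asymp
 then obtain L where L: "!!l. L <= l ==> 2 <= l & 8*log 2 l + 4 <= l/2" using eventually_from by blast
 have main: "log 2 (real n) powr (a + 1)/(C2 k r*real n) *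
   approx_error k r n J (cutoff n) m
   <= \<epsilon> (log 2 (real n))"
  if n: "L <= log 2 (real n)" and J: "1 <= J" "log 2 (real n)^5 <= real (J + 1)" "real J <= 4*log 2 (real n)^5"
   and m: "m = nat \<lfloor>log 2 (real n)\<rfloor>" for n J m
 proof -
  define l where "l = log 2 (real n)"
  have l: "2 <= l" "8*log 2 l + 4 <= l/2" using L n by (auto simp: l_def)
  have l1: "1 < log 2 (real n)" using l by (simp add: l_def)
  have n0: "0 < n" using l by (cases "n = 0") (auto simp: l_def log_def)
  have log0: "0 <= log 2 l" using l by simp
  have cut: "real (cutoff n)/real n <= 1/l^3"
   using cutoff_le(1)[OF l1] n0 l by (simp add: l_def field_simps)
  have la: "l powr (a + 1) <= l\<^sup>2"
   using powr_mono[of "a + 1" 2 l] a l by (simp add: powr_numeral)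
  have lJ: "log 2 (real J) <= 5*log 2 l + 2"
  proof -
   have "log 2 (real J) <= log 2 (4*l^5)" using J l by (intro log_mono) (auto simp: l_def)
   also have "... = log 2 (2^2) + 5*log 2 l" using l by (simp add: log_mult log_nat_power)
   also have "log 2 (2^2 :: real) = 2" by (subst log_nat_power) auto
   finally show ?thesis by simp
  qed
  have t1: "l powr (a + 1)/(C2 k r*real n)*real (cutoff n) <= 1/C2 k r*(1/l)"
  proof -
   have "l powr (a + 1)/(C2 k r*real n)*real (cutoff n) = 1/C2 k r*(l powr (a + 1)*(real (cutoff n)/real n))" by simp
   also have "... <= 1/C2 k r*(l\<^sup>2*(1/l^3))" using c2 la cut by (intro mult_left_mono mult_mono) auto
   also have "l\<^sup>2*(1/l^3) = 1/l" using l by (simp add: power2_eq_square power3_eq_cube)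
   finally show ?thesis .
  qed
  have t2: "l powr (a + 1)/(C2 k r*real n)*(2*real n/sqrt (real (J + 1))) <= 2/C2 k r*(1/sqrt l)"
  proof -
   have "sqrt (l^5) <= sqrt (real (J + 1))" using J(2) by (simp only: real_sqrt_le_iff l_def)
   moreover have "sqrt (l^5) = l\<^sup>2 * sqrt l" using l by (simp add: real_sqrt_mult power_numeral_reduce real_sqrt_power power2_eq_square)
   ultimately have s: "l\<^sup>2 * sqrt l <= sqrt (real (J + 1))" by simp
   have s0: "0 < l\<^sup>2 * sqrt l" using l by simp
   have "l powr (a + 1)/(C2 k r*real n)*(2*real n/sqrt (real (J + 1))) = 2/C2 k r*(l powr (a + 1)/sqrt (real (J + 1)))" using n0 by simp
   also have "... <= 2/C2 k r*(l\<^sup>2/(l\<^sup>2 * sqrt l))" using c2 la s s0 by (intro mult_left_mono frac_le) auto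
   also have "l\<^sup>2/(l\<^sup>2 * sqrt l) = 1/sqrt l" using l by simp
   finally show ?thesis .
  qed
  let ?A = "%v. real (card (ancs v \<inter> {1..J}))" and ?e = "%v. card (ancs v - {1..J})"
  let ?rho = "%v. (PINT x. gr r x*(Qk k x^?e v *(1 - Qk k x)\<^sup>2))"
  let ?b = "(2*(B l)\<^sup>2 + 2*B l*(8*log 2 l + 4))*(8*Cr*l powr (- (a + 2)))"
  have B0: "0 <= B l" using log0 by (simp add: B_def)
  have tv: "(2*(?A v)\<^sup>2 + 2*?A v *real (m - ?e v))*?rho v <= ?b" if v: "v \<in> {cutoff n<..n}" for v
  proof -
   have A: "?A v <= B l" using card_ancs_le[OF J(1), of v] lJ by (simp add: B_def)
   have dep: "real (depth v) = ?A v + real (?e v)"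
   proof -
    have "card (ancs v) = card ((ancs v \<inter> {1..J}) \<union> (ancs v - {1..J}))" by (rule arg_cong[of _ _ card]) auto
    also have "... = card (ancs v \<inter> {1..J}) + card (ancs v - {1..J})" by (rule card_Un_disjoint) auto
    finally show ?thesis by (simp add: depth_def)
   qed
   have e: "l - (8*log 2 l + 4) <= real (?e v)"
    using depth_above_cutoff[OF l1 v] A unfolding dep B_def l_def[symmetric] by linarith
   have e2: "l/2 <= real (?e v)" using e l by linarith
   have e1: "1 <= ?e v" using e2 l by linarith
   have ml: "real m <= l" unfolding m l_def[symmetric] using l by linarith
   have me: "real (m - ?e v) <= 8*log 2 l + 4"
    using e ml log0 by (cases "?e v <= m") (auto simp: of_nat_diff)
   have ex: "real (r + 2*k)/real k = a + 2" using k by (simp add: a_def add_divide_distrib)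
   have "real (?e v) powr (- (a + 2)) <= (l/2) powr (- (a + 2))" using e2 l a by (intro powr_mono2') auto
   also have "... = l powr (- (a + 2))*2 powr (a + 2)"
    by (simp only: powr_divide powr_minus[of 2 "a + 2"]) (simp only: divide_inverse inverse_inverse_eq)
   also have "... <= l powr (- (a + 2))*8" using powr_mono[of "a + 2" 3 "2::real"] a by (intro mult_left_mono) auto
   finally have "Cr*real (?e v) powr (- (a + 2)) <= Cr*(l powr (- (a + 2))*8)" using Cr by (intro mult_left_mono)
   hence rh: "?rho v <= 8*Cr*l powr (- (a + 2))" using Cr'[OF e1] unfolding ex by simp
   have rh0: "0 <= ?rho v" unfolding set_lebesgue_integral_def
    by (intro integral_nonneg_AE AE_I2) (auto simp: indicator_def gr_nonneg Qk_nonneg)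
   have A0: "0 <= ?A v" by simp
   show ?thesis
   proof (rule mult_mono[OF add_mono rh _ rh0])
    show "2*(?A v)\<^sup>2 <= 2*(B l)\<^sup>2" using power_mono[OF A A0, of 2] by simp
    show "2*?A v *real (m - ?e v) <= 2*B l*(8*log 2 l + 4)"
     using mult_mono[OF A me B0] by simp
    show "0 <= 2*(B l)\<^sup>2 + 2*B l*(8*log 2 l + 4)" using B0 log0 by simp
   qed
  qed
  have t3: "l powr (a + 1)/(C2 k r*real n)*(\<Sum>v\<in>{cutoff n<..n}. (2*(?A v)\<^sup>2 + 2*?A v *real (m - ?e v))*?rho v)
    <= 8*Cr/C2 k r*((2*(B l)\<^sup>2 + 2*B l*(8*log 2 l + 4))/l)"
  proof -
   have b0: "0 <= ?b" using B0 log0 Cr by (intro mult_nonneg_nonneg add_nonneg_nonneg) auto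
   have "(\<Sum>v\<in>{cutoff n<..n}. (2*(?A v)\<^sup>2 + 2*?A v *real (m - ?e v))*?rho v) <= (\<Sum>v\<in>{cutoff n<..n}. ?b)"
    by (rule sum_mono) (rule tv)
   also have "... = real (card {cutoff n<..n})*?b" by (simp only: sum_constant)
   also have "... <= real n*?b" using b0 by (intro mult_right_mono) auto
   finally have "l powr (a + 1)/(C2 k r*real n)*(\<Sum>v\<in>{cutoff n<..n}. (2*(?A v)\<^sup>2 + 2*?A v *real (m - ?e v))*?rho v)
     <= l powr (a + 1)/(C2 k r*real n)*(real n*?b)" using c2 by (intro mult_left_mono) auto
   also have "... = 8*Cr/C2 k r*((2*(B l)\<^sup>2 + 2*B l*(8*log 2 l + 4))*(l powr (a + 1)*l powr (- (a + 2))))"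
    using n0 by simp
   also have "l powr (a + 1)*l powr (- (a + 2)) = 1/l" using l by (simp add: powr_add[symmetric] powr_minus_divide)
   finally show ?thesis by simp
  qed
  have t4: "l powr (a + 1)/(C2 k r*real n)*(2*(psi k r m - psi k r (m + 1))*(real (cutoff n)*(log 2 (real J) + 2)))
    <= 8*(1 + Cd)*((5*log 2 l + 4)/l^3)"
  proof -
   have m1: "1 <= m" "l <= 2*real m" unfolding m l_def[symmetric] using l by linarith+
   define D where "D = (psi k r m - psi k r (m + 1))/C2 k r*real m powr (a + 1)"
   have "real m powr (- (1/real k)) <= real m powr 0" using m1 by (intro powr_mono) auto
   hence "Cd*real m powr (- (1/real k)) <= Cd*1" using m1 Cd by (intro mult_left_mono) auto
   hence D: "D <= 1 + Cd" using Cd'[OF m1(1)] unfolding D_def by linarith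
   have lm: "l powr (a + 1) = (l/real m) powr (a + 1)*real m powr (a + 1)" using l m1 by (simp add: powr_divide)
   have q: "(l/real m) powr (a + 1) <= 4"
   proof -
    have "(l/real m) powr (a + 1) <= 2 powr (a + 1)" using m1 l a by (intro powr_mono2) (auto simp: field_simps)
    also have "... <= 2 powr 2" using a by (intro powr_mono) auto
    finally show ?thesis by simp
   qed
   have J0: "0 <= log 2 (real J)" using J by simp
   have "l powr (a + 1)/(C2 k r*real n)*(2*(psi k r m - psi k r (m + 1))*(real (cutoff n)*(log 2 (real J) + 2)))
    = 2*((l/real m) powr (a + 1)*D)*(real (cutoff n)/real n*(log 2 (real J) + 2))"
    unfolding lm D_def by simp
   also have "... <= 2*(4*(1 + Cd))*(1/l^3*(5*log 2 l + 2 + 2))"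
   proof (rule mult_mono)
    have "(l/real m) powr (a + 1)*D <= (l/real m) powr (a + 1)*(1 + Cd)" using D by (intro mult_left_mono) auto
    also have "... <= 4*(1 + Cd)" using q Cd by (intro mult_right_mono) auto
    finally show "2*((l/real m) powr (a + 1)*D) <= 2*(4*(1 + Cd))" by simp
    show "real (cutoff n)/real n*(log 2 (real J) + 2) <= 1/l^3*(5*log 2 l + 2 + 2)"
     using cut lJ J0 l by (intro mult_mono) auto
   qed (use Cd J0 in auto)
   finally show ?thesis by (simp add: add.commute)
  qed
  have "l powr (a + 1)/(C2 k r*real n) *
   approx_error k r n J (cutoff n) m
   <= \<epsilon> l"
  proof -
   have "x*(p + q + s + t) <= p' + q' + s' + t'" if "x*p <= p'" "x*q <= q'" "x * s <= s'" "x*t <= t'" for x p q s t p' q' s' t' :: real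
    using that by (simp add: distrib_left)
   from this[OF t1 t2 t3 t4] show ?thesis unfolding \<epsilon>_def approx_error_def .
  qed
  thus ?thesis by (simp add: l_def)
 qed
 show ?thesis by (intro exI[of _ \<epsilon>] exI[of _ L] conjI allI impI lim) (rule main)
qed

lemma (in prob_space) char_diff_le:
 fixes A B :: "'a => real"
 assumes A: "A \<in> borel_measurable M" and B: "B \<in> borel_measurable M" and D: "integrable M (%w. A w - B w)"
 shows "norm (char (distr M borel A) t - char (distr M borel B) t) <= \<bar>t\<bar>*(LINT w|M. \<bar>A w - B w\<bar>)"
proof -
 have i1: "integrable M (%w. iexp (t*A w))" using A by (intro integrable_iexp) auto
 have i2: "integrable M (%w. iexp (t*B w))" using B by (intro integrable_iexp) auto
 have e: "char (distr M borel A) t - char (distr M borel B) t = (CLINT w|M. iexp (t*A w) - iexp (t*B w))"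
  using A B bochner_integral_diff[OF i1 i2] by (simp add: char_def integral_distr)
 have "norm (CLINT w|M. iexp (t*A w) - iexp (t*B w)) <= (LINT w|M. norm (iexp (t*A w) - iexp (t*B w)))"
  by (rule integral_norm_bound)
 also have "(LINT w|M. norm (iexp (t*A w) - iexp (t*B w))) <= (LINT w|M. \<bar>t\<bar>*\<bar>A w - B w\<bar>)"
 proof (rule integral_mono)
  show "integrable M (%w. norm (iexp (t*A w) - iexp (t*B w)))"
   by (intro integrable_norm bochner_diff i1 i2)
  show "integrable M (%w. \<bar>t\<bar>*\<bar>A w - B w\<bar>)" using D by (intro integrable_mult_right integrable_abs)
  fix w
  have "iexp (t*A w) - iexp (t*B w) = iexp (t*B w)*(iexp (t*(A w - B w)) - 1)"
   by (simp add: right_diff_distrib exp_add[symmetric])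
  hence "norm (iexp (t*A w) - iexp (t*B w)) = norm (iexp (t*(A w - B w)) - 1)"
   by (simp only: norm_mult norm_exp_i_times mult_1)
  also have "... <= \<bar>t*(A w - B w)\<bar>" by (rule norm_iexp_bounds(2))
  finally show "norm (iexp (t*A w) - iexp (t*B w)) <= \<bar>t\<bar>*\<bar>A w - B w\<bar>" by (simp only: abs_mult)
 qed
 also have "(LINT w|M. \<bar>t\<bar>*\<bar>A w - B w\<bar>) = \<bar>t\<bar>*(LINT w|M. \<bar>A w - B w\<bar>)"
  by (rule integral_mult_right_zero)
 finally show ?thesis unfolding e .
qed

section \<open>Assembling the approximation along a sequence of trees\<close>

locale record_scaling = record_sequence +
 assumes l_log: "!!i. l i = log 2 (real (n i))" and l_top: "filterlim l at_top sequentially"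
  and l_ge: "!!i. 2 <= l i" and m_floor: "!!i. m i = nat \<lfloor>l i\<rfloor>"
begin

lemma g_eq: "g i = log 2 (real (n i)) - log 2 (log 2 (real (n i))) - real (H i)"
proof -
 have "l i = log 2 (l i*2 powr (g i + real (H i)))" using n_scale[of i] by (simp add: l_log)
 also have "... = log 2 (l i) + (g i + real (H i))" using l_pos[of i] by (simp add: log_mult)
 finally show ?thesis by (simp add: l_log)
qed

lemma C3_Gamma: "C3 k r*Gamma (1 + a) = 1"
proof -
 have "0 < Gamma (1 + a)" using a01 by (intro Gamma_real_pos) simp
 thus ?thesis by (simp add: C3_def a_def[symmetric])
qed

lemma m_bounds: "real (m i) <= l i" "l i < real (m i) + 1"
 unfolding m_floor using l_ge[of i] by linarith+

text \<open>The normalised mean loss per unit of subtree size, up to the factor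
  \<open>\<Gamma>(1+a)\<close>; it tends to 1.\<close>

definition theta_ratio :: "nat => real" where
 "theta_ratio i = (l i/real (m i)) powr (a + 1)*((psi k r (m i) - psi k r (m i + 1))/C2 k r*real (m i) powr (a + 1))"

lemma sum_meanX: "(\<Sum>u\<in>A. meanX i u) = Gamma (1 + a)*(theta_ratio i*((\<Sum>u\<in>A. real (card (subtree (n i) u)))/real (n i)))"
proof -
 have m0: "0 < real (m i)" using m_pos[of i] by simp
 have "C3 k r ~= 0" using C3_Gamma by auto
 hence c: "1/(C2 k r*C3 k r) = Gamma (1 + a)/C2 k r"
  using C3_Gamma C2_pos[OF k r(1)] by (simp add: field_simps)
 have "meanX i u = Gamma (1 + a)*(theta_ratio i*(real (card (subtree (n i) u))/real (n i)))" for u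
 proof -
  have p: "(l i/real (m i)) powr (a + 1) = (l i/real (m i)) powr a*(l i/real (m i))"
   "real (m i) powr (a + 1) = real (m i) powr a*real (m i)"
   using m0 l_pos[of i] by (auto simp: powr_add)
  have "x*(y*z/w)*(G/C*M*D) = G*(x*(y/p)*(D/C*(M*p))*(z/w))" if "p ~= 0" for x y z w G C M D p :: real
   using that by (simp add: mult_ac)
  thus ?thesis unfolding meanX_def jump_def theta_ratio_def c p using m0 by (simp only: of_nat_0_less_iff neq0_conv of_nat_eq_0_iff)
 qed
 thus ?thesis by (simp add: sum_distrib_left sum_divide_distrib)
qed

text \<open>A rate is required, since the deviation from 1 is multiplied by a sum that is only
  bounded by \<open>lg l + 8\<close> in \<open>shift_limit\<close>.\<close>

lemma theta_ratio_bound: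
 obtains C where "0 <= C" "!!i. \<bar>theta_ratio i - 1\<bar> <= C*l i powr (- (1/real k))"
proof -
 obtain Cd where Cd: "0 <= Cd" and Cd': "\<forall>m\<ge>1.
  \<bar>(psi k r m - psi k r (m + 1))/C2 k r*real m powr (a + 1) - 1\<bar> <= Cd*real m powr (- (1/real k))"
  using psi_difference[OF k r(1)] unfolding a_def by blast
 have "\<bar>theta_ratio i - 1\<bar> <= (2*(4*Cd + 3))*l i powr (- (1/real k))" for i
 proof -
  define x where "x = l i/real (m i)"
  define D where "D = (psi k r (m i) - psi k r (m i + 1))/C2 k r*real (m i) powr (a + 1)"
  define y where "y = real (m i) powr (- (1/real k))"
  have m1: "1 <= real (m i)" using m_pos[of i] by simp
  have x: "1 <= x" "x <= 1 + 1/real (m i)" "x <= 2" using m_bounds[of i] m1 by (auto simp: x_def field_simps)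
  have xa: "1 <= x powr (a + 1)" "x powr (a + 1) <= x\<^sup>2"
   using x a01 powr_mono[of "a + 1" 2 x] by (auto simp: ge_one_powr_ge_zero powr_numeral)
  have x3: "x\<^sup>2 - 1 <= 3*(1/real (m i))"
  proof -
   have "x\<^sup>2 - 1 = (x + 1)*(x - 1)" by (simp add: power2_eq_square algebra_simps)
   also have "... <= 3*(1/real (m i))" using x by (intro mult_mono) auto
   finally show ?thesis .
  qed
  have x4: "x\<^sup>2 <= 4" using power_mono[of x 2 2] x by simp
  have my: "1/real (m i) <= y"
  proof -
   have "1/real (m i) = real (m i) powr (- 1)" using m1 by (simp add: powr_minus_divide)
   also have "... <= y" unfolding y_def using m1 k by (intro powr_mono) auto
   finally show ?thesis .
  qed
  have yl: "y <= 2*l i powr (- (1/real k))"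
  proof -
   have "y <= (l i/2) powr (- (1/real k))" unfolding y_def using l_m(1)[of i] l_pos[of i] by (intro powr_mono2') auto
   also have "... = l i powr (- (1/real k))*2 powr (1/real k)"
    by (simp only: powr_divide powr_minus[of 2 "1/real k"]) (simp only: divide_inverse inverse_inverse_eq)
   also have "... <= l i powr (- (1/real k))*2" using powr_mono[of "1/real k" 1 "2::real"] k by (intro mult_left_mono) auto
   finally show ?thesis by simp
  qed
  have D: "\<bar>D - 1\<bar> <= Cd*y" using Cd' m_pos[of i] by (simp add: D_def y_def)
  have "theta_ratio i - 1 = x powr (a + 1)*(D - 1) + (x powr (a + 1) - 1)"
   by (simp add: theta_ratio_def x_def D_def algebra_simps)
  also have "\<bar>...\<bar> <= x powr (a + 1)*\<bar>D - 1\<bar> + \<bar>x powr (a + 1) - 1\<bar>"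
   by (rule order_trans[OF abs_triangle_ineq]) (simp add: abs_mult)
  also have "... <= 4*(Cd*y) + 3*y"
  proof (rule add_mono)
   show "x powr (a + 1)*\<bar>D - 1\<bar> <= 4*(Cd*y)" using D xa x4 by (intro mult_mono) auto
   show "\<bar>x powr (a + 1) - 1\<bar> <= 3*y" using xa x3 my by linarith
  qed
  also have "... = (4*Cd + 3)*y" by (simp add: algebra_simps)
  also have "... <= (4*Cd + 3)*(2*l i powr (- (1/real k)))" using Cd yl by (intro mult_left_mono) auto
  also have "... = (2*(4*Cd + 3))*l i powr (- (1/real k))" by (simp only: mult_ac)
  finally show ?thesis .
 qed
 thus thesis using Cd by (intro that[of "2*(4*Cd + 3)"]) simp
qed

text \<open>Chosen so that \<open>1 - C3*W\<close> equals \<open>mean_height\<close> minus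
  \<open>C3\<close> times the sum of the centred jumps; this uses
  \<open>C3*\<Gamma>(1+a) = 1\<close>.\<close>

definition shift :: "nat => real" where
 "shift i = (\<Sum>u\<in>nodes i. meanX i u) + Gamma (1 + a)*(mean_height (n i) - 1)"

text \<open>The difference consists of the means of the shallow classes plus the
  \<open>mean_height\<close> term. The shallow means tend to
  \<open>\<Gamma>(1+a)(g + 2 - mean_height)\<close> by \<open>shallow_subtrees\<close>, so
  \<open>mean_height\<close> cancels and \<open>g + 1\<close> remains.\<close>

lemma shift_limit: "(%i. shift i - compensator i) ----> Gamma (1 + a)*(\<gamma> + 1)"
proof -
 define Sh where "Sh i = (\<Sum>u\<in>{1..n i div 2^H i}. real (card (subtree (n i) u)))/real (n i)" for i
 define \<eta> where "\<eta> i = 4*2^H i/real (n i) + 1/2^H i" for i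
 have e1: "shift i - compensator i = Gamma (1 + a)*(theta_ratio i*Sh i + mean_height (n i) - 1)" for i
 proof -
  have "n i div 2^H i <= n i div 2^h1 i" using h1(1)[of i] by (intro div_le_mono2) (auto intro: power_increasing)
  hence "nodes i = {1..n i div 2^H i} \<union> {u \<in> nodes i. n i div 2^H i < u}"
   using order_trans[of _ "n i div 2^H i" "n i div 2^h1 i"] by (auto simp: nodes_def)
  hence "(\<Sum>u\<in>nodes i. meanX i u) = (\<Sum>u\<in>{1..n i div 2^H i} \<union> {u \<in> nodes i. n i div 2^H i < u}. meanX i u)" by simp
  also have "... = (\<Sum>u\<in>{1..n i div 2^H i}. meanX i u) + compensator i"
   unfolding compensator_def by (rule sum.union_disjoint) (auto simp: nodes_def)
  finally show ?thesis unfolding shift_def Sh_def sum_meanX[of i "{1..n i div 2^H i}"] by (simp add: algebra_simps)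
 qed
 have n1: "1 <= n i" for i using n_pos[of i] by simp
 have nH: "2^H i/real (n i) <= 1/l i" for i
 proof -
  have "l i*2^H i <= l i*2 powr (g i + real (H i))"
   using l_pos[of i] g(1)[of i] by (intro mult_left_mono) (auto simp: powr_realpow[symmetric])
  thus ?thesis using n_scale[of i] n_pos[of i] l_pos[of i] by (simp add: field_simps)
 qed
 have linv: "(%i. 1/l i) ----> 0" by (rule tendsto_divide_0[OF tendsto_const filterlim_at_top_imp_at_infinity[OF l_top]])
 have Htop: "filterlim H at_top sequentially" by (rule filterlim_at_top_mono[OF h1(2)]) simp
 have "(%i. 1/(2::real)^H i) ----> 0"
  by (rule tendsto_divide_0[OF tendsto_const filterlim_compose[OF filterlim_realpow_sequentially_gt1 Htop]]) simp
 from tendsto_add[OF tendsto_mult_right_zero[OF linv, of 4] this]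
 have "(%i. 4*(1/l i) + 1/2^H i) ----> 0" by simp
 hence \<eta>lim: "\<eta> ----> 0"
 proof (rule Lim_null_comparison[rotated])
  show "\<forall>\<^sub>F i in sequentially. norm (\<eta> i) <= 4*(1/l i) + 1/2^H i"
  proof (rule always_eventually, rule allI)
   fix i
   have "norm (\<eta> i) = 4*(2^H i/real (n i)) + 1/2^H i" by (simp add: \<eta>_def)
   thus "norm (\<eta> i) <= 4*(1/l i) + 1/2^H i" using nH[of i] by linarith
  qed
 qed
 have Sh: "\<bar>Sh i - (g i + 2 - mean_height (n i))\<bar> <= \<eta> i" for i
  using shallow_subtrees[OF n1, of i "H i"] unfolding Sh_def \<eta>_def g_eq by simp
 obtain C where C: "0 <= C" "!!i. \<bar>theta_ratio i - 1\<bar> <= C*l i powr (- (1/real k))" using theta_ratio_bound by metis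
 have Sh0: "0 <= Sh i" for i by (auto simp: Sh_def intro!: divide_nonneg_nonneg sum_nonneg)
 have Sb: "Sh i <= log 2 (l i) + 8" for i
 proof -
  have "\<eta> i <= 5"
  proof -
   have "1/l i <= 1" using l_ge[of i] by simp
   moreover have "1/(2::real)^H i <= 1" by simp
   ultimately show ?thesis using nH[of i] unfolding \<eta>_def by linarith
  qed
  thus ?thesis using Sh[of i] g(2)[of i] mean_height_ge[OF n1, of i] unfolding l_log[symmetric] by linarith
 qed
 have t1: "(%i. (theta_ratio i - 1)*Sh i) ----> 0"
 proof (rule Lim_null_comparison)
  define c where "c = 1/real k"
  have "0 < c" using k by (simp add: c_def)
  hence "((%x::real. x powr (- c)*(log 2 x + 8)) ---> 0) at_top" by real_asymp
  from tendsto_mult_right_zero[OF filterlim_compose[OF this l_top], of C]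
  show "(%i. C*(l i powr (- (1/real k))*(log 2 (l i) + 8))) ----> 0" by (simp add: c_def)
  show "\<forall>\<^sub>F i in sequentially. norm ((theta_ratio i - 1)*Sh i) <= C*(l i powr (- (1/real k))*(log 2 (l i) + 8))"
  proof (rule always_eventually, rule allI)
   fix i
   have "\<bar>theta_ratio i - 1\<bar>*Sh i <= (C*l i powr (- (1/real k)))*(log 2 (l i) + 8)"
    using C Sb[of i] Sh0[of i] by (intro mult_mono) auto
   thus "norm ((theta_ratio i - 1)*Sh i) <= C*(l i powr (- (1/real k))*(log 2 (l i) + 8))"
    using Sh0[of i] by (simp add: abs_mult mult.assoc)
  qed
 qed
 have t2: "(%i. Sh i - (g i + 2 - mean_height (n i))) ----> 0"
  by (rule Lim_null_comparison[OF _ \<eta>lim]) (use Sh in \<open>auto intro!: always_eventually\<close>)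
 have "(%i. Gamma (1 + a)*((theta_ratio i - 1)*Sh i + (Sh i - (g i + 2 - mean_height (n i))) + (g i + 1))) ----> Gamma (1 + a)*(0 + 0 + (\<gamma> + 1))"
  by (intro tendsto_intros t1 t2 g(3))
 thus ?thesis unfolding e1 by (simp add: algebra_simps)
qed

definition W :: "nat => 'a => real" where "W i w = (\<Sum>u\<in>nodes i. X i u w) - shift i"

definition S :: "nat => 'a => real" where
 "S i w = l i powr (a + 1)/(C2 k r*real (n i))*real (num_records (E i) k r (n i) w) - centering k r (n i)"

lemma X_centered:
 "C3 k r*(X i u w - meanX i u) = l i powr (a + 1)/(C2 k r*real (n i)) *
  (real (card (subtree (n i) u))*(alarm_tree.L k r (m i) (alarm_tree.T k (E i) u w) - (psi k r (m i) - psi k r (m i + 1))))"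
proof -
 have m0: "0 < real (m i)" using m_pos[of i] by simp
 have c3: "C3 k r ~= 0" using C3_Gamma by auto
 have c: "C3 k r*(1/(C2 k r*C3 k r)) = 1/C2 k r" using c3 by simp
 have "jump i u*real (m i) powr a = l i powr (a + 1)/real (n i)*real (card (subtree (n i) u))"
  unfolding jump_def using m0 l_pos[of i] by (simp add: powr_add powr_divide)
 hence j: "C3 k r*(1/(C2 k r*C3 k r))*(jump i u*real (m i) powr a) = l i powr (a + 1)/(C2 k r*real (n i))*real (card (subtree (n i) u))"
  unfolding c by simp
 have "C3 k r*(X i u w - meanX i u) = C3 k r*(1/(C2 k r*C3 k r))*(jump i u*real (m i) powr a) *
   (alarm_tree.L k r (m i) (alarm_tree.T k (E i) u w) - (psi k r (m i) - psi k r (m i + 1)))"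
  unfolding X_def meanX_def by (simp only: right_diff_distrib mult_ac)
 thus ?thesis unfolding j by (simp only: mult.assoc)
qed

text \<open>An exact identity with two small parts: the linearisation error, controlled by
  \<open>num_records_approx\<close> and \<open>error_terms\<close>, and the error of the mean,
  controlled by \<open>mean_record_sum\<close>.\<close>

lemma S_decomposition:
 "S i w - (1 - C3 k r*W i w) = l i powr (a + 1)/(C2 k r*real (n i)) *
   (real (num_records (E i) k r (n i) w) - ((\<Sum>v\<in>{cutoff (n i)<..n i}. psi k r (depth v)) -
     (\<Sum>u\<in>nodes i. real (card (subtree (n i) u))*(alarm_tree.L k r (m i) (alarm_tree.T k (E i) u w) - (psi k r (m i) - psi k r (m i + 1))))))
   + (l i powr (a + 1)/(C2 k r*real (n i))*(\<Sum>v\<in>{cutoff (n i)<..n i}. psi k r (depth v)) - centering k r (n i) - mean_height (n i))"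
proof -
 have "C3 k r*W i w = (\<Sum>u\<in>nodes i. C3 k r*(X i u w - meanX i u)) - (C3 k r*Gamma (1 + a))*(mean_height (n i) - 1)"
  by (simp add: W_def shift_def algebra_simps sum_distrib_left sum_subtractf)
 hence "C3 k r*W i w = l i powr (a + 1)/(C2 k r*real (n i))*(\<Sum>u\<in>nodes i. real (card (subtree (n i) u))*(alarm_tree.L k r (m i) (alarm_tree.T k (E i) u w) - (psi k r (m i) - psi k r (m i + 1)))) - (mean_height (n i) - 1)"
  unfolding X_centered C3_Gamma by (simp only: sum_distrib_left mult_1)
 thus ?thesis unfolding S_def right_diff_distrib by linarith
qed

lemma W_measurable: "W i \<in> borel_measurable (M i)"
 unfolding W_def[abs_def] by (intro borel_measurable_diff borel_measurable_sum X_facts(1) borel_measurable_const)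

text \<open>L1-closeness of \<open>S\<close> and \<open>1 - C3*W\<close> makes their characteristic
  functions asymptotically equal; the affine map then converts \<open>char_limit\<close> at the
  argument \<open>- C3*t\<close>.\<close>

lemma S_approximation:
 assumes J: "!!i. 1 <= n i div 2^h1 i" "!!i. n i div 2^h1 i <= cutoff (n i)" "!!i. l i^5 <= real (n i div 2^h1 i + 1)"
   "!!i. real (n i div 2^h1 i) <= 4*l i^5"
  and S: "!!i. S i \<in> borel_measurable (M i)"
 shows "(%i. char (distr (M i) borel (S i)) t) ----> iexp t*exp (limit_exponent k r \<gamma> (- C3 k r*t))"
proof -
 obtain \<epsilon>1 L1 where e1: "(\<epsilon>1 ---> 0) at_top" and e1': "\<forall>n. L1 <= log 2 (real n) -->
  \<bar>log 2 (real n) powr (real r/real k + 1)/(C2 k r*real n)*(\<Sum>v\<in>{cutoff n<..n}. psi k r (depth v)) - centering k r n - mean_height n\<bar> <= \<epsilon>1 (log 2 (real n))"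
  using mean_record_sum[OF k r] by blast
 obtain \<epsilon>2 L2 where e2: "(\<epsilon>2 ---> 0) at_top" and e2': "\<forall>n J m. L2 <= log 2 (real n) --> 1 <= J -->
   log 2 (real n)^5 <= real (J + 1) --> real J <= 4*log 2 (real n)^5 --> m = nat \<lfloor>log 2 (real n)\<rfloor> -->
  log 2 (real n) powr (real r/real k + 1)/(C2 k r*real n) *
   approx_error k r n J (cutoff n) m
   <= \<epsilon>2 (log 2 (real n))"
  using error_terms[OF k r] by blast
 define D where "D i w = S i w - (1 - C3 k r*W i w)" for i w
 have Dm: "D i \<in> borel_measurable (M i)" for i unfolding D_def[abs_def] using S W_measurable by measurable
 have ev: "\<forall>\<^sub>F i in sequentially. max L1 L2 <= l i" using l_top unfolding filterlim_at_top by blast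
 have bound: "integrable (M i) (D i) & (LINT w|M i. \<bar>D i w\<bar>) <= \<epsilon>2 (l i) + \<epsilon>1 (l i)" if L: "max L1 L2 <= l i" for i
 proof -
  interpret A: alarm_tree "M i" "n i" k r "E i" by (rule tree)
  define \<alpha> where "\<alpha> = l i powr (a + 1)/(C2 k r*real (n i))"
  have \<alpha>0: "0 <= \<alpha>" using C2_pos[OF k r(1)] by (simp add: \<alpha>_def)
  define Y where "Y w = real (num_records (E i) k r (n i) w) - A.linearized (n i div 2^h1 i) (cutoff (n i)) (m i) w" for w
  define d where "d = \<alpha>*(\<Sum>v\<in>{cutoff (n i)<..n i}. psi k r (depth v)) - centering k r (n i) - mean_height (n i)"
  have De: "D i w = \<alpha>*Y w + d" for w
   unfolding D_def S_decomposition Y_def d_def \<alpha>_def A.linearized_def nodes_def ..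
  have l1: "1 < log 2 (real (n i))" using l_ge[of i] by (simp add: l_log)
  have dm: "depth v <= m i" if "v \<in> {1..n i}" for v
   using depth_le_log[OF that] unfolding m_floor l_log by linarith
  note approx = A.num_records_approx[OF J(1) J(2) cutoff_le(2)[OF l1] dm]
  have iY: "integrable (M i) Y" unfolding Y_def[abs_def] by (rule approx(1))
  have Yb: "\<alpha>*(LINT w|M i. \<bar>Y w\<bar>) <= \<epsilon>2 (l i)"
  proof -
   have "\<alpha>*(LINT w|M i. \<bar>Y w\<bar>) <= \<alpha>*approx_error k r (n i) (n i div 2^h1 i) (cutoff (n i)) (m i)"
    using mult_left_mono[OF approx(2) \<alpha>0] unfolding Y_def .
   also have "... <= \<epsilon>2 (l i)"
    unfolding \<alpha>_def l_log a_def using L J(1,3,4)[of i] m_floor[of i] by (intro e2'[rule_format]) (auto simp: l_log)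
   finally show ?thesis .
  qed
  have db: "\<bar>d\<bar> <= \<epsilon>1 (l i)"
   unfolding d_def \<alpha>_def l_log a_def using L by (intro e1'[rule_format]) (simp add: l_log)
  have iD: "integrable (M i) (D i)" unfolding De[abs_def] using iY by simp
  have "(LINT w|M i. \<bar>D i w\<bar>) <= (LINT w|M i. \<alpha>*\<bar>Y w\<bar> + \<bar>d\<bar>)"
  proof (rule integral_mono)
   show "integrable (M i) (%w. \<alpha>*\<bar>Y w\<bar> + \<bar>d\<bar>)" using iY by simp
   show "\<bar>D i w\<bar> <= \<alpha>*\<bar>Y w\<bar> + \<bar>d\<bar>" for w
    unfolding De using \<alpha>0 by (intro order_trans[OF abs_triangle_ineq]) (simp add: abs_mult)
  qed (use iD in simp)
  also have "... = \<alpha>*(LINT w|M i. \<bar>Y w\<bar>) + \<bar>d\<bar>" using iY by (simp add: A.prob_space)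
  finally show ?thesis using iD Yb db by simp
 qed
 have diff: "(%i. char (distr (M i) borel (S i)) t - char (distr (M i) borel (%w. 1 - C3 k r*W i w)) t) ----> 0"
 proof (rule Lim_null_comparison)
  have "(%i. \<epsilon>2 (l i) + \<epsilon>1 (l i)) ----> 0"
   by (intro tendsto_add_zero filterlim_compose[OF e1 l_top] filterlim_compose[OF e2 l_top])
  from tendsto_mult_right_zero[OF this, of "\<bar>t\<bar>"] show "(%i. \<bar>t\<bar>*(\<epsilon>2 (l i) + \<epsilon>1 (l i))) ----> 0" .
  show "\<forall>\<^sub>F i in sequentially. norm (char (distr (M i) borel (S i)) t - char (distr (M i) borel (%w. 1 - C3 k r*W i w)) t) <= \<bar>t\<bar>*(\<epsilon>2 (l i) + \<epsilon>1 (l i))"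
   using ev
  proof eventually_elim
   case (elim i)
   interpret A: alarm_tree "M i" "n i" k r "E i" by (rule tree)
   have V: "(%w. 1 - C3 k r*W i w) \<in> borel_measurable (M i)" using W_measurable[of i] by measurable
   have "norm (char (distr (M i) borel (S i)) t - char (distr (M i) borel (%w. 1 - C3 k r*W i w)) t) <= \<bar>t\<bar>*(LINT w|M i. \<bar>D i w\<bar>)"
    using A.char_diff_le[OF S V, of t] bound[OF elim] by (simp add: D_def[abs_def])
   also have "... <= \<bar>t\<bar>*(\<epsilon>2 (l i) + \<epsilon>1 (l i))" using bound[OF elim] by (intro mult_left_mono) auto
   finally show ?case .
  qed
 qed
 have "char (distr (M i) borel (%w. 1 - C3 k r*W i w)) t = iexp t*char (distr (M i) borel (W i)) (- C3 k r*t)" for i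
 proof -
  have "char (distr (M i) borel (%w. 1 - C3 k r*W i w)) t = (CLINT w|M i. iexp t*iexp ((- C3 k r*t)*W i w))"
   unfolding char_def using W_measurable[of i] by (subst integral_distr) (auto simp: exp_add[symmetric] algebra_simps)
  also have "... = iexp t*char (distr (M i) borel (W i)) (- C3 k r*t)"
   unfolding char_def using W_measurable[of i] by (subst integral_distr) auto
  finally show ?thesis .
 qed
 moreover have "(%i. iexp t*char (distr (M i) borel (W i)) (- C3 k r*t)) ----> iexp t*exp (limit_exponent k r \<gamma> (- C3 k r*t))"
  unfolding W_def[abs_def] by (intro tendsto_mult tendsto_const char_limit shift_limit)
 ultimately have "(%i. char (distr (M i) borel (%w. 1 - C3 k r*W i w)) t) ----> iexp t*exp (limit_exponent k r \<gamma> (- C3 k r*t))" by simp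
 from tendsto_add[OF diff this] show ?thesis by simp
qed

end

lemma (in alarm_tree) num_records_measurable: "(%w. real (num_records E k r n w)) \<in> borel_measurable M"
proof -
 have "real (num_records E k r n w) = (\<Sum>v\<in>{1..n}. I v w)" for w
  unfolding num_records_def I_def bin_tree_def by (simp add: of_bool_def sum.If_cases Int_def)
 moreover have "(%w. \<Sum>v\<in>{1..n}. I v w) \<in> borel_measurable M" by (intro borel_measurable_sum I_measurable)
 ultimately show ?thesis by (simp only:)
qed

section \<open>Choice of the parameters, and the limit theorem\<close>

text \<open>\<open>m = floor l\<close>, \<open>H\<close> and \<open>g\<close> are integer and
  fractional part of \<open>l - lg l\<close>, and \<open>ht = m + 1\<close>. The required
  inequalities hold only for large trees, hence the passage to the indices from \<open>i0\<close>
  on.\<close>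

lemma record_scaling_exists:
 fixes N :: "nat => nat"
 assumes kr: "1 <= k" "1 <= r" "r <= k"
  and iid: "!!n. n >= 1 ==> iid_exponential (M n) n (E n)"
  and N1: "!!i. N i >= 1" and Ntop: "filterlim N at_top sequentially"
  and Nfrac: "(%i. frac (log 2 (real (N i)) - log 2 (log 2 (real (N i))))) ----> \<gamma>"
 shows "\<exists>i0 m H h1 ht g. record_scaling k r \<gamma> (%i. N (i + i0)) m H h1 ht (%i. log 2 (real (N (i + i0)))) g (%i. M (N (i + i0))) (%i. E (N (i + i0))) &
  (\<forall>i. 1 <= N (i + i0) div 2^h1 i & N (i + i0) div 2^h1 i <= cutoff (N (i + i0)) &
   log 2 (real (N (i + i0)))^5 <= real (N (i + i0) div 2^h1 i + 1) & real (N (i + i0) div 2^h1 i) <= 4*log 2 (real (N (i + i0)))^5)"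
proof -
 have logN: "filterlim (%i. log 2 (real (N i))) at_top sequentially"
 proof -
  have "filterlim (%x::real. log 2 x) at_top at_top" by real_asymp
  thus ?thesis
   by (rule filterlim_compose) (rule filterlim_compose[OF filterlim_real_sequentially Ntop])
 qed
 have "eventually (%l::real. 4 <= l & 5*log 2 l + 3 <= l & 4*l^5 <= 2 powr l/l^3 - 1) at_top"
  by (intro eventually_conj eventually_ge_at_top) real_asymp+
 from eventually_compose_filterlim[OF this logN] obtain i0 where i0: "!!i. i0 <= i ==>
   4 <= log 2 (real (N i)) & 5*log 2 (log 2 (real (N i))) + 3 <= log 2 (real (N i)) & 4*log 2 (real (N i))^5 <= 2 powr log 2 (real (N i))/log 2 (real (N i))^3 - 1"
  unfolding eventually_sequentially by blast
 define n where "n i = N (i + i0)" for i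
 define l where "l i = log 2 (real (n i))" for i
 define p where "p i = log 2 (l i)" for i
 have n1: "1 <= n i" for i using N1 by (simp add: n_def)
 have nl: "real (n i) = 2 powr l i" for i using n1[of i] by (simp add: l_def)
 have big: "4 <= l i" "5*p i + 3 <= l i" "4*l i^5 <= real (n i)/l i^3 - 1" for i
  using i0[of "i + i0"] unfolding nl[of i] by (simp_all add: l_def n_def p_def)
 have lp: "l i = 2 powr p i" for i using big(1)[of i] by (simp add: p_def)
 have p0: "0 <= p i" for i using big(1)[of i] by (simp add: p_def)
 define m where "m i = nat \<lfloor>l i\<rfloor>" for i
 define H where "H i = nat \<lfloor>l i - p i\<rfloor>" for i
 define g where "g i = frac (l i - p i)" for i
 \<comment> \<open>The number \<open>J\<close> of top nodes is the integer part of
   \<open>l*2^(g+q)\<close>, and \<open>2^(4 lg l) = l^4\<close>; since \<open>g + q\<close> lies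
   between \<open>4 lg l\<close> and \<open>4 lg l + 2\<close>, \<open>J\<close> lies between
   \<open>l^5 - 1\<close> and \<open>4 l^5\<close>.\<close>
 define q where "q i = nat \<lceil>4*p i\<rceil>" for i
 define h1 where "h1 i = H i - q i" for i
 define ht where "ht i = m i + 1" for i
 have mb: "real (m i) <= l i" "l i < real (m i) + 1" for i using big(1)[of i] unfolding m_def by linarith+
 have Hb: "real (H i) = l i - p i - g i" for i
  using big(2)[of i] p0[of i] unfolding H_def g_def frac_def by (simp add: of_nat_nat)
 have gb: "0 <= g i" "g i < 1" for i by (auto simp: g_def frac_lt_1)
 have qb: "4*p i <= real (q i)" "real (q i) <= 4*p i + 1" for i using p0[of i] unfolding q_def by linarith+
 have qH: "q i <= H i" for i
 proof -
  have "real (q i) <= real (H i)" using qb(2)[of i] Hb[of i] gb(2)[of i] big(2)[of i] by linarith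
  thus ?thesis by simp
 qed
 have l_top: "filterlim l at_top sequentially"
  unfolding l_def n_def using filterlim_compose[OF logN filterlim_add_const_nat_at_top[of i0]] by simp
 have m_pos: "1 <= m i" for i using mb(2)[of i] big(1)[of i] by linarith
 have m_real: "filterlim (%i. real (m i)) at_top sequentially"
  by (rule filterlim_at_top_mono[OF filterlim_tendsto_add_at_top[OF tendsto_const[of "-1"] l_top]])
    (use mb(2) in \<open>auto intro!: always_eventually less_imp_le simp: algebra_simps\<close>)
 have m_top: "filterlim m at_top sequentially" using m_real by (simp add: filterlim_sequentially_iff_filterlim_real)
 have scale: "real (n i) = l i*2 powr (g i + real (H i))" for i
  unfolding Hb nl by (subst (2) lp) (simp add: powr_add[symmetric])
 have p_top: "filterlim p at_top sequentially"
 proof -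
  have "filterlim (%x::real. log 2 x) at_top at_top" by real_asymp
  from filterlim_compose[OF this l_top] show ?thesis by (simp add: p_def[abs_def])
 qed
 have lm1: "(%i. l i/real (m i)) ----> 1"
 proof (rule tendsto_sandwich)
  show "\<forall>\<^sub>F i in sequentially. 1 <= l i/real (m i)"
   using mb(1) m_pos by (intro always_eventually) (auto simp: field_simps Suc_le_eq)
  show "\<forall>\<^sub>F i in sequentially. l i/real (m i) <= 1 + 1/real (m i)"
  proof (rule always_eventually, rule allI)
   fix i
   have "0 < real (m i)" using m_pos[of i] by simp
   thus "l i/real (m i) <= 1 + 1/real (m i)" using mb(2)[of i] by (simp add: field_simps)
  qed
  have "(%i. 1/real (m i)) ----> 0" by (rule tendsto_divide_0[OF tendsto_const filterlim_at_top_imp_at_infinity[OF m_real]])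
  from tendsto_add[OF tendsto_const[of 1] this] show "(%i. 1 + 1/real (m i)) ----> 1" by simp
 qed simp
 have hh: "H i - h1 i = q i" for i using qH[of i] by (simp add: h1_def)
 have q_top: "filterlim (%i. H i - h1 i) at_top sequentially"
  unfolding hh filterlim_sequentially_iff_filterlim_real
 proof (rule filterlim_at_top_mono[OF p_top], rule always_eventually, rule allI)
  show "p i <= real (q i)" for i using qb(1)[of i] p0[of i] by linarith
 qed
 have Hht: "H i <= ht i" for i
 proof -
  have "real (H i) <= real (ht i)" using Hb[of i] gb(1)[of i] p0[of i] mb(2)[of i] unfolding ht_def by simp
  thus ?thesis by simp
 qed
 have htH: "filterlim (%i. ht i - H i) at_top sequentially"
  unfolding filterlim_sequentially_iff_filterlim_real
 proof (rule filterlim_at_top_mono[OF p_top], rule always_eventually, rule allI)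
  fix i
  show "p i <= real (ht i - H i)"
   using Hb[of i] gb(1)[of i] mb(2)[of i] Hht[of i] unfolding ht_def by (simp add: of_nat_diff)
 qed
 have hth1: "(%i. real (ht i - h1 i)/real (m i)) ----> 0"
 proof (rule Lim_null_comparison)
  have "((%x::real. (5*log 2 x + 3)/(x - 1)) ---> 0) at_top" by real_asymp
  from filterlim_compose[OF this l_top] show "(%i. (5*p i + 3)/(l i - 1)) ----> 0" by (simp add: p_def)
  show "\<forall>\<^sub>F i in sequentially. norm (real (ht i - h1 i)/real (m i)) <= (5*p i + 3)/(l i - 1)"
  proof (rule always_eventually, rule allI)
   fix i
   have "h1 i <= ht i" using Hht[of i] by (simp add: h1_def)
   hence "real (ht i - h1 i) = real (m i) + 1 - (real (H i) - real (q i))"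
    using qH[of i] by (simp add: ht_def h1_def of_nat_diff)
   also have "... <= 5*p i + 3" using mb(1)[of i] Hb[of i] gb(2)[of i] qb(2)[of i] by linarith
   finally have "real (ht i - h1 i)/real (m i) <= (5*p i + 3)/(l i - 1)"
    using mb(2)[of i] big(1)[of i] p0[of i] by (intro frac_le) auto
   thus "norm (real (ht i - h1 i)/real (m i)) <= (5*p i + 3)/(l i - 1)" by simp
  qed
 qed
 have nht: "n i < 2^ht i" for i
 proof -
  have "real (n i) < 2 powr (real (m i) + 1)" unfolding nl using mb(2)[of i] by (intro powr_less_mono) auto
  also have "... = real (2^ht i)" by (simp add: ht_def powr_add powr_realpow)
  finally show ?thesis by (simp only: of_nat_less_iff)
 qed
 have glim: "g ----> \<gamma>"
  using LIMSEQ_ignore_initial_segment[OF Nfrac, of i0] by (simp add: g_def[abs_def] l_def p_def n_def)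
 have "record_scaling k r \<gamma> n m H h1 ht l g (%i. M (n i)) (%i. E (n i))"
 proof unfold_locales
  show "iid_exponential (M (n i)) (n i) (E (n i))" for i by (rule iid[OF n1])
  show "0 < l i" "2 <= l i" for i using big(1)[of i] by auto
  show "l i <= 2*real (m i)" for i using mb(2)[of i] big(1)[of i] by linarith
  show "g i <= 1" for i using gb(2)[of i] by simp
  show "h1 i <= H i" for i by (simp add: h1_def)
 qed (fact kr m_pos m_top lm1 gb(1) glim scale q_top nht Hht htH hth1 l_def l_top m_def)+
 moreover have "1 <= n i div 2^h1 i & n i div 2^h1 i <= cutoff (n i) &
   l i^5 <= real (n i div 2^h1 i + 1) & real (n i div 2^h1 i) <= 4*l i^5" for i
 proof -
  let ?J = "n i div 2^h1 i"
  have e: "real (n i)/2^h1 i = l i*2 powr (g i + real (q i))"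
  proof -
   have "(2::real)^h1 i = 2 powr (real (H i) - real (q i))"
    using qH[of i] by (simp add: h1_def powr_realpow[symmetric] of_nat_diff)
   thus ?thesis unfolding scale[of i] by (simp add: powr_diff powr_add)
  qed
  have l5: "l i*2 powr (4*p i) = l i^5"
  proof -
   have "2 powr (4*p i) = (2 powr p i)^4" by (simp add: powr_realpow[symmetric] powr_powr mult.commute)
   also have "... = l i^4" by (simp only: lp[symmetric])
   finally show ?thesis by (simp add: power_numeral_reduce)
  qed
  have "real ?J = of_int \<lfloor>real (n i)/real (2^h1 i)\<rfloor>" unfolding floor_divide_of_nat_eq by simp
  hence J: "real ?J <= real (n i)/2^h1 i" "real (n i)/2^h1 i < real ?J + 1" by (auto simp: of_nat_power)
  have "l i*2 powr (4*p i) <= l i*2 powr (g i + real (q i))"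
   using gb(1)[of i] qb(1)[of i] big(1)[of i] by (intro mult_left_mono powr_mono) auto
  hence lo: "l i^5 < real ?J + 1" using J(2) unfolding e l5 by simp
  have "l i*2 powr (g i + real (q i)) <= l i*2 powr (4*p i + 2)"
   using gb(2)[of i] qb(2)[of i] big(1)[of i] by (intro mult_left_mono powr_mono) auto
  also have "... = 4*(l i*2 powr (4*p i))" by (simp add: powr_add powr_numeral)
  finally have hi: "real ?J <= 4*l i^5" using J(1) unfolding e l5 by simp
  have "1 < log 2 (real (n i))" using big(1)[of i] by (simp add: l_def)
  from cutoff_le(3)[OF this] have "real (n i)/l i^3 < real (cutoff (n i)) + 1" by (simp add: l_def)
  hence "real ?J <= real (cutoff (n i))" using hi big(3)[of i] by linarith
  moreover have "(2::real) <= l i^5"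
   using power_mono[of 2 "l i" 5] big(1)[of i] by simp
  hence "1 <= ?J" using lo by linarith
  ultimately show ?thesis using lo hi by simp
 qed
 ultimately show ?thesis unfolding n_def l_def by blast
qed

theorem theorem1p1:
 fixes k r :: nat and \<gamma> :: real
  and M :: "nat \<Rightarrow> 'a measure"
  and E :: "nat \<Rightarrow> nat \<Rightarrow> nat \<Rightarrow> 'a \<Rightarrow> real"
  and N :: "nat \<Rightarrow> nat"
 assumes "1 \<le> k" and "1 \<le> r" and "r \<le> k"
  and "0 \<le> \<gamma>" and "\<gamma> \<le> 1"
  and "\<And>n. n \<ge> 1 \<Longrightarrow> iid_exponential (M n) n (E n)"
  and "\<And>i. N i \<ge> 1"
  and "filterlim N at_top sequentially"
  and "(\<lambda>i. frac (log 2 (real (N i)) - log 2 (log 2 (real (N i))))) \<longlonglongrightarrow> \<gamma>"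
 shows "levy_measure (nu k r \<gamma>) \<and>
  (\<exists>W. real_distribution W \<and> infinitely_divisible W \<and>
   (\<forall>t. char W t =
    exp (\<i> * complex_of_real (drift k r \<gamma> * t) +
     (CLINT x|nu k r \<gamma>. iexp (t * x) - 1
       - \<i> * complex_of_real (t * x * indicator {..<1} x)))) \<and>
   weak_conv_m
    (\<lambda>i. distr (M (N i)) borel
     (\<lambda>\<omega>. log 2 (real (N i)) powr (real r / real k + 1) / (C2 k r * real (N i))
         * real (num_records (E (N i)) k r (N i) \<omega>)
        - centering k r (N i)))
    (distr W borel (\<lambda>w. 1 - C3 k r * w)))"
proof -
 note kr = assms(1-3)
 obtain i0 m H h1 ht g where
  scal: "record_scaling k r \<gamma> (%i. N (i + i0)) m H h1 ht (%i. log 2 (real (N (i + i0)))) g (%i. M (N (i + i0))) (%i. E (N (i + i0)))"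
  and J: "\<forall>i. 1 <= N (i + i0) div 2^h1 i & N (i + i0) div 2^h1 i <= cutoff (N (i + i0)) &
   log 2 (real (N (i + i0)))^5 <= real (N (i + i0) div 2^h1 i + 1) & real (N (i + i0) div 2^h1 i) <= 4*log 2 (real (N (i + i0)))^5"
  using record_scaling_exists[where M=M and E=E, OF kr assms(6-9)] by blast
 interpret R: record_scaling k r \<gamma> "%i. N (i + i0)" m H h1 ht "%i. log 2 (real (N (i + i0)))" g "%i. M (N (i + i0))" "%i. E (N (i + i0))"
  by (rule scal)
 let ?\<Phi> = "limit_exponent k r \<gamma>"
 have tree: "alarm_tree (M (N i)) (N i) k r (E (N i))" for i
  using assms(6)[OF assms(7)] kr by (simp add: alarm_tree_def)
 define Sn where "Sn i \<omega> = log 2 (real (N i)) powr (real r/real k + 1)/(C2 k r*real (N i))*real (num_records (E (N i)) k r (N i) \<omega>) - centering k r (N i)" for i \<omega>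
 have Sn: "Sn i \<in> borel_measurable (M (N i))" for i
  unfolding Sn_def[abs_def] using alarm_tree.num_records_measurable[OF tree] by measurable
 have RS: "R.S i = Sn (i + i0)" for i
  by (simp add: R.S_def[abs_def] Sn_def[abs_def] R.a_def)
 have is_ch: "is_char (%t. exp (of_real c*?\<Phi> t))" if "0 <= c" for c by (rule R.limit_law_is_char[OF that])
 obtain W where W: "real_distribution W" "char W = (%t. exp (of_real 1*?\<Phi> t))"
  using is_charE[OF is_ch[of 1]] by auto
 have cW: "char W t = exp (?\<Phi> t)" for t by (simp add: W(2))
 interpret W: real_distribution W by (rule W(1))
 have inf: "infinitely_divisible W"
 proof (rule infinitely_divisibleI[OF W(1)])
  fix n :: nat assume n: "1 <= n"
  \<comment> \<open>The \<open>n\<close>-th convolution root is the law for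
    \<open>c = 1/n\<close>.\<close>
  have "exp (of_real (1/real n)*?\<Phi> t)^n = char W t" for t
   using n by (simp add: cW exp_of_nat_mult[symmetric])
  thus "\<exists>\<phi>. is_char \<phi> & (\<forall>t. \<phi> t^n = char W t)"
   using is_ch[of "1/real n"] by (intro exI[of _ "%t. exp (of_real (1/real n)*?\<Phi> t)"]) auto
 qed
 have limc: "char (distr W borel (%w. 1 - C3 k r*w)) t = iexp t*exp (?\<Phi> (- C3 k r*t))" for t
 proof -
  have "char (distr W borel (%w. 1 - C3 k r*w)) t = (CLINT w|W. iexp t*iexp ((- C3 k r*t)*w))"
   unfolding char_def by (subst integral_distr) (auto simp: exp_add[symmetric] algebra_simps)
  also have "... = iexp t*char W (- C3 k r*t)" unfolding char_def by simp
  finally show ?thesis by (simp add: cW)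
 qed
 have conv: "weak_conv_m (%i. distr (M (N i)) borel (Sn i)) (distr W borel (%w. 1 - C3 k r*w))"
 proof (rule levy_continuity)
  show "real_distribution (distr (M (N i)) borel (Sn i))" for i
  proof -
   interpret A: alarm_tree "M (N i)" "N i" k r "E (N i)" by (rule tree)
   show ?thesis using Sn[of i] by (rule A.real_distribution_distr)
  qed
  show "real_distribution (distr W borel (%w. 1 - C3 k r*w))" by (rule W.real_distribution_distr) simp
  fix t
  have "(%i. char (distr (M (N (i + i0))) borel (R.S i)) t) ----> iexp t*exp (?\<Phi> (- C3 k r*t))"
   by (rule R.S_approximation) (use J Sn in \<open>auto simp: RS\<close>)
  \<comment> \<open>The finitely many small trees dropped at the start are put back; limits ignore
    them.\<close>
  thus "(%i. char (distr (M (N i)) borel (Sn i)) t) ----> char (distr W borel (%w. 1 - C3 k r*w)) t"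
   unfolding limc RS by (rule LIMSEQ_offset)
 qed
 show ?thesis
 proof (intro conjI exI[of _ W] W(1) inf)
  show "levy_measure (nu k r \<gamma>)" by (rule nu_levy_measure[OF kr])
  show "\<forall>t. char W t = exp (\<i>*complex_of_real (drift k r \<gamma>*t) +
     (CLINT x|nu k r \<gamma>. iexp (t*x) - 1 - \<i>*complex_of_real (t*x*indicator {..<1} x)))"
   unfolding cW limit_exponent_eq[OF kr] by simp
  show "weak_conv_m
    (%i. distr (M (N i)) borel
     (%\<omega>. log 2 (real (N i)) powr (real r/real k + 1)/(C2 k r*real (N i))
         * real (num_records (E (N i)) k r (N i) \<omega>)
        - centering k r (N i)))
    (distr W borel (%w. 1 - C3 k r*w))"
   using conv by (simp only: Sn_def[abs_def])
 qed
qed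

end
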